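(* Let $f,g:\mathbb{R}\to\mathbb{R}$ be bounded measurable functions and let $K=i[f(P),g(Q)]$ on $L^2(\mathbb{R})$. If $K\ge 0$ and $K\neq 0$, then $f$ and $g$ are both absolutely continuous with derivatives in $L^1(\mathbb{R})$.
   Context: On $L^2(\mathbb{R})$, $Q$ is multiplication by $x$ and $P=-i\,d/dx$; $f(P)$ and $g(Q)$ are the bounded self-adjoint operators given by the functional calculus (so $g(Q)$ is multiplication by $g$, and $f(P)=\mathcal{F}^{-1}f(\xi)\mathcal{F}$ with $\mathcal{F}$ the unitary Fourier transform $\hat\psi(\xi)=(2\pi)^{-1/2}\int e^{-i\xi x}\psi(x)\,dx$). $[A,B]=AB-BA$. $K\ge 0$ means $(\psi,K\psi)\ge 0$ for all $\psi\in L^2(\mathbb{R})$. Measurable functions are identified when they agree almost everywhere, so the conclusion means that $f$ and $g$ agree a.e. with absolutely continuous functions. *)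

theory Defs
  imports "HOL-Analysis.Analysis" "HOL-Library.Nonpos_Ints"
begin

(* Elements of L^2(R) are represented by square-integrable functions; equality in L^2(R) is
   equality almost everywhere.  Operators act on representatives. *)

definition L2 :: "(real \<Rightarrow> complex) set" where
  "L2 = {\<psi>. \<psi> \<in> borel_measurable lebesgue \<and> integrable lebesgue (\<lambda>x. (cmod (\<psi> x))\<^sup>2)}"

definition L2_inner :: "(real \<Rightarrow> complex) \<Rightarrow> (real \<Rightarrow> complex) \<Rightarrow> complex" where
  "L2_inner \<psi> \<phi> = (\<integral>x. cnj (\<psi> x) * \<phi> x \<partial>lebesgue)"

(* The nonnegative integral is used because the Bochner integral of a non-integrable function
   is 0. *)
definition L2_tendsto :: "(nat \<Rightarrow> real \<Rightarrow> complex) \<Rightarrow> (real \<Rightarrow> complex) \<Rightarrow> bool" where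
  "L2_tendsto u \<phi> \<longleftrightarrow>
     (\<lambda>n. \<integral>\<^sup>+x. ennreal ((cmod (u n x - \<phi> x))\<^sup>2) \<partial>lebesgue) \<longlonglongrightarrow> 0"

definition fourier_trunc :: "(real \<Rightarrow> complex) \<Rightarrow> nat \<Rightarrow> real \<Rightarrow> complex" where
  "fourier_trunc \<psi> n \<xi> = complex_of_real (1 / sqrt (2 * pi)) *
     (\<integral>x\<in>{- real n..real n}. exp (- (\<i> * complex_of_real \<xi> * complex_of_real x)) * \<psi> x \<partial>lebesgue)"

(* The unitary Fourier transform on L^2(R), as the limit in the mean of the truncated Fourier
   integrals.  The defining integral itself converges only for integrable functions. *)
definition is_fourier :: "(real \<Rightarrow> complex) \<Rightarrow> (real \<Rightarrow> complex) \<Rightarrow> bool" where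
  "is_fourier \<psi> \<phi> \<longleftrightarrow> \<psi> \<in> L2 \<and> \<phi> \<in> L2 \<and> L2_tendsto (fourier_trunc \<psi>) \<phi>"

(* By Plancherel's theorem the representatives chosen here exist for arguments in L2, and they
   are unique up to null sets. *)
definition fourier :: "(real \<Rightarrow> complex) \<Rightarrow> (real \<Rightarrow> complex)" where
  "fourier \<psi> = (SOME \<phi>. is_fourier \<psi> \<phi>)"

definition inv_fourier :: "(real \<Rightarrow> complex) \<Rightarrow> (real \<Rightarrow> complex)" where
  "inv_fourier \<phi> = (SOME \<psi>. is_fourier \<psi> \<phi>)"

type_synonym L2_op = "(real \<Rightarrow> complex) \<Rightarrow> (real \<Rightarrow> complex)"

definition fun_Q :: "(real \<Rightarrow> real) \<Rightarrow> L2_op" where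
  "fun_Q g \<psi> = (\<lambda>x. complex_of_real (g x) * \<psi> x)"

definition fun_P :: "(real \<Rightarrow> real) \<Rightarrow> L2_op" where
  "fun_P f \<psi> = inv_fourier (\<lambda>\<xi>. complex_of_real (f \<xi>) * fourier \<psi> \<xi>)"

definition commutator :: "L2_op \<Rightarrow> L2_op \<Rightarrow> L2_op" where
  "commutator A B \<psi> = (\<lambda>x. A (B \<psi>) x - B (A \<psi>) x)"

definition scale_op :: "complex \<Rightarrow> L2_op \<Rightarrow> L2_op" where
  "scale_op c A \<psi> = (\<lambda>x. c * A \<psi> x)"

definition op_nonneg :: "L2_op \<Rightarrow> bool" where
  "op_nonneg K \<longleftrightarrow> (\<forall>\<psi>\<in>L2. L2_inner \<psi> (K \<psi>) \<in> \<real>\<^sub>\<ge>\<^sub>0)"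

definition op_zero :: "L2_op \<Rightarrow> bool" where
  "op_zero K \<longleftrightarrow> (\<forall>\<psi>\<in>L2. AE x in lebesgue. K \<psi> x = 0)"

(* Absolute continuity on the whole real line, with one modulus for all of it. This is a priori
   stronger than absolute continuity on every compact interval; the two agree for functions
   whose derivative is in L^1(R).  A pair (a, b) in I stands for the interval from a to b. *)
definition abs_cont :: "(real \<Rightarrow> real) \<Rightarrow> bool" where
  "abs_cont f \<longleftrightarrow>
     (\<forall>\<epsilon>>0. \<exists>\<delta>>0. \<forall>I :: (real \<times> real) set.
        finite I \<and> (\<forall>(a, b)\<in>I. a \<le> b) \<and>
        pairwise (\<lambda>(a, b) (c, d). {a<..<b} \<inter> {c<..<d} = {}) I \<and>
        (\<Sum>(a, b)\<in>I. b - a) < \<delta>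
        \<longrightarrow> (\<Sum>(a, b)\<in>I. \<bar>f b - f a\<bar>) < \<epsilon>)"

definition has_L1_deriv :: "(real \<Rightarrow> real) \<Rightarrow> bool" where
  "has_L1_deriv f \<longleftrightarrow>
     (\<exists>f'. integrable lebesgue f' \<and> (AE x in lebesgue. (f has_real_derivative f' x) (at x)))"

end

theory Submission
  imports Defs "HOL-Probability.Probability"
begin

text \<open>
The operator $K = i[f(P), g(Q)]$ enters only through its Hermitian form. With
$\langle\phi, K\psi\rangle = i(\langle\hat\phi, f \widehat{g\psi}\rangle - \langle\widehat{g\phi}, f \hat\psi\rangle)$,
the form \<open>cform\<close>, and Plancherel's theorem, the hypotheses say that this form is
nonnegative and not identically zero (\<open>positive_commutatorI\<close>). Conjugation with the Fourier
transform turns the pair $(f, g)$ into $(g(-\cdot), -f)$ (\<open>positive_commutator_FT\<close>), so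
everything that is shown for $g$ also holds for $f$.

The first consequence is monotonicity (\<open>positive_commutator_monotone\<close>). For integrable $\phi$ one has
$\langle\phi, K\phi\rangle = \int f W$ with an integrable function $W$, depending on $g$ and $\phi$,
of integral $0$. Replacing $\phi$ by $e^{ipx}\phi$ translates $W$ by $p$. Averaging over $p$ with
weight $e^{-|p|/T}$ smooths $f$ on the scale $T$: up to an error that vanishes as $T$ tends to
infinity the averages of $f$ vary linearly in $\xi$, and along a subsequence their slope
becomes a number $c$ which depends on $f$ alone. Hence $c \int \xi W(\xi) d\xi \ge 0$, where
$\int \xi W(\xi) d\xi = -2\int g \phi \phi'$ for real $\phi$. Letting $\phi$ approach the indicator of
$[a, b]$ gives $c(g(b) - g(a)) \ge 0$ at Lebesgue points. If $c$ were $0$, then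
$\int \langle e^{ipx}\phi, K e^{ipx}\phi\rangle dp$ would vanish, so $K e^{ipx}\phi = 0$ for almost all
$p$, and $K = 0$ by injectivity of the Fourier transform. Thus $g$ and, by symmetry, $f$ agree
almost everywhere with bounded monotone functions, up to a sign.

It remains to exclude a singular part (\<open>compact_null_set\<close>). Let $f$ and $g$ be increasing and let $q$ be the
quadratic form of $K$, up to the sign that makes it nonnegative. For a short
interval $I$ the number $q(1_I)$ is comparable with $|I|$ times the increment of $g$ over $I$ or its middle half
(\<open>qf_box_upper\<close>, \<open>qf_box_lower\<close> and the bounds for \<open>specV\<close>): the function $W$ of
$1_I$ is minus the derivative of an explicit even function, which is largest at $0$, and the second
mean value theorem integrates $f$ against $W$. So the weighted numbers $2^n q(1_I)$, for dyadic $I$ of length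
$2^{-n}$, mimic the increments of $g$, but, unlike these, they are squared Hilbert space norms.
Their sum $S_n$ therefore behaves like the second moment of a martingale: it is bounded, because
$g$ is bounded, and $S_n - S_m$ is the sum of the squared distances to the averages over the
coarser intervals of level $m$ (\<open>dev_sum\<close>). Consequently $S_n$ converges, which makes the
numbers $2^n q(1_I)$ uniformly integrable (\<open>D_sum_le\<close>): their sum over few dyadic intervals is
small, uniformly in $n$. A compact Lebesgue null set is covered by few such intervals, so the
Lebesgue--Stieltjes measure of $g$ vanishes on it. By inner regularity this finite measure is
absolutely continuous, and its Radon--Nikodym density is the integrable derivative of $g$
(\<open>abs_cont_of_null_measure\<close>).
\<close>

section \<open>Square integrable functions\<close>

text \<open>Functions, not classes: an identity in $L^2$ appears as an equality almost everywhere. The measure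
is a parameter because Borel representatives (for \<^term>\<open>lborel\<close>) and Lebesgue measurable functions
(for \<^term>\<open>lebesgue\<close>) both occur.\<close>
definition sq_int :: "'a measure \<Rightarrow> ('a \<Rightarrow> complex) set" where
  "sq_int M = {\<psi>. \<psi> \<in> borel_measurable M \<and> integrable M (\<lambda>x. (cmod (\<psi> x))\<^sup>2)}"

definition ip :: "'a measure \<Rightarrow> ('a \<Rightarrow> complex) \<Rightarrow> ('a \<Rightarrow> complex) \<Rightarrow> complex" where
  "ip M \<phi> \<psi> = (\<integral>x. cnj (\<phi> x) * \<psi> x \<partial>M)"

definition nsq :: "'a measure \<Rightarrow> ('a \<Rightarrow> complex) \<Rightarrow> real" where
  "nsq M \<psi> = (\<integral>x. (cmod (\<psi> x))\<^sup>2 \<partial>M)"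

lemma sq_intD [dest]:
  assumes "\<psi> \<in> sq_int M"
  shows "\<psi> \<in> borel_measurable M" "integrable M (\<lambda>x. (cmod (\<psi> x))\<^sup>2)"
  using assms by (auto simp: sq_int_def)

lemma cnj_borel [measurable]: "cnj \<in> borel_measurable borel"
  by (intro borel_measurable_continuous_onI continuous_intros)

lemma sq_int_bound:
  assumes "\<psi> \<in> borel_measurable M" "\<phi> \<in> sq_int M" "\<And>x. cmod (\<psi> x) \<le> C * cmod (\<phi> x)"
  shows "\<psi> \<in> sq_int M"
proof -
  note [measurable] = assms(1) sq_intD(1)[OF assms(2)]
  have "integrable M (\<lambda>x. C\<^sup>2 * (cmod (\<phi> x))\<^sup>2)" using sq_intD(2)[OF assms(2)] by simp
  then have "integrable M (\<lambda>x. (cmod (\<psi> x))\<^sup>2)"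
  proof (rule Bochner_Integration.integrable_bound)
    show "AE x in M. norm ((cmod (\<psi> x))\<^sup>2) \<le> norm (C\<^sup>2 * (cmod (\<phi> x))\<^sup>2)"
      using assms(3) by (intro AE_I2) (simp add: power_mono flip: power_mult_distrib)
  qed measurable
  then show ?thesis by (simp add: sq_int_def)
qed

lemma sq_int_add [intro]:
  assumes "\<phi> \<in> sq_int M" "\<psi> \<in> sq_int M" shows "(\<lambda>x. \<phi> x + \<psi> x) \<in> sq_int M"
proof -
  note [measurable] = sq_intD(1)[OF assms(1)] sq_intD(1)[OF assms(2)]
  have "integrable M (\<lambda>x. 2 * (cmod (\<phi> x))\<^sup>2 + 2 * (cmod (\<psi> x))\<^sup>2)"
    using sq_intD(2)[OF assms(1)] sq_intD(2)[OF assms(2)] by simp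
  then have "integrable M (\<lambda>x. (cmod (\<phi> x + \<psi> x))\<^sup>2)"
  proof (rule Bochner_Integration.integrable_bound)
    have "(cmod (a + b))\<^sup>2 \<le> 2 * (cmod a)\<^sup>2 + 2 * (cmod b)\<^sup>2" for a b
    proof -
      have "(cmod (a + b))\<^sup>2 \<le> (cmod a + cmod b)\<^sup>2" by (simp add: norm_triangle_ineq power_mono)
      moreover have "0 \<le> (cmod a - cmod b)\<^sup>2" by simp
      ultimately show ?thesis unfolding power2_sum power2_diff by linarith
    qed
    then show "AE x in M. norm ((cmod (\<phi> x + \<psi> x))\<^sup>2) \<le> norm (2 * (cmod (\<phi> x))\<^sup>2 + 2 * (cmod (\<psi> x))\<^sup>2)"
      by auto
  qed measurable
  then show ?thesis by (simp add: sq_int_def)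
qed

lemma sq_int_cmult [intro]: "\<phi> \<in> sq_int M \<Longrightarrow> (\<lambda>x. c * \<phi> x) \<in> sq_int M"
  by (rule sq_int_bound[where \<phi>=\<phi> and C="cmod c"]) (auto simp: norm_mult)

lemma sq_int_uminus [intro]: "\<phi> \<in> sq_int M \<Longrightarrow> (\<lambda>x. - \<phi> x) \<in> sq_int M"
  using sq_int_cmult[of \<phi> M "-1"] by simp

lemma sq_int_cnj [intro]: "\<phi> \<in> sq_int M \<Longrightarrow> (\<lambda>x. cnj (\<phi> x)) \<in> sq_int M"
  by (rule sq_int_bound[where \<phi>=\<phi> and C=1]) auto

lemma sq_int_diff [intro]:
  "\<phi> \<in> sq_int M \<Longrightarrow> \<psi> \<in> sq_int M \<Longrightarrow> (\<lambda>x. \<phi> x - \<psi> x) \<in> sq_int M"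
  using sq_int_add[of \<phi> M "\<lambda>x. - \<psi> x"] by auto

lemma sq_int_0 [simp]: "(\<lambda>x. 0) \<in> sq_int M" by (simp add: sq_int_def)

lemma sq_int_sum [intro]: "(\<And>i. i \<in> A \<Longrightarrow> \<phi> i \<in> sq_int M) \<Longrightarrow> (\<lambda>x. \<Sum>i\<in>A. \<phi> i x) \<in> sq_int M"
  by (induction A rule: infinite_finite_induct) auto

lemma sq_int_mult_bounded:
  assumes "f \<in> borel_measurable M" "\<And>x. \<bar>f x\<bar> \<le> C" "\<phi> \<in> sq_int M"
  shows "(\<lambda>x. complex_of_real (f x) * \<phi> x) \<in> sq_int M"
proof (rule sq_int_bound[OF _ assms(3), where C=C])
  show "(\<lambda>x. complex_of_real (f x) * \<phi> x) \<in> borel_measurable M"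
    using assms(1) sq_intD(1)[OF assms(3)] by measurable
qed (auto simp: norm_mult assms(2) intro: mult_right_mono)

lemma integrable_ip [intro]:
  assumes "\<phi> \<in> sq_int M" "\<psi> \<in> sq_int M" shows "integrable M (\<lambda>x. \<phi> x * \<psi> x)"
proof -
  note [measurable] = sq_intD(1)[OF assms(1)] sq_intD(1)[OF assms(2)]
  have "integrable M (\<lambda>x. (cmod (\<phi> x))\<^sup>2 + (cmod (\<psi> x))\<^sup>2)"
    using sq_intD(2)[OF assms(1)] sq_intD(2)[OF assms(2)] by simp
  then show ?thesis
  proof (rule Bochner_Integration.integrable_bound)
    have "cmod (a * b) \<le> (cmod a)\<^sup>2 + (cmod b)\<^sup>2" for a b
      using arith_geo_mean_sqrt[of "(cmod a)\<^sup>2" "(cmod b)\<^sup>2"]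
      by (simp add: norm_mult real_sqrt_mult) (smt (verit) zero_le_power2)
    then show "AE x in M. norm (\<phi> x * \<psi> x) \<le> norm ((cmod (\<phi> x))\<^sup>2 + (cmod (\<psi> x))\<^sup>2)"
      by auto
  qed measurable
qed

lemma nsq_nonneg [simp]: "0 \<le> nsq M \<psi>" by (simp add: nsq_def)

lemma ip_add_right: "\<phi> \<in> sq_int M \<Longrightarrow> \<theta> \<in> sq_int M \<Longrightarrow> \<psi> \<in> sq_int M \<Longrightarrow>
    ip M \<psi> (\<lambda>x. \<phi> x + \<theta> x) = ip M \<psi> \<phi> + ip M \<psi> \<theta>"
  unfolding ip_def by (subst Bochner_Integration.integral_add[symmetric]) (auto simp: algebra_simps)

lemma ip_cmult_left: "ip M (\<lambda>x. c * \<phi> x) \<psi> = cnj c * ip M \<phi> \<psi>"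
  unfolding ip_def by (simp add: mult.assoc)

lemma ip_cmult_right: "ip M \<phi> (\<lambda>x. c * \<psi> x) = c * ip M \<phi> \<psi>"
  unfolding ip_def by (simp add: mult.left_commute)

lemma ip_diff_right: "\<phi> \<in> sq_int M \<Longrightarrow> \<theta> \<in> sq_int M \<Longrightarrow> \<psi> \<in> sq_int M \<Longrightarrow>
    ip M \<psi> (\<lambda>x. \<phi> x - \<theta> x) = ip M \<psi> \<phi> - ip M \<psi> \<theta>"
  unfolding ip_def by (subst Bochner_Integration.integral_diff[symmetric]) (auto simp: algebra_simps)

lemma ip_diff_left: "\<phi> \<in> sq_int M \<Longrightarrow> \<theta> \<in> sq_int M \<Longrightarrow> \<psi> \<in> sq_int M \<Longrightarrow>
    ip M (\<lambda>x. \<phi> x - \<theta> x) \<psi> = ip M \<phi> \<psi> - ip M \<theta> \<psi>"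
  unfolding ip_def by (subst Bochner_Integration.integral_diff[symmetric]) (auto simp: algebra_simps)

lemma ip_cnj: "cnj (ip M \<phi> \<psi>) = ip M \<psi> \<phi>"
proof -
  have "cnj (\<integral>x. cnj (\<phi> x) * \<psi> x \<partial>M) = (\<integral>x. cnj (cnj (\<phi> x) * \<psi> x) \<partial>M)"
    by (rule Bochner_Integration.integral_cnj[symmetric])
  then show ?thesis unfolding ip_def by (simp add: mult.commute)
qed

lemma ip_self: "ip M \<psi> \<psi> = complex_of_real (nsq M \<psi>)"
proof -
  have "cnj (\<psi> x) * \<psi> x = complex_of_real ((cmod (\<psi> x))\<^sup>2)" for x
    by (subst complex_norm_square) (simp add: mult.commute)
  then have "ip M \<psi> \<psi> = (\<integral>x. complex_of_real ((cmod (\<psi> x))\<^sup>2) \<partial>M)"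
    unfolding ip_def by simp
  then show ?thesis unfolding nsq_def integral_complex_of_real .
qed

lemma ip_cong_AE:
  assumes "AE x in M. \<phi> x = \<phi>' x" "AE x in M. \<psi> x = \<psi>' x"
    "\<phi> \<in> borel_measurable M" "\<phi>' \<in> borel_measurable M" "\<psi> \<in> borel_measurable M" "\<psi>' \<in> borel_measurable M"
  shows "ip M \<phi> \<psi> = ip M \<phi>' \<psi>'"
  unfolding ip_def using assms by (intro integral_cong_AE) auto

lemma nsq_eq_0: "\<psi> \<in> sq_int M \<Longrightarrow> nsq M \<psi> = 0 \<longleftrightarrow> (AE x in M. \<psi> x = 0)"
  unfolding nsq_def by (subst integral_nonneg_eq_0_iff_AE) auto

lemma nsq_cong_AE:
  assumes "AE x in M. \<phi> x = \<psi> x" "\<phi> \<in> borel_measurable M" "\<psi> \<in> borel_measurable M"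
  shows "nsq M \<phi> = nsq M \<psi>"
  unfolding nsq_def using assms by (intro integral_cong_AE) auto

text \<open>The expansion of a squared distance; with the optimal \<open>c\<close> it gives the Cauchy--Schwarz
inequality, and with $c = \pm 1$ the parallelogram law.\<close>
lemma nsq_expand:
  assumes "\<phi> \<in> sq_int M" "\<psi> \<in> sq_int M"
  shows "nsq M (\<lambda>x. \<phi> x - c * \<psi> x) = nsq M \<phi> - 2 * Re (c * ip M \<phi> \<psi>) + (cmod c)\<^sup>2 * nsq M \<psi>"
proof -
  have c\<psi>: "(\<lambda>x. c * \<psi> x) \<in> sq_int M" using assms by auto
  have "complex_of_real (nsq M (\<lambda>x. \<phi> x - c * \<psi> x)) = ip M (\<lambda>x. \<phi> x - c * \<psi> x) (\<lambda>x. \<phi> x - c * \<psi> x)"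
    by (simp add: ip_self)
  also have "\<dots> = ip M \<phi> \<phi> - c * ip M \<phi> \<psi> - (cnj c * ip M \<psi> \<phi> - cnj c * (c * ip M \<psi> \<psi>))"
    using assms c\<psi> sq_int_diff[OF assms(1) c\<psi>]
    by (simp add: ip_diff_left ip_diff_right ip_cmult_left ip_cmult_right right_diff_distrib)
  finally have "nsq M (\<lambda>x. \<phi> x - c * \<psi> x) = Re (ip M \<phi> \<phi> - c * ip M \<phi> \<psi> - (cnj c * ip M \<psi> \<phi> - cnj c * (c * ip M \<psi> \<psi>)))"
    by (metis Re_complex_of_real)
  moreover have "Re (cnj c * ip M \<psi> \<phi>) = Re (c * ip M \<phi> \<psi>)"
    by (metis complex_cnj_mult complex_cnj_cnj ip_cnj cnj.sel(1))
  moreover have "cnj c * (c * ip M \<psi> \<psi>) = complex_of_real ((cmod c)\<^sup>2 * nsq M \<psi>)"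
    by (metis complex_norm_square ip_self mult.assoc mult.commute of_real_mult)
  ultimately show ?thesis by (simp only: minus_complex.simps ip_self Re_complex_of_real)
qed

lemma Cauchy_Schwarz_ip:
  assumes "\<phi> \<in> sq_int M" "\<psi> \<in> sq_int M"
  shows "(cmod (ip M \<phi> \<psi>))\<^sup>2 \<le> nsq M \<phi> * nsq M \<psi>"
proof (cases "nsq M \<psi> = 0")
  case True
  then have "AE x in M. \<psi> x = 0" using nsq_eq_0 assms by blast
  then have "ip M \<phi> \<psi> = 0"
    unfolding ip_def by (intro integral_eq_zero_AE) auto
  then show ?thesis by simp
next
  case False
  define c where "c = cnj (ip M \<phi> \<psi>) / nsq M \<psi>"
  have "0 \<le> nsq M (\<lambda>x. \<phi> x - c * \<psi> x)" by simp
  also have "\<dots> = nsq M \<phi> - 2 * Re (c * ip M \<phi> \<psi>) + (cmod c)\<^sup>2 * nsq M \<psi>"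
    by (rule nsq_expand[OF assms])
  also have "c * ip M \<phi> \<psi> = complex_of_real ((cmod (ip M \<phi> \<psi>))\<^sup>2 / nsq M \<psi>)"
    unfolding c_def by (simp add: mult.commute flip: complex_norm_square)
  also have "(cmod c)\<^sup>2 = (cmod (ip M \<phi> \<psi>))\<^sup>2 / (nsq M \<psi>)\<^sup>2"
    by (simp add: c_def norm_divide power_divide)
  finally have "(cmod (ip M \<phi> \<psi>))\<^sup>2 / nsq M \<psi> \<le> nsq M \<phi>"
    using False by (simp add: power2_eq_square)
  then show ?thesis using False
    by (metis divide_le_eq nsq_nonneg order_le_less)
qed

lemma Cauchy_Schwarz_ip':
  assumes "\<phi> \<in> sq_int M" "\<psi> \<in> sq_int M"
  shows "cmod (ip M \<phi> \<psi>) \<le> sqrt (nsq M \<phi>) * sqrt (nsq M \<psi>)"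
  using real_le_rsqrt[OF Cauchy_Schwarz_ip[OF assms]] by (simp add: real_sqrt_mult)

lemma nsq_add_le:
  assumes "\<phi> \<in> sq_int M" "\<psi> \<in> sq_int M"
  shows "nsq M (\<lambda>x. \<phi> x + \<psi> x) \<le> 2 * nsq M \<phi> + 2 * nsq M \<psi>"
proof -
  have "nsq M (\<lambda>x. \<phi> x + \<psi> x) + nsq M (\<lambda>x. \<phi> x - \<psi> x) = 2 * nsq M \<phi> + 2 * nsq M \<psi>"
    using nsq_expand[OF assms, of 1] nsq_expand[OF assms, of "-1"] by simp
  then show ?thesis using nsq_nonneg[of M "\<lambda>x. \<phi> x - \<psi> x"] by linarith
qed

lemma nsq_diff_le:
  assumes "\<phi> \<in> sq_int M" "\<psi> \<in> sq_int M" "\<theta> \<in> sq_int M"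
  shows "nsq M (\<lambda>x. \<phi> x - \<psi> x) \<le> 2 * nsq M (\<lambda>x. \<phi> x - \<theta> x) + 2 * nsq M (\<lambda>x. \<psi> x - \<theta> x)"
proof -
  have "nsq M (\<lambda>x. (\<phi> x - \<theta> x) + (\<theta> x - \<psi> x)) \<le> 2 * nsq M (\<lambda>x. \<phi> x - \<theta> x) + 2 * nsq M (\<lambda>x. \<theta> x - \<psi> x)"
    using assms by (intro nsq_add_le) auto
  moreover have "nsq M (\<lambda>x. \<theta> x - \<psi> x) = nsq M (\<lambda>x. \<psi> x - \<theta> x)"
    unfolding nsq_def by (simp add: norm_minus_commute)
  ultimately show ?thesis by simp
qed

lemma nsq_cmult: "nsq M (\<lambda>x. c * \<psi> x) = (cmod c)\<^sup>2 * nsq M \<psi>"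
  unfolding nsq_def by (simp add: norm_mult power_mult_distrib)

lemma nn_integral_nsq: "\<psi> \<in> sq_int M \<Longrightarrow> (\<integral>\<^sup>+x. ennreal ((cmod (\<psi> x))\<^sup>2) \<partial>M) = ennreal (nsq M \<psi>)"
  unfolding nsq_def by (intro nn_integral_eq_integral) auto

lemma sq_int_nn_integral:
  assumes "\<psi> \<in> borel_measurable M" "(\<integral>\<^sup>+x. ennreal ((cmod (\<psi> x))\<^sup>2) \<partial>M) \<le> ennreal c" "0 \<le> c"
  shows "\<psi> \<in> sq_int M" "nsq M \<psi> \<le> c"
proof -
  have "integrable M (\<lambda>x. (cmod (\<psi> x))\<^sup>2)"
    using assms by (intro integrableI_bounded) (auto simp: top.extremum_strict le_less_trans)
  then show *: "\<psi> \<in> sq_int M" using assms by (simp add: sq_int_def)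
  show "nsq M \<psi> \<le> c" using assms(2,3) unfolding nn_integral_nsq[OF *] by simp
qed

text \<open>The Riesz--Fischer theorem. A subsequence whose successive squared distances are below $4^{-k}$
has increments with $\sum_k 2^k |d_k(x)|^2 < \infty$ almost everywhere, hence converges pointwise;
Fatou's lemma turns the Cauchy property into convergence in mean to that pointwise limit.\<close>
proposition L2_complete:
  fixes u :: "nat \<Rightarrow> 'a \<Rightarrow> complex"
  assumes u: "\<And>n. u n \<in> sq_int M"
    and Cauchy: "\<And>e. 0 < e \<Longrightarrow> \<exists>N. \<forall>m\<ge>N. \<forall>n\<ge>N. nsq M (\<lambda>x. u m x - u n x) < e"
  obtains \<phi> where "\<phi> \<in> sq_int M" "(\<lambda>n. nsq M (\<lambda>x. u n x - \<phi> x)) \<longlonglongrightarrow> 0"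
proof -
  note [measurable] = sq_intD(1)[OF u]
  have "\<exists>N. \<forall>k. (\<forall>m\<ge>N k. \<forall>n\<ge>N k. nsq M (\<lambda>x. u m x - u n x) < (1/4)^k)"
    using Cauchy by (intro choice) simp
  then obtain N where N: "\<And>k m n. m \<ge> N k \<Longrightarrow> n \<ge> N k \<Longrightarrow> nsq M (\<lambda>x. u m x - u n x) < (1/4)^k"
    by blast
  define r where "r k = (\<Sum>j\<le>k. N j)" for k
  have rN: "N k \<le> r k" for k unfolding r_def by (intro member_le_sum) auto
  have rS: "N k \<le> r (Suc k)" for k
    using rN[of k] by (simp add: r_def)
  have rk: "N j \<le> r k" if "j \<le> k" for j k
    unfolding r_def using that by (intro member_le_sum) auto
  define d where "d k x = u (r (Suc k)) x - u (r k) x" for k x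
  have d: "d k \<in> sq_int M" for k unfolding d_def using u by auto
  note [measurable] = sq_intD(1)[OF d]
  have nd: "nsq M (d k) < (1/4)^k" for k unfolding d_def by (intro N rS rN)
  have "(\<integral>\<^sup>+x. (\<Sum>k. ennreal (2^k * (cmod (d k x))\<^sup>2)) \<partial>M) = (\<Sum>k. \<integral>\<^sup>+x. ennreal (2^k * (cmod (d k x))\<^sup>2) \<partial>M)"
    by (intro nn_integral_suminf) measurable
  also have "\<dots> = (\<Sum>k. ennreal (2^k * nsq M (d k)))"
  proof (intro suminf_cong)
    fix k
    have "(\<integral>\<^sup>+x. ennreal (2^k * (cmod (d k x))\<^sup>2) \<partial>M) = ennreal (2^k) * (\<integral>\<^sup>+x. ennreal ((cmod (d k x))\<^sup>2) \<partial>M)"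
      by (subst nn_integral_cmult[symmetric]) (auto simp: ennreal_mult)
    then show "(\<integral>\<^sup>+x. ennreal (2^k * (cmod (d k x))\<^sup>2) \<partial>M) = ennreal (2^k * nsq M (d k))"
      using nn_integral_nsq[OF d] by (simp add: ennreal_mult)
  qed
  also have "\<dots> \<le> (\<Sum>k. ennreal ((1/2)^k))"
  proof (intro suminf_le ennreal_leI)
    fix k
    have "2^k * nsq M (d k) \<le> 2^k * (1/4)^k" using nd[of k] by (intro mult_left_mono) auto
    also have "\<dots> = (1/2)^k" by (simp flip: power_mult_distrib)
    finally show "2^k * nsq M (d k) \<le> (1/2)^k" .
  qed auto
  also have "\<dots> = ennreal (\<Sum>k. (1/2)^k)" by (intro suminf_ennreal2) auto
  also have "\<dots> < \<infinity>" by simp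
  finally have "AE x in M. (\<Sum>k. ennreal (2^k * (cmod (d k x))\<^sup>2)) \<noteq> \<infinity>"
    by (intro nn_integral_noteq_infinite) auto
  then have conv: "AE x in M. convergent (\<lambda>k. u (r k) x)"
  proof eventually_elim
    case (elim x)
    have "summable (\<lambda>k. 2^k * (cmod (d k x))\<^sup>2)"
      using elim by (intro summable_suminf_not_top) auto
    then obtain C where C: "\<And>k. \<bar>2^k * (cmod (d k x))\<^sup>2\<bar> \<le> C"
      using summable_imp_bounded[of "\<lambda>k. 2^k * (cmod (d k x))\<^sup>2"] by (auto simp: bounded_iff)
    have bd: "cmod (d k x) \<le> sqrt C * (sqrt (1/2))^k" for k
    proof -
      have "(cmod (d k x))\<^sup>2 \<le> C * (1/2)^k" using C[of k] by (simp add: field_simps power_divide)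
      then have "cmod (d k x) \<le> sqrt (C * (1/2)^k)" using real_le_rsqrt by blast
      then show ?thesis by (simp only: real_sqrt_mult real_sqrt_power)
    qed
    have "summable (\<lambda>k. d k x)"
    proof (rule summable_comparison_test'[where N=0])
      show "summable (\<lambda>k. sqrt C * (sqrt (1/2))^k)"
        by (intro summable_mult summable_geometric) (simp add: real_sqrt_divide)
    qed (use bd in auto)
    then have "convergent (\<lambda>n. \<Sum>k<n. d k x)" by (simp add: summable_iff_convergent)
    moreover have "(\<Sum>k<n. d k x) = u (r n) x - u (r 0) x" for n
      unfolding d_def by (rule sum_lessThan_telescope)
    ultimately have "convergent (\<lambda>n. u (r n) x - u (r 0) x)" by simp
    then have "convergent (\<lambda>n. (u (r n) x - u (r 0) x) + u (r 0) x)"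
      by (intro convergent_add convergent_const)
    then show ?case by simp
  qed
  define \<phi> where "\<phi> x = lim (\<lambda>k. u (r k) x)" for x
  have [measurable]: "\<phi> \<in> borel_measurable M" unfolding \<phi>_def by (intro borel_measurable_lim_metric) auto
  have key: "(\<integral>\<^sup>+x. ennreal ((cmod (u n x - \<phi> x))\<^sup>2) \<partial>M) \<le> ennreal ((1/4)^j)" if "n \<ge> N j" for n j
  proof -
    have "(\<integral>\<^sup>+x. ennreal ((cmod (u n x - \<phi> x))\<^sup>2) \<partial>M)
        = (\<integral>\<^sup>+x. liminf (\<lambda>k. ennreal ((cmod (u n x - u (r k) x))\<^sup>2)) \<partial>M)"
    proof (rule nn_integral_cong_AE)
      show "AE x in M. ennreal ((cmod (u n x - \<phi> x))\<^sup>2) = liminf (\<lambda>k. ennreal ((cmod (u n x - u (r k) x))\<^sup>2))"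
        using conv
      proof eventually_elim
        case (elim x)
        then have "(\<lambda>k. u (r k) x) \<longlonglongrightarrow> \<phi> x" unfolding \<phi>_def by (simp add: convergent_LIMSEQ_iff)
        then have "(\<lambda>k. ennreal ((cmod (u n x - u (r k) x))\<^sup>2)) \<longlonglongrightarrow> ennreal ((cmod (u n x - \<phi> x))\<^sup>2)"
          by (intro tendsto_intros)
        then show ?case using lim_imp_Liminf[OF sequentially_bot] by metis
      qed
    qed
    also have "\<dots> \<le> liminf (\<lambda>k. \<integral>\<^sup>+x. ennreal ((cmod (u n x - u (r k) x))\<^sup>2) \<partial>M)"
      by (intro nn_integral_liminf) measurable
    also have "\<dots> \<le> ennreal ((1/4)^j)"
    proof (rule Liminf_le)
      show "\<forall>\<^sub>F k in sequentially. (\<integral>\<^sup>+x. ennreal ((cmod (u n x - u (r k) x))\<^sup>2) \<partial>M) \<le> ennreal ((1/4)^j)"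
        using eventually_ge_at_top[of j]
      proof eventually_elim
        case (elim k)
        have "(\<lambda>x. u n x - u (r k) x) \<in> sq_int M" using u by auto
        from nn_integral_nsq[OF this] N[OF that rk[OF elim]] show ?case
          by (simp add: ennreal_leI)
      qed
    qed auto
    finally show ?thesis .
  qed
  have diff: "(\<lambda>x. u n x - \<phi> x) \<in> sq_int M" and small: "nsq M (\<lambda>x. u n x - \<phi> x) \<le> (1/4)^j"
    if "n \<ge> N j" for n j
    using sq_int_nn_integral[OF _ key[OF that]] by auto
  have \<phi>: "\<phi> \<in> sq_int M"
    using sq_int_diff[OF u diff[OF order_refl], of "N 0" 0] by simp
  have "(\<lambda>n. nsq M (\<lambda>x. u n x - \<phi> x)) \<longlonglongrightarrow> 0"
  proof (rule LIMSEQ_I)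
    fix e :: real assume "0 < e"
    then obtain j where j: "(1/4)^j < e" using real_arch_pow_inv[of e "1/4"] by auto
    show "\<exists>no. \<forall>n\<ge>no. norm (nsq M (\<lambda>x. u n x - \<phi> x) - 0) < e"
      using small[of j] j by (intro exI[of _ "N j"]) (auto intro: le_less_trans)
  qed
  with \<phi> show ?thesis by (rule that)
qed

lemma ip_tendsto:
  assumes "\<And>n. u n \<in> sq_int M" "\<phi> \<in> sq_int M" "(\<lambda>n. nsq M (\<lambda>x. u n x - \<phi> x)) \<longlonglongrightarrow> 0"
    and "\<And>n. v n \<in> sq_int M" "\<psi> \<in> sq_int M" "(\<lambda>n. nsq M (\<lambda>x. v n x - \<psi> x)) \<longlonglongrightarrow> 0"
  shows "(\<lambda>n. ip M (u n) (v n)) \<longlonglongrightarrow> ip M \<phi> \<psi>"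
proof -
  define a b where "a n = sqrt (nsq M (\<lambda>x. u n x - \<phi> x))" and "b n = sqrt (nsq M (\<lambda>x. v n x - \<psi> x))" for n
  have a: "a \<longlonglongrightarrow> 0" and b: "b \<longlonglongrightarrow> 0"
    unfolding a_def b_def using tendsto_real_sqrt[OF assms(3)] tendsto_real_sqrt[OF assms(6)] by simp_all
  have "(\<lambda>n. ip M (u n) (v n) - ip M \<phi> \<psi>) \<longlonglongrightarrow> 0"
  proof (rule Lim_null_comparison)
    have "(\<lambda>n. a n * b n + a n * sqrt (nsq M \<psi>) + sqrt (nsq M \<phi>) * b n)
        \<longlonglongrightarrow> 0 * 0 + 0 * sqrt (nsq M \<psi>) + sqrt (nsq M \<phi>) * 0"
      by (intro tendsto_add tendsto_mult a b tendsto_const)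
    then show "(\<lambda>n. a n * b n + a n * sqrt (nsq M \<psi>) + sqrt (nsq M \<phi>) * b n) \<longlonglongrightarrow> 0" by simp
    show "\<forall>\<^sub>F n in sequentially. cmod (ip M (u n) (v n) - ip M \<phi> \<psi>) \<le> a n * b n + a n * sqrt (nsq M \<psi>) + sqrt (nsq M \<phi>) * b n"
    proof (rule always_eventually, rule allI)
      fix n
      have du: "(\<lambda>x. u n x - \<phi> x) \<in> sq_int M" and dv: "(\<lambda>x. v n x - \<psi> x) \<in> sq_int M" using assms(1,2,4,5) by auto
      define p q s where "p = ip M (\<lambda>x. u n x - \<phi> x) (\<lambda>x. v n x - \<psi> x)"
        and "q = ip M (\<lambda>x. u n x - \<phi> x) \<psi>" and "s = ip M \<phi> (\<lambda>x. v n x - \<psi> x)"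
      have eq: "ip M (u n) (v n) - ip M \<phi> \<psi> = p + q + s"
        unfolding p_def q_def s_def using du dv assms(1,2,4,5) by (simp add: ip_diff_right ip_diff_left)
      have "cmod p \<le> a n * b n" "cmod q \<le> a n * sqrt (nsq M \<psi>)" "cmod s \<le> sqrt (nsq M \<phi>) * b n"
        unfolding a_def b_def p_def q_def s_def
        by (rule Cauchy_Schwarz_ip'[OF du dv] Cauchy_Schwarz_ip'[OF du assms(5)] Cauchy_Schwarz_ip'[OF assms(2) dv])+
      then show "cmod (ip M (u n) (v n) - ip M \<phi> \<psi>) \<le> a n * b n + a n * sqrt (nsq M \<psi>) + sqrt (nsq M \<phi>) * b n"
        unfolding eq using norm_triangle_ineq[of "p + q" s] norm_triangle_ineq[of p q] by linarith
    qed
  qed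
  then show ?thesis by (rule LIM_zero_cancel)
qed

lemma nsq_tendsto:
  assumes "\<And>n. u n \<in> sq_int M" "\<phi> \<in> sq_int M" "(\<lambda>n. nsq M (\<lambda>x. u n x - \<phi> x)) \<longlonglongrightarrow> 0"
  shows "(\<lambda>n. nsq M (u n)) \<longlonglongrightarrow> nsq M \<phi>"
proof -
  have "(\<lambda>n. Re (ip M (u n) (u n))) \<longlonglongrightarrow> Re (ip M \<phi> \<phi>)"
    by (intro tendsto_intros ip_tendsto assms)
  then show ?thesis by (simp add: ip_self)
qed

lemma L2_limit_unique:
  assumes "\<And>n. u n \<in> sq_int M" "\<phi> \<in> sq_int M" "(\<lambda>n. nsq M (\<lambda>x. u n x - \<phi> x)) \<longlonglongrightarrow> 0"
    "\<psi> \<in> sq_int M" "(\<lambda>n. nsq M (\<lambda>x. u n x - \<psi> x)) \<longlonglongrightarrow> 0"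
  shows "AE x in M. \<phi> x = \<psi> x"
proof -
  have d: "(\<lambda>x. \<phi> x - \<psi> x) \<in> sq_int M" using assms by auto
  have "nsq M (\<lambda>x. \<phi> x - \<psi> x) \<le> 2 * nsq M (\<lambda>x. u n x - \<phi> x) + 2 * nsq M (\<lambda>x. u n x - \<psi> x)" for n
    using nsq_diff_le[OF assms(2) assms(4) assms(1)[of n]] unfolding nsq_def by (simp add: norm_minus_commute)
  moreover have "(\<lambda>n. 2 * nsq M (\<lambda>x. u n x - \<phi> x) + 2 * nsq M (\<lambda>x. u n x - \<psi> x)) \<longlonglongrightarrow> 2 * 0 + 2 * 0"
    by (intro tendsto_add tendsto_mult tendsto_const assms)
  ultimately have "nsq M (\<lambda>x. \<phi> x - \<psi> x) \<le> 0"
    by (intro LIMSEQ_le_const[where X="\<lambda>n. 2 * nsq M (\<lambda>x. u n x - \<phi> x) + 2 * nsq M (\<lambda>x. u n x - \<psi> x)"]) auto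
  then have "nsq M (\<lambda>x. \<phi> x - \<psi> x) = 0" using nsq_nonneg[of M "\<lambda>x. \<phi> x - \<psi> x"] by linarith
  then show ?thesis using nsq_eq_0[OF d] by simp
qed

section \<open>Fourier integrals and Gaussian regularisation\<close>

definition ft :: "(real \<Rightarrow> complex) \<Rightarrow> real \<Rightarrow> complex" where
  "ft \<psi> \<xi> = complex_of_real (1 / sqrt (2 * pi)) *
     (\<integral>x. exp (- (\<i> * complex_of_real \<xi> * complex_of_real x)) * \<psi> x \<partial>lborel)"

lemma norm_exp_ii [simp]:
  "cmod (exp (- (\<i> * complex_of_real x * complex_of_real y))) = 1"
  "cmod (exp (\<i> * complex_of_real x * complex_of_real y)) = 1"
  by (simp_all add: norm_exp_eq_Re)

lemma exp_ii_measurable [measurable]: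
  "(\<lambda>p. exp (- (\<i> * complex_of_real (fst p) * complex_of_real (snd p)))) \<in> borel_measurable (borel \<Otimes>\<^sub>M borel)"
  by measurable

lemma ft_measurable [measurable]:
  assumes [measurable]: "\<psi> \<in> borel_measurable borel"
  shows "ft \<psi> \<in> borel_measurable borel"
proof -
  have "(\<lambda>(\<xi>::real, x::real). exp (- (\<i> * complex_of_real \<xi> * complex_of_real x)) * \<psi> x) \<in> borel_measurable (borel \<Otimes>\<^sub>M lborel)"
    by measurable
  from lborel.borel_measurable_lebesgue_integral[OF this]
  show ?thesis unfolding ft_def by measurable
qed

lemma integrable_ft_integrand:
  assumes "integrable lborel \<psi>"
  shows "integrable lborel (\<lambda>x. exp (- (\<i> * complex_of_real \<xi> * complex_of_real x)) * \<psi> x)"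
proof -
  note [measurable] = borel_measurable_integrable[OF assms]
  show ?thesis
    by (rule Bochner_Integration.integrable_bound[OF assms]) (auto simp: norm_mult)
qed

lemma ft_bound:
  assumes "integrable lborel \<psi>"
  shows "cmod (ft \<psi> \<xi>) \<le> (\<integral>x. cmod (\<psi> x) \<partial>lborel)"
proof -
  let ?I = "\<integral>x. exp (- (\<i> * complex_of_real \<xi> * complex_of_real x)) * \<psi> x \<partial>lborel"
  have "cmod ?I \<le> (\<integral>x. cmod (\<psi> x) \<partial>lborel)"
    using integral_norm_bound[of lborel "\<lambda>x. exp (- (\<i> * complex_of_real \<xi> * complex_of_real x)) * \<psi> x"]
    by (simp add: norm_mult)
  moreover have "1 / sqrt (2 * pi) \<le> 1" using pi_ge_two by (simp add: real_le_rsqrt)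
  moreover have "cmod (ft \<psi> \<xi>) = (1 / sqrt (2 * pi)) * cmod ?I" unfolding ft_def by (simp add: norm_mult norm_divide)
  ultimately show ?thesis
    using mult_right_mono[of "1 / sqrt (2 * pi)" 1 "cmod ?I"] by simp
qed

lemma ft_add: "integrable lborel \<phi> \<Longrightarrow> integrable lborel \<psi> \<Longrightarrow> ft (\<lambda>x. \<phi> x + \<psi> x) \<xi> = ft \<phi> \<xi> + ft \<psi> \<xi>"
  unfolding ft_def using integrable_ft_integrand[of \<phi> \<xi>] integrable_ft_integrand[of \<psi> \<xi>]
  by (simp add: distrib_left)

lemma ft_diff: "integrable lborel \<phi> \<Longrightarrow> integrable lborel \<psi> \<Longrightarrow> ft (\<lambda>x. \<phi> x - \<psi> x) \<xi> = ft \<phi> \<xi> - ft \<psi> \<xi>"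
  unfolding ft_def using integrable_ft_integrand[of \<phi> \<xi>] integrable_ft_integrand[of \<psi> \<xi>]
  by (simp add: right_diff_distrib)

lemma ft_cmult: "ft (\<lambda>x. c * \<psi> x) \<xi> = c * ft \<psi> \<xi>"
  unfolding ft_def by (simp add: mult.left_commute)

lemma ft_cnj: "cnj (ft \<psi> \<xi>) = ft (\<lambda>x. cnj (\<psi> x)) (- \<xi>)"
proof -
  have "cnj (\<integral>x. exp (- (\<i> * complex_of_real \<xi> * complex_of_real x)) * \<psi> x \<partial>lborel)
      = (\<integral>x. cnj (exp (- (\<i> * complex_of_real \<xi> * complex_of_real x)) * \<psi> x) \<partial>lborel)"
    by (rule Bochner_Integration.integral_cnj[symmetric])
  then show ?thesis unfolding ft_def by (simp add: exp_cnj)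
qed

text \<open>Fubini's theorem, as the kernel of the transform is symmetric. The regularised
Parseval identity and the adjoint of the transform are both drawn from it.\<close>
lemma ft_multiplication:
  assumes "integrable lborel \<phi>" "integrable lborel \<psi>"
  shows "(\<integral>\<xi>. ft \<phi> \<xi> * \<psi> \<xi> \<partial>lborel) = (\<integral>x. \<phi> x * ft \<psi> x \<partial>lborel)"
proof -
  note [measurable] = borel_measurable_integrable[OF assms(1)] borel_measurable_integrable[OF assms(2)]
  let ?E = "\<lambda>x y. exp (- (\<i> * complex_of_real x * complex_of_real y))"
  have int: "integrable (lborel \<Otimes>\<^sub>M lborel) (\<lambda>(\<xi>, x). ?E \<xi> x * \<phi> x * \<psi> \<xi>)"
  proof (rule lborel_pair.Fubini_integrable)
    show "(\<lambda>(\<xi>, x). ?E \<xi> x * \<phi> x * \<psi> \<xi>) \<in> borel_measurable (lborel \<Otimes>\<^sub>M lborel)" by measurable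
    have "(\<lambda>\<xi>. \<integral>x. norm (case (\<xi>, x) of (\<xi>, x) \<Rightarrow> ?E \<xi> x * \<phi> x * \<psi> \<xi>) \<partial>lborel)
       = (\<lambda>\<xi>. (\<integral>x. cmod (\<phi> x) \<partial>lborel) * cmod (\<psi> \<xi>))"
      by (simp add: norm_mult)
    then show "integrable lborel (\<lambda>\<xi>. \<integral>x. norm (case (\<xi>, x) of (\<xi>, x) \<Rightarrow> ?E \<xi> x * \<phi> x * \<psi> \<xi>) \<partial>lborel)"
      using integrable_norm[OF assms(2)] by simp
    show "AE \<xi> in lborel. integrable lborel (\<lambda>x. case (\<xi>, x) of (\<xi>, x) \<Rightarrow> ?E \<xi> x * \<phi> x * \<psi> \<xi>)"
      using integrable_ft_integrand[OF assms(1)] by auto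
  qed
  have "(\<integral>\<xi>. ft \<phi> \<xi> * \<psi> \<xi> \<partial>lborel)
      = (\<integral>\<xi>. complex_of_real (1 / sqrt (2 * pi)) * (\<integral>x. ?E \<xi> x * \<phi> x * \<psi> \<xi> \<partial>lborel) \<partial>lborel)"
    unfolding ft_def by (simp only: mult.assoc[of "complex_of_real (1 / sqrt (2 * pi))"] Bochner_Integration.integral_mult_left_zero)
  also have "\<dots> = complex_of_real (1 / sqrt (2 * pi)) * (\<integral>\<xi>. (\<integral>x. ?E \<xi> x * \<phi> x * \<psi> \<xi> \<partial>lborel) \<partial>lborel)"
    by (rule Bochner_Integration.integral_mult_right_zero)
  also have "(\<integral>\<xi>. (\<integral>x. ?E \<xi> x * \<phi> x * \<psi> \<xi> \<partial>lborel) \<partial>lborel) = (\<integral>x. (\<integral>\<xi>. ?E \<xi> x * \<phi> x * \<psi> \<xi> \<partial>lborel) \<partial>lborel)"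
    by (rule lborel_pair.Fubini_integral[symmetric]) (use int in simp)
  also have "\<dots> = (\<integral>x. \<phi> x * (\<integral>\<xi>. ?E x \<xi> * \<psi> \<xi> \<partial>lborel) \<partial>lborel)"
    by (simp add: mult.assoc mult.left_commute[of _ "\<phi> _"] mult.commute[of "complex_of_real _" "complex_of_real _"] ac_simps)
  also have "complex_of_real (1 / sqrt (2 * pi)) * \<dots> = (\<integral>x. complex_of_real (1 / sqrt (2 * pi)) * (\<phi> x * (\<integral>\<xi>. ?E x \<xi> * \<psi> \<xi> \<partial>lborel)) \<partial>lborel)"
    by (rule Bochner_Integration.integral_mult_right_zero[symmetric])
  also have "\<dots> = (\<integral>x. \<phi> x * ft \<psi> x \<partial>lborel)"
    unfolding ft_def by (simp add: mult.left_commute)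
  finally show ?thesis .
qed

definition gauss :: "real \<Rightarrow> real \<Rightarrow> real" where "gauss \<epsilon> \<xi> = exp (- (\<epsilon> * \<xi>)\<^sup>2 / 2)"

lemma gauss_bounds: "0 < gauss \<epsilon> \<xi>" "gauss \<epsilon> \<xi> \<le> 1"
  by (auto simp: gauss_def)

lemma gauss_measurable [measurable]: "gauss \<epsilon> \<in> borel_measurable borel"
  unfolding gauss_def by measurable

lemma gauss_eq: "0 < \<epsilon> \<Longrightarrow> gauss \<epsilon> \<xi> = sqrt (2 * pi) / \<epsilon> * normal_density 0 (1/\<epsilon>) \<xi>"
  unfolding gauss_def normal_density_def
  by (simp add: field_simps power_mult_distrib real_sqrt_divide real_sqrt_mult power_divide)

lemma integrable_gauss: "0 < \<epsilon> \<Longrightarrow> integrable lborel (gauss \<epsilon>)"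
  using integrable_normal_density[of "1/\<epsilon>" 0] gauss_eq[of \<epsilon>]
  by (subst Bochner_Integration.integrable_cong[where g="\<lambda>\<xi>. sqrt (2 * pi) / \<epsilon> * normal_density 0 (1/\<epsilon>) \<xi>"]) auto

text \<open>The characteristic function of the standard normal distribution, without its normalisation.\<close>
lemma std_normal_transform:
  "(\<integral>x. complex_of_real (exp (- x\<^sup>2 / 2)) * exp (\<i> * complex_of_real (t * x)) \<partial>lborel) = complex_of_real (sqrt (2 * pi) * exp (- t\<^sup>2 / 2))"
proof -
  have "complex_of_real (exp (- t\<^sup>2 / 2)) = char std_normal_distribution t"
    by (simp add: char_std_normal_distribution)
  also have "\<dots> = (\<integral>x. std_normal_density x *\<^sub>R exp (\<i> * complex_of_real (t * x)) \<partial>lborel)"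
    unfolding char_def by (subst integral_density) auto
  also have "\<dots> = (\<integral>x. complex_of_real (1 / sqrt (2 * pi)) * (complex_of_real (exp (- x\<^sup>2 / 2)) * exp (\<i> * complex_of_real (t * x))) \<partial>lborel)"
    by (simp add: std_normal_density_def scaleR_conv_of_real mult.assoc)
  also have "\<dots> = complex_of_real (1 / sqrt (2 * pi)) * (\<integral>x. complex_of_real (exp (- x\<^sup>2 / 2)) * exp (\<i> * complex_of_real (t * x)) \<partial>lborel)"
    by (rule Bochner_Integration.integral_mult_right_zero)
  finally have "complex_of_real (sqrt (2 * pi)) * complex_of_real (exp (- t\<^sup>2 / 2))
      = complex_of_real (sqrt (2 * pi)) * (complex_of_real (1 / sqrt (2 * pi)) * (\<integral>x. complex_of_real (exp (- x\<^sup>2 / 2)) * exp (\<i> * complex_of_real (t * x)) \<partial>lborel))"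
    by simp
  also have "\<dots> = (\<integral>x. complex_of_real (exp (- x\<^sup>2 / 2)) * exp (\<i> * complex_of_real (t * x)) \<partial>lborel)"
    by (simp flip: mult.assoc of_real_mult)
  finally show ?thesis by simp
qed

lemma gauss_transform:
  assumes "0 < \<epsilon>"
  shows "(\<integral>\<xi>. complex_of_real (gauss \<epsilon> \<xi>) * exp (\<i> * complex_of_real (z * \<xi>)) \<partial>lborel) = complex_of_real (2 * pi * normal_density 0 \<epsilon> z)"
proof -
  have "(\<integral>\<xi>. complex_of_real (gauss \<epsilon> \<xi>) * exp (\<i> * complex_of_real (z * \<xi>)) \<partial>lborel)
    = (1/\<epsilon>) *\<^sub>R (\<integral>u. complex_of_real (gauss \<epsilon> (0 + (1/\<epsilon>) * u)) * exp (\<i> * complex_of_real (z * (0 + (1/\<epsilon>) * u))) \<partial>lborel)"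
    using lborel_integral_real_affine[of "1/\<epsilon>" "\<lambda>\<xi>. complex_of_real (gauss \<epsilon> \<xi>) * exp (\<i> * complex_of_real (z * \<xi>))" 0] assms
    by simp
  also have "\<dots> = (1/\<epsilon>) *\<^sub>R (\<integral>u. complex_of_real (exp (- u\<^sup>2 / 2)) * exp (\<i> * complex_of_real ((z / \<epsilon>) * u)) \<partial>lborel)"
    using assms by (simp add: gauss_def)
  also have "\<dots> = (1/\<epsilon>) *\<^sub>R complex_of_real (sqrt (2 * pi) * exp (- (z / \<epsilon>)\<^sup>2 / 2))"
    by (simp only: std_normal_transform)
  also have "\<dots> = complex_of_real (2 * pi * normal_density 0 \<epsilon> z)"
  proof -
    have "sqrt (2 * pi) * sqrt (2 * pi) = 2 * pi" by simp
    then have "sqrt (2 * pi) / \<epsilon> = 2 * pi / sqrt (2 * pi * \<epsilon>\<^sup>2)"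
      using assms by (simp add: real_sqrt_mult field_simps)
    then show ?thesis using assms
      by (simp add: normal_density_def scaleR_conv_of_real power_divide field_simps flip: of_real_mult)
  qed
  finally show ?thesis .
qed

lemma ft_gauss_shift:
  assumes "0 < \<epsilon>"
  shows "ft (\<lambda>\<xi>. complex_of_real (gauss \<epsilon> \<xi>) * exp (\<i> * complex_of_real y * complex_of_real \<xi>)) x
     = complex_of_real (sqrt (2 * pi) * normal_density x \<epsilon> y)"
proof -
  have "(\<integral>\<xi>. exp (- (\<i> * complex_of_real x * complex_of_real \<xi>)) * (complex_of_real (gauss \<epsilon> \<xi>) * exp (\<i> * complex_of_real y * complex_of_real \<xi>)) \<partial>lborel)
    = (\<integral>\<xi>. complex_of_real (gauss \<epsilon> \<xi>) * exp (\<i> * complex_of_real ((y - x) * \<xi>)) \<partial>lborel)"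
    by (intro Bochner_Integration.integral_cong) (auto simp: exp_add[symmetric] algebra_simps)
  also have "\<dots> = complex_of_real (2 * pi * normal_density 0 \<epsilon> (y - x))" by (rule gauss_transform[OF assms])
  also have "normal_density 0 \<epsilon> (y - x) = normal_density x \<epsilon> y" by (simp add: normal_density_def)
  finally have *: "(\<integral>\<xi>. exp (- (\<i> * complex_of_real x * complex_of_real \<xi>)) * (complex_of_real (gauss \<epsilon> \<xi>) * exp (\<i> * complex_of_real y * complex_of_real \<xi>)) \<partial>lborel)
    = complex_of_real (2 * pi * normal_density x \<epsilon> y)" .
  have "1 / sqrt (2 * pi) * (2 * pi) = sqrt (2 * pi)" by (simp add: real_div_sqrt)
  then show ?thesis unfolding ft_def * by (simp only: of_real_mult[symmetric] mult.assoc[symmetric])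
qed

definition mollify :: "real \<Rightarrow> (real \<Rightarrow> complex) \<Rightarrow> real \<Rightarrow> complex" where
  "mollify \<epsilon> \<alpha> y = (\<integral>x. complex_of_real (normal_density x \<epsilon> y) * \<alpha> x \<partial>lborel)"

lemma normal_density_sym: "normal_density x \<epsilon> y = normal_density y \<epsilon> x"
  by (simp add: normal_density_def power2_commute)

lemma normal_density_measurable2 [measurable (raw)]:
  assumes [measurable]: "\<mu> \<in> borel_measurable M" "y \<in> borel_measurable M"
  shows "(\<lambda>x. normal_density (\<mu> x) \<epsilon> (y x)) \<in> borel_measurable M"
  unfolding normal_density_def by measurable

text \<open>Parseval's identity with a Gaussian cut-off: on the other side the cut-off becomes convolution
with a normal density of standard deviation \<open>\<epsilon>\<close>. The cut-off makes all integrals converge.\<close>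
lemma regularised_Parseval:
  assumes \<alpha>: "integrable lborel \<alpha>" and \<beta>: "integrable lborel \<beta>" and \<epsilon>: "0 < \<epsilon>"
  shows "(\<integral>\<xi>. complex_of_real (gauss \<epsilon> \<xi>) * (cnj (ft \<alpha> \<xi>) * ft \<beta> \<xi>) \<partial>lborel)
       = (\<integral>y. cnj (mollify \<epsilon> \<alpha> y) * \<beta> y \<partial>lborel)"
proof -
  note [measurable] = borel_measurable_integrable[OF \<alpha>] borel_measurable_integrable[OF \<beta>]
  let ?G = "\<lambda>\<xi>. complex_of_real (gauss \<epsilon> \<xi>)"
  have Gint: "integrable lborel (\<lambda>\<xi>. ?G \<xi> * c \<xi>)" if [measurable]: "c \<in> borel_measurable borel" and "\<And>\<xi>. cmod (c \<xi>) \<le> C" for c C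
  proof (rule Bochner_Integration.integrable_bound)
    show "integrable lborel (\<lambda>\<xi>. C * gauss \<epsilon> \<xi>)" using integrable_gauss[OF \<epsilon>] by simp
    have "0 \<le> C" using that(2)[of 0] norm_ge_zero order_trans by blast
    then show "AE \<xi> in lborel. norm (?G \<xi> * c \<xi>) \<le> norm (C * gauss \<epsilon> \<xi>)"
      using that(2) gauss_bounds(1)[of \<epsilon>, THEN less_imp_le]
      by (intro AE_I2) (simp add: norm_mult abs_mult mult.commute[of C] mult_left_mono)
  qed measurable
  have c: "integrable lborel (\<lambda>\<xi>. ?G \<xi> * cnj (ft \<alpha> \<xi>))"
    by (rule Gint[where C="\<integral>x. cmod (\<alpha> x) \<partial>lborel"]) (auto simp: ft_bound[OF \<alpha>])
  have key: "ft (\<lambda>\<xi>. ?G \<xi> * cnj (ft \<alpha> \<xi>)) y = cnj (mollify \<epsilon> \<alpha> y)" for y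
  proof -
    have e: "integrable lborel (\<lambda>\<xi>. ?G \<xi> * exp (\<i> * complex_of_real y * complex_of_real \<xi>))"
      by (rule Gint[where C=1]) auto
    have "cnj (ft (\<lambda>\<xi>. ?G \<xi> * cnj (ft \<alpha> \<xi>)) y)
      = complex_of_real (1 / sqrt (2 * pi)) * (\<integral>\<xi>. ft \<alpha> \<xi> * (?G \<xi> * exp (\<i> * complex_of_real y * complex_of_real \<xi>)) \<partial>lborel)"
      unfolding ft_cnj[of "\<lambda>\<xi>. ?G \<xi> * cnj (ft \<alpha> \<xi>)" y] ft_def[of "\<lambda>\<xi>. cnj (?G \<xi> * cnj (ft \<alpha> \<xi>))"]
      by (simp add: ac_simps)
    also have "(\<integral>\<xi>. ft \<alpha> \<xi> * (?G \<xi> * exp (\<i> * complex_of_real y * complex_of_real \<xi>)) \<partial>lborel)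
      = (\<integral>x. \<alpha> x * complex_of_real (sqrt (2 * pi) * normal_density x \<epsilon> y) \<partial>lborel)"
      unfolding ft_multiplication[OF \<alpha> e] ft_gauss_shift[OF \<epsilon>] ..
    also have "\<dots> = (\<integral>x. complex_of_real (sqrt (2 * pi)) * (complex_of_real (normal_density x \<epsilon> y) * \<alpha> x) \<partial>lborel)"
      by (simp add: ac_simps)
    also have "\<dots> = complex_of_real (sqrt (2 * pi)) * mollify \<epsilon> \<alpha> y"
      unfolding mollify_def by (rule Bochner_Integration.integral_mult_right_zero)
    finally have "cnj (ft (\<lambda>\<xi>. ?G \<xi> * cnj (ft \<alpha> \<xi>)) y) = mollify \<epsilon> \<alpha> y"
      by (simp flip: mult.assoc of_real_mult)
    then show ?thesis by (metis complex_cnj_cnj)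
  qed
  have "(\<integral>\<xi>. ?G \<xi> * (cnj (ft \<alpha> \<xi>) * ft \<beta> \<xi>) \<partial>lborel) = (\<integral>\<xi>. ft \<beta> \<xi> * (?G \<xi> * cnj (ft \<alpha> \<xi>)) \<partial>lborel)"
    by (simp add: ac_simps)
  also have "\<dots> = (\<integral>y. \<beta> y * ft (\<lambda>\<xi>. ?G \<xi> * cnj (ft \<alpha> \<xi>)) y \<partial>lborel)"
    by (rule ft_multiplication[OF \<beta> c])
  also have "\<dots> = (\<integral>y. \<beta> y * cnj (mollify \<epsilon> \<alpha> y) \<partial>lborel)" by (simp only: key)
  finally show ?thesis by (simp add: mult.commute)
qed

abbreviation "H \<equiv> sq_int (lborel :: real measure)"

lemma nn_integral_normal_density: "0 < \<epsilon> \<Longrightarrow> (\<integral>\<^sup>+y. ennreal (normal_density x \<epsilon> y) \<partial>lborel) = 1"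
  by (subst nn_integral_eq_integral) (auto simp: integrable_normal_density integral_normal_density)

text \<open>Convolution with a probability density does not increase the $L^2$ norm, by the inequality
$|\alpha(x)\alpha(y)| \le (|\alpha(x)|^2 + |\alpha(y)|^2)/2$ in the double integral. So the
regularised Parseval identity bounds the cut-off norm of the transform, uniformly in the cut-off,
and Fatou's lemma removes the cut-off. Equality is recovered only later, from inversion.\<close>
lemma ft_contraction:
  assumes \<alpha>: "integrable lborel \<alpha>" and \<alpha>H: "\<alpha> \<in> H"
  shows "ft \<alpha> \<in> H" "nsq lborel (ft \<alpha>) \<le> nsq lborel \<alpha>"
proof -
  have [measurable]: "\<alpha> \<in> borel_measurable borel" using borel_measurable_integrable[OF \<alpha>] by simp
  have regularised: "(\<integral>\<^sup>+\<xi>. ennreal (gauss \<epsilon> \<xi> * (cmod (ft \<alpha> \<xi>))\<^sup>2) \<partial>lborel) \<le> ennreal (nsq lborel \<alpha>)" if \<epsilon>: "0 < \<epsilon>" for \<epsilon>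
  proof -
    let ?k = "\<lambda>x y. normal_density x \<epsilon> y"
    let ?C = "\<integral>x. cmod (\<alpha> x) \<partial>lborel"
    \<comment> \<open>The Bochner integral in the Parseval identity has to be moved to nonnegative integrals,
      in which Fubini's theorem applies without integrability.\<close>
    have "integrable lborel (\<lambda>\<xi>. gauss \<epsilon> \<xi> * (cmod (ft \<alpha> \<xi>))\<^sup>2)"
    proof (rule Bochner_Integration.integrable_bound)
      show "integrable lborel (\<lambda>\<xi>. ?C\<^sup>2 * gauss \<epsilon> \<xi>)" using integrable_gauss[OF \<epsilon>] by simp
      show "AE \<xi> in lborel. norm (gauss \<epsilon> \<xi> * (cmod (ft \<alpha> \<xi>))\<^sup>2) \<le> norm (?C\<^sup>2 * gauss \<epsilon> \<xi>)"
        using gauss_bounds(1)[of \<epsilon>, THEN less_imp_le] ft_bound[OF \<alpha>]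
        by (intro AE_I2) (simp add: abs_mult mult.commute[of "?C\<^sup>2"] mult_left_mono power_mono)
    qed measurable
    then have "(\<integral>\<^sup>+\<xi>. ennreal (gauss \<epsilon> \<xi> * (cmod (ft \<alpha> \<xi>))\<^sup>2) \<partial>lborel) = ennreal (\<integral>\<xi>. gauss \<epsilon> \<xi> * (cmod (ft \<alpha> \<xi>))\<^sup>2 \<partial>lborel)"
      using gauss_bounds(1)[of \<epsilon>, THEN less_imp_le] by (intro nn_integral_eq_integral) auto
    also have "(\<integral>\<xi>. gauss \<epsilon> \<xi> * (cmod (ft \<alpha> \<xi>))\<^sup>2 \<partial>lborel) = cmod (complex_of_real (\<integral>\<xi>. gauss \<epsilon> \<xi> * (cmod (ft \<alpha> \<xi>))\<^sup>2 \<partial>lborel))"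
      using gauss_bounds(1)[of \<epsilon>, THEN less_imp_le] by simp
    also have "complex_of_real (\<integral>\<xi>. gauss \<epsilon> \<xi> * (cmod (ft \<alpha> \<xi>))\<^sup>2 \<partial>lborel)
        = (\<integral>\<xi>. complex_of_real (gauss \<epsilon> \<xi>) * (cnj (ft \<alpha> \<xi>) * ft \<alpha> \<xi>) \<partial>lborel)"
      unfolding integral_complex_of_real[symmetric]
      by (intro Bochner_Integration.integral_cong refl, simp only: of_real_mult complex_norm_square mult.commute[of "ft \<alpha> _"])
    also have "\<dots> = (\<integral>y. cnj (mollify \<epsilon> \<alpha> y) * \<alpha> y \<partial>lborel)" by (rule regularised_Parseval[OF \<alpha> \<alpha> \<epsilon>])
    also have "ennreal (cmod \<dots>) \<le> (\<integral>\<^sup>+y. ennreal (cmod (cnj (mollify \<epsilon> \<alpha> y) * \<alpha> y)) \<partial>lborel)"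
    proof (cases "integrable lborel (\<lambda>y. cnj (mollify \<epsilon> \<alpha> y) * \<alpha> y)")
      case True then show ?thesis by (rule integral_norm_bound_ennreal)
    qed (simp add: not_integrable_integral_eq)
    also have "\<dots> \<le> (\<integral>\<^sup>+y. (\<integral>\<^sup>+x. ennreal (?k x y * cmod (\<alpha> x)) * ennreal (cmod (\<alpha> y)) \<partial>lborel) \<partial>lborel)"
    proof (rule nn_integral_mono)
      fix y
      have "ennreal (cmod (mollify \<epsilon> \<alpha> y)) \<le> (\<integral>\<^sup>+x. ennreal (cmod (complex_of_real (?k x y) * \<alpha> x)) \<partial>lborel)"
      proof (cases "integrable lborel (\<lambda>x. complex_of_real (?k x y) * \<alpha> x)")
        case True then show ?thesis unfolding mollify_def by (rule integral_norm_bound_ennreal)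
      qed (simp add: not_integrable_integral_eq mollify_def)
      also have "\<dots> = (\<integral>\<^sup>+x. ennreal (?k x y * cmod (\<alpha> x)) \<partial>lborel)" by (simp add: norm_mult)
      finally have "ennreal (cmod (mollify \<epsilon> \<alpha> y)) * ennreal (cmod (\<alpha> y)) \<le> (\<integral>\<^sup>+x. ennreal (?k x y * cmod (\<alpha> x)) \<partial>lborel) * ennreal (cmod (\<alpha> y))"
        by (rule mult_right_mono) simp
      also have "\<dots> = (\<integral>\<^sup>+x. ennreal (?k x y * cmod (\<alpha> x)) * ennreal (cmod (\<alpha> y)) \<partial>lborel)"
        by (subst nn_integral_multc) auto
      finally show "ennreal (cmod (cnj (mollify \<epsilon> \<alpha> y) * \<alpha> y)) \<le> (\<integral>\<^sup>+x. ennreal (?k x y * cmod (\<alpha> x)) * ennreal (cmod (\<alpha> y)) \<partial>lborel)"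
        by (simp add: norm_mult ennreal_mult)
    qed
    also have "\<dots> \<le> (\<integral>\<^sup>+y. (\<integral>\<^sup>+x. ennreal (?k x y) * ennreal ((cmod (\<alpha> x))\<^sup>2 / 2) + ennreal (?k x y) * ennreal ((cmod (\<alpha> y))\<^sup>2 / 2) \<partial>lborel) \<partial>lborel)"
    proof (intro nn_integral_mono)
      fix x y
      have "0 \<le> (cmod (\<alpha> x) - cmod (\<alpha> y))\<^sup>2" by simp
      then have "cmod (\<alpha> x) * cmod (\<alpha> y) \<le> (cmod (\<alpha> x))\<^sup>2 / 2 + (cmod (\<alpha> y))\<^sup>2 / 2"
        unfolding power2_diff by simp
      then have "?k x y * (cmod (\<alpha> x) * cmod (\<alpha> y)) \<le> ?k x y * ((cmod (\<alpha> x))\<^sup>2 / 2 + (cmod (\<alpha> y))\<^sup>2 / 2)"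
        by (rule mult_left_mono) simp
      then have "ennreal (?k x y * (cmod (\<alpha> x) * cmod (\<alpha> y))) \<le> ennreal (?k x y * ((cmod (\<alpha> x))\<^sup>2 / 2) + ?k x y * ((cmod (\<alpha> y))\<^sup>2 / 2))"
        by (intro ennreal_leI) (simp add: distrib_left)
      then show "ennreal (?k x y * cmod (\<alpha> x)) * ennreal (cmod (\<alpha> y)) \<le> ennreal (?k x y) * ennreal ((cmod (\<alpha> x))\<^sup>2 / 2) + ennreal (?k x y) * ennreal ((cmod (\<alpha> y))\<^sup>2 / 2)"
        by (simp add: ennreal_mult[symmetric] mult.assoc)
    qed
    also have "\<dots> = (\<integral>\<^sup>+y. (\<integral>\<^sup>+x. ennreal (?k x y) * ennreal ((cmod (\<alpha> x))\<^sup>2 / 2) \<partial>lborel) \<partial>lborel) + (\<integral>\<^sup>+y. (\<integral>\<^sup>+x. ennreal (?k x y) * ennreal ((cmod (\<alpha> y))\<^sup>2 / 2) \<partial>lborel) \<partial>lborel)"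
      by (subst nn_integral_add[symmetric] | simp add: nn_integral_add)+
    also have "(\<integral>\<^sup>+y. (\<integral>\<^sup>+x. ennreal (?k x y) * ennreal ((cmod (\<alpha> y))\<^sup>2 / 2) \<partial>lborel) \<partial>lborel) = (\<integral>\<^sup>+y. ennreal ((cmod (\<alpha> y))\<^sup>2 / 2) \<partial>lborel)"
    proof -
      have "(\<integral>\<^sup>+x. ennreal (?k x y) * ennreal ((cmod (\<alpha> y))\<^sup>2 / 2) \<partial>lborel) = ennreal ((cmod (\<alpha> y))\<^sup>2 / 2)" for y
        using nn_integral_normal_density[OF \<epsilon>, of y] by (subst nn_integral_multc) (auto simp: normal_density_sym[of _ \<epsilon> y])
      then show ?thesis by simp
    qed
    also have "(\<integral>\<^sup>+y. (\<integral>\<^sup>+x. ennreal (?k x y) * ennreal ((cmod (\<alpha> x))\<^sup>2 / 2) \<partial>lborel) \<partial>lborel) = (\<integral>\<^sup>+x. (\<integral>\<^sup>+y. ennreal (?k x y) * ennreal ((cmod (\<alpha> x))\<^sup>2 / 2) \<partial>lborel) \<partial>lborel)"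
      by (rule lborel_pair.Fubini') measurable
    also have "\<dots> = (\<integral>\<^sup>+y. ennreal ((cmod (\<alpha> y))\<^sup>2 / 2) \<partial>lborel)"
      using nn_integral_normal_density[OF \<epsilon>] by (subst nn_integral_multc) auto
    also have "(\<integral>\<^sup>+y. ennreal ((cmod (\<alpha> y))\<^sup>2 / 2) \<partial>lborel) + (\<integral>\<^sup>+y. ennreal ((cmod (\<alpha> y))\<^sup>2 / 2) \<partial>lborel) = (\<integral>\<^sup>+y. ennreal ((cmod (\<alpha> y))\<^sup>2) \<partial>lborel)"
      by (subst nn_integral_add[symmetric]) (auto simp: ennreal_plus[symmetric] simp del: ennreal_plus)
    also have "\<dots> = ennreal (nsq lborel \<alpha>)" by (rule nn_integral_nsq[OF \<alpha>H])
    finally show ?thesis .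
  qed
  have "(\<integral>\<^sup>+\<xi>. ennreal ((cmod (ft \<alpha> \<xi>))\<^sup>2) \<partial>lborel) = (\<integral>\<^sup>+\<xi>. liminf (\<lambda>n. ennreal (gauss (1 / Suc n) \<xi> * (cmod (ft \<alpha> \<xi>))\<^sup>2)) \<partial>lborel)"
  proof (rule nn_integral_cong)
    fix \<xi>
    have "(\<lambda>n. gauss (1 / Suc n) \<xi>) \<longlonglongrightarrow> exp (- (0 * \<xi>)\<^sup>2 / 2)"
      unfolding gauss_def using LIMSEQ_Suc[OF lim_1_over_n] by (intro tendsto_intros) simp_all
    then have "(\<lambda>n. ennreal (gauss (1 / Suc n) \<xi> * (cmod (ft \<alpha> \<xi>))\<^sup>2)) \<longlonglongrightarrow> ennreal (exp (- (0 * \<xi>)\<^sup>2 / 2) * (cmod (ft \<alpha> \<xi>))\<^sup>2)"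
      by (intro tendsto_ennrealI tendsto_mult tendsto_const)
    then have "(\<lambda>n. ennreal (gauss (1 / Suc n) \<xi> * (cmod (ft \<alpha> \<xi>))\<^sup>2)) \<longlonglongrightarrow> ennreal ((cmod (ft \<alpha> \<xi>))\<^sup>2)" by simp
    then show "ennreal ((cmod (ft \<alpha> \<xi>))\<^sup>2) = liminf (\<lambda>n. ennreal (gauss (1 / Suc n) \<xi> * (cmod (ft \<alpha> \<xi>))\<^sup>2))"
      using lim_imp_Liminf[OF sequentially_bot] by metis
  qed
  also have "\<dots> \<le> liminf (\<lambda>n. \<integral>\<^sup>+\<xi>. ennreal (gauss (1 / Suc n) \<xi> * (cmod (ft \<alpha> \<xi>))\<^sup>2) \<partial>lborel)"
    by (intro nn_integral_liminf) measurable
  also have "\<dots> \<le> ennreal (nsq lborel \<alpha>)"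
    by (intro Liminf_le always_eventually allI regularised) auto
  finally have le: "(\<integral>\<^sup>+\<xi>. ennreal ((cmod (ft \<alpha> \<xi>))\<^sup>2) \<partial>lborel) \<le> ennreal (nsq lborel \<alpha>)" .
  show "ft \<alpha> \<in> H" "nsq lborel (ft \<alpha>) \<le> nsq lborel \<alpha>"
    using sq_int_nn_integral[OF _ le] by auto
qed

section \<open>The Fourier transform on square integrable functions\<close>

definition trunc :: "nat \<Rightarrow> (real \<Rightarrow> complex) \<Rightarrow> real \<Rightarrow> complex" where
  "trunc n \<psi> x = indicat_real {- real n..real n} x *\<^sub>R \<psi> x"

lemma trunc_sq_int: "\<psi> \<in> H \<Longrightarrow> trunc n \<psi> \<in> H"
  unfolding trunc_def scaleR_conv_of_real by (rule sq_int_mult_bounded[where C=1]) (auto simp: indicator_def)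

lemma indicator_sq_int [intro]: "A \<in> sets borel \<Longrightarrow> emeasure lborel A < \<infinity> \<Longrightarrow> (indicator A :: real \<Rightarrow> complex) \<in> H"
proof -
  assume A: "A \<in> sets borel" "emeasure lborel A < \<infinity>"
  have "(\<lambda>x. (cmod (indicator A x :: complex))\<^sup>2) = indicat_real A" by (auto simp: indicator_def)
  with A show ?thesis by (auto simp: sq_int_def)
qed

lemma box_sq_int [simp]: "(indicator {a..b} :: real \<Rightarrow> complex) \<in> H"
  by (rule indicator_sq_int) (auto simp: emeasure_lborel_Icc_eq)

lemma box_integrable: "integrable lborel (indicator {a..b} :: real \<Rightarrow> complex)"
proof -
  have "integrable lborel (\<lambda>x. indicator {a..b} x * (indicator {a..b} x :: complex))" by (rule integrable_ip) auto
  then show ?thesis by (simp flip: indicator_inter_arith)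
qed

lemma integrable_indicator_mult:
  assumes "\<psi> \<in> H" shows "integrable lborel (\<lambda>x. indicat_real {a..b} x *\<^sub>R \<psi> x)"
proof -
  have "integrable lborel (\<lambda>x. indicator {a..b} x * \<psi> x)" by (rule integrable_ip) (auto simp: assms)
  moreover have "indicat_real {a..b} x *\<^sub>R \<psi> x = indicator {a..b} x * \<psi> x" for x by (auto simp: indicator_def)
  ultimately show ?thesis by simp
qed

lemma trunc_integrable: "\<psi> \<in> H \<Longrightarrow> integrable lborel (trunc n \<psi>)"
  unfolding trunc_def by (rule integrable_indicator_mult)

lemma trunc_tendsto:
  assumes "\<psi> \<in> H" shows "(\<lambda>n. nsq lborel (\<lambda>x. trunc n \<psi> x - \<psi> x)) \<longlonglongrightarrow> 0"
proof -
  note [measurable] = sq_intD(1)[OF assms] sq_intD(1)[OF trunc_sq_int[OF assms]]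
  have "(\<lambda>n. \<integral>x. (cmod (trunc n \<psi> x - \<psi> x))\<^sup>2 \<partial>lborel) \<longlonglongrightarrow> (\<integral>x. 0 \<partial>(lborel :: real measure))"
  proof (rule integral_dominated_convergence)
    show "integrable lborel (\<lambda>x. (cmod (\<psi> x))\<^sup>2)" using assms by auto
    show "AE x in lborel. (\<lambda>n. (cmod (trunc n \<psi> x - \<psi> x))\<^sup>2) \<longlonglongrightarrow> 0"
    proof (rule AE_I2)
      fix x :: real
      obtain N where N: "\<bar>x\<bar> \<le> real N" using real_arch_simple by blast
      have "\<forall>\<^sub>F n in sequentially. (cmod (trunc n \<psi> x - \<psi> x))\<^sup>2 = 0"
        using eventually_ge_at_top[of N]
      proof eventually_elim
        case (elim n)
        then have "x \<in> {- real n..real n}" using N by auto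
        then show ?case by (simp add: trunc_def)
      qed
      then show "(\<lambda>n. (cmod (trunc n \<psi> x - \<psi> x))\<^sup>2) \<longlonglongrightarrow> 0" by (rule tendsto_eventually)
    qed
    show "AE x in lborel. norm ((cmod (trunc n \<psi> x - \<psi> x))\<^sup>2) \<le> (cmod (\<psi> x))\<^sup>2" for n
      by (intro AE_I2) (auto simp: trunc_def indicator_def)
  qed measurable
  then show ?thesis by (simp add: nsq_def)
qed

definition is_FT :: "(real \<Rightarrow> complex) \<Rightarrow> (real \<Rightarrow> complex) \<Rightarrow> bool" where
  "is_FT \<psi> \<phi> \<longleftrightarrow> \<phi> \<in> H \<and> (\<lambda>n. nsq lborel (\<lambda>\<xi>. ft (trunc n \<psi>) \<xi> - \<phi> \<xi>)) \<longlonglongrightarrow> 0"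

lemma nsq_ft_diff:
  assumes "integrable lborel \<alpha>" "\<alpha> \<in> H" "integrable lborel \<beta>" "\<beta> \<in> H"
  shows "nsq lborel (\<lambda>\<xi>. ft \<alpha> \<xi> - ft \<beta> \<xi>) \<le> nsq lborel (\<lambda>x. \<alpha> x - \<beta> x)"
proof -
  have "(\<lambda>\<xi>. ft \<alpha> \<xi> - ft \<beta> \<xi>) = ft (\<lambda>x. \<alpha> x - \<beta> x)"
    using ft_diff[OF assms(1,3)] by auto
  then show ?thesis using ft_contraction(2)[of "\<lambda>x. \<alpha> x - \<beta> x"] assms by auto
qed

lemma is_FT_exists:
  assumes "\<psi> \<in> H" shows "\<exists>\<phi>. is_FT \<psi> \<phi>"
proof -
  note T = trunc_integrable[OF assms] trunc_sq_int[OF assms]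
  have "\<exists>\<phi>. \<phi> \<in> H \<and> (\<lambda>n. nsq lborel (\<lambda>x. ft (trunc n \<psi>) x - \<phi> x)) \<longlonglongrightarrow> 0"
  proof (rule L2_complete)
    show "ft (trunc n \<psi>) \<in> H" for n by (rule ft_contraction(1)[OF T])
    fix e :: real assume "0 < e"
    then obtain N where N: "\<And>n. n \<ge> N \<Longrightarrow> nsq lborel (\<lambda>x. trunc n \<psi> x - \<psi> x) < e / 4"
      using order_tendstoD(2)[OF trunc_tendsto[OF assms], of "e/4"] by (auto simp: eventually_sequentially)
    have "nsq lborel (\<lambda>x. ft (trunc m \<psi>) x - ft (trunc n \<psi>) x) < e" if "m \<ge> N" "n \<ge> N" for m n
      using nsq_ft_diff[OF T[of m] T[of n]] nsq_diff_le[OF T(2)[of m] T(2)[of n] assms] N[OF that(1)] N[OF that(2)]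
      by linarith
    then show "\<exists>N. \<forall>m\<ge>N. \<forall>n\<ge>N. nsq lborel (\<lambda>x. ft (trunc m \<psi>) x - ft (trunc n \<psi>) x) < e" by blast
  qed auto
  then show ?thesis by (auto simp: is_FT_def)
qed

text \<open>The limit in the mean of truncated Fourier integrals, as for \<^const>\<open>fourier\<close>, but for Borel
representatives.\<close>
definition FT :: "(real \<Rightarrow> complex) \<Rightarrow> real \<Rightarrow> complex" where "FT \<psi> = (SOME \<phi>. is_FT \<psi> \<phi>)"

lemma is_FT_FT: "\<psi> \<in> H \<Longrightarrow> is_FT \<psi> (FT \<psi>)"
  unfolding FT_def using is_FT_exists by (rule someI_ex)

lemma FT_sq_int [simp, intro]: "\<psi> \<in> H \<Longrightarrow> FT \<psi> \<in> H"
  using is_FT_FT by (auto simp: is_FT_def)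

lemma FT_measurable: "\<psi> \<in> H \<Longrightarrow> FT \<psi> \<in> borel_measurable borel"
  using sq_intD(1)[OF FT_sq_int] by simp

lemma FT_tendsto: "\<psi> \<in> H \<Longrightarrow> (\<lambda>n. nsq lborel (\<lambda>\<xi>. ft (trunc n \<psi>) \<xi> - FT \<psi> \<xi>)) \<longlonglongrightarrow> 0"
  using is_FT_FT by (auto simp: is_FT_def)

lemma ft_trunc_sq_int: "\<psi> \<in> H \<Longrightarrow> ft (trunc n \<psi>) \<in> H"
  by (rule ft_contraction(1)[OF trunc_integrable trunc_sq_int])

lemma is_FT_unique: "\<psi> \<in> H \<Longrightarrow> is_FT \<psi> \<phi> \<Longrightarrow> AE \<xi> in lborel. FT \<psi> \<xi> = \<phi> \<xi>"
  using L2_limit_unique[of "\<lambda>n. ft (trunc n \<psi>)", OF ft_trunc_sq_int] is_FT_FT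
  unfolding is_FT_def by blast

lemma FT_eq_ft:
  assumes "integrable lborel \<psi>" "\<psi> \<in> H" shows "AE \<xi> in lborel. FT \<psi> \<xi> = ft \<psi> \<xi>"
proof (rule is_FT_unique[OF assms(2)])
  have "(\<lambda>n. nsq lborel (\<lambda>\<xi>. ft (trunc n \<psi>) \<xi> - ft \<psi> \<xi>)) \<longlonglongrightarrow> 0"
    using nsq_ft_diff[OF trunc_integrable[OF assms(2)] trunc_sq_int[OF assms(2)] assms]
    by (intro tendsto_sandwich[OF _ _ tendsto_const trunc_tendsto[OF assms(2)]]) auto
  then show "is_FT \<psi> (ft \<psi>)" unfolding is_FT_def using ft_contraction(1)[OF assms] by simp
qed

lemma FT_contraction: "\<psi> \<in> H \<Longrightarrow> nsq lborel (FT \<psi>) \<le> nsq lborel \<psi>"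
  using ft_contraction(2)[OF trunc_integrable trunc_sq_int]
  by (intro LIMSEQ_le[OF nsq_tendsto[OF ft_trunc_sq_int FT_sq_int FT_tendsto] nsq_tendsto[OF trunc_sq_int _ trunc_tendsto]]) auto

lemma FT_lincomb:
  assumes "\<phi> \<in> H" "\<psi> \<in> H"
  shows "AE \<xi> in lborel. FT (\<lambda>x. \<phi> x + c * \<psi> x) \<xi> = FT \<phi> \<xi> + c * FT \<psi> \<xi>"
proof (rule is_FT_unique)
  show H: "(\<lambda>x. \<phi> x + c * \<psi> x) \<in> H" using assms by auto
  have eq: "ft (trunc n (\<lambda>x. \<phi> x + c * \<psi> x)) \<xi> = ft (trunc n \<phi>) \<xi> + c * ft (trunc n \<psi>) \<xi>" for n \<xi>
  proof -
    have "trunc n (\<lambda>x. \<phi> x + c * \<psi> x) = (\<lambda>x. trunc n \<phi> x + c * trunc n \<psi> x)"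
      by (simp add: fun_eq_iff trunc_def scaleR_add_right)
    then show ?thesis using ft_add[of "trunc n \<phi>" "\<lambda>x. c * trunc n \<psi> x" \<xi>] trunc_integrable[OF assms(1)] trunc_integrable[OF assms(2)]
      by (simp add: ft_cmult)
  qed
  have b: "nsq lborel (\<lambda>\<xi>. ft (trunc n (\<lambda>x. \<phi> x + c * \<psi> x)) \<xi> - (FT \<phi> \<xi> + c * FT \<psi> \<xi>))
      \<le> 2 * nsq lborel (\<lambda>\<xi>. ft (trunc n \<phi>) \<xi> - FT \<phi> \<xi>) + 2 * ((cmod c)\<^sup>2 * nsq lborel (\<lambda>\<xi>. ft (trunc n \<psi>) \<xi> - FT \<psi> \<xi>))" for n
  proof -
    have "(\<lambda>\<xi>. ft (trunc n (\<lambda>x. \<phi> x + c * \<psi> x)) \<xi> - (FT \<phi> \<xi> + c * FT \<psi> \<xi>))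
       = (\<lambda>\<xi>. (ft (trunc n \<phi>) \<xi> - FT \<phi> \<xi>) + c * (ft (trunc n \<psi>) \<xi> - FT \<psi> \<xi>))"
      by (auto simp: eq algebra_simps)
    then show ?thesis
      using nsq_add_le[of "\<lambda>\<xi>. ft (trunc n \<phi>) \<xi> - FT \<phi> \<xi>" lborel "\<lambda>\<xi>. c * (ft (trunc n \<psi>) \<xi> - FT \<psi> \<xi>)"] assms
      by (simp add: nsq_cmult ft_trunc_sq_int sq_int_diff sq_int_cmult)
  qed
  define U V where "U n = nsq lborel (\<lambda>\<xi>. ft (trunc n (\<lambda>x. \<phi> x + c * \<psi> x)) \<xi> - (FT \<phi> \<xi> + c * FT \<psi> \<xi>))"
    and "V n = 2 * nsq lborel (\<lambda>\<xi>. ft (trunc n \<phi>) \<xi> - FT \<phi> \<xi>) + 2 * ((cmod c)\<^sup>2 * nsq lborel (\<lambda>\<xi>. ft (trunc n \<psi>) \<xi> - FT \<psi> \<xi>))" for n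
  have "V \<longlonglongrightarrow> 2 * 0 + 2 * ((cmod c)\<^sup>2 * 0)"
    unfolding V_def by (intro tendsto_add tendsto_mult tendsto_const FT_tendsto assms)
  moreover have "norm (U n) \<le> V n" for n using b[of n] unfolding U_def V_def by simp
  ultimately have "U \<longlonglongrightarrow> 0"
    by (intro Lim_null_comparison[of U V]) simp_all
  then show "is_FT (\<lambda>x. \<phi> x + c * \<psi> x) (\<lambda>\<xi>. FT \<phi> \<xi> + c * FT \<psi> \<xi>)"
    unfolding is_FT_def U_def using assms by (simp only: sq_int_add sq_int_cmult FT_sq_int simp_thms)
qed

lemma FT_diff:
  assumes "\<phi> \<in> H" "\<psi> \<in> H"
  shows "AE \<xi> in lborel. FT (\<lambda>x. \<phi> x - \<psi> x) \<xi> = FT \<phi> \<xi> - FT \<psi> \<xi>"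
  using FT_lincomb[OF assms, of "-1"] by simp

text \<open>Homogeneity is the case of a combination with the zero function, whose transform is determined
only almost everywhere and is found as a difference.\<close>
lemma FT_cmult:
  assumes "\<psi> \<in> H" shows "AE \<xi> in lborel. FT (\<lambda>x. c * \<psi> x) \<xi> = c * FT \<psi> \<xi>"
proof -
  have "AE \<xi> in lborel. FT (\<lambda>x. \<psi> x - \<psi> x) \<xi> = FT \<psi> \<xi> - FT \<psi> \<xi>" by (rule FT_diff[OF assms assms])
  then have z: "AE \<xi> in lborel. FT (\<lambda>x. 0) \<xi> = 0" by simp
  have "AE \<xi> in lborel. FT (\<lambda>x. 0 + c * \<psi> x) \<xi> = FT (\<lambda>x. 0) \<xi> + c * FT \<psi> \<xi>" by (rule FT_lincomb) (auto simp: assms)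
  with z show ?thesis by eventually_elim simp
qed

lemma FT_cong_AE:
  assumes "\<phi> \<in> H" "\<psi> \<in> H" "AE x in lborel. \<phi> x = \<psi> x"
  shows "AE \<xi> in lborel. FT \<phi> \<xi> = FT \<psi> \<xi>"
proof -
  have d: "(\<lambda>x. \<phi> x - \<psi> x) \<in> H" using assms by auto
  have "nsq lborel (\<lambda>x. \<phi> x - \<psi> x) = 0" using nsq_eq_0[OF d] assms(3) by simp
  then have "nsq lborel (FT (\<lambda>x. \<phi> x - \<psi> x)) = 0" using FT_contraction[OF d] by (simp add: order_antisym)
  then have "AE \<xi> in lborel. FT (\<lambda>x. \<phi> x - \<psi> x) \<xi> = 0" using nsq_eq_0[OF FT_sq_int[OF d]] by simp
  then show ?thesis using FT_diff[OF assms(1,2)] by eventually_elim simp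
qed

definition reflect :: "(real \<Rightarrow> complex) \<Rightarrow> real \<Rightarrow> complex" where "reflect \<psi> x = \<psi> (- x)"

lemma AE_lborel_uminus: "(AE x::real in lborel. P x) \<Longrightarrow> (AE x in lborel. P (- x))"
proof -
  assume "AE x in lborel. P x"
  then obtain N where N: "N \<in> null_sets lborel" "\<And>x. x \<notin> N \<Longrightarrow> P x" by (elim AE_E3) auto
  have "AE x in lborel. x \<notin> N" using N by (rule_tac AE_not_in)
  then have "AE x in lborel. - x \<notin> N"
    using AE_borel_affine[of "-1" "\<lambda>x. x \<notin> N" 0] null_setsD2[OF N(1)] by (simp add: pred_def)
  then show ?thesis by eventually_elim (use N(2) in auto)
qed

lemma integral_uminus:
  fixes f :: "real \<Rightarrow> 'a :: {banach, second_countable_topology}"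
  shows "(\<integral>x. f (- x) \<partial>lborel) = (\<integral>x. f x \<partial>lborel)"
  using lborel_integral_real_affine[of "-1" f 0] by simp

lemma integrable_uminus:
  fixes f :: "real \<Rightarrow> 'a :: {banach, second_countable_topology}"
  shows "integrable lborel f \<Longrightarrow> integrable lborel (\<lambda>x. f (- x))"
  using lborel_integrable_real_affine[of f "-1" 0] by simp

lemma reflect_sq_int [simp, intro]: "\<psi> \<in> H \<Longrightarrow> reflect \<psi> \<in> H"
  using integrable_uminus[of "\<lambda>x. (cmod (\<psi> x))\<^sup>2"] unfolding sq_int_def reflect_def by auto

lemma nsq_reflect: "nsq lborel (reflect \<psi>) = nsq lborel \<psi>"
  unfolding nsq_def reflect_def by (rule integral_uminus)

lemma ip_reflect: "ip lborel (reflect \<phi>) \<psi> = ip lborel \<phi> (reflect \<psi>)"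
  unfolding ip_def reflect_def using integral_uminus[of "\<lambda>x. cnj (\<phi> (- x)) * \<psi> x"] by simp

lemma reflect_reflect [simp]: "reflect (reflect \<psi>) = \<psi>" by (auto simp: reflect_def)

lemma ft_reflect: "ft (reflect \<psi>) \<xi> = reflect (ft \<psi>) \<xi>"
  unfolding ft_def reflect_def
  using integral_uminus[of "\<lambda>x. exp (- (\<i> * complex_of_real \<xi> * complex_of_real x)) * \<psi> (- x)"] by simp

lemma FT_reflect:
  assumes "\<psi> \<in> H" shows "AE \<xi> in lborel. FT (reflect \<psi>) \<xi> = reflect (FT \<psi>) \<xi>"
proof (rule is_FT_unique)
  have tr: "trunc n (reflect \<psi>) = reflect (trunc n \<psi>)" for n
    by (auto simp: fun_eq_iff trunc_def reflect_def indicator_def)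
  have "(\<lambda>\<xi>. ft (trunc n (reflect \<psi>)) \<xi> - reflect (FT \<psi>) \<xi>) = reflect (\<lambda>\<xi>. ft (trunc n \<psi>) \<xi> - FT \<psi> \<xi>)" for n
    by (intro ext) (simp only: tr ft_reflect, simp add: reflect_def)
  then show "is_FT (reflect \<psi>) (reflect (FT \<psi>))"
    unfolding is_FT_def using FT_tendsto[OF assms] assms by (simp only: nsq_reflect reflect_sq_int FT_sq_int simp_thms)
qed (use assms in auto)

lemma FT_cnj:
  assumes "\<psi> \<in> H" shows "AE \<xi> in lborel. FT (\<lambda>x. cnj (\<psi> x)) \<xi> = cnj (reflect (FT \<psi>) \<xi>)"
proof (rule is_FT_unique)
  have "trunc n (\<lambda>x. cnj (\<psi> x)) = (\<lambda>x. cnj (trunc n \<psi> x))" for n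
    by (simp add: fun_eq_iff trunc_def)
  then have "ft (trunc n (\<lambda>x. cnj (\<psi> x))) \<xi> - cnj (reflect (FT \<psi>) \<xi>) = cnj (reflect (\<lambda>\<xi>. ft (trunc n \<psi>) \<xi> - FT \<psi> \<xi>) \<xi>)" for n \<xi>
    using ft_cnj[of "trunc n \<psi>" "- \<xi>"] by (simp add: reflect_def)
  then have "nsq lborel (\<lambda>\<xi>. ft (trunc n (\<lambda>x. cnj (\<psi> x))) \<xi> - cnj (reflect (FT \<psi>) \<xi>)) = nsq lborel (\<lambda>\<xi>. ft (trunc n \<psi>) \<xi> - FT \<psi> \<xi>)" for n
    using nsq_reflect[of "\<lambda>\<xi>. ft (trunc n \<psi>) \<xi> - FT \<psi> \<xi>"] by (simp add: nsq_def del: complex_cnj_diff)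
  then show "is_FT (\<lambda>x. cnj (\<psi> x)) (\<lambda>\<xi>. cnj (reflect (FT \<psi>) \<xi>))"
    unfolding is_FT_def using FT_tendsto[OF assms] assms by auto
qed (use assms in auto)

lemma FT_multiplication:
  assumes "\<phi> \<in> H" "\<psi> \<in> H"
  shows "(\<integral>\<xi>. FT \<phi> \<xi> * \<psi> \<xi> \<partial>lborel) = (\<integral>x. \<phi> x * FT \<psi> x \<partial>lborel)"
proof (rule LIMSEQ_unique)
  have lim: "(\<lambda>n. \<integral>x. u n x * v n x \<partial>lborel) \<longlonglongrightarrow> (\<integral>x. a x * b x \<partial>lborel)"
    if "\<And>n. u n \<in> H" "a \<in> H" "(\<lambda>n. nsq lborel (\<lambda>x. u n x - a x)) \<longlonglongrightarrow> 0"
      "\<And>n. v n \<in> H" "b \<in> H" "(\<lambda>n. nsq lborel (\<lambda>x. v n x - b x)) \<longlonglongrightarrow> 0" for u v a b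
  proof -
    have "(\<lambda>n. ip lborel (\<lambda>x. cnj (u n x)) (v n)) \<longlonglongrightarrow> ip lborel (\<lambda>x. cnj (a x)) b"
    proof (rule ip_tendsto)
      have "nsq lborel (\<lambda>x. cnj (u n x) - cnj (a x)) = nsq lborel (\<lambda>x. u n x - a x)" for n
        unfolding nsq_def complex_cnj_diff[symmetric] complex_mod_cnj ..
      then show "(\<lambda>n. nsq lborel (\<lambda>x. cnj (u n x) - cnj (a x))) \<longlonglongrightarrow> 0" using that(3) by simp
    qed (use that in auto)
    then show ?thesis by (simp add: ip_def)
  qed
  show "(\<lambda>n. \<integral>\<xi>. ft (trunc n \<phi>) \<xi> * trunc n \<psi> \<xi> \<partial>lborel) \<longlonglongrightarrow> (\<integral>\<xi>. FT \<phi> \<xi> * \<psi> \<xi> \<partial>lborel)"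
    by (intro lim ft_trunc_sq_int trunc_sq_int FT_sq_int FT_tendsto trunc_tendsto assms)
  have "(\<lambda>n. \<integral>x. trunc n \<phi> x * ft (trunc n \<psi>) x \<partial>lborel) \<longlonglongrightarrow> (\<integral>x. \<phi> x * FT \<psi> x \<partial>lborel)"
    by (intro lim ft_trunc_sq_int trunc_sq_int FT_sq_int FT_tendsto trunc_tendsto assms)
  then show "(\<lambda>n. \<integral>\<xi>. ft (trunc n \<phi>) \<xi> * trunc n \<psi> \<xi> \<partial>lborel) \<longlonglongrightarrow> (\<integral>x. \<phi> x * FT \<psi> x \<partial>lborel)"
    by (simp only: ft_multiplication[OF trunc_integrable[OF assms(1)] trunc_integrable[OF assms(2)]])
qed

text \<open>The adjoint of the transform is the transform after a reflection. Unitarity is therefore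
equivalent to the inversion formula.\<close>
lemma ip_FT_adjoint:
  assumes "\<phi> \<in> H" "\<psi> \<in> H"
  shows "ip lborel (FT \<phi>) \<psi> = ip lborel \<phi> (FT (reflect \<psi>))"
proof -
  have m [measurable]: "FT \<phi> \<in> borel_measurable borel" "\<psi> \<in> borel_measurable borel"
     "FT (\<lambda>x. cnj (\<phi> x)) \<in> borel_measurable borel"
    using FT_measurable[OF assms(1)] FT_measurable[OF sq_int_cnj[OF assms(1)]] sq_intD(1)[OF assms(2)] by auto
  have "ip lborel (FT \<phi>) \<psi> = (\<integral>x. cnj (reflect (FT \<phi>) x) * reflect \<psi> x \<partial>lborel)"
    unfolding ip_def reflect_def using integral_uminus[of "\<lambda>x. cnj (FT \<phi> x) * \<psi> x"] by simp
  also have "\<dots> = (\<integral>x. FT (\<lambda>x. cnj (\<phi> x)) x * reflect \<psi> x \<partial>lborel)"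
    using FT_cnj[OF assms(1)] by (intro integral_cong_AE) (auto simp: reflect_def)
  also have "\<dots> = (\<integral>x. cnj (\<phi> x) * FT (reflect \<psi>) x \<partial>lborel)"
    by (rule FT_multiplication) (use assms in auto)
  finally show ?thesis by (simp add: ip_def)
qed

text \<open>Lebesgue's differentiation theorem recovers a locally integrable function from its integrals over
intervals, so intervals are enough as test functions.\<close>
lemma H_AE_zero:
  assumes h: "h \<in> H" and 0: "\<And>a b. ip lborel (indicator {a..b}) h = 0"
  shows "AE x in lborel. h x = 0"
proof -
  have si: "set_integrable lborel {a..b} h" for a b
    unfolding set_integrable_def by (rule integrable_indicator_mult[OF h])
  have I: "h integrable_on {a..b}" "integral {a..b} h = 0" for a b
  proof -
    show "h integrable_on {a..b}" using set_borel_integral_eq_integral(1)[OF si] .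
    have "integral {a..b} h = set_lebesgue_integral lborel {a..b} h"
      using set_borel_integral_eq_integral(2)[OF si] by simp
    also have "\<dots> = ip lborel (indicator {a..b}) h"
      unfolding set_lebesgue_integral_def ip_def by (intro Bochner_Integration.integral_cong) (auto simp: indicator_def)
    finally show "integral {a..b} h = 0" using 0 by simp
  qed
  obtain N where N: "negligible N" and
    lim: "\<And>x e. \<lbrakk>x \<notin> N; 0 < e\<rbrakk> \<Longrightarrow> \<exists>d>0. \<forall>k. 0 < k \<and> k < d \<longrightarrow>
        norm (integral (cbox x (x + k *\<^sub>R One)) h /\<^sub>R k ^ DIM(real) - h x) < e"
    using integrable_ccontinuous_explicit[of h] I(1) by (metis cbox_interval)
  have "h x = 0" if "x \<notin> N" for x
  proof (rule ccontr)
    assume "h x \<noteq> 0"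
    then have "0 < cmod (h x)" by simp
    from lim[OF that this] obtain d where d: "d > 0" "\<forall>k. 0 < k \<and> k < d \<longrightarrow>
        norm (integral (cbox x (x + k *\<^sub>R One)) h /\<^sub>R k ^ DIM(real) - h x) < cmod (h x)"
      by blast
    from d(2)[rule_format, of "d/2"] d(1) I(2) show False by (simp add: cbox_interval)
  qed
  then have "AE x in lebesgue. h x = 0"
    using N unfolding negligible_iff_null_sets by (intro AE_I'[of N]) auto
  then show ?thesis using AE_completion_iff[of "\<lambda>x. h x = 0" lborel] by simp
qed

lemma mollify_rescale:
  assumes "0 < \<epsilon>"
  shows "mollify \<epsilon> \<alpha> y = (\<integral>u. complex_of_real (std_normal_density u) * \<alpha> (y + \<epsilon> * u) \<partial>lborel)"
proof -
  have "normal_density (y + \<epsilon> * u) \<epsilon> y * \<epsilon> = std_normal_density u" for u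
    using assms by (simp add: normal_density_def real_sqrt_mult power_mult_distrib)
  then have "complex_of_real \<epsilon> * (complex_of_real (normal_density (y + \<epsilon> * u) \<epsilon> y) * \<alpha> (y + \<epsilon> * u)) = complex_of_real (std_normal_density u) * \<alpha> (y + \<epsilon> * u)" for u
    by (metis mult.assoc mult.commute of_real_mult)
  then show ?thesis
    unfolding mollify_def
    using lborel_integral_real_affine[of \<epsilon> "\<lambda>x. complex_of_real (normal_density x \<epsilon> y) * \<alpha> x" y] assms
    by (simp only: scaleR_conv_of_real abs_of_pos Bochner_Integration.integral_mult_right_zero[symmetric])
qed

lemma mollify_box_bound:
  assumes "0 < \<epsilon>" shows "cmod (mollify \<epsilon> (indicator {a..b}) y) \<le> 1"
proof -
  have "cmod (mollify \<epsilon> (indicator {a..b}) y) \<le> (\<integral>u. std_normal_density u \<partial>lborel)"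
    unfolding mollify_rescale[OF assms]
    by (rule Bochner_Integration.integral_norm_bound_integral[OF _ integrable_normal_density])
       (auto simp: norm_mult indicator_def intro!: Bochner_Integration.integrable_bound[OF integrable_normal_density[of 1 0]])
  then show ?thesis by simp
qed

lemma mollify_box_tendsto:
  assumes "y \<noteq> a" "y \<noteq> b"
  shows "(\<lambda>n. mollify (1 / Suc n) (indicator {a..b}) y) \<longlonglongrightarrow> indicator {a..b} y"
proof -
  have "(\<lambda>n. \<integral>u. complex_of_real (std_normal_density u) * indicator {a..b} (y + 1 / Suc n * u) \<partial>lborel)
     \<longlonglongrightarrow> (\<integral>u. complex_of_real (std_normal_density u) * indicator {a..b} y \<partial>lborel)"
  proof (rule integral_dominated_convergence)
    show "integrable lborel std_normal_density" by (rule integrable_normal_density) simp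
    show "AE u in lborel. (\<lambda>n. complex_of_real (std_normal_density u) * indicator {a..b} (y + 1 / Suc n * u))
        \<longlonglongrightarrow> complex_of_real (std_normal_density u) * indicator {a..b} y"
    proof (rule AE_I2, rule tendsto_mult[OF tendsto_const])
      fix u :: real
      have "(\<lambda>n. y + 1 / Suc n * u) \<longlonglongrightarrow> y + 0 * u"
        using LIMSEQ_Suc[OF lim_1_over_n] by (intro tendsto_intros) simp_all
      then have L: "(\<lambda>n. y + 1 / Suc n * u) \<longlonglongrightarrow> y" by simp
      have "\<forall>\<^sub>F n in sequentially. (indicator {a..b} (y + 1 / Suc n * u) :: complex) = indicator {a..b} y"
      proof -
        consider "y < a" | "b < y" | "a < y" "y < b" using assms by linarith
        then show ?thesis
        proof cases
          case 1 show ?thesis using order_tendstoD(2)[OF L 1] by eventually_elim (use 1 in \<open>auto simp: indicator_def\<close>)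
        next
          case 2 show ?thesis using order_tendstoD(1)[OF L 2] by eventually_elim (use 2 in \<open>auto simp: indicator_def\<close>)
        next
          case 3 show ?thesis using order_tendstoD(2)[OF L 3(2)] order_tendstoD(1)[OF L 3(1)]
            by eventually_elim (use 3 in \<open>auto simp: indicator_def\<close>)
        qed
      qed
      then show "(\<lambda>n. indicator {a..b} (y + 1 / Suc n * u) :: complex) \<longlonglongrightarrow> indicator {a..b} y"
        by (rule tendsto_eventually)
    qed
  qed (auto simp: norm_mult indicator_def)
  moreover have "(\<integral>u. complex_of_real (std_normal_density u) * indicator {a..b} y \<partial>lborel) = indicator {a..b} y"
    by (simp add: Bochner_Integration.integral_mult_left_zero)
  ultimately show ?thesis by (simp add: mollify_rescale)
qed

text \<open>For an indicator the regularised Parseval identity can be taken to the limit directly: the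
mollified indicator is bounded by $1$ and converges pointwise off the two end points.\<close>
lemma ip_ft_box:
  assumes \<psi>: "integrable lborel \<psi>" "\<psi> \<in> H"
  shows "ip lborel (ft (indicator {a..b})) (ft \<psi>) = ip lborel (indicator {a..b}) \<psi>"
proof (rule LIMSEQ_unique)
  let ?\<alpha> = "indicator {a..b} :: real \<Rightarrow> complex"
  note \<alpha> = box_integrable[of a b]
  have [measurable]: "\<psi> \<in> borel_measurable borel" using borel_measurable_integrable[OF \<psi>(1)] by simp
  have [measurable]: "mollify e ?\<alpha> \<in> borel_measurable borel" if "0 < e" for e
    unfolding mollify_rescale[OF that, abs_def] by measurable
  let ?I = "\<lambda>n. \<integral>\<xi>. complex_of_real (gauss (1 / Suc n) \<xi>) * (cnj (ft ?\<alpha> \<xi>) * ft \<psi> \<xi>) \<partial>lborel"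
  show "?I \<longlonglongrightarrow> ip lborel (ft ?\<alpha>) (ft \<psi>)"
    unfolding ip_def
  proof (rule integral_dominated_convergence)
    show "integrable lborel (\<lambda>\<xi>. norm (cnj (ft ?\<alpha> \<xi>) * ft \<psi> \<xi>))"
      by (intro integrable_norm integrable_ip sq_int_cnj ft_contraction(1) \<alpha> \<psi>) auto
    show "AE \<xi> in lborel. (\<lambda>n. complex_of_real (gauss (1 / Suc n) \<xi>) * (cnj (ft ?\<alpha> \<xi>) * ft \<psi> \<xi>)) \<longlonglongrightarrow> cnj (ft ?\<alpha> \<xi>) * ft \<psi> \<xi>"
    proof (rule AE_I2)
      fix \<xi> :: real
      have "(\<lambda>n. gauss (1 / Suc n) \<xi>) \<longlonglongrightarrow> exp (- (0 * \<xi>)\<^sup>2 / 2)"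
        unfolding gauss_def using LIMSEQ_Suc[OF lim_1_over_n] by (intro tendsto_intros) simp_all
      then have "(\<lambda>n. complex_of_real (gauss (1 / Suc n) \<xi>) * (cnj (ft ?\<alpha> \<xi>) * ft \<psi> \<xi>)) \<longlonglongrightarrow> complex_of_real 1 * (cnj (ft ?\<alpha> \<xi>) * ft \<psi> \<xi>)"
        by (intro tendsto_mult tendsto_of_real tendsto_const) simp
      then show "(\<lambda>n. complex_of_real (gauss (1 / Suc n) \<xi>) * (cnj (ft ?\<alpha> \<xi>) * ft \<psi> \<xi>)) \<longlonglongrightarrow> cnj (ft ?\<alpha> \<xi>) * ft \<psi> \<xi>" by simp
    qed
    show "AE \<xi> in lborel. norm (complex_of_real (gauss (1 / Suc n) \<xi>) * (cnj (ft ?\<alpha> \<xi>) * ft \<psi> \<xi>)) \<le> norm (cnj (ft ?\<alpha> \<xi>) * ft \<psi> \<xi>)" for n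
      using gauss_bounds[of "1 / Suc n"] by (intro AE_I2) (simp add: norm_mult less_imp_le mult_left_le_one_le)
  qed measurable
  have "(\<lambda>n. \<integral>y. cnj (mollify (1 / Suc n) ?\<alpha> y) * \<psi> y \<partial>lborel) \<longlonglongrightarrow> ip lborel ?\<alpha> \<psi>"
    unfolding ip_def
  proof (rule integral_dominated_convergence)
    show "integrable lborel (\<lambda>y. cmod (\<psi> y))" using \<psi> by simp
    have "AE y in lborel. y \<notin> {a, b}" by (intro AE_not_in countable_imp_null_set_lborel) auto
    then show "AE y in lborel. (\<lambda>n. cnj (mollify (1 / Suc n) ?\<alpha> y) * \<psi> y) \<longlonglongrightarrow> cnj (?\<alpha> y) * \<psi> y"
      by eventually_elim (intro tendsto_mult tendsto_const tendsto_cnj mollify_box_tendsto, auto)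
    show "AE y in lborel. norm (cnj (mollify (1 / Suc n) ?\<alpha> y) * \<psi> y) \<le> cmod (\<psi> y)" for n
      using mollify_box_bound[of "1 / Suc n" a b] by (intro AE_I2) (simp add: norm_mult mult_left_le_one_le)
  qed auto
  then show "?I \<longlonglongrightarrow> ip lborel ?\<alpha> \<psi>"
    by (simp only: regularised_Parseval[OF \<alpha> \<psi>(1)] of_nat_0_less_iff zero_less_Suc zero_less_divide_1_iff)
qed

text \<open>Tested against indicators of intervals, the inversion formula is the Parseval identity
\<open>ip_ft_box\<close>, extended to the whole space by continuity.\<close>
lemma FT_inverse:
  assumes \<psi>: "\<psi> \<in> H" shows "AE x in lborel. FT (reflect (FT \<psi>)) x = \<psi> x"
proof -
  have d: "(\<lambda>x. FT (reflect (FT \<psi>)) x - \<psi> x) \<in> H" using \<psi> by auto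
  have "ip lborel (indicator {a..b}) (\<lambda>x. FT (reflect (FT \<psi>)) x - \<psi> x) = 0" for a b
  proof -
    let ?\<alpha> = "indicator {a..b} :: real \<Rightarrow> complex"
    note \<alpha> = box_integrable[of a b]
    have "ip lborel (ft ?\<alpha>) (FT \<psi>) = ip lborel ?\<alpha> \<psi>"
    proof (rule LIMSEQ_unique)
      show "(\<lambda>n. ip lborel (ft ?\<alpha>) (ft (trunc n \<psi>))) \<longlonglongrightarrow> ip lborel (ft ?\<alpha>) (FT \<psi>)"
        by (intro ip_tendsto ft_contraction(1) \<alpha> box_sq_int ft_trunc_sq_int \<psi> FT_sq_int FT_tendsto) (simp add: nsq_def)
      have "(\<lambda>n. ip lborel ?\<alpha> (trunc n \<psi>)) \<longlonglongrightarrow> ip lborel ?\<alpha> \<psi>"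
        by (intro ip_tendsto trunc_sq_int trunc_tendsto \<psi> box_sq_int) (simp add: nsq_def)
      then show "(\<lambda>n. ip lborel (ft ?\<alpha>) (ft (trunc n \<psi>))) \<longlonglongrightarrow> ip lborel ?\<alpha> \<psi>"
        by (simp only: ip_ft_box[OF trunc_integrable[OF \<psi>] trunc_sq_int[OF \<psi>]])
    qed
    moreover have "ip lborel (ft ?\<alpha>) (FT \<psi>) = ip lborel (FT ?\<alpha>) (FT \<psi>)"
      using FT_eq_ft[OF \<alpha> box_sq_int] FT_measurable[OF \<psi>] FT_measurable[OF box_sq_int, of a b]
      by (intro ip_cong_AE) auto
    ultimately have "ip lborel ?\<alpha> (FT (reflect (FT \<psi>))) = ip lborel ?\<alpha> \<psi>"
      using ip_FT_adjoint[OF box_sq_int FT_sq_int[OF \<psi>], of a b] by simp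
    then show ?thesis using \<psi> by (subst ip_diff_right) auto
  qed
  from H_AE_zero[OF d this] show ?thesis by simp
qed

theorem Plancherel_ip:
  assumes "\<phi> \<in> H" "\<psi> \<in> H" shows "ip lborel (FT \<phi>) (FT \<psi>) = ip lborel \<phi> \<psi>"
  unfolding ip_FT_adjoint[OF assms(1) FT_sq_int[OF assms(2)]]
  using FT_inverse[OF assms(2)] sq_intD(1)[OF assms(1)] sq_intD(1)[OF assms(2)] FT_measurable[of "reflect (FT \<psi>)"] assms
  by (intro ip_cong_AE) auto

lemma Plancherel: "\<psi> \<in> H \<Longrightarrow> nsq lborel (FT \<psi>) = nsq lborel \<psi>"
  using Plancherel_ip[of \<psi> \<psi>] by (simp add: ip_self)

lemma FT_inverse':
  assumes \<phi>: "\<phi> \<in> H" shows "AE \<xi> in lborel. FT (FT (reflect \<phi>)) \<xi> = \<phi> \<xi>"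
proof -
  have "AE x in lborel. FT (reflect \<phi>) x = reflect (FT \<phi>) x" by (rule FT_reflect[OF \<phi>])
  then have "AE x in lborel. FT (FT (reflect \<phi>)) x = FT (reflect (FT \<phi>)) x"
    by (intro FT_cong_AE) (use \<phi> in auto)
  then show ?thesis using FT_inverse[OF \<phi>] by eventually_elim simp
qed

section \<open>The Hermitian form of the commutator\<close>

definition bdd_borel :: "(real \<Rightarrow> real) \<Rightarrow> bool" where
  "bdd_borel f \<longleftrightarrow> f \<in> borel_measurable borel \<and> bounded (range f)"

lemma bdd_borel_bound: "bdd_borel f \<Longrightarrow> \<exists>C>0. \<forall>x. \<bar>f x\<bar> \<le> C"
  unfolding bdd_borel_def bounded_pos by auto

lemma bdd_borelI: "f \<in> borel_measurable borel \<Longrightarrow> (\<And>x. \<bar>f x\<bar> \<le> C) \<Longrightarrow> bdd_borel f"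
  unfolding bdd_borel_def bounded_iff by auto

lemma bdd_borel_measurable: "bdd_borel f \<Longrightarrow> f \<in> borel_measurable borel"
  by (simp add: bdd_borel_def)

lemma H_measurable: "\<psi> \<in> H \<Longrightarrow> \<psi> \<in> borel_measurable borel"
  using sq_intD(1)[of \<psi> lborel] by simp

lemma fun_Q_sq_int [simp, intro]: "bdd_borel f \<Longrightarrow> \<psi> \<in> H \<Longrightarrow> fun_Q f \<psi> \<in> H"
proof -
  assume "bdd_borel f" and \<psi>: "\<psi> \<in> H"
  then obtain C where "\<And>x. \<bar>f x\<bar> \<le> C" and "f \<in> borel_measurable lborel"
    using bdd_borel_bound[of f] bdd_borel_measurable[of f] by auto
  then show ?thesis unfolding fun_Q_def using \<psi> by (intro sq_int_mult_bounded)
qed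

lemma ip_fun_Q: "ip M (fun_Q f \<phi>) \<psi> = ip M \<phi> (fun_Q f \<psi>)"
  unfolding ip_def fun_Q_def by (simp add: ac_simps)

text \<open>The form $\langle\phi, i[f(P), g(Q)]\psi\rangle$, with the unitary transform moved to both sides and
with \<open>f\<close> acting on the transforms. It involves no inverse transform.\<close>
definition cform :: "(real \<Rightarrow> real) \<Rightarrow> (real \<Rightarrow> real) \<Rightarrow> (real \<Rightarrow> complex) \<Rightarrow> (real \<Rightarrow> complex) \<Rightarrow> complex" where
  "cform f g \<phi> \<psi> = \<i> * (ip lborel (FT \<phi>) (fun_Q f (FT (fun_Q g \<psi>))) - ip lborel (FT (fun_Q g \<phi>)) (fun_Q f (FT \<psi>)))"

text \<open>The operator of the form \<^const>\<open>cform\<close>, on Borel representatives: the composition of \<^const>\<open>FT\<close>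
with a reflection is the inverse transform.\<close>
definition comm_op :: "(real \<Rightarrow> real) \<Rightarrow> (real \<Rightarrow> real) \<Rightarrow> (real \<Rightarrow> complex) \<Rightarrow> real \<Rightarrow> complex" where
  "comm_op f g \<psi> = (\<lambda>x. \<i> * (FT (reflect (fun_Q f (FT (fun_Q g \<psi>)))) x - fun_Q g (FT (reflect (fun_Q f (FT \<psi>)))) x))"

lemma comm_op_sq_int [simp, intro]: "bdd_borel f \<Longrightarrow> bdd_borel g \<Longrightarrow> \<psi> \<in> H \<Longrightarrow> comm_op f g \<psi> \<in> H"
  unfolding comm_op_def by (intro sq_int_cmult sq_int_diff fun_Q_sq_int FT_sq_int reflect_sq_int)

lemma cform_eq_ip:
  assumes "bdd_borel f" "bdd_borel g" "\<phi> \<in> H" "\<psi> \<in> H"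
  shows "cform f g \<phi> \<psi> = ip lborel \<phi> (comm_op f g \<psi>)"
proof -
  let ?X = "FT (reflect (fun_Q f (FT (fun_Q g \<psi>))))" and ?Y = "FT (reflect (fun_Q f (FT \<psi>)))"
  have X: "?X \<in> H" and Y: "?Y \<in> H" and gY: "fun_Q g ?Y \<in> H"
    by (intro FT_sq_int reflect_sq_int fun_Q_sq_int assms)+
  have e1: "ip lborel (FT \<phi>) (fun_Q f (FT (fun_Q g \<psi>))) = ip lborel \<phi> ?X"
    by (intro ip_FT_adjoint fun_Q_sq_int FT_sq_int assms)
  have e2: "ip lborel (FT (fun_Q g \<phi>)) (fun_Q f (FT \<psi>)) = ip lborel (fun_Q g \<phi>) ?Y"
    by (intro ip_FT_adjoint fun_Q_sq_int FT_sq_int assms)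
  show ?thesis unfolding comm_op_def cform_def e1 e2
    by (simp only: ip_cmult_right ip_diff_right[OF X gY assms(3)] ip_fun_Q)
qed

lemma cform_hermitian: "cform f g \<psi> \<phi> = cnj (cform f g \<phi> \<psi>)"
  unfolding cform_def by (simp only: complex_cnj_mult complex_cnj_diff ip_cnj ip_fun_Q complex_cnj_i) (simp add: right_diff_distrib)

lemma cform_cong_AE:
  assumes fg: "bdd_borel f" "bdd_borel g" "bdd_borel f'" "bdd_borel g'"
    and H: "\<phi> \<in> H" "\<psi> \<in> H" "\<phi>' \<in> H" "\<psi>' \<in> H"
    and "AE x in lborel. f x = f' x" "AE x in lborel. g x = g' x"
      "AE x in lborel. \<phi> x = \<phi>' x" "AE x in lborel. \<psi> x = \<psi>' x"
  shows "cform f g \<phi> \<psi> = cform f' g' \<phi>' \<psi>'"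
proof -
  have Q: "AE x in lborel. fun_Q u a x = fun_Q v b x"
    if "AE x in lborel. u x = v x" "AE x in lborel. a x = b x" for u v a b
    using that by eventually_elim (simp add: fun_Q_def)
  have m: "\<theta> \<in> borel_measurable lborel" if "\<theta> \<in> H" for \<theta> using that by auto
  have "ip lborel (FT \<phi>) (fun_Q f (FT (fun_Q g \<psi>))) = ip lborel (FT \<phi>') (fun_Q f' (FT (fun_Q g' \<psi>')))"
    by (intro ip_cong_AE Q FT_cong_AE m fun_Q_sq_int FT_sq_int assms)
  moreover have "ip lborel (FT (fun_Q g \<phi>)) (fun_Q f (FT \<psi>)) = ip lborel (FT (fun_Q g' \<phi>')) (fun_Q f' (FT \<psi>'))"
    by (intro ip_cong_AE Q FT_cong_AE m fun_Q_sq_int FT_sq_int assms)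
  ultimately show ?thesis by (simp add: cform_def)
qed

text \<open>The last condition says that the operator of the form is not zero: a bounded operator vanishes if
and only if all its matrix elements do.\<close>
definition positive_commutator :: "(real \<Rightarrow> real) \<Rightarrow> (real \<Rightarrow> real) \<Rightarrow> bool" where
  "positive_commutator f g \<longleftrightarrow> bdd_borel f \<and> bdd_borel g \<and>
     (\<forall>\<phi>\<in>H. cform f g \<phi> \<phi> \<in> \<real>\<^sub>\<ge>\<^sub>0) \<and> (\<exists>\<phi>\<in>H. \<exists>\<psi>\<in>H. cform f g \<phi> \<psi> \<noteq> 0)"

lemma FT_FT: "\<psi> \<in> H \<Longrightarrow> AE x in lborel. FT (FT \<psi>) x = reflect \<psi> x"
proof -
  assume \<psi>: "\<psi> \<in> H"
  have "AE x in lborel. reflect (FT (FT \<psi>)) x = \<psi> x"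
    using FT_inverse[OF \<psi>] FT_reflect[OF FT_sq_int[OF \<psi>]] by eventually_elim simp
  from AE_lborel_uminus[OF this] show ?thesis by eventually_elim (simp add: reflect_def)
qed

lemma fun_Q_uminus: "fun_Q (\<lambda>x. - f x) \<psi> = (\<lambda>x. (-1) * fun_Q f \<psi> x)"
  by (simp add: fun_eq_iff fun_Q_def)

lemma bdd_borel_reflect:
  assumes "bdd_borel g" shows "bdd_borel (\<lambda>x. g (- x))"
proof -
  obtain C where C: "\<And>x. \<bar>g x\<bar> \<le> C" using bdd_borel_bound[OF assms] by blast
  note [measurable] = bdd_borel_measurable[OF assms]
  show ?thesis by (rule bdd_borelI[where C=C]) (use C in auto)
qed

lemma bdd_borel_uminus:
  assumes "bdd_borel g" shows "bdd_borel (\<lambda>x. - g x)"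
proof -
  obtain C where C: "\<And>x. \<bar>g x\<bar> \<le> C" using bdd_borel_bound[OF assms] by blast
  note [measurable] = bdd_borel_measurable[OF assms]
  show ?thesis by (rule bdd_borelI[where C=C]) (use C in auto)
qed

text \<open>Conjugation with the Fourier transform turns $P$ into $Q$ and $Q$ into $-P$, so it interchanges the
two factors of the commutator; the sign that this causes is given to \<open>f\<close>.\<close>
lemma cform_FT:
  assumes f: "bdd_borel f" and g: "bdd_borel g" and \<phi>: "\<phi> \<in> H" and \<psi>: "\<psi> \<in> H"
  shows "cform (\<lambda>x. g (- x)) (\<lambda>x. - f x) (FT \<phi>) (FT \<psi>) = cform f g \<phi> \<psi>"
proof -
  note g' = bdd_borel_reflect[OF g]
  have main: "ip lborel (FT (FT \<phi>)) (fun_Q (\<lambda>x. g (- x)) (FT (fun_Q (\<lambda>x. - f x) (FT \<psi>))))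
     = - ip lborel (FT (fun_Q g \<phi>)) (fun_Q f (FT \<psi>))" if \<phi>: "\<phi> \<in> H" and \<psi>: "\<psi> \<in> H" for \<phi> \<psi>
  proof -
    let ?X = "fun_Q f (FT \<psi>)"
    have X: "?X \<in> H" using f \<psi> by auto
    let ?Y = "fun_Q (\<lambda>x. g (- x)) (\<lambda>x. (-1) * FT ?X x)"
    have Y: "?Y \<in> H" by (intro fun_Q_sq_int sq_int_cmult FT_sq_int X g')
    have e1: "ip lborel (FT (FT \<phi>)) (fun_Q (\<lambda>x. g (- x)) (FT (fun_Q (\<lambda>x. - f x) (FT \<psi>))))
       = ip lborel (reflect \<phi>) ?Y"
    proof (rule ip_cong_AE)
      show "AE x in lborel. fun_Q (\<lambda>x. g (- x)) (FT (fun_Q (\<lambda>x. - f x) (FT \<psi>))) x = ?Y x"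
        unfolding fun_Q_uminus using FT_cmult[OF X, of "-1"] by eventually_elim (simp add: fun_Q_def)
    qed (use FT_FT[OF \<phi>] \<phi> \<psi> f g' Y bdd_borel_uminus[OF f] in \<open>auto intro!: H_measurable\<close>)
    have "reflect ?Y = (\<lambda>x. (-1) * fun_Q g (reflect (FT ?X)) x)"
      by (simp add: fun_eq_iff reflect_def fun_Q_def)
    then have "ip lborel (reflect \<phi>) ?Y = (-1) * ip lborel (fun_Q g \<phi>) (reflect (FT ?X))"
      by (simp only: ip_reflect ip_cmult_right ip_fun_Q)
    then have e2: "ip lborel (reflect \<phi>) ?Y = - ip lborel (fun_Q g \<phi>) (reflect (FT ?X))"
      by (simp only: mult_minus1)
    have e3: "ip lborel (fun_Q g \<phi>) (reflect (FT ?X)) = ip lborel (fun_Q g \<phi>) (FT (reflect ?X))"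
    proof (rule ip_cong_AE)
      show "AE x in lborel. reflect (FT ?X) x = FT (reflect ?X) x"
        using FT_reflect[OF X] by eventually_elim (rule sym)
    qed (use X g \<phi> in \<open>auto intro!: H_measurable\<close>)
    have e4: "ip lborel (fun_Q g \<phi>) (FT (reflect ?X)) = ip lborel (FT (fun_Q g \<phi>)) ?X"
      by (rule ip_FT_adjoint[symmetric]) (use X g \<phi> in auto)
    show ?thesis unfolding e1 e2 e3 e4 ..
  qed
  have e1: "ip lborel (FT (fun_Q (\<lambda>x. - f x) (FT \<phi>))) (fun_Q (\<lambda>x. g (- x)) (FT (FT \<psi>)))
     = cnj (ip lborel (FT (FT \<psi>)) (fun_Q (\<lambda>x. g (- x)) (FT (fun_Q (\<lambda>x. - f x) (FT \<phi>)))))"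
    unfolding ip_cnj ip_fun_Q ..
  have e2: "cnj (- ip lborel (FT (fun_Q g \<psi>)) (fun_Q f (FT \<phi>))) = - ip lborel (FT \<phi>) (fun_Q f (FT (fun_Q g \<psi>)))"
    by (simp only: complex_cnj_minus ip_cnj ip_fun_Q)
  show ?thesis
    unfolding cform_def main[OF \<phi> \<psi>] e1 main[OF \<psi> \<phi>] e2 by (simp only: minus_diff_minus minus_diff_eq)
qed

lemma positive_commutator_FT:
  assumes "positive_commutator f g"
  shows "positive_commutator (\<lambda>x. g (- x)) (\<lambda>x. - f x)"
proof -
  have f: "bdd_borel f" and g: "bdd_borel g" using assms by (auto simp: positive_commutator_def)
  note f' = bdd_borel_uminus[OF f] and g' = bdd_borel_reflect[OF g]
  have "cform (\<lambda>x. g (- x)) (\<lambda>x. - f x) \<phi> \<phi> \<in> \<real>\<^sub>\<ge>\<^sub>0" if \<phi>: "\<phi> \<in> H" for \<phi>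
  proof -
    let ?\<psi> = "FT (reflect \<phi>)"
    have \<psi>: "?\<psi> \<in> H" using \<phi> by auto
    have "cform (\<lambda>x. g (- x)) (\<lambda>x. - f x) \<phi> \<phi> = cform (\<lambda>x. g (- x)) (\<lambda>x. - f x) (FT ?\<psi>) (FT ?\<psi>)"
      using FT_inverse'[OF \<phi>] by (intro cform_cong_AE f' g' \<phi> FT_sq_int \<psi>) auto
    also have "\<dots> = cform f g ?\<psi> ?\<psi>" by (rule cform_FT[OF f g \<psi> \<psi>])
    finally show ?thesis using assms \<psi> by (auto simp: positive_commutator_def)
  qed
  moreover obtain \<phi> \<psi> where "\<phi> \<in> H" "\<psi> \<in> H" "cform f g \<phi> \<psi> \<noteq> 0"
    using assms by (auto simp: positive_commutator_def)
  then have "\<exists>\<phi>\<in>H. \<exists>\<psi>\<in>H. cform (\<lambda>x. g (- x)) (\<lambda>x. - f x) \<phi> \<psi> \<noteq> 0"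
    using cform_FT[OF f g] by (metis FT_sq_int)
  ultimately show ?thesis using f' g' by (simp add: positive_commutator_def)
qed

section \<open>From operators on Lebesgue measurable functions to the form\<close>

text \<open>A Borel measurable version of an element of \<^const>\<open>L2\<close>. All operators are computed on such versions,
for which \<^term>\<open>lborel\<close> supports Fubini's theorem.\<close>
definition rep :: "(real \<Rightarrow> complex) \<Rightarrow> (real \<Rightarrow> complex) \<Rightarrow> bool" where
  "rep \<psi> \<psi>' \<longleftrightarrow> \<psi> \<in> L2 \<and> \<psi>' \<in> H \<and> (AE x in lebesgue. \<psi> x = \<psi>' x)"

lemma H_subset_L2: "\<psi> \<in> H \<Longrightarrow> \<psi> \<in> L2"
proof -
  assume \<psi>: "\<psi> \<in> H"
  have "(\<lambda>x. (cmod (\<psi> x))\<^sup>2) \<in> borel_measurable lborel" using sq_intD(1)[OF \<psi>] by measurable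
  then show ?thesis
    using sq_intD[OF \<psi>] unfolding L2_def by (simp add: integrable_completion measurable_completion)
qed

lemma rep_self: "\<psi> \<in> H \<Longrightarrow> rep \<psi> \<psi>"
  by (simp add: rep_def H_subset_L2)

lemma lebesgue_borel_version:
  fixes u :: "real \<Rightarrow> real"
  assumes "u \<in> borel_measurable lebesgue"
  obtains u' where "u' \<in> borel_measurable borel" "AE x in lebesgue. u x = u' x"
proof -
  obtain u' where u': "u' \<in> borel_measurable lborel" "AE x in lborel. u x = u' x"
    using completion_ex_borel_measurable_real[OF assms] by blast
  show ?thesis
    by (rule that[OF _ AE_completion[OF u'(2)]]) (use u'(1) in simp)
qed

lemma rep_exists:
  assumes "\<psi> \<in> L2" shows "\<exists>\<psi>'. rep \<psi> \<psi>'"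
proof -
  have m [measurable]: "\<psi> \<in> borel_measurable lebesgue" and i: "integrable lebesgue (\<lambda>x. (cmod (\<psi> x))\<^sup>2)"
    using assms by (auto simp: L2_def)
  obtain a where a [measurable]: "a \<in> borel_measurable borel" "AE x in lebesgue. Re (\<psi> x) = a x"
    using lebesgue_borel_version[of "\<lambda>x. Re (\<psi> x)"] by auto
  obtain b where b [measurable]: "b \<in> borel_measurable borel" "AE x in lebesgue. Im (\<psi> x) = b x"
    using lebesgue_borel_version[of "\<lambda>x. Im (\<psi> x)"] by auto
  define c where "c x = complex_of_real (a x) + \<i> * complex_of_real (b x)" for x
  have c [measurable]: "c \<in> borel_measurable borel" unfolding c_def by measurable
  have ae: "AE x in lebesgue. \<psi> x = c x" using a(2) b(2)
    by eventually_elim (simp add: c_def complex_eq_iff)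
  have "c \<in> borel_measurable lebesgue" using c by (simp add: measurable_completion)
  then have "(\<lambda>x. (cmod (c x))\<^sup>2) \<in> borel_measurable lebesgue" by measurable
  moreover have "AE x in lebesgue. (cmod (\<psi> x))\<^sup>2 = (cmod (c x))\<^sup>2" using ae by eventually_elim simp
  ultimately have "integrable lebesgue (\<lambda>x. (cmod (c x))\<^sup>2)" using i
    by (subst integrable_cong_AE[symmetric]) auto
  then have "c \<in> H" by (auto simp: sq_int_def integrable_completion)
  with ae assms show ?thesis by (auto simp: rep_def)
qed

lemma rep_AE: "rep \<psi> \<psi>' \<Longrightarrow> \<phi> \<in> H \<Longrightarrow> AE x in lborel. \<psi>' x = \<phi> x \<Longrightarrow> rep \<psi> \<phi>"
proof -
  assume r: "rep \<psi> \<psi>'" and \<phi>: "\<phi> \<in> H" and "AE x in lborel. \<psi>' x = \<phi> x"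
  then have "AE x in lebesgue. \<psi>' x = \<phi> x" by (intro AE_completion)
  moreover have "AE x in lebesgue. \<psi> x = \<psi>' x" using r by (simp add: rep_def)
  ultimately have "AE x in lebesgue. \<psi> x = \<phi> x" by eventually_elim simp
  with r \<phi> show ?thesis by (simp add: rep_def)
qed

lemma rep_fun_Q:
  assumes "rep \<psi> \<psi>'" and f: "f \<in> borel_measurable lebesgue" "bounded (range f)"
    and f': "bdd_borel f'" "AE x in lebesgue. f x = f' x"
  shows "rep (fun_Q f \<psi>) (fun_Q f' \<psi>')"
proof -
  obtain C where "\<And>x. \<bar>f x\<bar> \<le> C" using f(2) by (auto simp: bounded_iff)
  then have "fun_Q f \<psi> \<in> sq_int lebesgue"
    using assms(1) f(1) unfolding fun_Q_def
    by (intro sq_int_mult_bounded[where C=C]) (auto simp: rep_def L2_def sq_int_def)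
  then have "fun_Q f \<psi> \<in> L2" by (simp add: L2_def sq_int_def)
  moreover have "AE x in lebesgue. \<psi> x = \<psi>' x" using assms(1) by (simp add: rep_def)
  then have "AE x in lebesgue. fun_Q f \<psi> x = fun_Q f' \<psi>' x"
    using f'(2) by eventually_elim (simp add: fun_Q_def)
  ultimately show ?thesis using assms(1) f' by (auto simp: rep_def)
qed

lemma fourier_trunc_rep:
  assumes "rep \<psi> \<psi>'" shows "fourier_trunc \<psi> n = ft (trunc n \<psi>')"
proof
  fix \<xi> :: real
  have \<psi>': "\<psi>' \<in> H" and ae: "AE x in lebesgue. \<psi> x = \<psi>' x" and m: "\<psi> \<in> borel_measurable lebesgue"
    using assms by (auto simp: rep_def L2_def)
  have [measurable]: "\<psi>' \<in> borel_measurable borel" using sq_intD(1)[OF \<psi>'] by simp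
  have [measurable]: "(\<lambda>x. exp (- (\<i> * complex_of_real \<xi> * complex_of_real x))) \<in> borel_measurable borel" by measurable
  have "(\<integral>x\<in>{- real n..real n}. exp (- (\<i> * complex_of_real \<xi> * complex_of_real x)) * \<psi> x \<partial>lebesgue)
     = (\<integral>x. exp (- (\<i> * complex_of_real \<xi> * complex_of_real x)) * trunc n \<psi>' x \<partial>lebesgue)"
    unfolding set_lebesgue_integral_def
  proof (rule integral_cong_AE)
    show "AE x in lebesgue. indicat_real {- real n..real n} x *\<^sub>R (exp (- (\<i> * complex_of_real \<xi> * complex_of_real x)) * \<psi> x)
        = exp (- (\<i> * complex_of_real \<xi> * complex_of_real x)) * trunc n \<psi>' x"
      using ae by eventually_elim (simp add: trunc_def)
    have e: "(\<lambda>x. exp (- (\<i> * complex_of_real \<xi> * complex_of_real x))) \<in> borel_measurable lebesgue"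
      by (intro measurable_completion) measurable
    show "(\<lambda>x. indicat_real {- real n..real n} x *\<^sub>R (exp (- (\<i> * complex_of_real \<xi> * complex_of_real x)) * \<psi> x)) \<in> borel_measurable lebesgue"
      by (intro borel_measurable_scaleR borel_measurable_times e m borel_measurable_indicator) auto
    show "(\<lambda>x. exp (- (\<i> * complex_of_real \<xi> * complex_of_real x)) * trunc n \<psi>' x) \<in> borel_measurable lebesgue"
      unfolding trunc_def by (intro measurable_completion) measurable
  qed
  also have "\<dots> = (\<integral>x. exp (- (\<i> * complex_of_real \<xi> * complex_of_real x)) * trunc n \<psi>' x \<partial>lborel)"
    unfolding trunc_def by (intro integral_completion) measurable
  finally show "fourier_trunc \<psi> n \<xi> = ft (trunc n \<psi>') \<xi>"
    unfolding fourier_trunc_def ft_def by simp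
qed

lemma is_fourier_iff:
  assumes "rep \<psi> \<psi>'" "rep \<phi> \<phi>'"
  shows "is_fourier \<psi> \<phi> \<longleftrightarrow> is_FT \<psi>' \<phi>'"
proof -
  have \<psi>': "\<psi>' \<in> H" and \<phi>': "\<phi>' \<in> H" and L: "\<psi> \<in> L2" "\<phi> \<in> L2" and ae: "AE x in lebesgue. \<phi> x = \<phi>' x"
    using assms by (auto simp: rep_def)
  have "(\<integral>\<^sup>+x. ennreal ((cmod (fourier_trunc \<psi> n x - \<phi> x))\<^sup>2) \<partial>lebesgue) = ennreal (nsq lborel (\<lambda>\<xi>. ft (trunc n \<psi>') \<xi> - \<phi>' \<xi>))" for n
  proof -
    have "(\<integral>\<^sup>+x. ennreal ((cmod (fourier_trunc \<psi> n x - \<phi> x))\<^sup>2) \<partial>lebesgue)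
      = (\<integral>\<^sup>+x. ennreal ((cmod (ft (trunc n \<psi>') x - \<phi>' x))\<^sup>2) \<partial>lebesgue)"
      unfolding fourier_trunc_rep[OF assms(1)] using ae by (intro nn_integral_cong_AE) auto
    also have "\<dots> = (\<integral>\<^sup>+x. ennreal ((cmod (ft (trunc n \<psi>') x - \<phi>' x))\<^sup>2) \<partial>lborel)"
      by (rule nn_integral_completion)
    also have "\<dots> = ennreal (nsq lborel (\<lambda>\<xi>. ft (trunc n \<psi>') \<xi> - \<phi>' \<xi>))"
      by (rule nn_integral_nsq) (use ft_trunc_sq_int[OF \<psi>'] \<phi>' in auto)
    finally show ?thesis .
  qed
  then have "L2_tendsto (fourier_trunc \<psi>) \<phi> \<longleftrightarrow> (\<lambda>n. ennreal (nsq lborel (\<lambda>\<xi>. ft (trunc n \<psi>') \<xi> - \<phi>' \<xi>))) \<longlonglongrightarrow> ennreal 0"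
    by (simp add: L2_tendsto_def)
  also have "\<dots> \<longleftrightarrow> (\<lambda>n. nsq lborel (\<lambda>\<xi>. ft (trunc n \<psi>') \<xi> - \<phi>' \<xi>)) \<longlonglongrightarrow> 0"
    by (rule tendsto_ennreal_iff) auto
  finally show ?thesis using L \<phi>' by (simp add: is_fourier_def is_FT_def)
qed

lemma rep_fourier:
  assumes "rep \<psi> \<psi>'" shows "rep (fourier \<psi>) (FT \<psi>')"
proof -
  have \<psi>': "\<psi>' \<in> H" using assms by (simp add: rep_def)
  have "is_fourier \<psi> (FT \<psi>')"
    using is_fourier_iff[OF assms rep_self[OF FT_sq_int[OF \<psi>']]] is_FT_FT[OF \<psi>'] by simp
  then have F: "is_fourier \<psi> (fourier \<psi>)" unfolding fourier_def by (rule someI[of "is_fourier \<psi>"])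
  then have "fourier \<psi> \<in> L2" by (simp add: is_fourier_def)
  then obtain \<phi> where \<phi>: "rep (fourier \<psi>) \<phi>" using rep_exists by blast
  then have "is_FT \<psi>' \<phi>" using is_fourier_iff[OF assms \<phi>] F by simp
  from is_FT_unique[OF \<psi>' this] show ?thesis
    by (intro rep_AE[OF \<phi>]) (use \<psi>' in auto)
qed

text \<open>A preimage under the transform exists, namely the transform of the reflected function; the one
which is chosen in \<^const>\<open>inv_fourier\<close> agrees with it almost everywhere because the transform is
injective.\<close>
lemma rep_inv_fourier:
  assumes "rep \<phi> \<phi>'" shows "rep (inv_fourier \<phi>) (FT (reflect \<phi>'))"
proof -
  have \<phi>': "\<phi>' \<in> H" and r: "FT (reflect \<phi>') \<in> H" using assms by (auto simp: rep_def)
  have "is_FT (FT (reflect \<phi>')) \<phi>'"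
  proof -
    have "nsq lborel (\<lambda>\<xi>. ft (trunc n (FT (reflect \<phi>'))) \<xi> - FT (FT (reflect \<phi>')) \<xi>)
        = nsq lborel (\<lambda>\<xi>. ft (trunc n (FT (reflect \<phi>'))) \<xi> - \<phi>' \<xi>)" for n
    proof (rule nsq_cong_AE)
      show "AE \<xi> in lborel. ft (trunc n (FT (reflect \<phi>'))) \<xi> - FT (FT (reflect \<phi>')) \<xi> = ft (trunc n (FT (reflect \<phi>'))) \<xi> - \<phi>' \<xi>"
        using FT_inverse'[OF \<phi>'] by eventually_elim simp
    qed (intro sq_intD(1) sq_int_diff ft_trunc_sq_int r FT_sq_int \<phi>')+
    then show ?thesis using FT_tendsto[OF r] \<phi>' by (simp add: is_FT_def)
  qed
  then have "is_fourier (FT (reflect \<phi>')) \<phi>" using is_fourier_iff[OF rep_self[OF r] assms] by simp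
  then have F: "is_fourier (inv_fourier \<phi>) \<phi>" unfolding inv_fourier_def by (rule someI[of "\<lambda>\<psi>. is_fourier \<psi> \<phi>"])
  then have "inv_fourier \<phi> \<in> L2" by (simp add: is_fourier_def)
  then obtain \<psi> where \<psi>: "rep (inv_fourier \<phi>) \<psi>" using rep_exists by blast
  then have \<psi>H: "\<psi> \<in> H" by (simp add: rep_def)
  have "is_FT \<psi> \<phi>'" using is_fourier_iff[OF \<psi> assms] F by simp
  from is_FT_unique[OF \<psi>H this] have "AE x in lborel. reflect (FT \<psi>) x = reflect \<phi>' x"
    unfolding reflect_def by (rule AE_lborel_uminus)
  then have "AE x in lborel. FT (reflect (FT \<psi>)) x = FT (reflect \<phi>') x"
    by (intro FT_cong_AE) (use \<psi>H \<phi>' in auto)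
  with FT_inverse[OF \<psi>H] have "AE x in lborel. \<psi> x = FT (reflect \<phi>') x" by eventually_elim simp
  then show ?thesis by (intro rep_AE[OF \<psi>] r)
qed

text \<open>Bounded Borel versions of \<open>f\<close> and \<open>g\<close> are obtained by clipping Borel versions at a bound. The
form does not vanish since $\langle K\psi, K\psi\rangle > 0$ for some $\psi$.\<close>
lemma positive_commutatorI:
  assumes f: "f \<in> borel_measurable lebesgue" "bounded (range f)"
    and g: "g \<in> borel_measurable lebesgue" "bounded (range g)"
    and K: "K = scale_op \<i> (commutator (fun_P f) (fun_Q g))"
    and pos: "op_nonneg K" and nz: "\<not> op_zero K"
  obtains f' g' where "positive_commutator f' g'" "AE x in lebesgue. f x = f' x" "AE x in lebesgue. g x = g' x"
proof -
  have version: "\<exists>u'. bdd_borel u' \<and> (AE x in lebesgue. u x = u' x)"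
    if u: "u \<in> borel_measurable lebesgue" "bounded (range u)" for u :: "real \<Rightarrow> real"
  proof -
    obtain C where C: "\<And>x. \<bar>u x\<bar> \<le> C" using u(2) by (auto simp: bounded_iff)
    obtain v where v [measurable]: "v \<in> borel_measurable borel" "AE x in lebesgue. u x = v x"
      using lebesgue_borel_version[OF u(1)] by blast
    have "bdd_borel (\<lambda>x. max (- C) (min C (v x)))"
      by (rule bdd_borelI[where C="\<bar>C\<bar>"]) auto
    moreover have "AE x in lebesgue. u x = max (- C) (min C (v x))"
      using v(2)
    proof eventually_elim
      case (elim x) then show ?case using C[of x] by (simp add: abs_le_iff)
    qed
    ultimately show ?thesis by blast
  qed
  obtain f' where f': "bdd_borel f'" "AE x in lebesgue. f x = f' x" using version[OF f] by blast
  obtain g' where g': "bdd_borel g'" "AE x in lebesgue. g x = g' x" using version[OF g] by blast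
  have P: "rep (fun_P f \<psi>) (FT (reflect (fun_Q f' (FT \<psi>'))))" if "rep \<psi> \<psi>'" for \<psi> \<psi>'
    using rep_inv_fourier[OF rep_fun_Q[OF rep_fourier[OF that] f f']] by (simp add: fun_P_def fun_Q_def)
  note Q = rep_fun_Q[OF _ g g']
  have K_ae: "AE x in lebesgue. K \<psi> x = comm_op f' g' \<psi>' x" if r: "rep \<psi> \<psi>'" for \<psi> \<psi>'
  proof -
    have "AE x in lebesgue. fun_P f (fun_Q g \<psi>) x = FT (reflect (fun_Q f' (FT (fun_Q g' \<psi>')))) x"
      using P[OF Q[OF r]] by (simp add: rep_def)
    moreover have "AE x in lebesgue. fun_Q g (fun_P f \<psi>) x = fun_Q g' (FT (reflect (fun_Q f' (FT \<psi>')))) x"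
      using Q[OF P[OF r]] by (simp add: rep_def)
    ultimately show ?thesis unfolding K scale_op_def commutator_def comm_op_def
      by eventually_elim simp
  qed
  have "cform f' g' \<phi> \<phi> \<in> \<real>\<^sub>\<ge>\<^sub>0" if \<phi>: "\<phi> \<in> H" for \<phi>
  proof -
    have c: "comm_op f' g' \<phi> \<in> H" using \<phi> f' g' by auto
    have KL: "AE x in lebesgue. K \<phi> x = comm_op f' g' \<phi> x" by (rule K_ae[OF rep_self[OF \<phi>]])
    have Km: "K \<phi> \<in> borel_measurable lebesgue"
    proof -
      have "fun_P f (fun_Q g \<phi>) \<in> L2" "fun_Q g (fun_P f \<phi>) \<in> L2"
        using P[OF Q[OF rep_self[OF \<phi>]]] Q[OF P[OF rep_self[OF \<phi>]]] by (simp_all add: rep_def)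
      then show ?thesis unfolding K scale_op_def commutator_def by (auto simp: L2_def)
    qed
    have cm: "(\<lambda>x. cnj (\<phi> x) * comm_op f' g' \<phi> x) \<in> borel_measurable lborel"
      using sq_intD(1)[OF \<phi>] sq_intD(1)[OF c] by measurable
    have "L2_inner \<phi> (K \<phi>) = (\<integral>x. cnj (\<phi> x) * comm_op f' g' \<phi> x \<partial>lebesgue)"
      unfolding L2_inner_def
    proof (rule integral_cong_AE)
      show "AE x in lebesgue. cnj (\<phi> x) * K \<phi> x = cnj (\<phi> x) * comm_op f' g' \<phi> x"
        using KL by eventually_elim simp
      show "(\<lambda>x. cnj (\<phi> x) * K \<phi> x) \<in> borel_measurable lebesgue"
        using Km measurable_completion[OF sq_intD(1)[OF \<phi>]] by measurable
      show "(\<lambda>x. cnj (\<phi> x) * comm_op f' g' \<phi> x) \<in> borel_measurable lebesgue"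
        by (rule measurable_completion[OF cm])
    qed
    also have "\<dots> = ip lborel \<phi> (comm_op f' g' \<phi>)"
      unfolding ip_def by (rule integral_completion[OF cm])
    also have "\<dots> = cform f' g' \<phi> \<phi>" by (rule cform_eq_ip[symmetric]) (use f' g' \<phi> in auto)
    finally have "L2_inner \<phi> (K \<phi>) = cform f' g' \<phi> \<phi>" .
    moreover have "L2_inner \<phi> (K \<phi>) \<in> \<real>\<^sub>\<ge>\<^sub>0" using pos H_subset_L2[OF \<phi>] unfolding op_nonneg_def by blast
    ultimately show ?thesis by metis
  qed
  moreover have "\<exists>\<phi>\<in>H. \<exists>\<psi>\<in>H. cform f' g' \<phi> \<psi> \<noteq> 0"
  proof -
    obtain \<psi> where \<psi>: "\<psi> \<in> L2" "\<not> (AE x in lebesgue. K \<psi> x = 0)" using nz by (auto simp: op_zero_def)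
    obtain \<psi>' where r: "rep \<psi> \<psi>'" using rep_exists[OF \<psi>(1)] by blast
    let ?c = "comm_op f' g' \<psi>'"
    have c: "?c \<in> H" and \<psi>': "\<psi>' \<in> H" using r f' g' by (auto simp: rep_def)
    have "\<not> (AE x in lborel. ?c x = 0)"
    proof
      assume "AE x in lborel. ?c x = 0"
      then have "AE x in lebesgue. ?c x = 0" by (rule AE_completion)
      with K_ae[OF r] have "AE x in lebesgue. K \<psi> x = 0" by eventually_elim simp
      with \<psi>(2) show False by simp
    qed
    then have "cform f' g' ?c \<psi>' \<noteq> 0"
      using nsq_eq_0[OF c] cform_eq_ip[OF f'(1) g'(1) c \<psi>'] by (simp add: ip_self)
    then show ?thesis using c \<psi>' by blast
  qed
  ultimately have "positive_commutator f' g'" using f' g' by (simp add: positive_commutator_def)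
  then show ?thesis using f'(2) g'(2) by (rule that)
qed

section \<open>Averaging over modulations\<close>

lemma cform_lincomb_right:
  assumes f: "bdd_borel f" and g: "bdd_borel g" and H: "\<phi> \<in> H" "\<psi> \<in> H" "\<theta> \<in> H"
  shows "cform f g \<phi> (\<lambda>x. \<psi> x + c * \<theta> x) = cform f g \<phi> \<psi> + c * cform f g \<phi> \<theta>"
proof -
  have lin: "ip lborel \<alpha> (fun_Q f (FT (\<lambda>x. \<beta> x + c * \<gamma> x))) = ip lborel \<alpha> (fun_Q f (FT \<beta>)) + c * ip lborel \<alpha> (fun_Q f (FT \<gamma>))"
    if h: "\<alpha> \<in> H" "\<beta> \<in> H" "\<gamma> \<in> H" for \<alpha> \<beta> \<gamma>
  proof -
    have B: "fun_Q f (FT \<beta>) \<in> H" and c: "(\<lambda>x. c * fun_Q f (FT \<gamma>) x) \<in> H"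
      by (intro sq_int_cmult fun_Q_sq_int FT_sq_int f h)+
    have "ip lborel \<alpha> (fun_Q f (FT (\<lambda>x. \<beta> x + c * \<gamma> x))) = ip lborel \<alpha> (\<lambda>x. fun_Q f (FT \<beta>) x + c * fun_Q f (FT \<gamma>) x)"
    proof (rule ip_cong_AE)
      show "AE x in lborel. fun_Q f (FT (\<lambda>x. \<beta> x + c * \<gamma> x)) x = fun_Q f (FT \<beta>) x + c * fun_Q f (FT \<gamma>) x"
        using FT_lincomb[OF h(2,3), of c] by eventually_elim (simp add: fun_Q_def algebra_simps)
    qed (intro sq_intD(1) sq_int_add sq_int_cmult fun_Q_sq_int FT_sq_int f h | simp)+
    then show ?thesis by (simp only: ip_add_right[OF B c h(1)] ip_cmult_right)
  qed
  have e: "fun_Q g (\<lambda>x. \<psi> x + c * \<theta> x) = (\<lambda>x. fun_Q g \<psi> x + c * fun_Q g \<theta> x)"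
    by (simp add: fun_eq_iff fun_Q_def algebra_simps)
  show ?thesis
    unfolding cform_def e
    by (simp only: lin[OF FT_sq_int[OF H(1)] fun_Q_sq_int[OF g H(2)] fun_Q_sq_int[OF g H(3)]]
      lin[OF FT_sq_int[OF fun_Q_sq_int[OF g H(1)]] H(2) H(3)]) (simp add: algebra_simps)
qed

lemma cform_lincomb_left:
  assumes f: "bdd_borel f" and g: "bdd_borel g" and H: "\<phi> \<in> H" "\<psi> \<in> H" "\<theta> \<in> H"
  shows "cform f g (\<lambda>x. \<psi> x + c * \<theta> x) \<phi> = cform f g \<psi> \<phi> + cnj c * cform f g \<theta> \<phi>"
proof -
  have "cform f g (\<lambda>x. \<psi> x + c * \<theta> x) \<phi> = cnj (cform f g \<phi> \<psi> + c * cform f g \<phi> \<theta>)"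
    unfolding cform_lincomb_right[OF f g H, symmetric] by (rule cform_hermitian)
  also have "\<dots> = cform f g \<psi> \<phi> + cnj c * cform f g \<theta> \<phi>"
    by (simp only: complex_cnj_add complex_cnj_mult cform_hermitian[symmetric])
  finally show ?thesis .
qed

text \<open>The real part is taken so that the quadratic form is a real number by definition; the form is
Hermitian, hence nothing is lost.\<close>
definition qf :: "(real \<Rightarrow> real) \<Rightarrow> (real \<Rightarrow> real) \<Rightarrow> (real \<Rightarrow> complex) \<Rightarrow> real" where
  "qf f g \<phi> = Re (cform f g \<phi> \<phi>)"

lemma qf_lincomb:
  assumes f: "bdd_borel f" and g: "bdd_borel g" and H: "\<phi> \<in> H" "\<psi> \<in> H"
  shows "qf f g (\<lambda>x. \<phi> x + c * \<psi> x) = qf f g \<phi> + 2 * Re (c * cform f g \<phi> \<psi>) + (cmod c)\<^sup>2 * qf f g \<psi>"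
proof -
  let ?s = "\<lambda>x. \<phi> x + c * \<psi> x"
  have s: "?s \<in> H" by (intro sq_int_add sq_int_cmult H)
  have "cform f g ?s ?s = cform f g \<phi> ?s + cnj c * cform f g \<psi> ?s"
    by (rule cform_lincomb_left[OF f g s H])
  also have "\<dots> = cform f g \<phi> \<phi> + c * cform f g \<phi> \<psi> + cnj c * (cform f g \<psi> \<phi> + c * cform f g \<psi> \<psi>)"
    by (simp only: cform_lincomb_right[OF f g H(1) H] cform_lincomb_right[OF f g H(2) H])
  finally have e: "cform f g ?s ?s = cform f g \<phi> \<phi> + c * cform f g \<phi> \<psi> + cnj c * (cform f g \<psi> \<phi> + c * cform f g \<psi> \<psi>)" .
  have "cnj c * (cform f g \<psi> \<phi> + c * cform f g \<psi> \<psi>) = cnj (c * cform f g \<phi> \<psi>) + complex_of_real ((cmod c)\<^sup>2) * cform f g \<psi> \<psi>"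
    unfolding cform_hermitian[of f g \<psi> \<phi>] complex_norm_square by (simp add: algebra_simps)
  then show ?thesis unfolding qf_def e by (simp add: algebra_simps del: of_real_power)
qed

lemma positive_commutator_qf:
  assumes "positive_commutator f g" "\<phi> \<in> H"
  shows "0 \<le> qf f g \<phi>" "cform f g \<phi> \<phi> = complex_of_real (qf f g \<phi>)"
  using assms unfolding positive_commutator_def qf_def
  by (auto simp: complex_nonneg_Reals_iff complex_eq_iff)

text \<open>A null vector of a positive form is orthogonal to everything: the form at $\phi + c\psi$ is affine
in \<open>c\<close> and can be made negative unless its slope is zero.\<close>
lemma qf_zero_imp_cform_zero:
  assumes pc: "positive_commutator f g" and H: "\<phi> \<in> H" "\<psi> \<in> H" and 0: "qf f g \<psi> = 0"
  shows "cform f g \<phi> \<psi> = 0"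
proof (rule ccontr)
  define z where "z = cform f g \<phi> \<psi>"
  assume "cform f g \<phi> \<psi> \<noteq> 0"
  then have z: "0 < (cmod z)\<^sup>2" by (simp add: z_def)
  have fg: "bdd_borel f" "bdd_borel g" using pc by (auto simp: positive_commutator_def)
  obtain n :: nat where n: "qf f g \<phi> < real n * (cmod z)\<^sup>2" using reals_Archimedean3[OF z] by blast
  define c where "c = - complex_of_real (real n) * cnj z"
  have "0 \<le> qf f g (\<lambda>x. \<phi> x + c * \<psi> x)" by (intro positive_commutator_qf(1)[OF pc] sq_int_add sq_int_cmult H)
  also have "\<dots> = qf f g \<phi> + 2 * Re (c * z)"
    unfolding qf_lincomb[OF fg H] 0 z_def by simp
  also have "c * z = - complex_of_real (real n * (cmod z)\<^sup>2)"
    unfolding c_def of_real_mult complex_norm_square by (simp add: ac_simps)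
  finally have "2 * (real n * (cmod z)\<^sup>2) \<le> qf f g \<phi>" by simp
  moreover have "0 \<le> real n * (cmod z)\<^sup>2" by simp
  ultimately show False using n by linarith
qed

text \<open>The density of the quadratic form of the commutator in momentum space, see \<open>cform_explicit\<close>.\<close>
definition specW :: "(real \<Rightarrow> real) \<Rightarrow> (real \<Rightarrow> complex) \<Rightarrow> real \<Rightarrow> real" where
  "specW g \<phi> \<xi> = - 2 * Im (cnj (ft \<phi> \<xi>) * ft (fun_Q g \<phi>) \<xi>)"

lemma fun_Q_integrable:
  assumes "bdd_borel g" "integrable lborel \<phi>" shows "integrable lborel (fun_Q g \<phi>)"
proof -
  obtain C where C: "\<And>x. \<bar>g x\<bar> \<le> C" using bdd_borel_bound[OF assms(1)] by blast
  have [measurable]: "g \<in> borel_measurable borel" "\<phi> \<in> borel_measurable borel"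
    using bdd_borel_measurable[OF assms(1)] borel_measurable_integrable[OF assms(2)] by auto
  show ?thesis
  proof (rule Bochner_Integration.integrable_bound)
    show "integrable lborel (\<lambda>x. C * cmod (\<phi> x))" using assms(2) by simp
    have "0 \<le> C" using C[of 0] by linarith
    then show "AE x in lborel. norm (fun_Q g \<phi> x) \<le> norm (C * cmod (\<phi> x))"
      using C by (intro AE_I2) (simp add: fun_Q_def norm_mult abs_mult mult_right_mono)
  qed (simp add: fun_Q_def)
qed

lemma bdd_borel_integrable:
  fixes w :: "real \<Rightarrow> real"
  assumes "bdd_borel f" "integrable lborel w" shows "integrable lborel (\<lambda>x. f x * w x)"
proof -
  obtain C where C: "\<And>x. \<bar>f x\<bar> \<le> C" using bdd_borel_bound[OF assms(1)] by blast
  have [measurable]: "f \<in> borel_measurable borel" "w \<in> borel_measurable borel"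
    using bdd_borel_measurable[OF assms(1)] borel_measurable_integrable[OF assms(2)] by auto
  show ?thesis
  proof (rule Bochner_Integration.integrable_bound)
    show "integrable lborel (\<lambda>x. C * \<bar>w x\<bar>)" using assms(2) by simp
    have "0 \<le> C" using C[of 0] by linarith
    then show "AE x in lborel. norm (f x * w x) \<le> norm (C * \<bar>w x\<bar>)"
      using C by (intro AE_I2) (simp add: abs_mult mult_right_mono)
  qed simp
qed

lemma specW_integrable:
  assumes "bdd_borel g" "\<phi> \<in> H" "integrable lborel \<phi>"
  shows "integrable lborel (specW g \<phi>)"
proof -
  have "integrable lborel (\<lambda>\<xi>. cnj (ft \<phi> \<xi>) * ft (fun_Q g \<phi>) \<xi>)"
    by (intro integrable_ip sq_int_cnj ft_contraction(1) fun_Q_integrable fun_Q_sq_int assms)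
  then have "integrable lborel (\<lambda>\<xi>. Im (cnj (ft \<phi> \<xi>) * ft (fun_Q g \<phi>) \<xi>))" by (rule integrable_Im)
  then show ?thesis unfolding specW_def[abs_def] by (intro integrable_mult_right)
qed

lemma cform_explicit:
  assumes f: "bdd_borel f" and g: "bdd_borel g" and \<phi>: "\<phi> \<in> H" "integrable lborel \<phi>"
  shows "cform f g \<phi> \<phi> = complex_of_real (\<integral>\<xi>. f \<xi> * specW g \<phi> \<xi> \<partial>lborel)"
proof -
  let ?a = "ft \<phi>" and ?b = "ft (fun_Q g \<phi>)"
  note gi = fun_Q_integrable[OF g \<phi>(2)] and gH = fun_Q_sq_int[OF g \<phi>(1)]
  have aH: "?a \<in> H" and bH: "?b \<in> H" by (intro ft_contraction(1) \<phi> gi gH)+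
  have fQ: "AE x in lborel. fun_Q f u x = fun_Q f v x" if "AE x in lborel. u x = v x" for u v
    using that by eventually_elim (simp add: fun_Q_def)
  have e1: "ip lborel (FT \<phi>) (fun_Q f (FT (fun_Q g \<phi>))) = ip lborel ?a (fun_Q f ?b)"
    by (intro ip_cong_AE fQ FT_eq_ft \<phi> gi gH sq_intD(1) FT_sq_int fun_Q_sq_int f aH bH)
  have e2: "ip lborel (FT (fun_Q g \<phi>)) (fun_Q f (FT \<phi>)) = ip lborel ?b (fun_Q f ?a)"
    by (intro ip_cong_AE fQ FT_eq_ft \<phi> gi gH sq_intD(1) FT_sq_int fun_Q_sq_int f aH bH)
  have i1: "integrable lborel (\<lambda>x. cnj (?a x) * fun_Q f ?b x)" and i2: "integrable lborel (\<lambda>x. cnj (?b x) * fun_Q f ?a x)"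
    by (intro integrable_ip sq_int_cnj fun_Q_sq_int f aH bH)+
  have "cform f g \<phi> \<phi> = \<i> * (\<integral>x. cnj (?a x) * fun_Q f ?b x - cnj (?b x) * fun_Q f ?a x \<partial>lborel)"
    unfolding cform_def e1 e2 unfolding ip_def by (simp only: Bochner_Integration.integral_diff[OF i1 i2])
  also have "\<dots> = (\<integral>x. \<i> * (cnj (?a x) * fun_Q f ?b x - cnj (?b x) * fun_Q f ?a x) \<partial>lborel)"
    by (rule Bochner_Integration.integral_mult_right_zero[symmetric])
  also have "\<dots> = (\<integral>x. complex_of_real (f x * specW g \<phi> x) \<partial>lborel)"
  proof (rule Bochner_Integration.integral_cong[OF refl])
    fix x
    show "\<i> * (cnj (?a x) * fun_Q f ?b x - cnj (?b x) * fun_Q f ?a x) = complex_of_real (f x * specW g \<phi> x)"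
      by (simp add: complex_eq_iff specW_def fun_Q_def[of f] algebra_simps)
  qed
  also have "\<dots> = complex_of_real (\<integral>\<xi>. f \<xi> * specW g \<phi> \<xi> \<partial>lborel)" by (rule integral_complex_of_real)
  finally show ?thesis .
qed

text \<open>Constant functions \<open>f\<close> commute with everything, so the form vanishes for them.\<close>
lemma specW_integral:
  assumes g: "bdd_borel g" and \<phi>: "\<phi> \<in> H" "integrable lborel \<phi>"
  shows "(\<integral>\<xi>. specW g \<phi> \<xi> \<partial>lborel) = 0"
proof -
  have one: "bdd_borel (\<lambda>x. 1)" by (rule bdd_borelI[where C=1]) auto
  have Q1: "fun_Q (\<lambda>x. 1) u = u" for u by (simp add: fun_Q_def)
  have "complex_of_real (\<integral>\<xi>. 1 * specW g \<phi> \<xi> \<partial>lborel) = cform (\<lambda>x. 1) g \<phi> \<phi>"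
    by (rule cform_explicit[OF one g \<phi>, symmetric])
  also have "\<dots> = 0"
    unfolding cform_def Q1 Plancherel_ip[OF \<phi>(1) fun_Q_sq_int[OF g \<phi>(1)]] Plancherel_ip[OF fun_Q_sq_int[OF g \<phi>(1)] \<phi>(1)] ip_fun_Q
    by simp
  finally show ?thesis by simp
qed

definition modul :: "real \<Rightarrow> (real \<Rightarrow> complex) \<Rightarrow> real \<Rightarrow> complex" where
  "modul p \<phi> x = exp (\<i> * complex_of_real p * complex_of_real x) * \<phi> x"

lemma modul_sq_int: "\<phi> \<in> H \<Longrightarrow> modul p \<phi> \<in> H"
  by (rule sq_int_bound[where \<phi>=\<phi> and C=1]) (auto simp: modul_def[abs_def] norm_mult dest: H_measurable)

lemma modul_integrable:
  assumes "integrable lborel \<phi>" shows "integrable lborel (modul p \<phi>)"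
proof -
  have [measurable]: "\<phi> \<in> borel_measurable borel" using borel_measurable_integrable[OF assms] by simp
  show ?thesis
    by (rule Bochner_Integration.integrable_bound[OF assms]) (auto simp: modul_def[abs_def] norm_mult)
qed

lemma ft_modul: "ft (modul p \<phi>) \<xi> = ft \<phi> (\<xi> - p)"
proof -
  have "exp (- (\<i> * complex_of_real \<xi> * complex_of_real x)) * modul p \<phi> x = exp (- (\<i> * complex_of_real (\<xi> - p) * complex_of_real x)) * \<phi> x" for x
    unfolding modul_def mult.assoc[symmetric] exp_add[symmetric] by (simp add: algebra_simps)
  then show ?thesis unfolding ft_def by simp
qed

lemma fun_Q_modul: "fun_Q g (modul p \<phi>) = modul p (fun_Q g \<phi>)"
  by (simp add: fun_eq_iff fun_Q_def modul_def ac_simps)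

text \<open>Multiplication by $e^{ipx}$ translates the transform, and it commutes with multiplication by
\<open>g\<close>; so it only translates \<open>f\<close> in the quadratic form.\<close>
lemma qf_modul:
  assumes f: "bdd_borel f" and g: "bdd_borel g" and \<phi>: "\<phi> \<in> H" "integrable lborel \<phi>"
  shows "qf f g (modul p \<phi>) = (\<integral>\<xi>. f (\<xi> + p) * specW g \<phi> \<xi> \<partial>lborel)"
proof -
  have W: "specW g (modul p \<phi>) \<xi> = specW g \<phi> (\<xi> - p)" for \<xi>
    unfolding specW_def fun_Q_modul ft_modul ..
  have "qf f g (modul p \<phi>) = (\<integral>\<xi>. f \<xi> * specW g \<phi> (\<xi> - p) \<partial>lborel)"
    unfolding qf_def cform_explicit[OF f g modul_sq_int[OF \<phi>(1)] modul_integrable[OF \<phi>(2)]] W by simp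
  then show ?thesis
    using lborel_integral_real_affine[of 1 "\<lambda>\<xi>. f \<xi> * specW g \<phi> (\<xi> - p)" p] by (simp add: add.commute)
qed

text \<open>This weight is comparable with its translates and differentiable off $0$ with a derivative that is
again a multiple of the weight; both facts give dominated convergence below.\<close>
definition expw :: "real \<Rightarrow> real" where "expw t = exp (- \<bar>t\<bar>)"

lemma expw_pos [simp]: "0 < expw t" "0 \<le> expw t" by (simp_all add: expw_def)

lemma expw_measurable [measurable]: "expw \<in> borel_measurable borel" unfolding expw_def[abs_def] by measurable

lemma expw_shift_le: "expw (t - d) \<le> exp \<bar>d\<bar> * expw t"
  unfolding expw_def exp_add[symmetric] exp_le_cancel_iff by simp

lemma expw_integral: "integrable lborel expw" "(\<integral>t. expw t \<partial>lborel) = 2"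
proof -
  let ?e = "exponential_density 1"
  have i: "has_bochner_integral lborel ?e 1"
  proof -
    interpret prob_space "density lborel ?e" by (rule prob_space_exponential_density) simp
    have "(\<integral>\<^sup>+x. ennreal (?e x) \<partial>lborel) = 1"
      using emeasure_space_1 by (simp add: emeasure_density exponential_density_def)
    then show ?thesis
      by (intro has_bochner_integral_nn_integral) (auto simp: exponential_density_nonneg)
  qed
  have r: "has_bochner_integral lborel (\<lambda>x. ?e (- x)) 1"
    using i integrable_uminus[of ?e] integral_uminus[of ?e] by (simp add: has_bochner_integral_iff)
  have "AE t in lborel. t \<noteq> (0::real)" by (rule AE_lborel_singleton)
  then have ae: "AE t in lborel. ?e t + ?e (- t) = expw t"
    by eventually_elim (auto simp: exponential_density_def expw_def)
  have "has_bochner_integral lborel (\<lambda>t. ?e t + ?e (- t)) (1 + 1)" by (rule has_bochner_integral_add[OF i r])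
  then have "has_bochner_integral lborel expw (1 + 1)"
    by (rule has_bochner_integralI_AE[OF _ _ ae]) simp
  then show "integrable lborel expw" "(\<integral>t. expw t \<partial>lborel) = 2" by (simp_all add: has_bochner_integral_iff)
qed

lemma expw_diff: "\<bar>expw (s - d) - expw s\<bar> \<le> \<bar>d\<bar> * (expw (s - d) + expw s)"
proof -
  have *: "exp (- a) - exp (- b) \<le> (b - a) * exp (- a)" if "a \<le> b" for a b :: real
  proof -
    have "1 - (b - a) \<le> exp (- (b - a))" using exp_ge_add_one_self[of "- (b - a)"] by linarith
    then have "exp (- a) * (1 - (b - a)) \<le> exp (- a) * exp (- (b - a))" by (intro mult_left_mono) auto
    then show ?thesis by (simp add: algebra_simps flip: exp_add)
  qed
  have d: "\<bar>\<bar>s - d\<bar> - \<bar>s\<bar>\<bar> \<le> \<bar>d\<bar>" by linarith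
  have e: "0 \<le> \<bar>d\<bar> * expw (s - d)" "0 \<le> \<bar>d\<bar> * expw s" by simp_all
  show ?thesis
  proof (cases "\<bar>s - d\<bar> \<le> \<bar>s\<bar>")
    case True
    have "expw (s - d) - expw s \<le> (\<bar>s\<bar> - \<bar>s - d\<bar>) * expw (s - d)" unfolding expw_def by (rule *[OF True])
    also have "\<dots> \<le> \<bar>d\<bar> * expw (s - d)" using d by (intro mult_right_mono) auto
    finally have "expw (s - d) - expw s \<le> \<bar>d\<bar> * expw (s - d)" .
    moreover have "expw s \<le> expw (s - d)" using True by (simp add: expw_def)
    ultimately show ?thesis unfolding distrib_left using e by linarith
  next
    case False
    then have F: "\<bar>s\<bar> \<le> \<bar>s - d\<bar>" by simp
    have "expw s - expw (s - d) \<le> (\<bar>s - d\<bar> - \<bar>s\<bar>) * expw s" unfolding expw_def by (rule *[OF F])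
    also have "\<dots> \<le> \<bar>d\<bar> * expw s" using d by (intro mult_right_mono) auto
    finally have "expw s - expw (s - d) \<le> \<bar>d\<bar> * expw s" .
    moreover have "expw (s - d) \<le> expw s" using F by (simp add: expw_def)
    ultimately show ?thesis unfolding distrib_left using e by linarith
  qed
qed

lemma expw_shift_integral: "integrable lborel (\<lambda>s. expw (s - d))" "(\<integral>s. expw (s - d) \<partial>lborel) = 2"
  using lborel_integrable_real_affine[OF expw_integral(1), of 1 "- d"] lborel_integral_real_affine[of 1 expw "- d"] expw_integral(2)
  by simp_all

text \<open>The average of \<open>f\<close> around $\xi$ on the scale $T$. A change of variables shifts the dependence on
$\xi$ to the weight, so that the average is smooth in $\xi$ even if \<open>f\<close> is not.\<close>
definition Gavg :: "(real \<Rightarrow> real) \<Rightarrow> real \<Rightarrow> real \<Rightarrow> real" where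
  "Gavg f T \<xi> = (\<integral>t. f (\<xi> + T * t) * expw t \<partial>lborel)"

text \<open>The slope in $\xi$ of \<^const>\<open>Gavg\<close> at the origin, multiplied by \<open>T\<close>.\<close>
definition cavg :: "(real \<Rightarrow> real) \<Rightarrow> real \<Rightarrow> real" where
  "cavg f T = (\<integral>s. f (T * s) * (sgn s * expw s) \<partial>lborel)"

lemma bdd_borel_affine: assumes "bdd_borel f" shows "bdd_borel (\<lambda>s. f (a + T * s))"
proof -
  obtain C where C: "\<And>x. \<bar>f x\<bar> \<le> C" using bdd_borel_bound[OF assms] by blast
  note [measurable] = bdd_borel_measurable[OF assms]
  show ?thesis by (rule bdd_borelI[where C=C]) (use C in auto)
qed

lemma bdd_borel_scale: "bdd_borel f \<Longrightarrow> bdd_borel (\<lambda>s. f (T * s))"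
  using bdd_borel_affine[of f 0 T] by simp

lemma bdd_integral_le:
  fixes w v :: "real \<Rightarrow> real"
  assumes f: "bdd_borel f" and C: "\<And>x. \<bar>f x\<bar> \<le> C" and w: "integrable lborel w" and v: "integrable lborel v"
    and le: "\<And>x. \<bar>w x\<bar> \<le> v x"
  shows "\<bar>\<integral>x. f x * w x \<partial>lborel\<bar> \<le> C * (\<integral>x. v x \<partial>lborel)"
proof -
  have C0: "0 \<le> C" using C[of 0] by linarith
  have "norm (\<integral>x. f x * w x \<partial>lborel) \<le> (\<integral>x. C * v x \<partial>lborel)"
  proof (rule Bochner_Integration.integral_norm_bound_integral)
    show "integrable lborel (\<lambda>x. f x * w x)" by (rule bdd_borel_integrable[OF f w])
    show "integrable lborel (\<lambda>x. C * v x)" using v by simp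
    show "norm (f x * w x) \<le> C * v x" for x
      using mult_mono[OF C[of x] le[of x] C0] by (simp add: abs_mult)
  qed
  then show ?thesis by simp
qed

lemma Gavg_shift:
  assumes "0 < T" shows "Gavg f T \<xi> = (\<integral>s. f (T * s) * expw (s - \<xi> / T) \<partial>lborel)"
proof -
  have "(\<integral>s. f (T * s) * expw (s - \<xi> / T) \<partial>lborel) = (\<integral>s. f (T * (\<xi> / T + s)) * expw (\<xi> / T + s - \<xi> / T) \<partial>lborel)"
    using lborel_integral_real_affine[of 1 "\<lambda>s. f (T * s) * expw (s - \<xi> / T)" "\<xi> / T"] by simp
  then show ?thesis using assms unfolding Gavg_def by (simp add: distrib_left)
qed

lemma Gavg_bound:
  assumes f: "bdd_borel f" and C: "\<And>x. \<bar>f x\<bar> \<le> C" and T: "0 < T"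
  shows "\<bar>T * (Gavg f T \<xi> - Gavg f T 0)\<bar> \<le> 4 * C * \<bar>\<xi>\<bar>"
proof -
  let ?d = "\<xi> / T"
  let ?w = "\<lambda>s. expw (s - ?d) - expw s"
  let ?v = "\<lambda>s. \<bar>?d\<bar> * (expw (s - ?d) + expw s)"
  have f': "bdd_borel (\<lambda>s. f (T * s))" by (rule bdd_borel_scale[OF f])
  have w: "integrable lborel ?w" and v: "integrable lborel ?v"
    using expw_shift_integral(1)[of ?d] expw_integral(1) by simp_all
  have vi: "(\<integral>s. ?v s \<partial>lborel) = \<bar>?d\<bar> * 4"
    using expw_shift_integral[of ?d] expw_integral by simp
  have "Gavg f T \<xi> - Gavg f T 0 = (\<integral>s. f (T * s) * expw (s - ?d) \<partial>lborel) - (\<integral>s. f (T * s) * expw s \<partial>lborel)"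
    unfolding Gavg_shift[OF T] by simp
  also have "\<dots> = (\<integral>s. f (T * s) * ?w s \<partial>lborel)"
    using bdd_borel_integrable[OF f' expw_shift_integral(1)[of ?d]] bdd_borel_integrable[OF f' expw_integral(1)]
    by (subst Bochner_Integration.integral_diff[symmetric]) (simp_all add: right_diff_distrib)
  finally have "\<bar>Gavg f T \<xi> - Gavg f T 0\<bar> \<le> C * (\<bar>?d\<bar> * 4)"
    using bdd_integral_le[OF f' C w v expw_diff] unfolding vi by simp
  then have "T * \<bar>Gavg f T \<xi> - Gavg f T 0\<bar> \<le> T * (C * (\<bar>?d\<bar> * 4))" using T by (intro mult_left_mono) auto
  also have "\<dots> = 4 * C * \<bar>\<xi>\<bar>" using T by (simp add: abs_divide)
  finally show ?thesis using T by (simp add: abs_mult)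
qed

lemma expw_has_derivative:
  assumes "s \<noteq> 0" shows "(expw has_real_derivative (- sgn s * expw s)) (at s)"
proof (cases "0 < s")
  case True
  have "((\<lambda>x. exp (- x)) has_real_derivative (- sgn s * expw s)) (at s)"
    using True by (auto intro!: derivative_eq_intros simp: expw_def)
  then show ?thesis
    by (rule has_field_derivative_transform_within_open[where S="{0<..}"]) (use True in \<open>auto simp: expw_def\<close>)
next
  case False
  then have s: "s < 0" using assms by simp
  have "((\<lambda>x. exp x) has_real_derivative (- sgn s * expw s)) (at s)"
    using s by (auto intro!: derivative_eq_intros simp: expw_def)
  then show ?thesis
    by (rule has_field_derivative_transform_within_open[where S="{..<0}"]) (use s in \<open>auto simp: expw_def\<close>)
qed

text \<open>The difference quotient of the weight tends to its derivative, and it is dominated by a multiple of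
the weight.\<close>
lemma Gavg_limit:
  assumes f: "bdd_borel f"
  shows "(\<lambda>n. real (Suc n) * (Gavg f (real (Suc n)) \<xi> - Gavg f (real (Suc n)) 0) - \<xi> * cavg f (real (Suc n))) \<longlonglongrightarrow> 0"
proof (cases "\<xi> = 0")
  case True then show ?thesis by simp
next
  case False
  obtain C where C: "\<And>x. \<bar>f x\<bar> \<le> C" using bdd_borel_bound[OF f] by blast
  have C0: "0 \<le> C" using C[of 0] by linarith
  note [measurable] = bdd_borel_measurable[OF f]
  define T where "T n = real (Suc n)" for n
  have T: "1 \<le> T n" "0 < T n" for n by (auto simp: T_def)
  define d where "d n = \<xi> / T n" for n
  have d0: "d n \<noteq> 0" for n using False T(2)[of n] by (simp add: d_def)
  have dle: "\<bar>d n\<bar> \<le> \<bar>\<xi>\<bar>" for n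
    using T[of n] mult_left_mono[of 1 "T n" "\<bar>\<xi>\<bar>"] by (simp add: d_def abs_divide divide_le_eq)
  define R where "R n s = (expw (s - d n) - expw s) / d n - sgn s * expw s" for n s
  have [measurable]: "R n \<in> borel_measurable borel" for n unfolding R_def[abs_def] by measurable
  have Rle: "\<bar>R n s\<bar> \<le> (exp \<bar>\<xi>\<bar> + 2) * expw s" for n s
  proof -
    have "\<bar>(expw (s - d n) - expw s) / d n\<bar> \<le> expw (s - d n) + expw s"
      using expw_diff[of s "d n"] d0[of n] by (simp add: abs_divide divide_le_eq mult.commute)
    moreover have "\<bar>sgn s * expw s\<bar> \<le> expw s" by (simp add: abs_mult abs_sgn_eq)
    moreover have "expw (s - d n) \<le> exp \<bar>\<xi>\<bar> * expw s"
      by (rule order_trans[OF expw_shift_le]) (use dle in simp)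
    ultimately show ?thesis unfolding R_def distrib_right
      using abs_triangle_ineq4[of "(expw (s - d n) - expw s) / d n" "sgn s * expw s"] by linarith
  qed
  have w: "integrable lborel (\<lambda>s. C * ((exp \<bar>\<xi>\<bar> + 2) * expw s))" using expw_integral(1) by simp
  have eq: "T n * (Gavg f (T n) \<xi> - Gavg f (T n) 0) - \<xi> * cavg f (T n) = \<xi> * (\<integral>s. f (T n * s) * R n s \<partial>lborel)" for n
  proof -
    have f': "bdd_borel (\<lambda>s. f (T n * s))" by (rule bdd_borel_scale[OF f])
    have sgi: "integrable lborel (\<lambda>s. sgn s * expw s)"
      by (rule Bochner_Integration.integrable_bound[OF expw_integral(1)]) (auto simp: abs_mult abs_sgn_eq)
    note i1 = bdd_borel_integrable[OF f' expw_shift_integral(1)[of "d n"]] and i2 = bdd_borel_integrable[OF f' expw_integral(1)]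
      and i3 = bdd_borel_integrable[OF f' sgi]
    have "(\<integral>s. f (T n * s) * R n s \<partial>lborel)
       = (\<integral>s. (1 / d n) * (f (T n * s) * expw (s - d n) - f (T n * s) * expw s) - f (T n * s) * (sgn s * expw s) \<partial>lborel)"
      unfolding R_def by (intro Bochner_Integration.integral_cong) (auto simp: field_simps)
    also have "\<dots> = (1 / d n) * (Gavg f (T n) \<xi> - Gavg f (T n) 0) - cavg f (T n)"
      using i1 i2 i3 by (simp add: Gavg_shift[OF T(2)] cavg_def d_def)
    finally have h1: "\<xi> * (\<integral>s. f (T n * s) * R n s \<partial>lborel) = \<xi> * (1 / d n) * (Gavg f (T n) \<xi> - Gavg f (T n) 0) - \<xi> * cavg f (T n)"
      by (simp add: right_diff_distrib)
    have h2: "\<xi> * (1 / d n) = T n" using False by (simp add: d_def)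
    show ?thesis unfolding h1 h2 ..
  qed
  have dlim: "d \<longlonglongrightarrow> 0"
  proof -
    have "(\<lambda>n. \<xi> * (1 / real (Suc n))) \<longlonglongrightarrow> \<xi> * 0"
      by (intro tendsto_mult tendsto_const LIMSEQ_Suc[OF lim_1_over_n])
    then show ?thesis by (simp add: d_def[abs_def] T_def)
  qed
  have "(\<lambda>n. \<integral>s. f (T n * s) * R n s \<partial>lborel) \<longlonglongrightarrow> (\<integral>s. 0 \<partial>(lborel :: real measure))"
  proof (rule integral_dominated_convergence[OF _ _ w])
    show "AE s in lborel. (\<lambda>n. f (T n * s) * R n s) \<longlonglongrightarrow> 0"
      using AE_lborel_singleton[of 0]
    proof eventually_elim
      case (elim s)
      have "((\<lambda>h. (expw (s + h) - expw s) / h) \<longlongrightarrow> - sgn s * expw s) (at 0)"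
        using DERIV_D[OF expw_has_derivative[OF elim]] .
      moreover have "filterlim (\<lambda>n. - d n) (at 0) sequentially"
        using tendsto_minus[OF dlim] d0 by (simp add: filterlim_at)
      ultimately have "(\<lambda>n. (expw (s + - d n) - expw s) / - d n) \<longlonglongrightarrow> - sgn s * expw s"
        by (rule filterlim_compose)
      then have "(\<lambda>n. - ((expw (s + - d n) - expw s) / - d n) - sgn s * expw s) \<longlonglongrightarrow> - (- sgn s * expw s) - sgn s * expw s"
        by (intro tendsto_diff tendsto_minus tendsto_const)
      then have "(\<lambda>n. R n s) \<longlonglongrightarrow> 0" unfolding R_def by simp
      then have "(\<lambda>n. C * \<bar>R n s\<bar>) \<longlonglongrightarrow> C * \<bar>0\<bar>" by (intro tendsto_mult[OF tendsto_const] tendsto_rabs)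
      then have l: "(\<lambda>n. C * \<bar>R n s\<bar>) \<longlonglongrightarrow> 0" by simp
      have "norm (f (T n * s) * R n s) \<le> C * \<bar>R n s\<bar>" for n
        unfolding real_norm_def abs_mult by (rule mult_right_mono[OF C]) simp
      then show ?case by (intro Lim_null_comparison[OF always_eventually l] allI)
    qed
    show "AE s in lborel. norm (f (T n * s) * R n s) \<le> C * ((exp \<bar>\<xi>\<bar> + 2) * expw s)" for n
      unfolding real_norm_def abs_mult by (intro AE_I2 mult_mono[OF C Rle C0]) simp
  qed measurable
  then have "(\<lambda>n. \<integral>s. f (T n * s) * R n s \<partial>lborel) \<longlonglongrightarrow> 0" by simp
  then have "(\<lambda>n. \<xi> * (\<integral>s. f (T n * s) * R n s \<partial>lborel)) \<longlonglongrightarrow> \<xi> * 0"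
    by (rule tendsto_mult[OF tendsto_const])
  then show ?thesis unfolding eq[symmetric] mult_zero_right unfolding T_def .
qed

definition qavg :: "(real \<Rightarrow> real) \<Rightarrow> (real \<Rightarrow> real) \<Rightarrow> (real \<Rightarrow> complex) \<Rightarrow> real \<Rightarrow> real" where
  "qavg f g \<phi> T = (\<integral>t. qf f g (modul (T * t) \<phi>) * expw t \<partial>lborel)"

lemma qf_modul_measurable:
  assumes f: "bdd_borel f" and g: "bdd_borel g" and \<phi>: "\<phi> \<in> H" "integrable lborel \<phi>"
  shows "(\<lambda>p. qf f g (modul p \<phi>)) \<in> borel_measurable borel"
proof -
  note [measurable] = bdd_borel_measurable[OF f] borel_measurable_integrable[OF specW_integrable[OF g \<phi>]]
  have "(\<lambda>(p::real, \<xi>::real). f (\<xi> + p) * specW g \<phi> \<xi>) \<in> borel_measurable (borel \<Otimes>\<^sub>M lborel)" by measurable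
  from lborel.borel_measurable_lebesgue_integral[OF this]
  show ?thesis unfolding qf_modul[OF f g \<phi>] by simp
qed

lemma qf_modul_bdd:
  assumes f: "bdd_borel f" and g: "bdd_borel g" and \<phi>: "\<phi> \<in> H" "integrable lborel \<phi>"
  shows "bdd_borel (\<lambda>p. qf f g (modul p \<phi>))"
proof -
  obtain C where C: "\<And>x. \<bar>f x\<bar> \<le> C" using bdd_borel_bound[OF f] by blast
  note W = specW_integrable[OF g \<phi>]
  have "\<bar>qf f g (modul p \<phi>)\<bar> \<le> C * (\<integral>\<xi>. \<bar>specW g \<phi> \<xi>\<bar> \<partial>lborel)" for p
    unfolding qf_modul[OF f g \<phi>]
    by (rule bdd_integral_le[OF _ C W integrable_abs[OF W]]) (use bdd_borel_affine[OF f, of p 1] in \<open>simp_all add: add.commute\<close>)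
  then show ?thesis by (rule bdd_borelI[OF qf_modul_measurable[OF f g \<phi>]])
qed

text \<open>By Fubini's theorem the average over modulations replaces \<open>f\<close> by \<^const>\<open>Gavg\<close>. The value of the latter at $0$
can be subtracted since the density has integral $0$; this gains the factor $1/T$.\<close>
lemma qavg_eq:
  assumes f: "bdd_borel f" and g: "bdd_borel g" and \<phi>: "\<phi> \<in> H" "integrable lborel \<phi>"
  shows "qavg f g \<phi> T = (\<integral>\<xi>. (Gavg f T \<xi> - Gavg f T 0) * specW g \<phi> \<xi> \<partial>lborel)"
proof -
  let ?W = "specW g \<phi>"
  note W = specW_integrable[OF g \<phi>]
  obtain C where C: "\<And>x. \<bar>f x\<bar> \<le> C" using bdd_borel_bound[OF f] by blast
  have C0: "0 \<le> C" using C[of 0] by linarith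
  note [measurable] = bdd_borel_measurable[OF f] borel_measurable_integrable[OF W]
  have int: "integrable (lborel \<Otimes>\<^sub>M lborel) (\<lambda>(t, \<xi>). f (\<xi> + T * t) * expw t * ?W \<xi>)"
  proof (rule Bochner_Integration.integrable_bound)
    show "integrable (lborel \<Otimes>\<^sub>M lborel) (\<lambda>(t, \<xi>). C * (expw t * \<bar>?W \<xi>\<bar>))"
    proof (rule lborel_pair.Fubini_integrable)
      show "(\<lambda>(t, \<xi>). C * (expw t * \<bar>?W \<xi>\<bar>)) \<in> borel_measurable (lborel \<Otimes>\<^sub>M lborel)" by measurable
      show "integrable lborel (\<lambda>t. \<integral>\<xi>. norm (case (t, \<xi>) of (t, \<xi>) \<Rightarrow> C * (expw t * \<bar>?W \<xi>\<bar>)) \<partial>lborel)"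
        using expw_integral(1) by (simp add: abs_mult)
      show "AE t in lborel. integrable lborel (\<lambda>\<xi>. case (t, \<xi>) of (t, \<xi>) \<Rightarrow> C * (expw t * \<bar>?W \<xi>\<bar>))"
        using integrable_abs[OF W] by auto
    qed
    show "AE x in lborel \<Otimes>\<^sub>M lborel. norm (case x of (t, \<xi>) \<Rightarrow> f (\<xi> + T * t) * expw t * ?W \<xi>) \<le> norm (case x of (t, \<xi>) \<Rightarrow> C * (expw t * \<bar>?W \<xi>\<bar>))"
      using C0 by (intro AE_I2) (auto simp: abs_mult mult.assoc intro!: mult_right_mono C)
  qed measurable
  have "qavg f g \<phi> T = (\<integral>t. (\<integral>\<xi>. f (\<xi> + T * t) * expw t * ?W \<xi> \<partial>lborel) \<partial>lborel)"
    unfolding qavg_def qf_modul[OF f g \<phi>] by (simp add: ac_simps flip: Bochner_Integration.integral_mult_left_zero)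
  also have "\<dots> = (\<integral>\<xi>. (\<integral>t. f (\<xi> + T * t) * expw t * ?W \<xi> \<partial>lborel) \<partial>lborel)"
    by (rule lborel_pair.Fubini_integral[symmetric]) (use int in simp)
  also have "\<dots> = (\<integral>\<xi>. Gavg f T \<xi> * ?W \<xi> \<partial>lborel)" unfolding Gavg_def by simp
  also have "\<dots> = (\<integral>\<xi>. (Gavg f T \<xi> - Gavg f T 0) * ?W \<xi> \<partial>lborel)"
  proof -
    have Gm: "Gavg f T \<in> borel_measurable borel"
    proof -
      have "(\<lambda>(\<xi>::real, t::real). f (\<xi> + T * t) * expw t) \<in> borel_measurable (borel \<Otimes>\<^sub>M lborel)" by measurable
      from lborel.borel_measurable_lebesgue_integral[OF this] show ?thesis unfolding Gavg_def[abs_def] by simp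
    qed
    have "\<bar>Gavg f T \<xi>\<bar> \<le> C * 2" for \<xi>
      unfolding Gavg_def expw_integral(2)[symmetric]
      by (rule bdd_integral_le[OF bdd_borel_affine[OF f] C expw_integral(1) expw_integral(1)]) simp
    then have "bdd_borel (Gavg f T)" by (rule bdd_borelI[OF Gm])
    from bdd_borel_integrable[OF this W] W specW_integral[OF g \<phi>] show ?thesis
      by (simp add: left_diff_distrib)
  qed
  finally show ?thesis .
qed

text \<open>The slopes \<^const>\<open>cavg\<close> are bounded, so they converge along a subsequence. The subsequence and the limit
depend on \<open>f\<close> alone; that one constant serves all \<open>g\<close> and $\phi$ is what makes its sign meaningful.\<close>
lemma qavg_limit:
  assumes f: "bdd_borel f"
  obtains c r where "strict_mono (r :: nat \<Rightarrow> nat)"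
    "\<And>g \<phi>. bdd_borel g \<Longrightarrow> \<phi> \<in> H \<Longrightarrow> integrable lborel \<phi> \<Longrightarrow> integrable lborel (\<lambda>\<xi>. \<xi> * specW g \<phi> \<xi>) \<Longrightarrow>
       (\<lambda>k. real (Suc (r k)) * qavg f g \<phi> (real (Suc (r k)))) \<longlonglongrightarrow> c * (\<integral>\<xi>. \<xi> * specW g \<phi> \<xi> \<partial>lborel)"
proof -
  obtain C where C: "\<And>x. \<bar>f x\<bar> \<le> C" using bdd_borel_bound[OF f] by blast
  have "\<bar>cavg f (real (Suc n))\<bar> \<le> C * 2" for n
    unfolding cavg_def expw_integral(2)[symmetric]
  proof (rule bdd_integral_le[OF bdd_borel_scale[OF f] C _ expw_integral(1)])
    show "integrable lborel (\<lambda>s. sgn s * expw s)"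
      by (rule Bochner_Integration.integrable_bound[OF expw_integral(1)]) (auto simp: abs_mult abs_sgn_eq)
  qed (auto simp: abs_mult abs_sgn_eq)
  then have "bounded (range (\<lambda>n. cavg f (real (Suc n))))" unfolding bounded_iff by auto
  from bounded_imp_convergent_subsequence[OF this]
  obtain c r where r: "strict_mono r" and c: "((\<lambda>n. cavg f (real (Suc n))) \<circ> r) \<longlonglongrightarrow> c" by blast
  define T where "T k = real (Suc (r k))" for k
  have c': "(\<lambda>k. cavg f (T k)) \<longlonglongrightarrow> c" using c by (simp add: comp_def T_def)
  have T0: "0 < T k" for k by (simp add: T_def)
  show thesis
  proof (rule that[OF r])
    fix g \<phi> assume g: "bdd_borel g" and \<phi>: "\<phi> \<in> H" "integrable lborel \<phi>" and iW: "integrable lborel (\<lambda>\<xi>. \<xi> * specW g \<phi> \<xi>)"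
    let ?W = "specW g \<phi>"
    note [measurable] = bdd_borel_measurable[OF f] borel_measurable_integrable[OF specW_integrable[OF g \<phi>]]
    have [measurable]: "Gavg f T \<in> borel_measurable borel" for T
    proof -
      have "(\<lambda>(\<xi>::real, t::real). f (\<xi> + T * t) * expw t) \<in> borel_measurable (borel \<Otimes>\<^sub>M lborel)" by measurable
      from lborel.borel_measurable_lebesgue_integral[OF this] show ?thesis unfolding Gavg_def[abs_def] by simp
    qed
    have "(\<lambda>k. \<integral>\<xi>. T k * (Gavg f (T k) \<xi> - Gavg f (T k) 0) * ?W \<xi> \<partial>lborel) \<longlonglongrightarrow> (\<integral>\<xi>. c * (\<xi> * ?W \<xi>) \<partial>lborel)"
    proof (rule integral_dominated_convergence[where w="\<lambda>\<xi>. 4 * C * \<bar>\<xi> * ?W \<xi>\<bar>"])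
      show "integrable lborel (\<lambda>\<xi>. 4 * C * \<bar>\<xi> * ?W \<xi>\<bar>)" using iW by simp
      show "AE \<xi> in lborel. (\<lambda>k. T k * (Gavg f (T k) \<xi> - Gavg f (T k) 0) * ?W \<xi>) \<longlonglongrightarrow> c * (\<xi> * ?W \<xi>)"
      proof (rule AE_I2)
        fix \<xi> :: real
        have "(\<lambda>k. T k * (Gavg f (T k) \<xi> - Gavg f (T k) 0) - \<xi> * cavg f (T k)) \<longlonglongrightarrow> 0"
          using LIMSEQ_subseq_LIMSEQ[OF Gavg_limit[OF f, of \<xi>] r] by (simp add: comp_def T_def)
        then have "(\<lambda>k. (T k * (Gavg f (T k) \<xi> - Gavg f (T k) 0) - \<xi> * cavg f (T k)) + \<xi> * cavg f (T k)) \<longlonglongrightarrow> 0 + \<xi> * c"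
          by (intro tendsto_add tendsto_mult tendsto_const c')
        then have "(\<lambda>k. T k * (Gavg f (T k) \<xi> - Gavg f (T k) 0)) \<longlonglongrightarrow> \<xi> * c" by simp
        then have "(\<lambda>k. T k * (Gavg f (T k) \<xi> - Gavg f (T k) 0) * ?W \<xi>) \<longlonglongrightarrow> \<xi> * c * ?W \<xi>" by (rule tendsto_mult[OF _ tendsto_const])
        then show "(\<lambda>k. T k * (Gavg f (T k) \<xi> - Gavg f (T k) 0) * ?W \<xi>) \<longlonglongrightarrow> c * (\<xi> * ?W \<xi>)" by (simp add: ac_simps)
      qed
      show "AE \<xi> in lborel. norm (T k * (Gavg f (T k) \<xi> - Gavg f (T k) 0) * ?W \<xi>) \<le> 4 * C * \<bar>\<xi> * ?W \<xi>\<bar>" for k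
      proof (rule AE_I2)
        fix \<xi> :: real
        have "\<bar>T k * (Gavg f (T k) \<xi> - Gavg f (T k) 0)\<bar> * \<bar>?W \<xi>\<bar> \<le> 4 * C * \<bar>\<xi>\<bar> * \<bar>?W \<xi>\<bar>"
          by (rule mult_right_mono[OF Gavg_bound[OF f C T0]]) simp
        then show "norm (T k * (Gavg f (T k) \<xi> - Gavg f (T k) 0) * ?W \<xi>) \<le> 4 * C * \<bar>\<xi> * ?W \<xi>\<bar>"
          by (simp add: abs_mult mult.assoc)
      qed
    qed measurable
    moreover have "(\<integral>\<xi>. T k * (Gavg f (T k) \<xi> - Gavg f (T k) 0) * ?W \<xi> \<partial>lborel) = T k * qavg f g \<phi> (T k)" for k
      unfolding qavg_eq[OF f g \<phi>] by (simp add: mult.assoc)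
    ultimately show "(\<lambda>k. real (Suc (r k)) * qavg f g \<phi> (real (Suc (r k)))) \<longlonglongrightarrow> c * (\<integral>\<xi>. \<xi> * ?W \<xi> \<partial>lborel)"
      by (simp add: T_def)
  qed
qed

text \<open>In terms of $p = Tt$ the quantity in the limit is $\int q(e^{ipx}\phi)\, e^{-|p|/T} dp$, which
increases with $T$. If it tends to $0$ it is $0$ throughout.\<close>
lemma qf_modul_AE_zero:
  assumes pc: "positive_commutator f g" and \<phi>: "\<phi> \<in> H" "integrable lborel \<phi>" and r: "strict_mono (r :: nat \<Rightarrow> nat)"
    and lim: "(\<lambda>k. real (Suc (r k)) * qavg f g \<phi> (real (Suc (r k)))) \<longlonglongrightarrow> 0"
  shows "AE p in lborel. qf f g (modul p \<phi>) = 0"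
proof -
  have f: "bdd_borel f" and g: "bdd_borel g" using pc by (auto simp: positive_commutator_def)
  define b where "b p = qf f g (modul p \<phi>)" for p
  have b: "bdd_borel b" unfolding b_def[abs_def] by (rule qf_modul_bdd[OF f g \<phi>])
  have b0: "0 \<le> b p" for p unfolding b_def by (intro positive_commutator_qf(1)[OF pc] modul_sq_int \<phi>)
  have bi: "integrable lborel (\<lambda>p. b p * expw p)" by (rule bdd_borel_integrable[OF b expw_integral(1)])
  have le: "(\<integral>p. b p * expw p \<partial>lborel) \<le> T * qavg f g \<phi> T" if T: "1 \<le> T" for T
  proof -
    have "T * qavg f g \<phi> T = (\<integral>p. b p * expw (p / T) \<partial>lborel)"
      using lborel_integral_real_affine[of T "\<lambda>p. b p * expw (p / T)" 0] T by (simp add: qavg_def b_def)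
    moreover have "(\<integral>p. b p * expw p \<partial>lborel) \<le> (\<integral>p. b p * expw (p / T) \<partial>lborel)"
    proof (rule integral_mono[OF bi])
      show "integrable lborel (\<lambda>p. b p * expw (p / T))"
        using lborel_integrable_real_affine[OF expw_integral(1), of "1/T" 0] T
        by (intro bdd_borel_integrable[OF b]) simp
      show "b p * expw p \<le> b p * expw (p / T)" for p
      proof (rule mult_left_mono[OF _ b0])
        have "\<bar>p\<bar> \<le> \<bar>p\<bar> * T" using mult_left_mono[OF T, of "\<bar>p\<bar>"] by simp
        then show "expw p \<le> expw (p / T)" unfolding expw_def using T by (simp add: abs_divide divide_le_eq)
      qed
    qed
    ultimately show ?thesis by simp
  qed
  have "(\<integral>p. b p * expw p \<partial>lborel) \<le> 0"
    by (rule LIMSEQ_le_const[OF lim]) (intro exI[of _ 0] allI impI le, simp)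
  moreover have "0 \<le> (\<integral>p. b p * expw p \<partial>lborel)" using b0 by (intro Bochner_Integration.integral_nonneg) simp
  ultimately have "(\<integral>p. b p * expw p \<partial>lborel) = 0" by simp
  then have "AE p in lborel. b p * expw p = 0"
    using integral_nonneg_eq_0_iff_AE[OF bi] b0 by simp
  then show ?thesis
  proof eventually_elim
    case (elim p)
    moreover have "expw p \<noteq> 0" using expw_pos(1)[of p] by linarith
    ultimately show ?case by (simp add: b_def)
  qed
qed

section \<open>Monotonicity from trapezoidal test functions\<close>

text \<open>The trapezoid that rises from $0$ to $1$ on $[a, a+e]$ and falls on $[b, b+e]$: an approximation of the
indicator of $[a, b]$ with a bounded derivative of bounded support. Both ramps lie to the right of
their points, so that one-sided Lebesgue points are sufficient.\<close>
definition trap :: "real \<Rightarrow> real \<Rightarrow> real \<Rightarrow> real \<Rightarrow> real" where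
  "trap a b e x = max 0 (min 1 (min ((x - a) / e) ((b + e - x) / e)))"

definition dtrap :: "real \<Rightarrow> real \<Rightarrow> real \<Rightarrow> real \<Rightarrow> real" where
  "dtrap a b e x = (indicator {a..a+e} x - indicator {b..b+e} x) / e"

lemma trap_bounds: "0 \<le> trap a b e x" "trap a b e x \<le> 1" by (auto simp: trap_def)

lemma trap_measurable [measurable]: "trap a b e \<in> borel_measurable borel" "dtrap a b e \<in> borel_measurable borel"
  unfolding trap_def[abs_def] dtrap_def[abs_def] by measurable

lemma trap_pos: "0 < e \<Longrightarrow> a < x \<Longrightarrow> x < b + e \<Longrightarrow> 0 < trap a b e x"
  by (simp add: trap_def)

lemma trap_outside:
  assumes "0 < e" "x \<notin> {a<..<b+e}" shows "trap a b e x = 0"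
proof -
  have "x - a \<le> 0 \<or> b + e - x \<le> 0" using assms(2) by auto
  then have "(x - a) / e \<le> 0 \<or> (b + e - x) / e \<le> 0" using assms(1) by (auto simp: divide_le_0_iff)
  then have "min ((x - a) / e) ((b + e - x) / e) \<le> 0" by (simp add: min_le_iff_disj)
  then show ?thesis unfolding trap_def by (simp add: min.coboundedI2 max_absorb1)
qed

lemma trap_values:
  assumes e: "0 < e" "a + e \<le> b"
  shows "x \<in> {a..a+e} \<Longrightarrow> trap a b e x = (x - a) / e"
    "x \<in> {a+e..b} \<Longrightarrow> trap a b e x = 1"
    "x \<in> {b..b+e} \<Longrightarrow> trap a b e x = (b + e - x) / e"
proof -
  assume x: "x \<in> {a..a+e}"
  have "0 \<le> (x - a) / e" "(x - a) / e \<le> 1" "(x - a) / e \<le> (b + e - x) / e"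
    using x e by (auto intro!: divide_right_mono)
  then show "trap a b e x = (x - a) / e" by (simp add: trap_def)
next
  assume x: "x \<in> {a+e..b}"
  have "1 \<le> (x - a) / e" "1 \<le> (b + e - x) / e" using x e by auto
  then show "trap a b e x = 1" by (simp add: trap_def)
next
  assume x: "x \<in> {b..b+e}"
  have "0 \<le> (b + e - x) / e" "(b + e - x) / e \<le> 1" "(b + e - x) / e \<le> (x - a) / e"
    using x e by (auto intro!: divide_right_mono)
  then show "trap a b e x = (b + e - x) / e" by (simp add: trap_def)
qed

lemma trap_has_derivative:
  assumes e: "0 < e" "a + e < b" and x: "x \<in> {a<..<b+e} - {a+e, b}"
  shows "(trap a b e has_real_derivative dtrap a b e x) (at x)"
proof -
  consider "x \<in> {a<..<a+e}" | "x \<in> {a+e<..<b}" | "x \<in> {b<..<b+e}" using x e by fastforce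
  then show ?thesis
  proof cases
    case 1
    have "((\<lambda>x. (x - a) / e) has_real_derivative dtrap a b e x) (at x)"
      using 1 e by (auto intro!: derivative_eq_intros simp: dtrap_def indicator_def)
    then show ?thesis
      by (rule has_field_derivative_transform_within_open[where S="{a<..<a+e}"])
         (use 1 trap_values(1)[of e a b] e in auto)
  next
    case 2
    have "((\<lambda>x. 1) has_real_derivative dtrap a b e x) (at x)"
      using 2 e by (auto intro!: derivative_eq_intros simp: dtrap_def indicator_def)
    then show ?thesis
      by (rule has_field_derivative_transform_within_open[where S="{a+e<..<b}"])
         (use 2 trap_values(2)[of e a b] e in auto)
  next
    case 3
    have "((\<lambda>x. (b + e - x) / e) has_real_derivative dtrap a b e x) (at x)"
      using 3 e by (auto intro!: derivative_eq_intros simp: dtrap_def indicator_def field_simps)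
    then show ?thesis
      by (rule has_field_derivative_transform_within_open[where S="{b<..<b+e}"])
         (use 3 trap_values(3)[of e a b] e in auto)
  qed
qed

definition ctrap :: "real \<Rightarrow> real \<Rightarrow> real \<Rightarrow> real \<Rightarrow> complex" where
  "ctrap a b e x = complex_of_real (trap a b e x)"

definition cdtrap :: "real \<Rightarrow> real \<Rightarrow> real \<Rightarrow> real \<Rightarrow> complex" where
  "cdtrap a b e x = complex_of_real (dtrap a b e x)"

lemma bounded_support_sq_int:
  fixes \<phi> :: "real \<Rightarrow> complex"
  assumes "\<phi> \<in> borel_measurable borel" "\<And>x. cmod (\<phi> x) \<le> C * indicator {l..u} x"
  shows "\<phi> \<in> H" "integrable lborel \<phi>"
proof -
  show H: "\<phi> \<in> H"
  proof (rule sq_int_bound[where \<phi>="indicator {l..u}" and C=C])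
    show "cmod (\<phi> x) \<le> C * cmod (indicator {l..u} x)" for x
      using assms(2)[of x] by (cases "x \<in> {l..u}") simp_all
  qed (use assms(1) in simp_all)
  have "indicat_real {l..u} x *\<^sub>R \<phi> x = \<phi> x" for x
    using assms(2)[of x] by (cases "x \<in> {l..u}") simp_all
  then show "integrable lborel \<phi>" using integrable_indicator_mult[OF H, of l u] by simp
qed

lemma ctrap_H:
  assumes "0 < e"
  shows "ctrap a b e \<in> H" "integrable lborel (ctrap a b e)"
proof -
  have b: "cmod (ctrap a b e x) \<le> 1 * indicator {a..b+e} x" for x
  proof (cases "x \<in> {a<..<b+e}")
    case True then show ?thesis using trap_bounds[of a b e x] by (simp add: ctrap_def)
  next
    case False then show ?thesis using trap_outside[OF assms False] by (simp add: ctrap_def)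
  qed
  have m: "ctrap a b e \<in> borel_measurable borel" unfolding ctrap_def[abs_def] by measurable
  show "ctrap a b e \<in> H" "integrable lborel (ctrap a b e)" by (rule bounded_support_sq_int[OF m b])+
qed

lemma cdtrap_bound:
  assumes "0 < e" "a + e < b" shows "cmod (cdtrap a b e x) \<le> 1 / e * indicator {a..b+e} x"
  using assms by (auto simp: cdtrap_def dtrap_def indicator_def norm_divide)

lemma cdtrap_H:
  assumes "0 < e" "a + e < b"
  shows "cdtrap a b e \<in> H" "integrable lborel (cdtrap a b e)"
proof -
  have m: "cdtrap a b e \<in> borel_measurable borel" unfolding cdtrap_def[abs_def] by measurable
  show "cdtrap a b e \<in> H" "integrable lborel (cdtrap a b e)"
    by (rule bounded_support_sq_int[OF m cdtrap_bound[OF assms]])+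
qed

text \<open>Integration by parts; the boundary terms vanish as the trapezoid has bounded support.\<close>
lemma ft_cdtrap:
  assumes e: "0 < e" "a + e < b"
  shows "ft (cdtrap a b e) \<xi> = \<i> * complex_of_real \<xi> * ft (ctrap a b e) \<xi>"
proof -
  let ?E = "\<lambda>x. exp (- (\<i> * complex_of_real \<xi> * complex_of_real x))"
  define k where "k x = ?E x * cdtrap a b e x - \<i> * complex_of_real \<xi> * (?E x * ctrap a b e x)" for x
  have i1: "integrable lborel (\<lambda>x. ?E x * cdtrap a b e x)" by (rule integrable_ft_integrand[OF cdtrap_H(2)[OF e]])
  have i2: "integrable lborel (\<lambda>x. ?E x * ctrap a b e x)" by (rule integrable_ft_integrand[OF ctrap_H(2)[OF e(1)]])
  have ki: "integrable lborel k" unfolding k_def using i1 i2 by simp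
  have dE: "(?E has_vector_derivative (- \<i> * complex_of_real \<xi> * ?E x)) (at x)" for x
  proof -
    have "((\<lambda>z. exp (- (\<i> * complex_of_real \<xi> * z))) has_field_derivative (- \<i> * complex_of_real \<xi> * ?E x)) (at (complex_of_real x))"
      by (auto intro!: derivative_eq_intros)
    from has_vector_derivative_real_field[OF this] show ?thesis by (simp add: o_def)
  qed
  have "(k has_integral ?E (b+e) * ctrap a b e (b+e) - ?E a * ctrap a b e a) {a..b+e}"
  proof (rule fundamental_theorem_of_calculus_interior_strong)
    show "finite {a+e, b}" by simp
    show "a \<le> b + e" using e by simp
    show "continuous_on {a..b+e} (\<lambda>x. ?E x * ctrap a b e x)"
      unfolding ctrap_def trap_def using e by (intro continuous_intros) auto
    fix x assume x: "x \<in> {a<..<b+e} - {a+e, b}"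
    have "(ctrap a b e has_vector_derivative cdtrap a b e x) (at x)"
      using has_vector_derivative_of_real[OF trap_has_derivative[OF e x]]
      by (simp add: ctrap_def[abs_def] cdtrap_def)
    from has_vector_derivative_mult[OF dE[of x] this]
    show "((\<lambda>x. ?E x * ctrap a b e x) has_vector_derivative k x) (at x)"
      by (simp add: k_def algebra_simps)
  qed
  moreover have "ctrap a b e (b+e) = 0" "ctrap a b e a = 0"
    using trap_outside[OF e(1)] by (auto simp: ctrap_def)
  ultimately have "(k has_integral 0) {a..b+e}" by simp
  then have "(k has_integral 0) UNIV"
  proof (rule has_integral_on_superset)
    fix x assume "x \<notin> {a..b+e}"
    then show "k x = 0"
      using trap_outside[OF e(1), of x a b] e by (auto simp: k_def ctrap_def cdtrap_def dtrap_def indicator_def)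
  qed simp
  moreover have "(k has_integral (integral\<^sup>L lborel k)) UNIV" by (rule has_integral_integral_lborel[OF ki])
  ultimately have "integral\<^sup>L lborel k = 0" using has_integral_unique by blast
  then have "(\<integral>x. ?E x * cdtrap a b e x \<partial>lborel) = \<i> * complex_of_real \<xi> * (\<integral>x. ?E x * ctrap a b e x \<partial>lborel)"
    unfolding k_def using i1 i2 by simp
  then show ?thesis unfolding ft_def by simp
qed

text \<open>Multiplication by $\xi$ is differentiation of the test function, and Plancherel's theorem returns
to position space.\<close>
lemma specW_first_moment:
  assumes g: "bdd_borel g" and e: "0 < e" "a + e < b"
  shows "integrable lborel (\<lambda>\<xi>. \<xi> * specW g (ctrap a b e) \<xi>)"
    "(\<integral>\<xi>. \<xi> * specW g (ctrap a b e) \<xi> \<partial>lborel) = - 2 * (\<integral>x. dtrap a b e x * g x * trap a b e x \<partial>lborel)"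
proof -
  let ?\<phi> = "ctrap a b e" and ?\<theta> = "cdtrap a b e"
  note \<phi> = ctrap_H[OF e(1), of a b] and \<theta> = cdtrap_H[OF e]
  note gH = fun_Q_sq_int[OF g \<phi>(1)] and gi = fun_Q_integrable[OF g \<phi>(2)]
  have eq: "\<xi> * specW g ?\<phi> \<xi> = - 2 * Re (cnj (ft ?\<theta> \<xi>) * ft (fun_Q g ?\<phi>) \<xi>)" for \<xi>
    unfolding specW_def ft_cdtrap[OF e] by (simp add: algebra_simps)
  have zi: "integrable lborel (\<lambda>\<xi>. cnj (ft ?\<theta> \<xi>) * ft (fun_Q g ?\<phi>) \<xi>)"
    by (intro integrable_ip sq_int_cnj ft_contraction(1) \<theta> gH gi)
  then have ri: "integrable lborel (\<lambda>\<xi>. Re (cnj (ft ?\<theta> \<xi>) * ft (fun_Q g ?\<phi>) \<xi>))" by (rule integrable_Re)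
  show "integrable lborel (\<lambda>\<xi>. \<xi> * specW g ?\<phi> \<xi>)" unfolding eq by (intro integrable_mult_right ri)
  have aH: "ft ?\<theta> \<in> H" "ft (fun_Q g ?\<phi>) \<in> H" by (intro ft_contraction(1) \<theta> gH gi)+
  have "ip lborel (ft ?\<theta>) (ft (fun_Q g ?\<phi>)) = ip lborel (FT ?\<theta>) (FT (fun_Q g ?\<phi>))"
  proof (rule ip_cong_AE)
    show "AE x in lborel. ft ?\<theta> x = FT ?\<theta> x" using FT_eq_ft[OF \<theta>(2,1)] by eventually_elim (rule sym)
    show "AE x in lborel. ft (fun_Q g ?\<phi>) x = FT (fun_Q g ?\<phi>) x" using FT_eq_ft[OF gi gH] by eventually_elim (rule sym)
  qed (intro sq_intD(1) FT_sq_int aH \<theta> gH)+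
  also have "\<dots> = ip lborel ?\<theta> (fun_Q g ?\<phi>)" by (rule Plancherel_ip[OF \<theta>(1) gH])
  also have "\<dots> = (\<integral>x. complex_of_real (dtrap a b e x * g x * trap a b e x) \<partial>lborel)"
    unfolding ip_def fun_Q_def ctrap_def cdtrap_def by (simp add: mult.assoc)
  also have "\<dots> = complex_of_real (\<integral>x. dtrap a b e x * g x * trap a b e x \<partial>lborel)" by (rule integral_complex_of_real)
  finally have P: "ip lborel (ft ?\<theta>) (ft (fun_Q g ?\<phi>)) = complex_of_real (\<integral>x. dtrap a b e x * g x * trap a b e x \<partial>lborel)" .
  have "(\<integral>\<xi>. \<xi> * specW g ?\<phi> \<xi> \<partial>lborel) = - 2 * (\<integral>\<xi>. Re (cnj (ft ?\<theta> \<xi>) * ft (fun_Q g ?\<phi>) \<xi>) \<partial>lborel)"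
    unfolding eq by (rule Bochner_Integration.integral_mult_right_zero)
  also have "(\<integral>\<xi>. Re (cnj (ft ?\<theta> \<xi>) * ft (fun_Q g ?\<phi>) \<xi>) \<partial>lborel) = Re (ip lborel (ft ?\<theta>) (ft (fun_Q g ?\<phi>)))"
    unfolding ip_def by (rule integral_Re[OF zi])
  finally show "(\<integral>\<xi>. \<xi> * specW g ?\<phi> \<xi> \<partial>lborel) = - 2 * (\<integral>x. dtrap a b e x * g x * trap a b e x \<partial>lborel)"
    unfolding P by simp
qed

lemma bdd_borel_box_integrable:
  assumes "bdd_borel g" shows "integrable lborel (\<lambda>x. g x * indicat_real {a..b} x)"
  by (rule bdd_borel_integrable[OF assms]) (simp add: emeasure_lborel_Icc_eq)

lemma bdd_borel_has_integral:
  assumes "bdd_borel g" shows "(g has_integral (\<integral>x. g x * indicator {a..b} x \<partial>lborel)) {a..b}"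
proof -
  have "set_integrable lborel {a..b} g"
    unfolding set_integrable_def using bdd_borel_box_integrable[OF assms, of a b] by (simp add: mult.commute)
  from set_borel_integral_eq_integral[OF this] show ?thesis
    unfolding set_lebesgue_integral_def has_integral_iff by (simp add: mult.commute)
qed

definition lebesgue_point :: "(real \<Rightarrow> real) \<Rightarrow> real \<Rightarrow> bool" where
  "lebesgue_point g x \<longleftrightarrow> (\<forall>\<eta>>0. \<exists>d>0. \<forall>h. 0 < h \<and> h < d \<longrightarrow>
     (\<integral>y. \<bar>g y - g x\<bar> * indicator {x..x+h} y \<partial>lborel) \<le> \<eta> * h)"

text \<open>Differentiation of the integral is applied to $|g - r|$ for the countably many rational $r$, and
$g(x)$ is approximated by such an $r$.\<close>
lemma lebesgue_points_AE:
  assumes g: "bdd_borel g"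
  obtains N where "N \<in> null_sets lebesgue" "\<And>x. x \<notin> N \<Longrightarrow> lebesgue_point g x"
proof -
  obtain C where C: "\<And>x. \<bar>g x\<bar> \<le> C" using bdd_borel_bound[OF g] by blast
  note [measurable] = bdd_borel_measurable[OF g]
  have bq: "bdd_borel (\<lambda>y. \<bar>g y - q\<bar>)" for q
  proof (rule bdd_borelI[where C="C + \<bar>q\<bar>"])
    show "\<bar>\<bar>g x - q\<bar>\<bar> \<le> C + \<bar>q\<bar>" for x using C[of x] by linarith
  qed measurable
  have "\<exists>N. negligible N \<and> (\<forall>x e. x \<notin> N \<longrightarrow> 0 < e \<longrightarrow> (\<exists>d>0. \<forall>h. 0 < h \<and> h < d \<longrightarrow>
          norm (integral (cbox x (x + h *\<^sub>R One)) (\<lambda>y. \<bar>g y - q\<bar>) /\<^sub>R h ^ DIM(real) - \<bar>g x - q\<bar>) < e))" for q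
  proof -
    have "(\<lambda>y. \<bar>g y - q\<bar>) integrable_on cbox a b" for a b
      using bdd_borel_has_integral[OF bq, of q a b] by (auto simp: cbox_interval)
    from integrable_ccontinuous_explicit[OF this] show ?thesis by metis
  qed
  then obtain N where N: "\<And>q. negligible (N q)" and
    lim: "\<And>q x e. x \<notin> N q \<Longrightarrow> 0 < e \<Longrightarrow> \<exists>d>0. \<forall>h. 0 < h \<and> h < d \<longrightarrow>
          norm (integral (cbox x (x + h *\<^sub>R One)) (\<lambda>y. \<bar>g y - q\<bar>) /\<^sub>R h ^ DIM(real) - \<bar>g x - q\<bar>) < e"
    by metis
  show thesis
  proof (rule that)
    show "(\<Union>q\<in>\<rat>. N q) \<in> null_sets lebesgue"
      using N by (intro null_sets_UN') (auto simp: countable_rat negligible_iff_null_sets)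
    fix x assume x: "x \<notin> (\<Union>q\<in>\<rat>. N q)"
    show "lebesgue_point g x" unfolding lebesgue_point_def
    proof (intro allI impI)
      fix \<eta> :: real assume \<eta>: "0 < \<eta>"
      have "g x - \<eta>/4 < g x + \<eta>/4" using \<eta> by simp
      from Rats_dense_in_real[OF this] obtain q where q: "q \<in> \<rat>" "\<bar>g x - q\<bar> < \<eta>/4" by (auto simp: abs_if)
      have xq: "x \<notin> N q" using x q(1) by blast
      have "0 < \<eta>/4" using \<eta> by simp
      from lim[OF xq this] obtain d where d: "d > 0" "\<And>h. 0 < h \<Longrightarrow> h < d \<Longrightarrow>
          norm (integral (cbox x (x + h *\<^sub>R One)) (\<lambda>y. \<bar>g y - q\<bar>) /\<^sub>R h ^ DIM(real) - \<bar>g x - q\<bar>) < \<eta>/4" by blast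
      show "\<exists>d>0. \<forall>h. 0 < h \<and> h < d \<longrightarrow> (\<integral>y. \<bar>g y - g x\<bar> * indicator {x..x+h} y \<partial>lborel) \<le> \<eta> * h"
      proof (intro exI conjI allI impI)
        show "d > 0" by (rule d(1))
        fix h assume h: "0 < h \<and> h < d"
        let ?I = "\<integral>y. \<bar>g y - q\<bar> * indicator {x..x+h} y \<partial>lborel"
        have I: "integral {x..x+h} (\<lambda>y. \<bar>g y - q\<bar>) = ?I"
          using bdd_borel_has_integral[OF bq, of q x "x+h"] by (rule integral_unique)
        have "norm (integral (cbox x (x + h *\<^sub>R One)) (\<lambda>y. \<bar>g y - q\<bar>) /\<^sub>R h ^ DIM(real) - \<bar>g x - q\<bar>) < \<eta>/4"
          by (rule d(2)) (use h in auto)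
        moreover have "integral (cbox x (x + h *\<^sub>R One)) (\<lambda>y. \<bar>g y - q\<bar>) /\<^sub>R h ^ DIM(real) = ?I / h"
          unfolding I[symmetric] by (simp add: cbox_interval divide_inverse mult.commute)
        ultimately have "\<bar>?I / h - \<bar>g x - q\<bar>\<bar> < \<eta>/4" by (simp only: real_norm_def)
        then have "?I / h \<le> \<eta>/2" using q(2) by linarith
        then have Ile: "?I \<le> \<eta>/2 * h" using h by (simp add: divide_le_eq)
        have "(\<integral>y. \<bar>g y - g x\<bar> * indicator {x..x+h} y \<partial>lborel)
           \<le> (\<integral>y. \<bar>g y - q\<bar> * indicator {x..x+h} y + \<bar>g x - q\<bar> * indicator {x..x+h} y \<partial>lborel)"
        proof (rule integral_mono)
          show "integrable lborel (\<lambda>y. \<bar>g y - g x\<bar> * indicat_real {x..x+h} y)" by (rule bdd_borel_box_integrable[OF bq])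
          show "integrable lborel (\<lambda>y. \<bar>g y - q\<bar> * indicat_real {x..x+h} y + \<bar>g x - q\<bar> * indicat_real {x..x+h} y)"
            using bdd_borel_box_integrable[OF bq, of q x "x+h"] by (simp add: emeasure_lborel_Icc_eq)
          show "\<bar>g y - g x\<bar> * indicat_real {x..x+h} y \<le> \<bar>g y - q\<bar> * indicat_real {x..x+h} y + \<bar>g x - q\<bar> * indicat_real {x..x+h} y" for y
            by (auto simp: indicator_def)
        qed
        also have "\<dots> = ?I + \<bar>g x - q\<bar> * h"
          using bdd_borel_box_integrable[OF bq, of q x "x+h"] h by (simp add: emeasure_lborel_Icc_eq)
        also have "\<dots> \<le> \<eta>/2 * h + \<eta>/4 * h" using Ile q(2) h by (intro add_mono mult_right_mono) auto
        also have "\<dots> \<le> \<eta> * h" using \<eta> h by simp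
        finally show "(\<integral>y. \<bar>g y - g x\<bar> * indicator {x..x+h} y \<partial>lborel) \<le> \<eta> * h" .
      qed
    qed
  qed
qed

lemma ramp_average:
  assumes g: "bdd_borel g" and w: "w \<in> borel_measurable borel" "\<And>x. x \<in> {a..a+e} \<Longrightarrow> \<bar>w x\<bar> \<le> e"
    and e: "0 < e" and int: "(\<integral>x. w x * indicator {a..a+e} x \<partial>lborel) = e\<^sup>2 / 2"
  shows "\<bar>(\<integral>x. g x * (w x * indicator {a..a+e} x) \<partial>lborel) - g a * (e\<^sup>2 / 2)\<bar> \<le> e * (\<integral>y. \<bar>g y - g a\<bar> * indicator {a..a+e} y \<partial>lborel)"
proof -
  obtain C where C: "\<And>x. \<bar>g x\<bar> \<le> C" using bdd_borel_bound[OF g] by blast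
  note [measurable] = bdd_borel_measurable[OF g] w(1)
  have bq: "bdd_borel (\<lambda>y. \<bar>g y - q\<bar>)" for q
  proof (rule bdd_borelI[where C="C + \<bar>q\<bar>"])
    show "\<bar>\<bar>g x - q\<bar>\<bar> \<le> C + \<bar>q\<bar>" for x using C[of x] by linarith
  qed measurable
  have "(\<integral>x. w x * indicator {a..a+e} x \<partial>lborel) \<noteq> 0" unfolding int using e by simp
  then have wi: "integrable lborel (\<lambda>x. w x * indicator {a..a+e} x)"
    using not_integrable_integral_eq by blast
  have gwi: "integrable lborel (\<lambda>x. g x * (w x * indicator {a..a+e} x))" by (rule bdd_borel_integrable[OF g wi])
  have eq: "(\<integral>x. g x * (w x * indicator {a..a+e} x) \<partial>lborel) - g a * (e\<^sup>2 / 2)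
     = (\<integral>x. g x * (w x * indicator {a..a+e} x) - g a * (w x * indicator {a..a+e} x) \<partial>lborel)"
    using gwi wi by (simp add: int)
  have le: "norm (\<integral>x. g x * (w x * indicator {a..a+e} x) - g a * (w x * indicator {a..a+e} x) \<partial>lborel)
      \<le> (\<integral>y. e * (\<bar>g y - g a\<bar> * indicator {a..a+e} y) \<partial>lborel)"
  proof (rule Bochner_Integration.integral_norm_bound_integral)
    show "integrable lborel (\<lambda>x. g x * (w x * indicator {a..a+e} x) - g a * (w x * indicator {a..a+e} x))" using gwi wi by simp
    show "integrable lborel (\<lambda>y. e * (\<bar>g y - g a\<bar> * indicator {a..a+e} y))" using bdd_borel_box_integrable[OF bq] by simp
    fix x
    show "norm (g x * (w x * indicator {a..a+e} x) - g a * (w x * indicator {a..a+e} x)) \<le> e * (\<bar>g x - g a\<bar> * indicator {a..a+e} x)"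
    proof (cases "x \<in> {a..a+e}")
      case True
      have "\<bar>(g x - g a) * w x\<bar> \<le> \<bar>g x - g a\<bar> * e" unfolding abs_mult by (intro mult_left_mono w(2)[OF True]) simp
      moreover have "g x * (w x * indicator {a..a+e} x) - g a * (w x * indicator {a..a+e} x) = (g x - g a) * w x"
        using True by (simp add: left_diff_distrib)
      ultimately show ?thesis using True by (simp add: mult.commute[of e])
    qed simp
  qed
  show ?thesis using le unfolding eq by simp
qed

lemma ramp_integrals:
  fixes a e :: real
  assumes "0 < e"
  shows "(\<integral>x. (x - a) * indicator {a..a+e} x \<partial>lborel) = e\<^sup>2 / 2"
    "(\<integral>x. (a + e - x) * indicator {a..a+e} x \<partial>lborel) = e\<^sup>2 / 2"
proof -
  have "(\<integral>x. (x - a) * indicator {a..a+e} x \<partial>lborel) = (a + e - a)\<^sup>2 / 2 - (a - a)\<^sup>2 / 2"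
    by (rule integral_FTC_Icc_real) (use assms in \<open>auto intro!: derivative_eq_intros\<close>)
  then show "(\<integral>x. (x - a) * indicator {a..a+e} x \<partial>lborel) = e\<^sup>2 / 2" by simp
  have "(\<integral>x. (a + e - x) * indicator {a..a+e} x \<partial>lborel) = - (a + e - (a + e))\<^sup>2 / 2 - (- (a + e - a)\<^sup>2 / 2)"
    by (rule integral_FTC_Icc_real) (use assms in \<open>auto intro!: derivative_eq_intros simp: field_simps\<close>)
  then show "(\<integral>x. (a + e - x) * indicator {a..a+e} x \<partial>lborel) = e\<^sup>2 / 2" by simp
qed

text \<open>The product of the trapezoid with its derivative is a ramp on each of the short intervals at $a$ and
$b$, with masses $1/2$ and $-1/2$; at Lebesgue points these averages of \<open>g\<close> converge.\<close>
lemma trap_derivative_average: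
  assumes g: "bdd_borel g" and pts: "lebesgue_point g a" "lebesgue_point g b" and "a < b" and \<eta>: "0 < \<eta>"
  obtains e where "0 < e" "a + e < b" "\<bar>2 * (\<integral>x. dtrap a b e x * g x * trap a b e x \<partial>lborel) - (g a - g b)\<bar> \<le> 4 * \<eta>"
proof -
  obtain d1 where d1: "d1 > 0" "\<And>h. 0 < h \<Longrightarrow> h < d1 \<Longrightarrow> (\<integral>y. \<bar>g y - g a\<bar> * indicator {a..a+h} y \<partial>lborel) \<le> \<eta> * h"
    using pts(1) \<eta> unfolding lebesgue_point_def by blast
  obtain d2 where d2: "d2 > 0" "\<And>h. 0 < h \<Longrightarrow> h < d2 \<Longrightarrow> (\<integral>y. \<bar>g y - g b\<bar> * indicator {b..b+h} y \<partial>lborel) \<le> \<eta> * h"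
    using pts(2) \<eta> unfolding lebesgue_point_def by blast
  define e where "e = min (min d1 d2) (b - a) / 2"
  have e: "0 < e" "a + e < b" "e < d1" "e < d2" using d1(1) d2(1) \<open>a < b\<close> by (auto simp: e_def min_def field_simps)
  let ?A = "\<integral>x. g x * ((x - a) * indicator {a..a+e} x) \<partial>lborel"
  let ?B = "\<integral>x. g x * ((b + e - x) * indicator {b..b+e} x) \<partial>lborel"
  have "(\<integral>x. (x - a) * indicator {a..a+e} x \<partial>lborel) \<noteq> 0" "(\<integral>x. (b + e - x) * indicator {b..b+e} x \<partial>lborel) \<noteq> 0"
    unfolding ramp_integrals[OF e(1)] using e(1) by simp_all
  then have wi: "integrable lborel (\<lambda>x. (x - a) * indicat_real {a..a+e} x)" "integrable lborel (\<lambda>x. (b + e - x) * indicat_real {b..b+e} x)"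
    using not_integrable_integral_eq by blast+
  have "\<bar>?A - g a * (e\<^sup>2 / 2)\<bar> \<le> e * (\<integral>y. \<bar>g y - g a\<bar> * indicator {a..a+e} y \<partial>lborel)"
    by (rule ramp_average[OF g _ _ e(1) ramp_integrals(1)[OF e(1)]]) auto
  also have "\<dots> \<le> e * (\<eta> * e)" using d1(2)[OF e(1,3)] e(1) by (intro mult_left_mono) auto
  finally have A: "\<bar>?A - g a * (e\<^sup>2 / 2)\<bar> \<le> \<eta> * e\<^sup>2" by (simp add: power2_eq_square ac_simps)
  have "\<bar>?B - g b * (e\<^sup>2 / 2)\<bar> \<le> e * (\<integral>y. \<bar>g y - g b\<bar> * indicator {b..b+e} y \<partial>lborel)"
    by (rule ramp_average[OF g _ _ e(1) ramp_integrals(2)[OF e(1)]]) auto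
  also have "\<dots> \<le> e * (\<eta> * e)" using d2(2)[OF e(1,4)] e(1) by (intro mult_left_mono) auto
  finally have B: "\<bar>?B - g b * (e\<^sup>2 / 2)\<bar> \<le> \<eta> * e\<^sup>2" by (simp add: power2_eq_square ac_simps)
  have J: "(\<integral>x. dtrap a b e x * g x * trap a b e x \<partial>lborel) = (?A - ?B) / e\<^sup>2"
  proof -
    have "dtrap a b e x * g x * trap a b e x = (g x * ((x - a) * indicator {a..a+e} x) - g x * ((b + e - x) * indicator {b..b+e} x)) / e\<^sup>2" for x
    proof -
      consider "x \<in> {a..a+e}" | "x \<in> {b..b+e}" | "x \<notin> {a..a+e}" "x \<notin> {b..b+e}" by blast
      then show ?thesis
      proof cases
        case 1
        then have "x \<notin> {b..b+e}" using e by auto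
        with 1 show ?thesis using trap_values(1)[of e a b x] e by (simp add: dtrap_def power2_eq_square)
      next
        case 2
        then have "x \<notin> {a..a+e}" using e by auto
        with 2 show ?thesis using trap_values(3)[of e a b x] e by (simp add: dtrap_def power2_eq_square)
      next
        case 3 then show ?thesis by (simp add: dtrap_def)
      qed
    qed
    then show ?thesis using bdd_borel_integrable[OF g wi(1)] bdd_borel_integrable[OF g wi(2)] by simp
  qed
  have "\<bar>(?A - ?B) - (g a - g b) * (e\<^sup>2 / 2)\<bar> \<le> 2 * \<eta> * e\<^sup>2"
    using A B unfolding left_diff_distrib by linarith
  moreover have "2 * ((?A - ?B) / e\<^sup>2) - (g a - g b) = (2 / e\<^sup>2) * ((?A - ?B) - (g a - g b) * (e\<^sup>2 / 2))"
    using e(1) by (simp add: field_simps)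
  ultimately have "\<bar>2 * ((?A - ?B) / e\<^sup>2) - (g a - g b)\<bar> \<le> (2 / e\<^sup>2) * (2 * \<eta> * e\<^sup>2)"
    by (simp only: abs_mult) (intro mult_mono, auto)
  also have "\<dots> = 4 * \<eta>" using e(1) by simp
  finally show thesis using that[OF e(1,2)] J by simp
qed

text \<open>The constant \<open>c\<close> is the one of \<open>qavg_limit\<close>; positivity of the averaged form gives it the sign that
makes $c g$ increasing. If it were $0$, then by \<open>qf_modul_AE_zero\<close> the form would annihilate almost all
modulated trapezoids $e^{ipx}\phi$, that is, the Fourier transform of $\phi K\psi$ would vanish for
all $\psi$. As the trapezoids are positive on arbitrarily large intervals, $K\psi$ would be $0$.\<close>
theorem positive_commutator_monotone:
  assumes pc: "positive_commutator f g"
  obtains c N where "c \<noteq> 0" "N \<in> null_sets lebesgue" "\<And>a b. a \<notin> N \<Longrightarrow> b \<notin> N \<Longrightarrow> a < b \<Longrightarrow> c * g a \<le> c * g b"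
proof -
  have f: "bdd_borel f" and g: "bdd_borel g" using pc by (auto simp: positive_commutator_def)
  obtain c r where r: "strict_mono (r :: nat \<Rightarrow> nat)" and lim:
    "\<And>g \<phi>. bdd_borel g \<Longrightarrow> \<phi> \<in> H \<Longrightarrow> integrable lborel \<phi> \<Longrightarrow> integrable lborel (\<lambda>\<xi>. \<xi> * specW g \<phi> \<xi>) \<Longrightarrow>
       (\<lambda>k. real (Suc (r k)) * qavg f g \<phi> (real (Suc (r k)))) \<longlonglongrightarrow> c * (\<integral>\<xi>. \<xi> * specW g \<phi> \<xi> \<partial>lborel)"
    by (rule qavg_limit[OF f], rule that, assumption, assumption)
  have lim_trap: "(\<lambda>k. real (Suc (r k)) * qavg f g (ctrap a b e) (real (Suc (r k)))) \<longlonglongrightarrow> c * (- 2 * (\<integral>x. dtrap a b e x * g x * trap a b e x \<partial>lborel))"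
    if "0 < e" "a + e < b" for a b e
    using lim[OF g ctrap_H[OF that(1)] specW_first_moment(1)[OF g that]] unfolding specW_first_moment(2)[OF g that] .
  have "c \<noteq> 0"
  proof
    assume c: "c = 0"
    have "cform f g \<phi> \<psi> = 0" if \<phi>: "\<phi> \<in> H" and \<psi>: "\<psi> \<in> H" for \<phi> \<psi>
    proof -
      define k where "k = comm_op f g \<psi>"
      have k: "k \<in> H" unfolding k_def by (rule comm_op_sq_int[OF f g \<psi>])
      have ae: "AE x in lborel. x \<in> {- real (Suc n)<..<real (Suc n) + 1} \<longrightarrow> k x = 0" for n :: nat
      proof -
        let ?a = "- real (Suc n)" and ?b = "real (Suc n)"
        let ?\<phi> = "ctrap ?a ?b 1"
        have e: "(0::real) < 1" "?a + 1 < ?b" by simp_all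
        note \<phi> = ctrap_H[OF e(1), of ?a ?b]
        let ?m = "fun_Q (trap ?a ?b 1) k"
        have t: "bdd_borel (trap ?a ?b 1)"
          by (rule bdd_borelI[where C=1]) (simp_all add: trap_bounds)
        have m: "?m \<in> H" by (rule fun_Q_sq_int[OF t k])
        have "integrable lborel (\<lambda>x. ?\<phi> x * k x)" by (rule integrable_ip[OF \<phi>(1) k])
        then have mi: "integrable lborel ?m" by (simp add: fun_Q_def ctrap_def)
        have "(\<lambda>k. real (Suc (r k)) * qavg f g ?\<phi> (real (Suc (r k)))) \<longlonglongrightarrow> 0"
          using lim_trap[OF e] unfolding c by simp
        from qf_modul_AE_zero[OF pc \<phi> r this] have "AE p in lborel. ft ?m p = 0"
        proof eventually_elim
          case (elim p)
          have "cform f g \<psi> (modul p ?\<phi>) = 0"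
            by (rule qf_zero_imp_cform_zero[OF pc \<psi> modul_sq_int[OF \<phi>(1)] elim])
          then have "cform f g (modul p ?\<phi>) \<psi> = 0" by (subst cform_hermitian) simp
          then have "ip lborel (modul p ?\<phi>) k = 0"
            unfolding k_def cform_eq_ip[OF f g modul_sq_int[OF \<phi>(1)] \<psi>] .
          moreover have "cnj (modul p ?\<phi> x) * k x = exp (- (\<i> * complex_of_real p * complex_of_real x)) * ?m x" for x
            by (simp add: modul_def ctrap_def fun_Q_def exp_cnj)
          ultimately show ?case unfolding ip_def ft_def by simp
        qed
        then have "AE p in lborel. FT ?m p = 0" using FT_eq_ft[OF mi m] by eventually_elim simp
        then have "nsq lborel (FT ?m) = 0" using nsq_eq_0[OF FT_sq_int[OF m]] by simp
        then have "AE x in lborel. ?m x = 0" using Plancherel[OF m] nsq_eq_0[OF m] by simp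
        then show ?thesis
        proof eventually_elim
          case (elim x)
          show ?case
          proof
            assume "x \<in> {?a<..<?b + 1}"
            then have "0 < trap ?a ?b 1 x" by (intro trap_pos) auto
            with elim show "k x = 0" by (simp add: fun_Q_def)
          qed
        qed
      qed
      have "AE x in lborel. \<forall>n. x \<in> {- real (Suc n)<..<real (Suc n) + 1} \<longrightarrow> k x = 0"
        using ae by (simp only: AE_all_countable) blast
      then have "AE x in lborel. k x = 0"
      proof eventually_elim
        case (elim x)
        obtain n where "\<bar>x\<bar> \<le> real n" using real_arch_simple by blast
        then have "x \<in> {- real (Suc n)<..<real (Suc n) + 1}" by auto
        with elim show ?case by blast
      qed
      then have "AE x in lborel. cnj (\<phi> x) * k x = 0" by eventually_elim simp
      then have "ip lborel \<phi> k = 0" unfolding ip_def by (rule integral_eq_zero_AE)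
      then show ?thesis unfolding k_def cform_eq_ip[OF f g \<phi> \<psi>] .
    qed
    then show False using pc by (auto simp: positive_commutator_def)
  qed
  obtain N where N: "N \<in> null_sets lebesgue" "\<And>x. x \<notin> N \<Longrightarrow> lebesgue_point g x"
    using lebesgue_points_AE[OF g] by blast
  show thesis
  proof (rule that[OF \<open>c \<noteq> 0\<close> N(1)])
    fix a b assume ab: "a \<notin> N" "b \<notin> N" "a < b"
    have "c * (g a - g b) \<le> \<bar>c\<bar> * (4 * \<eta>)" if \<eta>: "0 < \<eta>" for \<eta>
    proof -
      obtain e where e: "0 < e" "a + e < b" and J: "\<bar>2 * (\<integral>x. dtrap a b e x * g x * trap a b e x \<partial>lborel) - (g a - g b)\<bar> \<le> 4 * \<eta>"
        using trap_derivative_average[OF g N(2)[OF ab(1)] N(2)[OF ab(2)] ab(3) \<eta>] by blast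
      let ?J = "\<integral>x. dtrap a b e x * g x * trap a b e x \<partial>lborel"
      have "0 \<le> real (Suc (r k)) * qavg f g (ctrap a b e) (real (Suc (r k)))" for k
        unfolding qavg_def
        by (intro mult_nonneg_nonneg Bochner_Integration.integral_nonneg positive_commutator_qf(1)[OF pc] modul_sq_int ctrap_H e) auto
      then have "0 \<le> c * (- 2 * ?J)" by (intro LIMSEQ_le_const[OF lim_trap[OF e]]) auto
      moreover have "\<bar>c * (2 * ?J - (g a - g b))\<bar> \<le> \<bar>c\<bar> * (4 * \<eta>)"
        unfolding abs_mult by (intro mult_left_mono J) simp
      moreover have "c * (2 * ?J - (g a - g b)) = - (c * (- 2 * ?J)) - c * (g a - g b)" by (simp add: algebra_simps)
      ultimately show ?thesis by linarith
    qed
    then have small: "c * (g a - g b) / (4 * \<bar>c\<bar>) \<le> \<eta>" if "0 < \<eta>" for \<eta>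
      using that \<open>c \<noteq> 0\<close> by (simp add: divide_le_eq mult.commute mult.left_commute)
    have "c * (g a - g b) / (4 * \<bar>c\<bar>) \<le> 0" by (rule field_le_epsilon) (use small in simp)
    then show "c * g a \<le> c * g b" using \<open>c \<noteq> 0\<close> by (simp add: divide_le_0_iff right_diff_distrib)
  qed
qed

section \<open>Monotone functions and their Lebesgue--Stieltjes measures\<close>

lemma null_set_dense:
  fixes x y :: real
  assumes "N \<in> null_sets lebesgue" "x < y" shows "\<exists>z. x < z \<and> z < y \<and> z \<notin> N"
proof (rule ccontr)
  assume "\<not> ?thesis"
  then have "{x<..<y} \<subseteq> N" by auto
  then have "{x<..<y} \<in> null_sets lebesgue" using assms(1) null_sets_subset[of N lebesgue "{x<..<y}"] by auto
  then have "emeasure lborel {x<..<y} = 0" by (auto simp: null_sets_def)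
  then show False using assms(2) by simp
qed

text \<open>The infimum over the points to the right, outside the exceptional set, is right continuous; a monotone function
has only countably many discontinuities, and it agrees with \<open>g\<close> at its points of continuity off that set.\<close>
lemma monotone_representative:
  assumes g: "bdd_borel g" and N: "N \<in> null_sets lebesgue"
    and mono: "\<And>a b. a \<notin> N \<Longrightarrow> b \<notin> N \<Longrightarrow> a < b \<Longrightarrow> g a \<le> g b"
  obtains g\<^sub>0 where "mono g\<^sub>0" "\<And>a. continuous (at_right a) g\<^sub>0" "bdd_borel g\<^sub>0" "AE x in lborel. g x = g\<^sub>0 x"
proof -
  obtain C where C: "\<And>x. \<bar>g x\<bar> \<le> C" using bdd_borel_bound[OF g] by blast
  define S where "S x = g ` ({x<..} - N)" for x
  define g\<^sub>0 where "g\<^sub>0 x = Inf (S x)" for x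
  have ne: "S x \<noteq> {}" for x using null_set_dense[OF N, of x "x + 1"] by (auto simp: S_def)
  have bd: "bdd_below (S x)" for x
    unfolding S_def using C by (intro bdd_belowI[where m="- C"]) (auto simp: abs_le_iff minus_le_iff)
  have le: "g\<^sub>0 x \<le> g y" if "x < y" "y \<notin> N" for x y
    unfolding g\<^sub>0_def using that by (intro cInf_lower bd) (auto simp: S_def)
  have ge: "v \<le> g\<^sub>0 x" if "\<And>y. x < y \<Longrightarrow> y \<notin> N \<Longrightarrow> v \<le> g y" for x v
    unfolding g\<^sub>0_def using that by (intro cInf_greatest ne) (auto simp: S_def)
  have mono0: "mono g\<^sub>0"
    by (intro monoI ge le) auto
  have bdd: "bdd_borel g\<^sub>0"
  proof (rule bdd_borelI[where C=C])
    show "g\<^sub>0 \<in> borel_measurable borel" by (rule borel_measurable_mono[OF mono0])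
    fix x
    obtain y where y: "x < y" "y \<notin> N" using null_set_dense[OF N, of x "x + 1"] by auto
    have "g\<^sub>0 x \<le> C" using le[OF y] C[of y] by linarith
    moreover have "- C \<le> g\<^sub>0 x"
    proof (rule ge)
      fix y show "- C \<le> g y" using C[of y] by linarith
    qed
    ultimately show "\<bar>g\<^sub>0 x\<bar> \<le> C" by linarith
  qed
  have rc: "continuous (at_right a) g\<^sub>0" for a
  proof (subst continuous_at_right_real_increasing)
    show "g\<^sub>0 x \<le> g\<^sub>0 y" if "x \<le> y" for x y using mono0 that by (rule monoD)
    show "\<forall>e>0. \<exists>d>0. g\<^sub>0 (a + d) - g\<^sub>0 a < e"
    proof (intro allI impI)
      fix e :: real assume "0 < e"
      then have "Inf (S a) < g\<^sub>0 a + e" by (simp add: g\<^sub>0_def)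
      then obtain v where "v \<in> S a" "v < g\<^sub>0 a + e" using cInf_lessD[OF ne] by blast
      then obtain y where y: "a < y" "y \<notin> N" "g y < g\<^sub>0 a + e" by (auto simp: S_def)
      have "g\<^sub>0 (a + (y - a) / 2) \<le> g y" by (rule le) (use y in \<open>auto simp: field_simps\<close>)
      then have "g\<^sub>0 (a + (y - a) / 2) - g\<^sub>0 a < e" using y(3) by linarith
      then show "\<exists>d>0. g\<^sub>0 (a + d) - g\<^sub>0 a < e" using y(1) by (intro exI[of _ "(y - a) / 2"]) auto
    qed
  qed
  have "countable {x. \<not> isCont g\<^sub>0 x}" by (rule mono_ctble_discont[OF mono0])
  then have D: "AE x in lborel. isCont g\<^sub>0 x"
    using AE_not_in[OF countable_imp_null_set_lborel] by fastforce
  have "AE x in lebesgue. g x = g\<^sub>0 x"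
    using AE_not_in[OF N] AE_completion[OF D]
  proof eventually_elim
    case (elim x)
    have "g x \<le> g\<^sub>0 x" by (intro ge mono elim)
    moreover have "g\<^sub>0 x \<le> g x"
    proof (rule tendsto_upperbound[where F="at_left x"])
      show "(g\<^sub>0 \<longlongrightarrow> g\<^sub>0 x) (at_left x)" using elim(2) by (simp add: isCont_def filterlim_at_split)
      show "\<forall>\<^sub>F z in at_left x. g\<^sub>0 z \<le> g x"
        using eventually_at_left_real[of "x - 1" x] by (auto elim!: eventually_mono intro!: le elim(1))
    qed simp
    ultimately show ?case by simp
  qed
  moreover have "{x \<in> space lborel. g x = g\<^sub>0 x} \<in> sets lborel"
    using bdd_borel_measurable[OF g] bdd_borel_measurable[OF bdd] by measurable
  ultimately have "AE x in lborel. g x = g\<^sub>0 x" by (simp add: AE_completion_iff)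
  with mono0 rc bdd show thesis by (rule that)
qed

text \<open>Absolute continuity of the integral. The part of \<open>k\<close> above a large level has a small integral, and below
that level \<open>k\<close> is bounded. Weights \<open>w\<close> with values in $[0, 1]$ take the place of sets because sums of
indicators of intervals are to be inserted.\<close>
lemma integrable_uniformly_small:
  fixes k :: "real \<Rightarrow> real"
  assumes k: "integrable lborel k" and k0: "\<And>x. 0 \<le> k x" and e: "0 < e"
  obtains d where "0 < d"
    "\<And>w. w \<in> borel_measurable borel \<Longrightarrow> (\<And>x. 0 \<le> w x \<and> w x \<le> 1) \<Longrightarrow> integrable lborel w \<Longrightarrow>
       (\<integral>x. w x \<partial>lborel) < d \<Longrightarrow> (\<integral>x. w x * k x \<partial>lborel) < e"
proof -
  note [measurable] = borel_measurable_integrable[OF k]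
  have "(\<lambda>n. \<integral>x. max 0 (k x - real n) \<partial>lborel) \<longlonglongrightarrow> (\<integral>x. 0 \<partial>(lborel :: real measure))"
  proof (rule integral_dominated_convergence[OF _ _ k])
    show "AE x in lborel. (\<lambda>n. max 0 (k x - real n)) \<longlonglongrightarrow> 0"
    proof (rule AE_I2)
      fix x
      obtain m where m: "k x \<le> real m" using real_arch_simple by blast
      have "\<forall>\<^sub>F n in sequentially. max 0 (k x - real n) = 0"
        using eventually_ge_at_top[of m] by eventually_elim (use m in auto)
      then show "(\<lambda>n. max 0 (k x - real n)) \<longlonglongrightarrow> 0" by (rule tendsto_eventually)
    qed
  qed (use k0 in auto)
  then have lim: "(\<lambda>n. \<integral>x. max 0 (k x - real n) \<partial>lborel) \<longlonglongrightarrow> 0" by simp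
  have "\<forall>\<^sub>F n in sequentially. (\<integral>x. max 0 (k x - real n) \<partial>lborel) < e / 2"
    using order_tendstoD(2)[OF lim, of "e / 2"] e by simp
  then obtain n where n: "(\<integral>x. max 0 (k x - real n) \<partial>lborel) < e / 2"
    by (auto simp: eventually_sequentially)
  have pi: "integrable lborel (\<lambda>x. max 0 (k x - real n))"
    by (rule Bochner_Integration.integrable_bound[OF k]) (use k0 in auto)
  show thesis
  proof (rule that)
    show "0 < e / (2 * (real n + 1))" using e by simp
    fix w :: "real \<Rightarrow> real"
    assume w: "w \<in> borel_measurable borel" "\<And>x. 0 \<le> w x \<and> w x \<le> 1" "integrable lborel w" "(\<integral>x. w x \<partial>lborel) < e / (2 * (real n + 1))"
    have "(\<integral>x. w x * k x \<partial>lborel) \<le> (\<integral>x. real n * w x + max 0 (k x - real n) \<partial>lborel)"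
    proof (rule integral_mono)
      show "integrable lborel (\<lambda>x. w x * k x)"
      proof (rule Bochner_Integration.integrable_bound[OF k])
        show "AE x in lborel. norm (w x * k x) \<le> norm (k x)"
          using w(2) k0 by (intro AE_I2) (simp add: abs_mult mult_left_le_one_le)
      qed (use w(1) in measurable)
      show "integrable lborel (\<lambda>x. real n * w x + max 0 (k x - real n))" using w(3) pi by simp
      fix x
      have "w x * k x \<le> w x * real n + w x * max 0 (k x - real n)"
        using w(2)[of x] mult_left_mono[of "k x" "real n + max 0 (k x - real n)" "w x"] by (simp add: distrib_left)
      also have "w x * max 0 (k x - real n) \<le> max 0 (k x - real n)" using w(2)[of x] by (simp add: mult_left_le_one_le)
      finally show "w x * k x \<le> real n * w x + max 0 (k x - real n)" by (simp add: mult.commute)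
    qed
    also have "\<dots> = real n * (\<integral>x. w x \<partial>lborel) + (\<integral>x. max 0 (k x - real n) \<partial>lborel)" using w(3) pi by simp
    also have "\<dots> < e / 2 + e / 2"
    proof (rule add_le_less_mono[OF _ n])
      have "0 \<le> (\<integral>x. w x \<partial>lborel)" using w(2) by (intro Bochner_Integration.integral_nonneg) simp
      then have "real n * (\<integral>x. w x \<partial>lborel) \<le> (real n + 1) * (\<integral>x. w x \<partial>lborel)" by (intro mult_right_mono) auto
      also have "\<dots> \<le> (real n + 1) * (e / (2 * (real n + 1)))" using w(4) by (intro mult_left_mono) auto
      also have "\<dots> = e / 2" by (simp add: field_simps)
      finally show "real n * (\<integral>x. w x \<partial>lborel) \<le> e / 2" .
    qed
    finally show "(\<integral>x. w x * k x \<partial>lborel) < e" by simp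
  qed
qed

lemma integral_increment_abs_cont:
  assumes k: "integrable lborel k" and k0: "\<And>x. 0 \<le> k x"
    and G: "\<And>a b. a \<le> b \<Longrightarrow> G b - G a = (\<integral>x. indicator {a<..<b} x * k x \<partial>lborel)"
  shows "abs_cont G"
  unfolding abs_cont_def
proof (intro allI impI)
  fix e :: real assume "0 < e"
  from integrable_uniformly_small[OF k k0 this] obtain d where d: "0 < d"
    "\<And>w. w \<in> borel_measurable borel \<Longrightarrow> (\<And>x. 0 \<le> w x \<and> w x \<le> 1) \<Longrightarrow> integrable lborel w \<Longrightarrow>
       (\<integral>x. w x \<partial>lborel) < d \<Longrightarrow> (\<integral>x. w x * k x \<partial>lborel) < e" by blast
  show "\<exists>\<delta>>0. \<forall>I :: (real \<times> real) set.
        finite I \<and> (\<forall>(a, b)\<in>I. a \<le> b) \<and>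
        pairwise (\<lambda>(a, b) (c, d). {a<..<b} \<inter> {c<..<d} = {}) I \<and>
        (\<Sum>(a, b)\<in>I. b - a) < \<delta>
        \<longrightarrow> (\<Sum>(a, b)\<in>I. \<bar>G b - G a\<bar>) < e"
  proof (intro exI[of _ d] conjI d(1) allI impI)
    fix I :: "(real \<times> real) set"
    assume *: "finite I \<and> (\<forall>(a, b)\<in>I. a \<le> b) \<and>
        pairwise (\<lambda>(a, b) (c, d). {a<..<b} \<inter> {c<..<d} = {}) I \<and> (\<Sum>(a, b)\<in>I. b - a) < d"
    then have fin: "finite I" and ab: "\<And>p. p \<in> I \<Longrightarrow> fst p \<le> snd p"
      and disj: "\<And>p q. p \<in> I \<Longrightarrow> q \<in> I \<Longrightarrow> p \<noteq> q \<Longrightarrow> {fst p<..<snd p} \<inter> {fst q<..<snd q} = {}"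
      and sm: "(\<Sum>p\<in>I. snd p - fst p) < d"
      by (auto simp: pairwise_def case_prod_beta)
    define w where "w x = (\<Sum>p\<in>I. indicat_real {fst p<..<snd p} x)" for x
    have wm: "w \<in> borel_measurable borel" unfolding w_def[abs_def] by measurable
    have w1: "0 \<le> w x \<and> w x \<le> 1" for x
    proof (cases "\<exists>p\<in>I. x \<in> {fst p<..<snd p}")
      case True
      then obtain p where p: "p \<in> I" "x \<in> {fst p<..<snd p}" by blast
      have "w x = indicat_real {fst p<..<snd p} x + (\<Sum>q\<in>I - {p}. indicat_real {fst q<..<snd q} x)"
        unfolding w_def by (rule sum.remove[OF fin p(1)])
      also have "(\<Sum>q\<in>I - {p}. indicat_real {fst q<..<snd q} x) = 0"
      proof (rule sum.neutral, rule ballI)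
        fix q assume "q \<in> I - {p}"
        then have "{fst p<..<snd p} \<inter> {fst q<..<snd q} = {}" using disj[OF p(1), of q] by blast
        then have "x \<notin> {fst q<..<snd q}" using p(2) by blast
        then show "indicat_real {fst q<..<snd q} x = 0" by simp
      qed
      finally show ?thesis using p(2) by simp
    next
      case False
      then have "w x = 0" unfolding w_def by (intro sum.neutral) auto
      then show ?thesis by simp
    qed
    have wi: "integrable lborel w" and wI: "(\<integral>x. w x \<partial>lborel) = (\<Sum>p\<in>I. snd p - fst p)"
    proof -
      have i: "integrable lborel (indicat_real {fst p<..<snd p})" if "p \<in> I" for p
        using ab[OF that] by (auto intro!: integrable_real_indicator)
      then show "integrable lborel w" unfolding w_def[abs_def] by simp
      have "(\<integral>x. w x \<partial>lborel) = (\<Sum>p\<in>I. \<integral>x. indicat_real {fst p<..<snd p} x \<partial>lborel)"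
        unfolding w_def by (rule Bochner_Integration.integral_sum) (rule i)
      also have "\<dots> = (\<Sum>p\<in>I. snd p - fst p)" by (intro sum.cong refl) (use ab in simp)
      finally show "(\<integral>x. w x \<partial>lborel) = (\<Sum>p\<in>I. snd p - fst p)" .
    qed
    have ki: "integrable lborel (\<lambda>x. indicat_real {a<..<b} x * k x)" for a b
      using integrable_real_mult_indicator[OF _ k, of "{a<..<b}"] by (simp add: mult.commute)
    have "(\<Sum>(a, b)\<in>I. \<bar>G b - G a\<bar>) = (\<Sum>p\<in>I. \<integral>x. indicat_real {fst p<..<snd p} x * k x \<partial>lborel)"
      unfolding case_prod_beta
    proof (intro sum.cong refl)
      fix p assume "p \<in> I"
      from G[OF ab[OF this]] show "\<bar>G (snd p) - G (fst p)\<bar> = (\<integral>x. indicat_real {fst p<..<snd p} x * k x \<partial>lborel)"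
        using k0 by (simp add: Bochner_Integration.integral_nonneg)
    qed
    also have "\<dots> = (\<integral>x. (\<Sum>p\<in>I. indicat_real {fst p<..<snd p} x * k x) \<partial>lborel)"
      by (rule Bochner_Integration.integral_sum[symmetric]) (rule ki)
    also have "\<dots> = (\<integral>x. w x * k x \<partial>lborel)" unfolding w_def by (simp add: sum_distrib_right)
    also have "\<dots> < e" by (rule d(2)[OF wm w1 wi]) (use sm wI in simp)
    finally show "(\<Sum>(a, b)\<in>I. \<bar>G b - G a\<bar>) < e" .
  qed
qed

text \<open>Differentiation of the integral gives the right derivative; the left derivative is the right
derivative of the reflected function.\<close>
lemma integral_increment_derivative:
  assumes k: "integrable lborel k"
    and G: "\<And>a b. a \<le> b \<Longrightarrow> G b - G a = (\<integral>x. indicator {a<..<b} x * k x \<partial>lborel)"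
  shows "AE x in lebesgue. (G has_real_derivative k x) (at x)"
proof -
  have right: "\<exists>N. negligible N \<and> (\<forall>x. x \<notin> N \<longrightarrow> ((\<lambda>h. (F (x + h) - F x) / h) \<longlongrightarrow> l x) (at_right 0))"
    if l: "integrable lborel l" and F: "\<And>a b. a \<le> b \<Longrightarrow> F b - F a = (\<integral>x. indicator {a<..<b} x * l x \<partial>lborel)"
    for F l :: "real \<Rightarrow> real"
  proof -
    have I: "(l has_integral F b - F a) {a..b}" if "a \<le> b" for a b
    proof -
      have "set_integrable lborel {a..b} l"
        using integrable_real_mult_indicator[OF _ l, of "{a..b}"] unfolding set_integrable_def by (simp add: mult.commute)
      from set_borel_integral_eq_integral[OF this]
      have "(l has_integral set_lebesgue_integral lborel {a..b} l) {a..b}" by (simp add: has_integral_iff)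
      moreover have "set_lebesgue_integral lborel {a..b} l = (\<integral>x. indicator {a<..<b} x * l x \<partial>lborel)"
        unfolding set_lebesgue_integral_def
      proof (rule integral_cong_AE)
        have "AE x in lborel. x \<notin> {a, b}" by (intro AE_not_in countable_imp_null_set_lborel) auto
        then show "AE x in lborel. indicat_real {a..b} x *\<^sub>R l x = indicat_real {a<..<b} x * l x"
          by eventually_elim (auto simp: indicator_def)
      qed (use borel_measurable_integrable[OF l] in measurable)
      ultimately show ?thesis using F[OF that] by simp
    qed
    have "l integrable_on cbox a b" for a b
      using I[of a b] by (cases "a \<le> b") (auto simp: cbox_interval)
    from integrable_ccontinuous_explicit[OF this] obtain N where N: "negligible N" and
      lim: "\<And>x e. \<lbrakk>x \<notin> N; 0 < e\<rbrakk> \<Longrightarrow> \<exists>d>0. \<forall>h. 0 < h \<and> h < d \<longrightarrow>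
         norm (integral (cbox x (x + h *\<^sub>R One)) l /\<^sub>R h ^ DIM(real) - l x) < e" by metis
    have "((\<lambda>h. (F (x + h) - F x) / h) \<longlongrightarrow> l x) (at_right 0)" if x: "x \<notin> N" for x
    proof (rule tendstoI)
      fix e :: real assume "0 < e"
      from lim[OF x this] obtain d where d: "d > 0" "\<And>h. 0 < h \<Longrightarrow> h < d \<Longrightarrow>
         norm (integral (cbox x (x + h *\<^sub>R One)) l /\<^sub>R h ^ DIM(real) - l x) < e" by blast
      have "dist ((F (x + h) - F x) / h) (l x) < e" if h: "0 < h" "h < d" for h
      proof -
        have "integral {x..x + h} l = F (x + h) - F x" using I[of x "x + h"] h by (intro integral_unique) auto
        then have "integral (cbox x (x + h *\<^sub>R One)) l /\<^sub>R h ^ DIM(real) = (F (x + h) - F x) / h"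
          by (simp add: cbox_interval divide_inverse mult.commute)
        then show ?thesis using d(2)[OF h] by (simp only: dist_norm)
      qed
      then show "\<forall>\<^sub>F h in at_right 0. dist ((F (x + h) - F x) / h) (l x) < e"
        unfolding eventually_at_right_field using d(1) by (intro exI[of _ d]) auto
    qed
    then show ?thesis using N by blast
  qed
  obtain N1 where N1: "negligible N1" "\<And>x. x \<notin> N1 \<Longrightarrow> ((\<lambda>h. (G (x + h) - G x) / h) \<longlongrightarrow> k x) (at_right 0)"
    using right[OF k G] by blast
  have "- G (- b) - - G (- a) = (\<integral>x. indicator {a<..<b} x * k (- x) \<partial>lborel)" if "a \<le> b" for a b
  proof -
    have "(\<integral>x. indicat_real {a<..<b} x * k (- x) \<partial>lborel) = (\<integral>x. indicat_real {a<..<b} (- x) * k x \<partial>lborel)"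
      using integral_uminus[of "\<lambda>x. indicat_real {a<..<b} (- x) * k x"] by simp
    also have "(\<lambda>x. indicat_real {a<..<b} (- x)) = indicat_real {- b<..<- a}" by (auto simp: indicator_def fun_eq_iff)
    then have "(\<integral>x. indicat_real {a<..<b} (- x) * k x \<partial>lborel) = (\<integral>x. indicat_real {- b<..<- a} x * k x \<partial>lborel)" by metis
    finally show ?thesis using G[of "- b" "- a"] that by simp
  qed
  from right[OF integrable_uminus[OF k] this]
  obtain N2 where N2: "negligible N2" "\<And>x. x \<notin> N2 \<Longrightarrow> ((\<lambda>h. (- G (- (x + h)) - - G (- x)) / h) \<longlongrightarrow> k (- x)) (at_right 0)"
    by blast
  have AE2: "AE x in lebesgue. - x \<notin> N2"
  proof -
    obtain N' where N': "N' \<in> null_sets lborel" "N2 \<subseteq> N'"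
      using N2(1) unfolding negligible_iff_null_sets null_sets_completion_iff2 by blast
    have "AE x in lborel. - x \<notin> N'" by (rule AE_lborel_uminus[OF AE_not_in[OF N'(1)]])
    from AE_completion[OF this] show ?thesis by eventually_elim (use N'(2) in blast)
  qed
  have "AE x in lebesgue. x \<notin> N1" using N1(1) by (intro AE_not_in) (simp add: negligible_iff_null_sets)
  with AE2 show ?thesis
  proof eventually_elim
    case (elim x)
    have R: "((\<lambda>h. (G (x + h) - G x) / h) \<longlongrightarrow> k x) (at_right 0)" by (rule N1(2)[OF elim(2)])
    have "((\<lambda>h. (- G (- (- x + h)) - - G (- (- x))) / h) \<longlongrightarrow> k (- (- x))) (at_right 0)" by (rule N2(2)[OF elim(1)])
    moreover have "(- G (- (- x + h)) - - G (- (- x))) / h = (G (x + - h) - G x) / - h" for h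
      by (simp add: minus_divide_right[symmetric] divide_simps)
    ultimately have "((\<lambda>h. (G (x + - h) - G x) / - h) \<longlongrightarrow> k x) (at_right 0)" by simp
    then have L: "((\<lambda>h. (G (x + h) - G x) / h) \<longlongrightarrow> k x) (at_left 0)"
      by (simp add: filterlim_at_left_to_right[of _ _ 0])
    from L R show ?case unfolding DERIV_def by (simp add: filterlim_split_at)
  qed
qed

text \<open>A finite Borel measure on the line is inner regular, so it is absolutely continuous as soon as it
vanishes on compact null sets. Its Radon--Nikodym density is then the derivative of its
distribution function.\<close>
lemma abs_cont_of_null_measure:
  assumes mono: "mono g" and rc: "\<And>a. continuous (at_right a) g" and C: "\<And>x. \<bar>g x\<bar> \<le> C"
    and null: "\<And>K. compact K \<Longrightarrow> K \<in> null_sets lborel \<Longrightarrow> emeasure (interval_measure g) K = 0"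
  shows "abs_cont g" "has_L1_deriv g"
proof -
  let ?\<nu> = "interval_measure g"
  have m: "\<And>x y. x \<le> y \<Longrightarrow> g x \<le> g y" using mono by (rule monoD)
  have "emeasure ?\<nu> UNIV \<le> ennreal (2 * C)"
  proof -
    have "(\<lambda>n. emeasure ?\<nu> {- real n<..real n}) \<longlonglongrightarrow> emeasure ?\<nu> (\<Union>n. {- real n<..real n})"
    proof (rule Lim_emeasure_incseq)
      show "incseq (\<lambda>n. {- real n<..real n})" by (auto simp: incseq_def)
    qed auto
    moreover have "(\<Union>n. {- real n<..real n}) = (UNIV :: real set)"
    proof -
      have "x \<in> (\<Union>n. {- real n<..real n})" for x :: real
        using reals_Archimedean2[of "\<bar>x\<bar>"] by (auto simp: abs_less_iff intro: less_imp_le) (meson less_imp_le minus_less_iff)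
      then show ?thesis by blast
    qed
    moreover have "emeasure ?\<nu> {- real n<..real n} \<le> ennreal (2 * C)" for n
    proof -
      have "emeasure ?\<nu> {- real n<..real n} = ennreal (g (real n) - g (- real n))"
        by (rule emeasure_interval_measure_Ioc[OF _ m rc]) auto
      also have "\<dots> \<le> ennreal (2 * C)" using C[of "real n"] C[of "- real n"] by (intro ennreal_leI) linarith
      finally show ?thesis .
    qed
    ultimately show ?thesis by (intro LIMSEQ_le_const2[of "\<lambda>n. emeasure ?\<nu> {- real n<..real n}"]) auto
  qed
  then have fin': "emeasure ?\<nu> (space ?\<nu>) \<noteq> \<infinity>" by (auto simp: top.extremum_unique)
  have ac: "absolutely_continuous lborel ?\<nu>"
    unfolding absolutely_continuous_def
  proof
    fix B assume B: "B \<in> null_sets (lborel :: real measure)"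
    then have Bb: "B \<in> sets borel" by auto
    have "emeasure ?\<nu> B = (SUP K \<in> {K. K \<subseteq> B \<and> compact K}. emeasure ?\<nu> K)"
      by (rule inner_regular[OF _ fin' Bb]) simp
    also have "\<dots> = (SUP K \<in> {K. K \<subseteq> B \<and> compact K}. 0)"
    proof (rule SUP_cong[OF refl])
      fix K assume "K \<in> {K. K \<subseteq> B \<and> compact K}"
      then have K: "K \<subseteq> B" "compact K" by auto
      then have "K \<in> null_sets lborel" using B null_sets_subset[of B lborel K] borel_compact by auto
      then show "emeasure ?\<nu> K = 0" by (rule null[OF K(2)])
    qed
    also have "\<dots> = 0" by (rule SUP_eq_const) auto
    finally show "B \<in> null_sets ?\<nu>" using Bb by (intro null_setsI) auto
  qed
  obtain k where k: "k \<in> borel_measurable lborel" "density lborel k = ?\<nu>"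
    using sigma_finite_measure.Radon_Nikodym[OF sigma_finite_lborel ac] by auto
  have kfin: "(\<integral>\<^sup>+x. k x \<partial>lborel) \<noteq> \<infinity>"
  proof -
    have "(\<integral>\<^sup>+x. k x \<partial>lborel) = emeasure (density lborel k) UNIV" using k(1) by (subst emeasure_density) auto
    then show ?thesis using fin' by (simp add: k(2))
  qed
  then have kae: "AE x in lborel. k x \<noteq> \<infinity>" using k(1) by (intro nn_integral_noteq_infinite) auto
  define k' where "k' x = enn2real (k x)" for x
  have k'ae: "AE x in lborel. ennreal (k' x) = k x" using kae by eventually_elim (simp add: k'_def less_top)
  have k'm [measurable]: "k' \<in> borel_measurable borel" unfolding k'_def[abs_def] using k(1) by measurable
  have k'0: "0 \<le> k' x" for x by (simp add: k'_def)
  have k'i: "integrable lborel k'"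
  proof (rule integrableI_nonneg)
    have "(\<integral>\<^sup>+x. ennreal (k' x) \<partial>lborel) = (\<integral>\<^sup>+x. k x \<partial>lborel)" by (rule nn_integral_cong_AE[OF k'ae])
    then show "(\<integral>\<^sup>+x. ennreal (k' x) \<partial>lborel) < \<infinity>" using kfin by (simp add: less_top)
  qed (use k'0 in auto)
  have G: "g b - g a = (\<integral>x. indicator {a<..<b} x * k' x \<partial>lborel)" if "a \<le> b" for a b
  proof -
    have i: "integrable lborel (\<lambda>x. indicat_real {a<..<b} x * k' x)"
      using integrable_real_mult_indicator[OF _ k'i, of "{a<..<b}"] by (simp add: mult.commute)
    have "ennreal (g b - g a) = emeasure ?\<nu> {a<..b}" by (rule emeasure_interval_measure_Ioc[OF that m rc, symmetric])
    also have "\<dots> = (\<integral>\<^sup>+x. k x * indicator {a<..b} x \<partial>lborel)"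
      unfolding k(2)[symmetric] using k(1) by (subst emeasure_density) auto
    also have "\<dots> = (\<integral>\<^sup>+x. ennreal (indicat_real {a<..<b} x * k' x) \<partial>lborel)"
    proof (rule nn_integral_cong_AE)
      have "AE x in lborel. x \<noteq> b" by (rule AE_lborel_singleton)
      with k'ae show "AE x in lborel. k x * indicator {a<..b} x = ennreal (indicat_real {a<..<b} x * k' x)"
        by eventually_elim (auto simp: indicator_def)
    qed
    also have "\<dots> = ennreal (\<integral>x. indicat_real {a<..<b} x * k' x \<partial>lborel)"
      by (rule nn_integral_eq_integral[OF i]) (use k'0 in auto)
    finally show ?thesis using m[OF that] k'0 by (subst (asm) ennreal_inj) (auto intro!: Bochner_Integration.integral_nonneg)
  qed
  show "abs_cont g" by (rule integral_increment_abs_cont[OF k'i k'0 G])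
  have "integrable lebesgue k'" using k'i k'm by (simp add: integrable_completion)
  then show "has_L1_deriv g"
    unfolding has_L1_deriv_def using integral_increment_derivative[OF k'i G] by blast
qed

section \<open>The quadratic form of an interval\<close>

definition ibox :: "(real \<Rightarrow> real) \<Rightarrow> real \<Rightarrow> real \<Rightarrow> real" where
  "ibox g u v = (\<integral>x. g x * indicator {u..v} x \<partial>lborel)"

lemma ibox_combine:
  assumes g: "bdd_borel g" and "a \<le> b" "b \<le> c" shows "ibox g a c = ibox g a b + ibox g b c"
proof -
  have "AE x in lborel. x \<noteq> b" by (rule AE_lborel_singleton)
  then have "AE x in lborel. g x * indicat_real {a..c} x = g x * indicator {a..b} x + g x * indicator {b..c} x"
    by eventually_elim (use assms(2,3) in \<open>auto simp: indicator_def\<close>)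
  then have "ibox g a c = (\<integral>x. g x * indicator {a..b} x + g x * indicator {b..c} x \<partial>lborel)"
    unfolding ibox_def using bdd_borel_measurable[OF g] by (intro integral_cong_AE) auto
  then show ?thesis unfolding ibox_def using bdd_borel_box_integrable[OF g] by simp
qed

lemma ibox_bounds:
  assumes g: "bdd_borel g" and "u \<le> v"
  shows "(\<And>x. x \<in> {u..v} \<Longrightarrow> g x \<le> M) \<Longrightarrow> ibox g u v \<le> M * (v - u)"
    "(\<And>x. x \<in> {u..v} \<Longrightarrow> m \<le> g x) \<Longrightarrow> m * (v - u) \<le> ibox g u v"
proof -
  have c: "(\<integral>x. K * indicat_real {u..v} x \<partial>lborel) = K * (v - u)" for K using assms(2) by simp
  have ci: "integrable lborel (\<lambda>x. K * indicat_real {u..v} x)" for K by (simp add: emeasure_lborel_Icc_eq)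
  { assume "\<And>x. x \<in> {u..v} \<Longrightarrow> g x \<le> M"
    then show "ibox g u v \<le> M * (v - u)" unfolding ibox_def c[symmetric]
      by (intro integral_mono bdd_borel_box_integrable g ci) (auto simp: indicator_def) }
  { assume "\<And>x. x \<in> {u..v} \<Longrightarrow> m \<le> g x"
    then show "m * (v - u) \<le> ibox g u v" unfolding ibox_def c[symmetric]
      by (intro integral_mono bdd_borel_box_integrable g ci) (auto simp: indicator_def) }
qed

lemma ibox_shift: "ibox g (u + z) (v + z) = ibox (\<lambda>x. g (x + z)) u v"
proof -
  have "ibox g (u + z) (v + z) = (\<integral>x. g (z + x) * indicator {u + z..v + z} (z + x) \<partial>lborel)"
    unfolding ibox_def using lborel_integral_real_affine[of 1 "\<lambda>x. g x * indicat_real {u + z..v + z} x" z] by simp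
  also have "\<dots> = ibox (\<lambda>x. g (x + z)) u v"
    unfolding ibox_def by (intro Bochner_Integration.integral_cong) (auto simp: indicator_def add.commute)
  finally show ?thesis .
qed

text \<open>The difference of the integrals of \<open>g\<close> over the right and the left part of $[\alpha, \beta]$, after
parts of length \<open>z\<close> are removed at the opposite end. For increasing \<open>g\<close> it is of the order of \<open>z\<close>
times an increment of \<open>g\<close>.\<close>
definition osc :: "(real \<Rightarrow> real) \<Rightarrow> real \<Rightarrow> real \<Rightarrow> real \<Rightarrow> real" where
  "osc g \<alpha> \<beta> z = ibox g (\<alpha> + z) \<beta> - ibox g \<alpha> (\<beta> - z)"

text \<open>Both sides come from the integral over $[\alpha, \beta]$, split at $\alpha + z$ and at $\beta - z$.\<close>
lemma osc_eq:
  assumes g: "bdd_borel g" and z: "0 \<le> z" "z \<le> \<beta> - \<alpha>"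
  shows "osc g \<alpha> \<beta> z = ibox g (\<beta> - z) \<beta> - ibox g \<alpha> (\<alpha> + z)"
proof -
  have "ibox g \<alpha> \<beta> = ibox g \<alpha> (\<alpha> + z) + ibox g (\<alpha> + z) \<beta>" by (rule ibox_combine[OF g]) (use z in auto)
  moreover have "ibox g \<alpha> \<beta> = ibox g \<alpha> (\<beta> - z) + ibox g (\<beta> - z) \<beta>" by (rule ibox_combine[OF g]) (use z in auto)
  ultimately show ?thesis by (simp add: osc_def)
qed

lemma osc_bounds:
  assumes g: "bdd_borel g" and mono: "mono g" and z: "0 \<le> z" "z \<le> \<beta> - \<alpha>"
  shows "0 \<le> osc g \<alpha> \<beta> z" "osc g \<alpha> \<beta> z \<le> z * (g \<beta> - g \<alpha>)"
    "z * (g (\<beta> - z) - g (\<alpha> + z)) \<le> osc g \<alpha> \<beta> z"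
proof -
  note m = monoD[OF mono]
  have "ibox g (\<beta> - z) \<beta> \<le> g \<beta> * (\<beta> - (\<beta> - z))" by (rule ibox_bounds(1)[OF g]) (use z m in auto)
  moreover have "g \<alpha> * (\<alpha> + z - \<alpha>) \<le> ibox g \<alpha> (\<alpha> + z)" by (rule ibox_bounds(2)[OF g]) (use z m in auto)
  ultimately show "osc g \<alpha> \<beta> z \<le> z * (g \<beta> - g \<alpha>)" unfolding osc_eq[OF g z] by (simp add: algebra_simps)
  have "g (\<beta> - z) * (\<beta> - (\<beta> - z)) \<le> ibox g (\<beta> - z) \<beta>" by (rule ibox_bounds(2)[OF g]) (use z m in auto)
  moreover have "ibox g \<alpha> (\<alpha> + z) \<le> g (\<alpha> + z) * (\<alpha> + z - \<alpha>)" by (rule ibox_bounds(1)[OF g]) (use z m in auto)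
  ultimately show "z * (g (\<beta> - z) - g (\<alpha> + z)) \<le> osc g \<alpha> \<beta> z" unfolding osc_eq[OF g z] by (simp add: algebra_simps)
  have gz: "bdd_borel (\<lambda>x. g (x + z))" using bdd_borel_affine[OF g, of z 1] by (simp add: add.commute)
  have "ibox g \<alpha> (\<beta> - z) \<le> ibox (\<lambda>x. g (x + z)) \<alpha> (\<beta> - z)"
    unfolding ibox_def by (intro integral_mono bdd_borel_box_integrable g gz) (use z m in \<open>auto simp: indicator_def\<close>)
  also have "\<dots> = ibox g (\<alpha> + z) \<beta>" using ibox_shift[of g \<alpha> z "\<beta> - z"] by simp
  finally show "0 \<le> osc g \<alpha> \<beta> z" by (simp add: osc_def)
qed

lemma osc_measurable [measurable]:
  assumes [measurable]: "g \<in> borel_measurable borel" shows "osc g \<alpha> \<beta> \<in> borel_measurable borel"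
proof -
  have "(\<lambda>(z::real, x::real). g x * (if \<alpha> + z \<le> x \<and> x \<le> \<beta> then 1 else 0)) \<in> borel_measurable (borel \<Otimes>\<^sub>M lborel)" by measurable
  from lborel.borel_measurable_lebesgue_integral[OF this]
  have 1: "(\<lambda>z. ibox g (\<alpha> + z) \<beta>) \<in> borel_measurable borel" unfolding ibox_def by (simp add: indicator_def of_bool_def)
  have "(\<lambda>(z::real, x::real). g x * (if \<alpha> \<le> x \<and> x \<le> \<beta> - z then 1 else 0)) \<in> borel_measurable (borel \<Otimes>\<^sub>M lborel)" by measurable
  from lborel.borel_measurable_lebesgue_integral[OF this]
  have 2: "(\<lambda>z. ibox g \<alpha> (\<beta> - z)) \<in> borel_measurable borel" unfolding ibox_def by (simp add: indicator_def of_bool_def)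
  show ?thesis unfolding osc_def[abs_def] using 1 2 by measurable
qed

text \<open>Fubini's theorem for a product density and a bounded kernel, in the form in which it is used for
sine transforms and for incomplete integrals.\<close>
lemma box_Fubini:
  fixes r :: "real \<Rightarrow> real \<Rightarrow> real"
  assumes u: "integrable lborel u" and v: "integrable lborel v"
    and r: "(\<lambda>(y, z). r y z) \<in> borel_measurable (borel \<Otimes>\<^sub>M borel)" "\<And>y z. \<bar>r y z\<bar> \<le> 1"
  shows "(\<integral>y. u y * (\<integral>z. v z * r y z \<partial>lborel) \<partial>lborel) = (\<integral>z. v z * (\<integral>y. u y * r y z \<partial>lborel) \<partial>(lborel :: real measure))"
proof -
  note [measurable] = borel_measurable_integrable[OF u] borel_measurable_integrable[OF v] r(1)
  have rm: "(\<lambda>(y, z). r y z) \<in> borel_measurable (lborel \<Otimes>\<^sub>M lborel)" using r(1) by simp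
  have int: "integrable (lborel \<Otimes>\<^sub>M lborel) (\<lambda>(y, z). u y * v z * r y z)"
  proof (rule Bochner_Integration.integrable_bound)
    show "integrable (lborel \<Otimes>\<^sub>M lborel) (\<lambda>(y, z). u y * v z)"
    proof (rule lborel_pair.Fubini_integrable)
      show "(\<lambda>(y, z). u y * v z) \<in> borel_measurable (lborel \<Otimes>\<^sub>M lborel)" by measurable
      show "integrable lborel (\<lambda>y. \<integral>z. norm (case (y, z) of (y, z) \<Rightarrow> u y * v z) \<partial>lborel)"
        using integrable_abs[OF u] by (simp add: abs_mult)
      show "AE y in lborel. integrable lborel (\<lambda>z. case (y, z) of (y, z) \<Rightarrow> u y * v z)" using v by auto
    qed
    have "(\<lambda>p. u (fst p) * v (snd p)) \<in> borel_measurable (lborel \<Otimes>\<^sub>M lborel)" by measurable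
    then have "(\<lambda>p. u (fst p) * v (snd p) * (case p of (y, z) \<Rightarrow> r y z)) \<in> borel_measurable (lborel \<Otimes>\<^sub>M lborel)"
      by (rule borel_measurable_times[OF _ rm])
    then show "(\<lambda>(y, z). u y * v z * r y z) \<in> borel_measurable (lborel \<Otimes>\<^sub>M lborel)" by (simp add: case_prod_beta)
    show "AE p in lborel \<Otimes>\<^sub>M lborel. norm (case p of (y, z) \<Rightarrow> u y * v z * r y z) \<le> norm (case p of (y, z) \<Rightarrow> u y * v z)"
    proof (rule AE_I2)
      fix p :: "real \<times> real"
      have "\<bar>u (fst p) * v (snd p)\<bar> * \<bar>r (fst p) (snd p)\<bar> \<le> \<bar>u (fst p) * v (snd p)\<bar> * 1"
        by (intro mult_left_mono r(2)) simp
      then show "norm (case p of (y, z) \<Rightarrow> u y * v z * r y z) \<le> norm (case p of (y, z) \<Rightarrow> u y * v z)"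
        by (simp add: case_prod_beta abs_mult)
    qed
  qed
  have "(\<integral>y. u y * (\<integral>z. v z * r y z \<partial>lborel) \<partial>lborel) = (\<integral>y. (\<integral>z. u y * v z * r y z \<partial>lborel) \<partial>lborel)"
    by (simp add: mult.assoc)
  also have "\<dots> = (\<integral>z. (\<integral>y. u y * v z * r y z \<partial>lborel) \<partial>lborel)"
    by (rule lborel_pair.Fubini_integral[symmetric]) (use int in simp)
  also have "\<dots> = (\<integral>z. (\<integral>y. v z * (u y * r y z) \<partial>lborel) \<partial>lborel)" by (simp only: ac_simps)
  also have "\<dots> = (\<integral>z. v z * (\<integral>y. u y * r y z \<partial>lborel) \<partial>lborel)" by simp
  finally show ?thesis .
qed

lemma sin_box_integral:
  fixes \<xi> :: real assumes "\<xi> \<noteq> 0" "a \<le> b"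
  shows "(\<integral>x. sin (\<xi> * x) * indicator {a..b} x \<partial>lborel) = (cos (\<xi> * a) - cos (\<xi> * b)) / \<xi>"
proof -
  have "(\<integral>x. sin (\<xi> * x) * indicator {a..b} x \<partial>lborel) = - cos (\<xi> * b) / \<xi> - (- cos (\<xi> * a) / \<xi>)"
    by (rule integral_FTC_Icc_real) (use assms in \<open>auto intro!: derivative_eq_intros\<close>)
  then show ?thesis by (simp add: diff_divide_distrib)
qed

text \<open>The product of the two transforms is a double integral of $\sin(\xi(x - y)) g(y)$ over the square of
the interval. Integrating over \<open>x\<close> and writing the result as an integral over the distance \<open>z\<close> of
\<open>y\<close> to an end point of the interval collects the factor \<^const>\<open>osc\<close>.\<close>
lemma specW_box:
  assumes g: "bdd_borel g" and ab: "\<alpha> < \<beta>"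
  shows "specW g (indicator {\<alpha>..\<beta>}) \<xi> = (1 / pi) * (\<integral>z. (sin (\<xi> * z) * indicator {0..\<beta>-\<alpha>} z) * osc g \<alpha> \<beta> z \<partial>lborel)"
proof (cases "\<xi> = 0")
  case True
  have cI: "(indicator {\<alpha>..\<beta>} x :: complex) = complex_of_real (indicator {\<alpha>..\<beta>} x)" for x by (simp add: indicator_def)
  have a: "ft (indicator {\<alpha>..\<beta>}) 0 = complex_of_real (1 / sqrt (2 * pi) * (\<integral>x. indicator {\<alpha>..\<beta>} x \<partial>lborel))"
    unfolding ft_def cI of_real_mult integral_complex_of_real[symmetric] by simp
  have b: "ft (fun_Q g (indicator {\<alpha>..\<beta>})) 0 = complex_of_real (1 / sqrt (2 * pi) * (\<integral>x. g x * indicator {\<alpha>..\<beta>} x \<partial>lborel))"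
    unfolding ft_def fun_Q_def cI of_real_mult[of "1 / sqrt (2 * pi)"] integral_complex_of_real[symmetric] by simp
  have "Im (cnj (ft (indicator {\<alpha>..\<beta>}) 0) * ft (fun_Q g (indicator {\<alpha>..\<beta>})) 0) = 0"
    unfolding a b complex_cnj_complex_of_real of_real_mult[symmetric] by (rule Im_complex_of_real)
  then show ?thesis unfolding True specW_def by simp
next
  case False
  let ?I = "indicat_real {\<alpha>..\<beta>}" and ?h = "\<beta> - \<alpha>"
  let ?E = "\<lambda>x. exp (- (\<i> * complex_of_real \<xi> * complex_of_real x))"
  \<comment> \<open>The integral over x of the sine kernel, and the primitive of the sine on the interval;
    the former is a difference of two values of the latter, one for each end point.\<close>
  define s where "s y = (\<integral>x. sin (\<xi> * (x - y)) * ?I x \<partial>lborel)" for y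
  define k where "k t = (\<integral>z. (sin (\<xi> * z) * indicator {0..?h} z) * (if z \<le> t then 1 else 0) \<partial>lborel)" for t
  have cI: "(indicator {\<alpha>..\<beta>} x :: complex) = complex_of_real (?I x)" for x by (simp add: indicator_def)
  have imr: "Im (z * complex_of_real r) = Im z * r" and iml: "Im (complex_of_real r * z) = r * Im z" for z r by simp_all
  define A where "A = (\<integral>x. cnj (?E x) * complex_of_real (?I x) \<partial>lborel)"
  have ci: "cnj (\<integral>x. ?E x * complex_of_real (?I x) \<partial>lborel) = A"
    unfolding A_def by (subst Bochner_Integration.integral_cnj[symmetric]) simp
  have bi: "integrable lborel (\<lambda>x. complex_of_real (?I x))" using box_integrable[of \<alpha> \<beta>] by (simp add: cI[abs_def])
  have Ai: "integrable lborel (\<lambda>x. cnj (?E x) * complex_of_real (?I x))"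
    using integrable_ft_integrand[OF bi, of "- \<xi>"] by (simp add: exp_cnj)
  have gi: "integrable lborel (\<lambda>x. complex_of_real (g x) * complex_of_real (?I x))"
    using bdd_borel_box_integrable[OF g, of \<alpha> \<beta>] by (simp flip: of_real_mult)
  have Bi: "integrable lborel (\<lambda>y. ?E y * (complex_of_real (g y) * complex_of_real (?I y)))"
    by (rule integrable_ft_integrand[OF gi])
  have ImA: "Im (?E y * A) = s y" for y
  proof -
    have "?E y * A = (\<integral>x. ?E y * (cnj (?E x) * complex_of_real (?I x)) \<partial>lborel)"
      unfolding A_def by (rule Bochner_Integration.integral_mult_right_zero[symmetric])
    then have "Im (?E y * A) = (\<integral>x. Im (?E y * (cnj (?E x) * complex_of_real (?I x))) \<partial>lborel)"
      using integral_Im[OF integrable_mult_right[OF Ai, of "?E y"]] by simp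
    also have "\<dots> = s y" unfolding s_def
    proof (rule Bochner_Integration.integral_cong[OF refl])
      fix x
      have "?E y * cnj (?E x) = exp (\<i> * complex_of_real (\<xi> * (x - y)))"
        by (simp add: exp_cnj exp_add[symmetric] algebra_simps)
      then have "Im (?E y * cnj (?E x)) = sin (\<xi> * (x - y))" by (simp only: Im_exp) simp
      then show "Im (?E y * (cnj (?E x) * complex_of_real (?I x))) = sin (\<xi> * (x - y)) * ?I x"
        by (simp only: mult.assoc[symmetric] imr)
    qed
    finally show ?thesis .
  qed
  have cc: "complex_of_real (1 / sqrt (2 * pi)) * complex_of_real (1 / sqrt (2 * pi)) = complex_of_real (1 / (2 * pi))"
    by (simp flip: of_real_mult)
  have "cnj (ft (indicator {\<alpha>..\<beta>}) \<xi>) * ft (fun_Q g (indicator {\<alpha>..\<beta>})) \<xi>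
     = complex_of_real (1 / (2 * pi)) * (A * (\<integral>y. ?E y * (complex_of_real (g y) * complex_of_real (?I y)) \<partial>lborel))"
    unfolding ft_def fun_Q_def cI complex_cnj_mult ci complex_cnj_complex_of_real cc[symmetric] by (simp only: ac_simps)
  also have "A * (\<integral>y. ?E y * (complex_of_real (g y) * complex_of_real (?I y)) \<partial>lborel)
     = (\<integral>y. A * (?E y * (complex_of_real (g y) * complex_of_real (?I y))) \<partial>lborel)"
    by (rule Bochner_Integration.integral_mult_right_zero[symmetric])
  finally have P: "cnj (ft (indicator {\<alpha>..\<beta>}) \<xi>) * ft (fun_Q g (indicator {\<alpha>..\<beta>})) \<xi>
     = complex_of_real (1 / (2 * pi)) * (\<integral>y. A * (?E y * (complex_of_real (g y) * complex_of_real (?I y))) \<partial>lborel)" .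
  have "Im (\<integral>y. A * (?E y * (complex_of_real (g y) * complex_of_real (?I y))) \<partial>lborel)
     = (\<integral>y. Im (A * (?E y * (complex_of_real (g y) * complex_of_real (?I y)))) \<partial>lborel)"
    by (rule integral_Im[symmetric]) (intro integrable_mult_right Bi)
  also have "\<dots> = (\<integral>y. (g y * ?I y) * s y \<partial>lborel)"
  proof (rule Bochner_Integration.integral_cong[OF refl])
    fix y
    have "A * (?E y * (complex_of_real (g y) * complex_of_real (?I y))) = complex_of_real (g y * ?I y) * (?E y * A)"
      by (simp add: ac_simps)
    then show "Im (A * (?E y * (complex_of_real (g y) * complex_of_real (?I y)))) = (g y * ?I y) * s y"
      by (simp only: iml ImA)
  qed
  finally have W: "specW g (indicator {\<alpha>..\<beta>}) \<xi> = (1 / pi) * - (\<integral>y. (g y * ?I y) * s y \<partial>lborel)"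
    unfolding specW_def P by (simp add: times_complex.sel)
  have kv: "k t = (1 - cos (\<xi> * t)) / \<xi>" if t: "0 \<le> t" "t \<le> ?h" for t
  proof -
    have "k t = (\<integral>z. sin (\<xi> * z) * indicator {0..t} z \<partial>lborel)"
      unfolding k_def by (intro Bochner_Integration.integral_cong) (use t in \<open>auto simp: indicator_def\<close>)
    then show ?thesis using sin_box_integral[OF False t(1)] by simp
  qed
  have sv: "s y = k (\<beta> - y) - k (y - \<alpha>)" if y: "y \<in> {\<alpha>..\<beta>}" for y
  proof -
    have "s y = (\<integral>x. sin (\<xi> * (y + x - y)) * ?I (y + x) \<partial>lborel)"
      unfolding s_def using lborel_integral_real_affine[of 1 "\<lambda>x. sin (\<xi> * (x - y)) * ?I x" y] by simp
    also have "\<dots> = (\<integral>x. sin (\<xi> * x) * indicator {\<alpha>-y..\<beta>-y} x \<partial>lborel)"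
      by (intro Bochner_Integration.integral_cong) (auto simp: indicator_def)
    also have "\<dots> = (cos (\<xi> * (\<alpha> - y)) - cos (\<xi> * (\<beta> - y))) / \<xi>"
      by (rule sin_box_integral[OF False]) (use ab in simp)
    also have "cos (\<xi> * (\<alpha> - y)) = cos (\<xi> * (y - \<alpha>))" by (metis cos_minus minus_diff_eq mult_minus_right)
    finally show ?thesis using y by (simp add: kv diff_divide_distrib)
  qed
  note [measurable] = bdd_borel_measurable[OF g]
  have ui: "integrable lborel (\<lambda>y. g y * ?I y)" by (rule bdd_borel_box_integrable[OF g])
  have si: "integrable lborel (\<lambda>z. sin (\<xi> * z) * indicat_real {0..?h} z)"
    by (rule bdd_borel_box_integrable) (rule bdd_borelI[where C=1], auto)
  have F1: "(\<integral>y. (g y * ?I y) * k (y - \<alpha>) \<partial>lborel) = (\<integral>z. (sin (\<xi> * z) * indicator {0..?h} z) * ibox g (\<alpha> + z) \<beta> \<partial>lborel)"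
  proof -
    have "(\<integral>y. (g y * ?I y) * k (y - \<alpha>) \<partial>lborel) = (\<integral>z. (sin (\<xi> * z) * indicator {0..?h} z) * (\<integral>y. (g y * ?I y) * (if z \<le> y - \<alpha> then 1 else 0) \<partial>lborel) \<partial>lborel)"
      unfolding k_def by (rule box_Fubini[OF ui si]) auto
    also have "\<dots> = (\<integral>z. (sin (\<xi> * z) * indicator {0..?h} z) * ibox g (\<alpha> + z) \<beta> \<partial>lborel)"
    proof (rule Bochner_Integration.integral_cong[OF refl])
      fix z
      have "(\<integral>y. (g y * ?I y) * (if z \<le> y - \<alpha> then 1 else 0) \<partial>lborel) = ibox g (\<alpha> + z) \<beta>" if "0 \<le> z"
        unfolding ibox_def by (intro Bochner_Integration.integral_cong) (use that in \<open>auto simp: indicator_def\<close>)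
      then show "(sin (\<xi> * z) * indicator {0..?h} z) * (\<integral>y. (g y * ?I y) * (if z \<le> y - \<alpha> then 1 else 0) \<partial>lborel) = (sin (\<xi> * z) * indicator {0..?h} z) * ibox g (\<alpha> + z) \<beta>"
        by (auto simp: indicator_def)
    qed
    finally show ?thesis .
  qed
  have F2: "(\<integral>y. (g y * ?I y) * k (\<beta> - y) \<partial>lborel) = (\<integral>z. (sin (\<xi> * z) * indicator {0..?h} z) * ibox g \<alpha> (\<beta> - z) \<partial>lborel)"
  proof -
    have "(\<integral>y. (g y * ?I y) * k (\<beta> - y) \<partial>lborel) = (\<integral>z. (sin (\<xi> * z) * indicator {0..?h} z) * (\<integral>y. (g y * ?I y) * (if z \<le> \<beta> - y then 1 else 0) \<partial>lborel) \<partial>lborel)"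
      unfolding k_def by (rule box_Fubini[OF ui si]) auto
    also have "\<dots> = (\<integral>z. (sin (\<xi> * z) * indicator {0..?h} z) * ibox g \<alpha> (\<beta> - z) \<partial>lborel)"
    proof (rule Bochner_Integration.integral_cong[OF refl])
      fix z
      have "(\<integral>y. (g y * ?I y) * (if z \<le> \<beta> - y then 1 else 0) \<partial>lborel) = ibox g \<alpha> (\<beta> - z)" if "0 \<le> z"
        unfolding ibox_def by (intro Bochner_Integration.integral_cong) (use that in \<open>auto simp: indicator_def\<close>)
      then show "(sin (\<xi> * z) * indicator {0..?h} z) * (\<integral>y. (g y * ?I y) * (if z \<le> \<beta> - y then 1 else 0) \<partial>lborel) = (sin (\<xi> * z) * indicator {0..?h} z) * ibox g \<alpha> (\<beta> - z)"
        by (auto simp: indicator_def)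
    qed
    finally show ?thesis .
  qed
  have kb: "bdd_borel k"
  proof (rule bdd_borelI)
    have "(\<lambda>(t::real, z::real). (sin (\<xi> * z) * indicat_real {0..?h} z) * (if z \<le> t then 1 else 0)) \<in> borel_measurable (borel \<Otimes>\<^sub>M lborel)" by measurable
    from lborel.borel_measurable_lebesgue_integral[OF this] show "k \<in> borel_measurable borel" unfolding k_def[abs_def] by simp
    fix t
    have "norm (k t) \<le> (\<integral>z. \<bar>sin (\<xi> * z) * indicat_real {0..?h} z\<bar> \<partial>lborel)"
      unfolding k_def
    proof (rule Bochner_Integration.integral_norm_bound_integral)
      show "integrable lborel (\<lambda>z. (sin (\<xi> * z) * indicat_real {0..?h} z) * (if z \<le> t then 1 else 0))"
        by (rule Bochner_Integration.integrable_bound[OF si]) auto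
      show "integrable lborel (\<lambda>z. \<bar>sin (\<xi> * z) * indicat_real {0..?h} z\<bar>)" by (rule integrable_abs[OF si])
    qed auto
    then show "\<bar>k t\<bar> \<le> (\<integral>z. \<bar>sin (\<xi> * z) * indicat_real {0..?h} z\<bar> \<partial>lborel)" by simp
  qed
  have k1: "bdd_borel (\<lambda>y. k (y - \<alpha>))" using bdd_borel_affine[OF kb, of "- \<alpha>" 1] by simp
  have k2: "bdd_borel (\<lambda>y. k (\<beta> - y))" using bdd_borel_affine[OF kb, of \<beta> "-1"] by simp
  have i1: "integrable lborel (\<lambda>y. (g y * ?I y) * k (y - \<alpha>))" using bdd_borel_integrable[OF k1 ui] by (simp add: mult.commute)
  have i2: "integrable lborel (\<lambda>y. (g y * ?I y) * k (\<beta> - y))" using bdd_borel_integrable[OF k2 ui] by (simp add: mult.commute)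
  have "- (\<integral>y. (g y * ?I y) * s y \<partial>lborel) = (\<integral>y. - ((g y * ?I y) * s y) \<partial>lborel)" by simp
  also have "\<dots> = (\<integral>y. (g y * ?I y) * k (y - \<alpha>) - (g y * ?I y) * k (\<beta> - y) \<partial>lborel)"
  proof (rule Bochner_Integration.integral_cong[OF refl])
    fix y show "- ((g y * ?I y) * s y) = (g y * ?I y) * k (y - \<alpha>) - (g y * ?I y) * k (\<beta> - y)"
      by (cases "y \<in> {\<alpha>..\<beta>}") (simp_all add: sv right_diff_distrib)
  qed
  also have "\<dots> = (\<integral>z. (sin (\<xi> * z) * indicator {0..?h} z) * ibox g (\<alpha> + z) \<beta> \<partial>lborel) - (\<integral>z. (sin (\<xi> * z) * indicator {0..?h} z) * ibox g \<alpha> (\<beta> - z) \<partial>lborel)"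
    using i1 i2 by (simp add: F1 F2)
  also have "\<dots> = (\<integral>z. (sin (\<xi> * z) * indicator {0..?h} z) * osc g \<alpha> \<beta> z \<partial>lborel)"
  proof -
    obtain C where C: "\<And>x. \<bar>g x\<bar> \<le> C" using bdd_borel_bound[OF g] by blast
    have C0: "0 \<le> C" using C[of 0] by linarith
    have bnd: "\<bar>ibox g u v\<bar> \<le> C * ?h" if "u \<le> v" "v - u \<le> ?h" for u v
    proof -
      have "g x \<le> C" "- C \<le> g x" for x using C[of x] by linarith+
      then have "ibox g u v \<le> C * (v - u)" "- C * (v - u) \<le> ibox g u v"
        by (intro ibox_bounds(1)[OF g that(1)] ibox_bounds(2)[OF g that(1)]; blast)+
      then have "\<bar>ibox g u v\<bar> \<le> C * (v - u)" by (simp add: abs_le_iff)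
      also have "\<dots> \<le> C * ?h" using that C0 by (intro mult_left_mono)
      finally show ?thesis .
    qed
    have int: "integrable lborel (\<lambda>z. (sin (\<xi> * z) * indicator {0..?h} z) * m z)"
      if m: "m \<in> borel_measurable borel" "\<And>z. z \<in> {0..?h} \<Longrightarrow> \<bar>m z\<bar> \<le> C * ?h" for m
    proof (rule Bochner_Integration.integrable_bound)
      show "integrable lborel (\<lambda>z. (C * ?h) * \<bar>sin (\<xi> * z) * indicat_real {0..?h} z\<bar>)" using si by simp
      have "0 \<le> C * ?h" using C0 ab by simp
      then have "\<bar>(sin (\<xi> * z) * indicat_real {0..?h} z) * m z\<bar> \<le> \<bar>(C * ?h) * \<bar>sin (\<xi> * z) * indicat_real {0..?h} z\<bar>\<bar>" for z
        using m(2)[of z] mult_left_mono[of "\<bar>m z\<bar>" "C * ?h" "\<bar>sin (\<xi> * z)\<bar>"]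
        ab
        by (cases "z \<in> {0..?h}") (simp_all add: abs_mult ac_simps abs_of_nonneg[OF C0])
      then show "AE z in lborel. norm ((sin (\<xi> * z) * indicat_real {0..?h} z) * m z) \<le> norm ((C * ?h) * \<bar>sin (\<xi> * z) * indicat_real {0..?h} z\<bar>)"
        by simp
    qed (use m(1) in measurable)
    have m1: "(\<lambda>z. ibox g (\<alpha> + z) \<beta>) \<in> borel_measurable borel"
    proof -
      have "(\<lambda>(z::real, x::real). g x * (if \<alpha> + z \<le> x \<and> x \<le> \<beta> then 1 else 0)) \<in> borel_measurable (borel \<Otimes>\<^sub>M lborel)" by measurable
      from lborel.borel_measurable_lebesgue_integral[OF this] show ?thesis unfolding ibox_def by (simp add: indicator_def of_bool_def)
    qed
    have m2: "(\<lambda>z. ibox g \<alpha> (\<beta> - z)) \<in> borel_measurable borel"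
    proof -
      have "(\<lambda>(z::real, x::real). g x * (if \<alpha> \<le> x \<and> x \<le> \<beta> - z then 1 else 0)) \<in> borel_measurable (borel \<Otimes>\<^sub>M lborel)" by measurable
      from lborel.borel_measurable_lebesgue_integral[OF this] show ?thesis unfolding ibox_def by (simp add: indicator_def of_bool_def)
    qed
    show ?thesis
      unfolding osc_def right_diff_distrib
      by (rule Bochner_Integration.integral_diff[symmetric]; rule int) (auto intro!: bnd m1 m2)
  qed
  finally show ?thesis unfolding W by simp
qed

text \<open>The quotient is bounded near $0$ for monotone \<open>g\<close>; its value at $z = 0$ is $0$ by the convention for
division by zero.\<close>
definition slope :: "(real \<Rightarrow> real) \<Rightarrow> real \<Rightarrow> real \<Rightarrow> real \<Rightarrow> real" where
  "slope g \<alpha> \<beta> z = (osc g \<alpha> \<beta> z / z) * indicator {0..\<beta>-\<alpha>} z"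

text \<open>Minus a primitive of the density \<^const>\<open>specW\<close> of the interval, see \<open>specW_integral_box\<close>. As the cosine
transform of a nonnegative function it is even and attains its maximal absolute value at $0$.\<close>
definition specV :: "(real \<Rightarrow> real) \<Rightarrow> real \<Rightarrow> real \<Rightarrow> real \<Rightarrow> real" where
  "specV g \<alpha> \<beta> \<xi> = (1 / pi) * (\<integral>z. slope g \<alpha> \<beta> z * cos (\<xi> * z) \<partial>lborel)"

lemma slope_bounds:
  assumes g: "bdd_borel g" "mono g" and ab: "\<alpha> < \<beta>"
  shows "0 \<le> slope g \<alpha> \<beta> z" "slope g \<alpha> \<beta> z \<le> (g \<beta> - g \<alpha>) * indicator {0..\<beta>-\<alpha>} z"
proof -
  have "0 \<le> slope g \<alpha> \<beta> z \<and> slope g \<alpha> \<beta> z \<le> (g \<beta> - g \<alpha>) * indicator {0..\<beta>-\<alpha>} z"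
  proof (cases "z \<in> {0<..\<beta>-\<alpha>}")
    case True
    then have z: "0 \<le> z" "z \<le> \<beta> - \<alpha>" "0 < z" by auto
    have "osc g \<alpha> \<beta> z / z \<le> g \<beta> - g \<alpha>" "0 \<le> osc g \<alpha> \<beta> z / z"
      using osc_bounds(1,2)[OF g z(1,2)] z(3) by (auto simp: divide_le_eq mult.commute)
    then show ?thesis using z by (simp add: slope_def)
  next
    case False
    have "0 \<le> g \<beta> - g \<alpha>" using monoD[OF g(2), of \<alpha> \<beta>] ab by simp
    moreover have "slope g \<alpha> \<beta> z = 0" using False by (cases "z = 0") (auto simp: slope_def indicator_def)
    ultimately show ?thesis by simp
  qed
  then show "0 \<le> slope g \<alpha> \<beta> z" "slope g \<alpha> \<beta> z \<le> (g \<beta> - g \<alpha>) * indicator {0..\<beta>-\<alpha>} z" by auto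
qed

lemma slope_measurable [measurable]:
  assumes "bdd_borel g" shows "slope g \<alpha> \<beta> \<in> borel_measurable borel"
proof -
  note [measurable] = bdd_borel_measurable[OF assms]
  show ?thesis unfolding slope_def[abs_def] by measurable
qed

lemma slope_integrable:
  assumes g: "bdd_borel g" "mono g" and ab: "\<alpha> < \<beta>"
  shows "integrable lborel (slope g \<alpha> \<beta>)"
proof (rule Bochner_Integration.integrable_bound)
  show "integrable lborel (\<lambda>z. (g \<beta> - g \<alpha>) * indicat_real {0..\<beta>-\<alpha>} z)" by (simp add: emeasure_lborel_Icc_eq)
  show "AE z in lborel. norm (slope g \<alpha> \<beta> z) \<le> norm ((g \<beta> - g \<alpha>) * indicat_real {0..\<beta>-\<alpha>} z)"
    using slope_bounds[OF g ab] by (intro AE_I2) (simp add: order_trans[OF _ abs_ge_self])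
qed (use slope_measurable[OF g(1)] in simp)

lemma cos_bdd: "bdd_borel (\<lambda>z. cos (\<xi> * z))"
  by (rule bdd_borelI[where C=1]) auto

lemma slope_cos_integrable:
  assumes "bdd_borel g" "mono g" "\<alpha> < \<beta>"
  shows "integrable lborel (\<lambda>z. slope g \<alpha> \<beta> z * cos (\<xi> * z))"
  unfolding mult.commute[of "slope g \<alpha> \<beta> _"] by (rule bdd_borel_integrable[OF cos_bdd slope_integrable[OF assms]])

lemma specV_even: "specV g \<alpha> \<beta> (- \<xi>) = specV g \<alpha> \<beta> \<xi>"
  by (simp add: specV_def)

lemma specV_le:
  assumes g: "bdd_borel g" "mono g" and ab: "\<alpha> < \<beta>"
  shows "\<bar>specV g \<alpha> \<beta> \<xi>\<bar> \<le> specV g \<alpha> \<beta> 0"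
proof -
  have "norm (\<integral>z. slope g \<alpha> \<beta> z * cos (\<xi> * z) \<partial>lborel) \<le> (\<integral>z. slope g \<alpha> \<beta> z \<partial>lborel)"
  proof (rule Bochner_Integration.integral_norm_bound_integral[OF slope_cos_integrable[OF g ab] slope_integrable[OF g ab]])
    show "norm (slope g \<alpha> \<beta> z * cos (\<xi> * z)) \<le> slope g \<alpha> \<beta> z" for z
      using mult_left_mono[of "\<bar>cos (\<xi> * z)\<bar>" 1 "slope g \<alpha> \<beta> z"] slope_bounds(1)[OF g ab, of z] by (simp add: abs_mult)
  qed
  then show ?thesis by (simp add: specV_def divide_right_mono)
qed

lemma cos_ge_half: assumes "\<bar>x\<bar> \<le> 1" shows "1 / 2 \<le> cos (x::real)"
proof -
  have "cos (pi / 3) \<le> cos \<bar>x\<bar>" using assms pi_gt3 by (intro cos_monotone_0_pi_le) auto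
  then show ?thesis by (simp add: cos_60)
qed

text \<open>The argument of the cosine is at most $1 < \pi/3$, so the cosine is at least $1/2$.\<close>
lemma specV_ge:
  assumes g: "bdd_borel g" "mono g" and ab: "\<alpha> < \<beta>" and \<xi>: "\<bar>\<xi>\<bar> * (\<beta> - \<alpha>) \<le> 1"
  shows "specV g \<alpha> \<beta> 0 / 2 \<le> specV g \<alpha> \<beta> \<xi>"
proof -
  have "(\<integral>z. slope g \<alpha> \<beta> z * (1 / 2) \<partial>lborel) \<le> (\<integral>z. slope g \<alpha> \<beta> z * cos (\<xi> * z) \<partial>lborel)"
  proof (rule integral_mono)
    show "integrable lborel (\<lambda>z. slope g \<alpha> \<beta> z * (1 / 2))" using slope_integrable[OF g ab] by simp
    show "integrable lborel (\<lambda>z. slope g \<alpha> \<beta> z * cos (\<xi> * z))" by (rule slope_cos_integrable[OF g ab])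
    show "slope g \<alpha> \<beta> z * (1 / 2) \<le> slope g \<alpha> \<beta> z * cos (\<xi> * z)" for z
    proof (cases "z \<in> {0..\<beta>-\<alpha>}")
      case True
      then have "\<bar>\<xi> * z\<bar> \<le> \<bar>\<xi>\<bar> * (\<beta> - \<alpha>)" by (simp add: abs_mult mult_left_mono)
      then have "1 / 2 \<le> cos (\<xi> * z)" using \<xi> by (intro cos_ge_half) linarith
      then show ?thesis by (intro mult_left_mono slope_bounds(1)[OF g ab])
    qed (simp add: slope_def)
  qed
  then have "(1 / pi) * ((\<integral>z. slope g \<alpha> \<beta> z \<partial>lborel) * (1 / 2)) \<le> (1 / pi) * (\<integral>z. slope g \<alpha> \<beta> z * cos (\<xi> * z) \<partial>lborel)"
    by (intro mult_left_mono) simp_all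
  then show ?thesis by (simp add: specV_def)
qed

lemma specV_0_upper:
  assumes g: "bdd_borel g" "mono g" and ab: "\<alpha> < \<beta>"
  shows "specV g \<alpha> \<beta> 0 \<le> (1 / pi) * ((\<beta> - \<alpha>) * (g \<beta> - g \<alpha>))"
proof -
  have "(\<integral>z. slope g \<alpha> \<beta> z \<partial>lborel) \<le> (\<integral>z. (g \<beta> - g \<alpha>) * indicator {0..\<beta>-\<alpha>} z \<partial>lborel)"
    by (intro integral_mono slope_integrable[OF g ab] slope_bounds(2)[OF g ab]) (simp add: emeasure_lborel_Icc_eq)
  also have "\<dots> = (\<beta> - \<alpha>) * (g \<beta> - g \<alpha>)" using ab by simp
  finally show ?thesis by (simp add: specV_def divide_right_mono)
qed

text \<open>Only the quarter $z \le (\beta - \alpha)/4$ is kept, on which \<^const>\<open>osc\<close> is at least \<open>z\<close> times the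
increment of \<open>g\<close> over the middle half of the interval.\<close>
lemma specV_0_lower:
  assumes g: "bdd_borel g" "mono g" and ab: "\<alpha> < \<beta>"
  shows "(1 / pi) * ((\<beta> - \<alpha>) / 4 * (g (\<beta> - (\<beta> - \<alpha>) / 4) - g (\<alpha> + (\<beta> - \<alpha>) / 4))) \<le> specV g \<alpha> \<beta> 0"
proof -
  let ?q = "(\<beta> - \<alpha>) / 4"
  let ?D = "g (\<beta> - ?q) - g (\<alpha> + ?q)"
  have q: "0 < ?q" "?q \<le> \<beta> - \<alpha>" using ab by auto
  have D: "0 \<le> ?D" using monoD[OF g(2), of "\<alpha> + ?q" "\<beta> - ?q"] ab by (simp add: field_simps)
  have "?q * ?D = (\<integral>z. ?D * indicator {0..?q} z \<partial>lborel)" using q by simp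
  also have "\<dots> \<le> (\<integral>z. slope g \<alpha> \<beta> z \<partial>lborel)"
  proof (rule integral_mono_AE)
    show "integrable lborel (\<lambda>z. ?D * indicat_real {0..?q} z)" by (simp add: emeasure_lborel_Icc_eq)
    show "integrable lborel (slope g \<alpha> \<beta>)" by (rule slope_integrable[OF g ab])
    have "AE z in lborel. z \<noteq> (0::real)" by (rule AE_lborel_singleton)
    then show "AE z in lborel. ?D * indicat_real {0..?q} z \<le> slope g \<alpha> \<beta> z"
    proof eventually_elim
      case (elim z)
      show ?case
      proof (cases "z \<in> {0..?q}")
        case True
        then have z: "0 \<le> z" "z \<le> \<beta> - \<alpha>" "0 < z" "z \<le> ?q" using elim q by auto
        have "?D \<le> g (\<beta> - z) - g (\<alpha> + z)"
          using monoD[OF g(2), of "\<beta> - ?q" "\<beta> - z"] monoD[OF g(2), of "\<alpha> + z" "\<alpha> + ?q"] z(4) by linarith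
        then have "z * ?D \<le> osc g \<alpha> \<beta> z"
          using osc_bounds(3)[OF g z(1,2)] mult_left_mono[OF _ z(1)] order_trans by blast
        then have "?D \<le> osc g \<alpha> \<beta> z / z" using z(3) by (simp add: le_divide_eq mult.commute)
        then show ?thesis using True z by (simp add: slope_def)
      qed (simp add: slope_bounds(1)[OF g ab])
    qed
  qed
  finally have le: "?q * ?D \<le> (\<integral>z. slope g \<alpha> \<beta> z \<partial>lborel)" .
  show ?thesis using mult_left_mono[OF le, of "1 / pi"] by (simp add: specV_def)
qed

lemma specW_integral_box:
  assumes g: "bdd_borel g" "mono g" and ab: "\<alpha> < \<beta>" and t: "t1 \<le> t2"
  shows "(\<integral>\<xi>. specW g (indicator {\<alpha>..\<beta>}) \<xi> * indicator {t1..t2} \<xi> \<partial>lborel) = specV g \<alpha> \<beta> t1 - specV g \<alpha> \<beta> t2"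
proof -
  let ?v = "\<lambda>z. osc g \<alpha> \<beta> z * indicat_real {0..\<beta>-\<alpha>} z"
  note [measurable] = bdd_borel_measurable[OF g(1)]
  have vi: "integrable lborel ?v"
  proof (rule Bochner_Integration.integrable_bound)
    show "integrable lborel (\<lambda>z. ((\<beta> - \<alpha>) * (g \<beta> - g \<alpha>)) * indicat_real {0..\<beta>-\<alpha>} z)" by (simp add: emeasure_lborel_Icc_eq)
    have "\<bar>?v z\<bar> \<le> \<bar>((\<beta> - \<alpha>) * (g \<beta> - g \<alpha>)) * indicat_real {0..\<beta>-\<alpha>} z\<bar>" for z
    proof (cases "z \<in> {0..\<beta>-\<alpha>}")
      case True
      then have z: "0 \<le> z" "z \<le> \<beta> - \<alpha>" by auto
      have "0 \<le> g \<beta> - g \<alpha>" using monoD[OF g(2), of \<alpha> \<beta>] ab by simp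
      then have "z * (g \<beta> - g \<alpha>) \<le> (\<beta> - \<alpha>) * (g \<beta> - g \<alpha>)" using z by (intro mult_right_mono) auto
      then have "osc g \<alpha> \<beta> z \<le> (\<beta> - \<alpha>) * (g \<beta> - g \<alpha>)" using osc_bounds(2)[OF g z] by linarith
      then show ?thesis using osc_bounds(1)[OF g z] True by simp
    qed simp
    then show "AE z in lborel. norm (?v z) \<le> norm (((\<beta> - \<alpha>) * (g \<beta> - g \<alpha>)) * indicat_real {0..\<beta>-\<alpha>} z)" by simp
  qed measurable
  have ui: "integrable lborel (indicat_real {t1..t2})" by (simp add: emeasure_lborel_Icc_eq)
  have inner: "(\<integral>\<xi>. indicat_real {t1..t2} \<xi> * sin (\<xi> * z) \<partial>lborel) = (cos (t1 * z) - cos (t2 * z)) / z" if "z \<noteq> 0" for z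
    using sin_box_integral[OF that t] by (simp add: mult.commute)
  have "(\<integral>\<xi>. specW g (indicator {\<alpha>..\<beta>}) \<xi> * indicator {t1..t2} \<xi> \<partial>lborel)
     = (\<integral>\<xi>. (1 / pi) * (indicat_real {t1..t2} \<xi> * (\<integral>z. ?v z * sin (\<xi> * z) \<partial>lborel)) \<partial>lborel)"
    unfolding specW_box[OF g(1) ab] by (simp add: ac_simps)
  also have "\<dots> = (1 / pi) * (\<integral>\<xi>. indicat_real {t1..t2} \<xi> * (\<integral>z. ?v z * sin (\<xi> * z) \<partial>lborel) \<partial>lborel)"
    by (rule Bochner_Integration.integral_mult_right_zero)
  also have "(\<integral>\<xi>. indicat_real {t1..t2} \<xi> * (\<integral>z. ?v z * sin (\<xi> * z) \<partial>lborel) \<partial>lborel)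
     = (\<integral>z. ?v z * (\<integral>\<xi>. indicat_real {t1..t2} \<xi> * sin (\<xi> * z) \<partial>lborel) \<partial>lborel)"
    by (rule box_Fubini[OF ui vi]) auto
  also have "\<dots> = (\<integral>z. slope g \<alpha> \<beta> z * cos (t1 * z) - slope g \<alpha> \<beta> z * cos (t2 * z) \<partial>lborel)"
  proof (rule integral_cong_AE)
    have "AE z in lborel. z \<noteq> (0::real)" by (rule AE_lborel_singleton)
    then show "AE z in lborel. ?v z * (\<integral>\<xi>. indicat_real {t1..t2} \<xi> * sin (\<xi> * z) \<partial>lborel) = slope g \<alpha> \<beta> z * cos (t1 * z) - slope g \<alpha> \<beta> z * cos (t2 * z)"
    proof eventually_elim
      case (elim z)
      show ?case unfolding inner[OF elim] by (simp add: slope_def right_diff_distrib diff_divide_distrib)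
    qed
    have "(\<lambda>(z::real, \<xi>::real). indicat_real {t1..t2} \<xi> * sin (\<xi> * z)) \<in> borel_measurable (borel \<Otimes>\<^sub>M lborel)" by measurable
    from lborel.borel_measurable_lebesgue_integral[OF this]
    show "(\<lambda>z. ?v z * (\<integral>\<xi>. indicat_real {t1..t2} \<xi> * sin (\<xi> * z) \<partial>lborel)) \<in> borel_measurable lborel" by simp
    show "(\<lambda>z. slope g \<alpha> \<beta> z * cos (t1 * z) - slope g \<alpha> \<beta> z * cos (t2 * z)) \<in> borel_measurable lborel"
      using slope_measurable[OF g(1)] by measurable
  qed
  also have "\<dots> = (\<integral>z. slope g \<alpha> \<beta> z * cos (t1 * z) \<partial>lborel) - (\<integral>z. slope g \<alpha> \<beta> z * cos (t2 * z) \<partial>lborel)"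
    by (intro Bochner_Integration.integral_diff slope_cos_integrable[OF g ab])
  finally show ?thesis by (simp add: specV_def right_diff_distrib diff_divide_distrib)
qed

text \<open>Up to a factor this is the real part of the Fourier transform of a square integrable function, hence it is
itself square integrable and cannot stay away from $0$.\<close>
lemma specV_small:
  assumes g: "bdd_borel g" "mono g" and ab: "\<alpha> < \<beta>" and \<eta>: "0 < \<eta>"
  obtains T where "T\<^sub>0 \<le> T" "\<bar>specV g \<alpha> \<beta> T\<bar> < \<eta>"
proof (rule ccontr)
  assume "\<not> thesis"
  then have big: "\<eta> \<le> \<bar>specV g \<alpha> \<beta> T\<bar>" if "T\<^sub>0 \<le> T" for T using that \<open>\<And>T. \<lbrakk>T\<^sub>0 \<le> T; \<bar>specV g \<alpha> \<beta> T\<bar> < \<eta>\<rbrakk> \<Longrightarrow> thesis\<close> by (meson not_le)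
  let ?s = "\<lambda>z. complex_of_real (slope g \<alpha> \<beta> z)"
  have sm: "?s \<in> borel_measurable borel" using slope_measurable[OF g(1)] by measurable
  have sb: "cmod (?s z) \<le> (g \<beta> - g \<alpha>) * indicator {0..\<beta>-\<alpha>} z" for z
    using slope_bounds[OF g ab, of z] by simp
  note s = bounded_support_sq_int[OF sm sb]
  have R: "Re (ft ?s \<xi>) = (1 / sqrt (2 * pi)) * (pi * specV g \<alpha> \<beta> \<xi>)" for \<xi>
  proof -
    have "Re (\<integral>z. exp (- (\<i> * complex_of_real \<xi> * complex_of_real z)) * ?s z \<partial>lborel)
       = (\<integral>z. Re (exp (- (\<i> * complex_of_real \<xi> * complex_of_real z)) * ?s z) \<partial>lborel)"
      by (rule integral_Re[OF integrable_ft_integrand[OF s(2)], symmetric])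
    also have "\<dots> = (\<integral>z. slope g \<alpha> \<beta> z * cos (\<xi> * z) \<partial>lborel)"
      by (intro Bochner_Integration.integral_cong) (auto simp: Re_exp)
    finally have "Re (\<integral>z. exp (- (\<i> * complex_of_real \<xi> * complex_of_real z)) * ?s z \<partial>lborel) = pi * specV g \<alpha> \<beta> \<xi>"
      by (simp add: specV_def)
    moreover have "Re (complex_of_real a * w) = a * Re w" for a w by simp
    ultimately show ?thesis unfolding ft_def by (simp only:)
  qed
  define K where "K = (1 / sqrt (2 * pi)) * (pi * \<eta>)"
  have K: "0 < K" using \<eta> by (simp add: K_def)
  have le: "K\<^sup>2 * indicat_real {T\<^sub>0..} \<xi> \<le> (cmod (ft ?s \<xi>))\<^sup>2" for \<xi>
  proof (cases "T\<^sub>0 \<le> \<xi>")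
    case True
    have "K \<le> (1 / sqrt (2 * pi)) * (pi * \<bar>specV g \<alpha> \<beta> \<xi>\<bar>)"
      unfolding K_def using big[OF True] by (intro mult_left_mono) simp_all
    also have "\<dots> = \<bar>Re (ft ?s \<xi>)\<bar>" unfolding R by (simp add: abs_mult)
    also have "\<dots> \<le> cmod (ft ?s \<xi>)" by (rule abs_Re_le_cmod)
    finally show ?thesis using True K by (simp add: power_mono)
  qed simp
  have "integrable lborel (\<lambda>\<xi>. K\<^sup>2 * indicat_real {T\<^sub>0..} \<xi>)"
    by (rule Bochner_Integration.integrable_bound[OF sq_intD(2)[OF ft_contraction(1)[OF s(2,1)]]]) (use le in auto)
  then have "integrable lborel (\<lambda>\<xi>. indicat_real {T\<^sub>0..} \<xi>)" using K by simp
  then have fin: "emeasure lborel {T\<^sub>0..} < \<infinity>" by (simp add: integrable_indicator_iff)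
  have "ennreal n \<le> emeasure lborel {T\<^sub>0..}" if "0 \<le> n" for n
  proof -
    have "emeasure lborel {T\<^sub>0..T\<^sub>0 + n} \<le> emeasure lborel {T\<^sub>0..}" by (rule emeasure_mono) auto
    then show ?thesis using that by simp
  qed
  then have "emeasure lborel {T\<^sub>0..} = \<infinity>"
    using fin by (metis ennreal_cases ennreal_less_iff gt_ex infinity_ennreal_def less_le_trans linorder_not_less order_less_imp_le)
  then show False using fin by simp
qed

text \<open>The second mean value theorem for increasing \<open>f\<close>, with the integrals of the density expressed by \<^const>\<open>specV\<close>.\<close>
lemma second_mean_value_piece:
  assumes f: "bdd_borel f" "mono f" and g: "bdd_borel g" "mono g" and ab: "\<alpha> < \<beta>" and t: "a \<le> b"
  obtains c where "c \<in> {a..b}"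
    "(\<integral>\<xi>. f \<xi> * specW g (indicator {\<alpha>..\<beta>}) \<xi> * indicator {a..b} \<xi> \<partial>lborel)
      = (f b - f a) * specV g \<alpha> \<beta> c + f a * specV g \<alpha> \<beta> a - f b * specV g \<alpha> \<beta> b"
proof -
  let ?W = "specW g (indicator {\<alpha>..\<beta>})"
  have W: "integrable lborel ?W" by (rule specW_integrable[OF g(1) box_sq_int box_integrable])
  have HK: "u integrable_on {p..q}" "integral {p..q} u = (\<integral>x. u x * indicator {p..q} x \<partial>lborel)"
    if u: "integrable lborel u" for u :: "real \<Rightarrow> real" and p q
  proof -
    have "set_integrable lborel {p..q} u"
      using integrable_real_mult_indicator[OF _ u, of "{p..q}"] unfolding set_integrable_def by (simp add: mult.commute)
    from set_borel_integral_eq_integral[OF this] show "u integrable_on {p..q}" "integral {p..q} u = (\<integral>x. u x * indicator {p..q} x \<partial>lborel)"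
      unfolding set_lebesgue_integral_def by (simp_all add: mult.commute)
  qed
  obtain c where c: "c \<in> {a..b}" and I: "((\<lambda>x. f x * ?W x) has_integral (f a * integral {a..c} ?W + f b * integral {c..b} ?W)) {a..b}"
    using second_mean_value_theorem_full[OF HK(1)[OF W] t, of f] monoD[OF f(2)] by blast
  have "(\<integral>\<xi>. f \<xi> * ?W \<xi> * indicator {a..b} \<xi> \<partial>lborel) = f a * integral {a..c} ?W + f b * integral {c..b} ?W"
    using HK(2)[OF bdd_borel_integrable[OF f(1) W], of a b] integral_unique[OF I] by simp
  also have "integral {a..c} ?W = specV g \<alpha> \<beta> a - specV g \<alpha> \<beta> c"
    unfolding HK(2)[OF W] by (rule specW_integral_box[OF g ab]) (use c in auto)
  also have "integral {c..b} ?W = specV g \<alpha> \<beta> c - specV g \<alpha> \<beta> b"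
    unfolding HK(2)[OF W] by (rule specW_integral_box[OF g ab]) (use c in auto)
  finally have "(\<integral>\<xi>. f \<xi> * ?W \<xi> * indicator {a..b} \<xi> \<partial>lborel) = (f b - f a) * specV g \<alpha> \<beta> c + f a * specV g \<alpha> \<beta> a - f b * specV g \<alpha> \<beta> b"
    by (simp add: algebra_simps)
  with c show thesis by (rule that)
qed

text \<open>The cut-offs $T_k$ are taken where \<^const>\<open>specV\<close> is small, so that the boundary terms of the second
mean value theorem disappear in the limit.\<close>
lemma qf_box_eq_limit:
  assumes f: "bdd_borel f" and g: "bdd_borel g" "mono g" and ab: "\<alpha> < \<beta>"
  obtains T where "\<And>k. T\<^sub>0 \<le> T k" "(\<lambda>k. specV g \<alpha> \<beta> (T k)) \<longlonglongrightarrow> 0"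
    "(\<lambda>k. \<integral>\<xi>. f \<xi> * specW g (indicator {\<alpha>..\<beta>}) \<xi> * indicator {- T k..T k} \<xi> \<partial>lborel) \<longlonglongrightarrow> qf f g (indicator {\<alpha>..\<beta>})"
proof -
  let ?W = "specW g (indicator {\<alpha>..\<beta>})"
  have "\<exists>T. max T\<^sub>0 (real k) \<le> T \<and> \<bar>specV g \<alpha> \<beta> T\<bar> < 1 / real (Suc k)" for k
  proof -
    have "0 < 1 / real (Suc k)" by simp
    from specV_small[OF g ab this] show ?thesis by metis
  qed
  then obtain T where T: "\<And>k. max T\<^sub>0 (real k) \<le> T k" "\<And>k. \<bar>specV g \<alpha> \<beta> (T k)\<bar> < 1 / real (Suc k)" by metis
  have W: "integrable lborel ?W" by (rule specW_integrable[OF g(1) box_sq_int box_integrable])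
  have fW: "integrable lborel (\<lambda>\<xi>. f \<xi> * ?W \<xi>)" by (rule bdd_borel_integrable[OF f W])
  note [measurable] = borel_measurable_integrable[OF W] bdd_borel_measurable[OF f]
  show thesis
  proof (rule that)
    show "T\<^sub>0 \<le> T k" for k using T(1)[of k] by simp
    show "(\<lambda>k. specV g \<alpha> \<beta> (T k)) \<longlonglongrightarrow> 0"
      by (rule Lim_null_comparison[OF always_eventually LIMSEQ_Suc[OF lim_1_over_n]])
         (use T(2) less_imp_le in \<open>auto simp del: of_nat_Suc\<close>)
    have "(\<lambda>k. \<integral>\<xi>. f \<xi> * ?W \<xi> * indicator {- T k..T k} \<xi> \<partial>lborel) \<longlonglongrightarrow> (\<integral>\<xi>. f \<xi> * ?W \<xi> \<partial>lborel)"
    proof (rule integral_dominated_convergence[where w="\<lambda>\<xi>. \<bar>f \<xi> * ?W \<xi>\<bar>"])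
      show "integrable lborel (\<lambda>\<xi>. \<bar>f \<xi> * ?W \<xi>\<bar>)" by (rule integrable_abs[OF fW])
      show "AE \<xi> in lborel. (\<lambda>k. f \<xi> * ?W \<xi> * indicator {- T k..T k} \<xi>) \<longlonglongrightarrow> f \<xi> * ?W \<xi>"
      proof (rule AE_I2)
        fix \<xi> :: real
        obtain n where n: "\<bar>\<xi>\<bar> \<le> real n" using real_arch_simple by blast
        have "\<forall>\<^sub>F k in sequentially. f \<xi> * ?W \<xi> * indicator {- T k..T k} \<xi> = f \<xi> * ?W \<xi>"
          using eventually_ge_at_top[of n]
        proof eventually_elim
          case (elim k)
          have "real n \<le> real k" using elim by simp
          then have "\<bar>\<xi>\<bar> \<le> T k" using n T(1)[of k] by simp
          then have "\<xi> \<in> {- T k..T k}" by auto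
          then show ?case by simp
        qed
        then show "(\<lambda>k. f \<xi> * ?W \<xi> * indicator {- T k..T k} \<xi>) \<longlonglongrightarrow> f \<xi> * ?W \<xi>" by (rule tendsto_eventually)
      qed
      show "AE \<xi> in lborel. norm (f \<xi> * ?W \<xi> * indicator {- T k..T k} \<xi>) \<le> \<bar>f \<xi> * ?W \<xi>\<bar>" for k
        by (intro AE_I2) (auto simp: indicator_def)
    qed measurable
    then show "(\<lambda>k. \<integral>\<xi>. f \<xi> * ?W \<xi> * indicator {- T k..T k} \<xi> \<partial>lborel) \<longlonglongrightarrow> qf f g (indicator {\<alpha>..\<beta>})"
      unfolding qf_def cform_explicit[OF f g(1) box_sq_int box_integrable] by simp
  qed
qed

text \<open>In the limit the second mean value theorem gives a value of \<^const>\<open>specV\<close> times an increment of \<open>f\<close>.\<close>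
lemma qf_box_upper:
  assumes f: "bdd_borel f" "mono f" and M: "\<And>x y. f x - f y \<le> M" and g: "bdd_borel g" "mono g" and ab: "\<alpha> < \<beta>"
  shows "\<bar>qf f g (indicator {\<alpha>..\<beta>})\<bar> \<le> M * specV g \<alpha> \<beta> 0"
proof -
  let ?V = "specV g \<alpha> \<beta>"
  obtain T where T: "\<And>k. 0 \<le> T k" "(\<lambda>k. ?V (T k)) \<longlonglongrightarrow> 0"
    "(\<lambda>k. \<integral>\<xi>. f \<xi> * specW g (indicator {\<alpha>..\<beta>}) \<xi> * indicator {- T k..T k} \<xi> \<partial>lborel) \<longlonglongrightarrow> qf f g (indicator {\<alpha>..\<beta>})"
    using qf_box_eq_limit[OF f(1) g ab, of 0] by blast
  have "\<bar>\<integral>\<xi>. f \<xi> * specW g (indicator {\<alpha>..\<beta>}) \<xi> * indicator {- T k..T k} \<xi> \<partial>lborel\<bar> \<le> M * ?V 0 + M * \<bar>?V (T k)\<bar>" for k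
  proof -
    obtain c where c: "(\<integral>\<xi>. f \<xi> * specW g (indicator {\<alpha>..\<beta>}) \<xi> * indicator {- T k..T k} \<xi> \<partial>lborel)
      = (f (T k) - f (- T k)) * ?V c + f (- T k) * ?V (- T k) - f (T k) * ?V (T k)"
      using second_mean_value_piece[OF f g ab, of "- T k" "T k"] T(1)[of k] by auto
    let ?d = "f (T k) - f (- T k)"
    have d: "0 \<le> ?d" "?d \<le> M" using monoD[OF f(2), of "- T k" "T k"] T(1)[of k] M by auto
    have e: "(\<integral>\<xi>. f \<xi> * specW g (indicator {\<alpha>..\<beta>}) \<xi> * indicator {- T k..T k} \<xi> \<partial>lborel) = ?d * ?V c - ?d * ?V (T k)"
      unfolding c specV_even by (simp add: algebra_simps)
    have "\<bar>?d * ?V c\<bar> \<le> M * ?V 0" unfolding abs_mult using d specV_le[OF g ab, of c] by (intro mult_mono) auto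
    moreover have "\<bar>?d * ?V (T k)\<bar> \<le> M * \<bar>?V (T k)\<bar>" unfolding abs_mult using d by (intro mult_right_mono) auto
    ultimately show ?thesis unfolding e by linarith
  qed
  moreover have "(\<lambda>k. M * ?V 0 + M * \<bar>?V (T k)\<bar>) \<longlonglongrightarrow> M * ?V 0 + M * \<bar>0\<bar>"
    by (intro tendsto_add tendsto_mult[OF tendsto_const] tendsto_rabs T(2) tendsto_const)
  ultimately show ?thesis
    using LIMSEQ_le[OF tendsto_rabs[OF T(3)], of "\<lambda>k. M * ?V 0 + M * \<bar>?V (T k)\<bar>" "M * ?V 0"] by simp
qed

text \<open>The increment of \<open>f\<close> over $[-t, t]$ is at least $3M/4$, and there \<^const>\<open>specV\<close> is at least half of its
value at $0$; the remaining increments sum up to at most $M/4$, with factors not below minus that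
value. This leaves $3/8 - 1/4 = 1/8$.\<close>
lemma qf_box_lower:
  assumes f: "bdd_borel f" "mono f" and M: "\<And>x y. f x - f y \<le> M" and g: "bdd_borel g" "mono g" and ab: "\<alpha> < \<beta>"
    and t: "0 \<le> t" "t * (\<beta> - \<alpha>) \<le> 1" "3 / 4 * M \<le> f t - f (- t)"
  shows "M / 8 * specV g \<alpha> \<beta> 0 \<le> qf f g (indicator {\<alpha>..\<beta>})"
proof -
  let ?V = "specV g \<alpha> \<beta>" and ?J = "\<lambda>a b. \<integral>\<xi>. f \<xi> * specW g (indicator {\<alpha>..\<beta>}) \<xi> * indicator {a..b} \<xi> \<partial>lborel"
  obtain T where T: "\<And>k. t \<le> T k" "(\<lambda>k. ?V (T k)) \<longlonglongrightarrow> 0" "(\<lambda>k. ?J (- T k) (T k)) \<longlonglongrightarrow> qf f g (indicator {\<alpha>..\<beta>})"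
    using qf_box_eq_limit[OF f(1) g ab, of t] by blast
  have V0: "0 \<le> ?V 0" using specV_le[OF g ab, of 0] by linarith
  have W: "integrable lborel (specW g (indicator {\<alpha>..\<beta>}))" by (rule specW_integrable[OF g(1) box_sq_int box_integrable])
  have fW: "integrable lborel (\<lambda>\<xi>. f \<xi> * specW g (indicator {\<alpha>..\<beta>}) \<xi>)" by (rule bdd_borel_integrable[OF f(1) W])
  have comb: "?J a c = ?J a b + ?J b c" if "a \<le> b" "b \<le> c" for a b c
  proof -
    note [measurable] = borel_measurable_integrable[OF fW]
    have i: "integrable lborel (\<lambda>\<xi>. f \<xi> * specW g (indicator {\<alpha>..\<beta>}) \<xi> * indicator {p..q} \<xi>)" for p q :: real
      using integrable_real_mult_indicator[OF _ fW, of "{p..q}"] by simp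
    have "?J a c = (\<integral>\<xi>. f \<xi> * specW g (indicator {\<alpha>..\<beta>}) \<xi> * indicator {a..b} \<xi> + f \<xi> * specW g (indicator {\<alpha>..\<beta>}) \<xi> * indicator {b..c} \<xi> \<partial>lborel)"
    proof (rule integral_cong_AE)
      have "AE x in lborel. x \<noteq> b" by (rule AE_lborel_singleton)
      then show "AE \<xi> in lborel. f \<xi> * specW g (indicator {\<alpha>..\<beta>}) \<xi> * indicat_real {a..c} \<xi> = f \<xi> * specW g (indicator {\<alpha>..\<beta>}) \<xi> * indicator {a..b} \<xi> + f \<xi> * specW g (indicator {\<alpha>..\<beta>}) \<xi> * indicator {b..c} \<xi>"
        by eventually_elim (use that in \<open>auto simp: indicator_def\<close>)
    qed measurable
    also have "\<dots> = ?J a b + ?J b c" by (rule Bochner_Integration.integral_add[OF i i])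
    finally show ?thesis .
  qed
  have lin: "M / 8 \<le> (a - b) / 2 - (b - d) - (c - a)" if "3 / 4 * M \<le> a - b" "c - d \<le> M" for a b c d :: real
    using that by (simp add: field_simps)
  have "M / 8 * ?V 0 - M * \<bar>?V (T k)\<bar> \<le> ?J (- T k) (T k)" for k
  proof -
    let ?T = "T k"
    have ord: "- ?T \<le> - t" "- t \<le> t" "t \<le> ?T" using T(1)[of k] t(1) by auto
    have V': "\<And>x. ?V (- x) = ?V x" by (rule specV_even)
    obtain c1 where c1: "?J (- ?T) (- t) = (f (- t) - f (- ?T)) * ?V c1 + f (- ?T) * ?V ?T - f (- t) * ?V t"
      using second_mean_value_piece[OF f g ab ord(1)] unfolding V' by metis
    obtain c2 where c2: "c2 \<in> {- t..t}" "?J (- t) t = (f t - f (- t)) * ?V c2 + f (- t) * ?V t - f t * ?V t"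
      using second_mean_value_piece[OF f g ab ord(2)] unfolding V' by metis
    obtain c3 where c3: "?J t ?T = (f ?T - f t) * ?V c3 + f t * ?V t - f ?T * ?V ?T"
      using second_mean_value_piece[OF f g ab ord(3)] unfolding V' by metis
    have J: "?J (- ?T) ?T = (f (- t) - f (- ?T)) * ?V c1 + (f t - f (- t)) * ?V c2 + (f ?T - f t) * ?V c3 - (f ?T - f (- ?T)) * ?V ?T"
      using comb[of "- ?T" "- t" ?T] comb[of "- t" t ?T] ord unfolding c1 c2(2) c3 by (simp add: algebra_simps)
    have "\<bar>c2\<bar> \<le> t" using c2(1) by auto
    then have "\<bar>c2\<bar> * (\<beta> - \<alpha>) \<le> 1" using t(2) ab mult_right_mono[of "\<bar>c2\<bar>" t "\<beta> - \<alpha>"] by linarith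
    then have Vc2: "?V 0 / 2 \<le> ?V c2" by (rule specV_ge[OF g ab])
    have d: "0 \<le> f (- t) - f (- ?T)" "0 \<le> f t - f (- t)" "0 \<le> f ?T - f t"
      using monoD[OF f(2) ord(1)] monoD[OF f(2) ord(2)] monoD[OF f(2) ord(3)] by auto
    have b1: "- ((f (- t) - f (- ?T)) * ?V 0) \<le> (f (- t) - f (- ?T)) * ?V c1"
      using mult_left_mono[of "- ?V 0" "?V c1", OF _ d(1)] specV_le[OF g ab, of c1] by simp
    have b2: "(f t - f (- t)) * (?V 0 / 2) \<le> (f t - f (- t)) * ?V c2" by (rule mult_left_mono[OF Vc2 d(2)])
    have b3: "- ((f ?T - f t) * ?V 0) \<le> (f ?T - f t) * ?V c3"
      using mult_left_mono[of "- ?V 0" "?V c3", OF _ d(3)] specV_le[OF g ab, of c3] by simp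
    have b4: "(f ?T - f (- ?T)) * ?V ?T \<le> M * \<bar>?V ?T\<bar>"
    proof -
      have "(f ?T - f (- ?T)) * ?V ?T \<le> (f ?T - f (- ?T)) * \<bar>?V ?T\<bar>" using d by (intro mult_left_mono) auto
      also have "\<dots> \<le> M * \<bar>?V ?T\<bar>" by (intro mult_right_mono M) simp
      finally show ?thesis .
    qed
    have "M / 8 \<le> (f t - f (- t)) / 2 - (f (- t) - f (- ?T)) - (f ?T - f t)" by (rule lin[OF t(3) M])
    from mult_right_mono[OF this V0]
    have b5: "M / 8 * ?V 0 \<le> (f t - f (- t)) * (?V 0 / 2) - (f (- t) - f (- ?T)) * ?V 0 - (f ?T - f t) * ?V 0"
      by (simp add: algebra_simps)
    show ?thesis unfolding J using b1 b2 b3 b4 b5 by linarith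
  qed
  moreover have "(\<lambda>k. M / 8 * ?V 0 - M * \<bar>?V (T k)\<bar>) \<longlonglongrightarrow> M / 8 * ?V 0 - M * \<bar>0\<bar>"
    by (intro tendsto_diff tendsto_mult[OF tendsto_const] tendsto_rabs T(2) tendsto_const)
  ultimately show ?thesis
    using LIMSEQ_le[of "\<lambda>k. M / 8 * ?V 0 - M * \<bar>?V (T k)\<bar>" "M / 8 * ?V 0", OF _ T(3)] by simp
qed

section \<open>Dyadic intervals and uniform integrability\<close>

lemma qf_cong_AE:
  assumes "bdd_borel f" "bdd_borel g" "\<phi> \<in> H" "\<psi> \<in> H" "AE x in lborel. \<phi> x = \<psi> x"
  shows "qf f g \<phi> = qf f g \<psi>"
  unfolding qf_def using cform_cong_AE[OF assms(1,2,1,2,3,3,4,4) _ _ assms(5,5)] by simp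

lemma cform_sum_left:
  assumes fg: "bdd_borel f" "bdd_borel g" and \<psi>: "\<psi> \<in> H" and fin: "finite A" and \<phi>: "\<And>k. k \<in> A \<Longrightarrow> \<phi> k \<in> H"
  shows "cform f g (\<lambda>x. \<Sum>k\<in>A. \<phi> k x) \<psi> = (\<Sum>k\<in>A. cform f g (\<phi> k) \<psi>)"
  using fin \<phi>
proof (induction A rule: finite_induct)
  case empty
  have "cform f g (\<lambda>x. \<psi> x + (-1) * \<psi> x) \<psi> = 0"
    unfolding cform_lincomb_left[OF fg \<psi> \<psi> \<psi>] by simp
  then show ?case by simp
next
  case (insert a A)
  have a: "\<phi> a \<in> H" and s: "(\<lambda>x. \<Sum>k\<in>A. \<phi> k x) \<in> H" using insert.prems by auto
  have "cform f g (\<lambda>x. \<phi> a x + 1 * (\<Sum>k\<in>A. \<phi> k x)) \<psi> = cform f g (\<phi> a) \<psi> + cform f g (\<lambda>x. \<Sum>k\<in>A. \<phi> k x) \<psi>"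
    unfolding cform_lincomb_left[OF fg \<psi> a s] by simp
  then show ?case using insert by simp
qed

text \<open>The sum of the squared deviations from the mean, for vectors instead of numbers.\<close>
lemma qf_variance:
  assumes fg: "bdd_borel f" "bdd_borel g" and fin: "finite A" "A \<noteq> {}" and \<phi>: "\<And>k. k \<in> A \<Longrightarrow> \<phi> k \<in> H"
    and \<psi>: "\<psi> = (\<lambda>x. \<Sum>k\<in>A. \<phi> k x)"
  shows "(\<Sum>k\<in>A. qf f g (\<lambda>x. \<phi> k x + complex_of_real (- 1 / real (card A)) * \<psi> x)) = (\<Sum>k\<in>A. qf f g (\<phi> k)) - qf f g \<psi> / real (card A)"
proof -
  let ?R = "real (card A)"
  have R: "0 < ?R" using fin by (simp add: card_gt_0_iff)
  have \<psi>H: "\<psi> \<in> H" unfolding \<psi> using \<phi> by auto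
  have "cform f g (\<lambda>x. \<Sum>k\<in>A. \<phi> k x) \<psi> = (\<Sum>k\<in>A. cform f g (\<phi> k) \<psi>)"
    by (rule cform_sum_left[OF fg \<psi>H fin(1) \<phi>])
  then have sum_eq: "(\<Sum>k\<in>A. cform f g (\<phi> k) \<psi>) = cform f g \<psi> \<psi>" unfolding \<psi>[symmetric] by (rule sym)
  have "(\<Sum>k\<in>A. qf f g (\<lambda>x. \<phi> k x + complex_of_real (- 1 / ?R) * \<psi> x))
     = (\<Sum>k\<in>A. qf f g (\<phi> k) - 2 / ?R * Re (cform f g (\<phi> k) \<psi>) + (1 / ?R)\<^sup>2 * qf f g \<psi>)"
  proof (rule sum.cong[OF refl])
    fix k assume "k \<in> A"
    have "Re (complex_of_real (- 1 / ?R) * z) = - (1 / ?R * Re z)" for z by simp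
    moreover have "(cmod (complex_of_real (- 1 / ?R)))\<^sup>2 = (1 / ?R)\<^sup>2" unfolding norm_of_real power2_abs by (simp add: power2_eq_square)
    ultimately show "qf f g (\<lambda>x. \<phi> k x + complex_of_real (- 1 / ?R) * \<psi> x) = qf f g (\<phi> k) - 2 / ?R * Re (cform f g (\<phi> k) \<psi>) + (1 / ?R)\<^sup>2 * qf f g \<psi>"
      unfolding qf_lincomb[OF fg \<phi>[OF \<open>k \<in> A\<close>] \<psi>H] by simp
  qed
  also have "\<dots> = (\<Sum>k\<in>A. qf f g (\<phi> k)) - 2 / ?R * Re (\<Sum>k\<in>A. cform f g (\<phi> k) \<psi>) + ?R * ((1 / ?R)\<^sup>2 * qf f g \<psi>)"
    by (simp add: sum.distrib sum_subtractf Re_sum flip: sum_distrib_left sum_divide_distrib)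
  also have "(\<Sum>k\<in>A. cform f g (\<phi> k) \<psi>) = cform f g \<psi> \<psi>"
    using sum_eq by simp
  also have "Re (cform f g \<psi> \<psi>) = qf f g \<psi>" by (simp add: qf_def)
  finally show ?thesis using R by (simp add: power2_eq_square)
qed

lemma int_telescope:
  fixes u :: "int \<Rightarrow> real" assumes "a \<le> b" shows "(\<Sum>k\<in>{a..<b}. u (k + 1) - u k) = u b - u a"
  using assms
proof (induction b rule: int_ge_induct)
  case (step i)
  have "{a..<i + 1} = insert i {a..<i}" using step.hyps by auto
  then show ?case using step.IH by simp
qed simp

lemma int_sum_blocks:
  fixes F :: "int \<Rightarrow> real" assumes "a \<le> b" "0 < R"
  shows "(\<Sum>k\<in>{a * R..<b * R}. F k) = (\<Sum>j\<in>{a..<b}. \<Sum>k\<in>{j * R..<(j + 1) * R}. F k)"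
  using assms(1)
proof (induction b rule: int_ge_induct)
  case (step i)
  have "{a..<i + 1} = insert i {a..<i}" using step.hyps by auto
  moreover have "{a * R..<(i + 1) * R} = {a * R..<i * R} \<union> {i * R..<(i + 1) * R}"
    by (rule ivl_disj_un_two(3)[symmetric]) (use step.hyps assms(2) in \<open>auto simp: mult_right_mono\<close>)
  moreover have "sum F ({a * R..<i * R} \<union> {i * R..<(i + 1) * R}) = sum F {a * R..<i * R} + sum F {i * R..<(i + 1) * R}"
    by (rule sum.union_disjoint) auto
  ultimately show ?case using step.IH by simp
qed simp

text \<open>The functions are increasing, at the price of a sign $\sigma$ in front of the form. The number \<open>M\<close> bounds the total increment of \<open>f\<close>, and most of it takes place on $[-t, t]$.\<close>
locale monotone_pair =
  fixes f g :: "real \<Rightarrow> real" and \<sigma> M t C :: real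
  assumes f: "bdd_borel f" "mono f" and g: "bdd_borel g" "mono g"
    and M: "0 < M" "\<And>x y. f x - f y \<le> M" and t: "0 \<le> t" "3 / 4 * M \<le> f t - f (- t)"
    and C: "\<And>x. \<bar>g x\<bar> \<le> C"
    and \<sigma>: "\<bar>\<sigma>\<bar> = 1" and pos: "\<And>\<phi>. \<phi> \<in> H \<Longrightarrow> 0 \<le> \<sigma> * qf f g \<phi>"
    and rc: "\<And>a. continuous (at_right a) g"
begin

definition q :: "(real \<Rightarrow> complex) \<Rightarrow> real" where "q \<phi> = \<sigma> * qf f g \<phi>"

lemma q_nonneg: "\<phi> \<in> H \<Longrightarrow> 0 \<le> q \<phi>" unfolding q_def by (rule pos)

lemma q_abs: "\<phi> \<in> H \<Longrightarrow> q \<phi> = \<bar>qf f g \<phi>\<bar>"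
  using q_nonneg[of \<phi>] \<sigma> by (simp add: q_def) (metis abs_mult abs_of_nonneg mult_1)

lemma q_add_le:
  assumes "\<phi> \<in> H" "\<psi> \<in> H" shows "q (\<lambda>x. \<phi> x + \<psi> x) \<le> 2 * q \<phi> + 2 * q \<psi>"
proof -
  have "q (\<lambda>x. \<phi> x + 1 * \<psi> x) + q (\<lambda>x. \<phi> x + (-1) * \<psi> x) = 2 * q \<phi> + 2 * q \<psi>"
    unfolding q_def qf_lincomb[OF f(1) g(1) assms] by (simp add: algebra_simps)
  moreover have "0 \<le> q (\<lambda>x. \<phi> x + (-1) * \<psi> x)" by (intro q_nonneg sq_int_add sq_int_cmult assms)
  ultimately show ?thesis by simp
qed

lemma q_scale:
  assumes "\<phi> \<in> H" shows "q (\<lambda>x. complex_of_real r * \<phi> x) = r\<^sup>2 * q \<phi>"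
proof -
  have "cform f g (\<lambda>x. 0 + complex_of_real r * \<phi> x) (\<lambda>x. 0 + complex_of_real r * \<phi> x) = complex_of_real (r\<^sup>2) * cform f g \<phi> \<phi>"
  proof -
    have r: "(\<lambda>x. 0 + complex_of_real r * \<phi> x) \<in> H" using assms by auto
    have z: "cform f g \<theta> (\<lambda>x. 0) = 0" if "\<theta> \<in> H" for \<theta>
    proof -
      have "cform f g \<theta> (\<lambda>x. \<theta> x + (-1) * \<theta> x) = 0" unfolding cform_lincomb_right[OF f(1) g(1) that that that] by simp
      then show ?thesis by simp
    qed
    have "cform f g (\<lambda>x. 0) \<theta> = 0" if "\<theta> \<in> H" for \<theta> using cform_hermitian[of f g "\<lambda>x. 0" \<theta>] z[OF that] by simp
    then show ?thesis
      unfolding cform_lincomb_left[OF f(1) g(1) r sq_int_0 assms] cform_lincomb_right[OF f(1) g(1) assms sq_int_0 assms]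
      using r assms z by (simp add: power2_eq_square)
  qed
  then show ?thesis unfolding q_def qf_def by simp
qed

text \<open>Half-open intervals, which form exact partitions; for the form they are the same as closed ones.\<close>
definition ioc :: "real \<Rightarrow> real \<Rightarrow> real \<Rightarrow> complex" where "ioc a b = indicator {a<..b}"

lemma ioc_H: "ioc a b \<in> H"
  unfolding ioc_def
  by (rule indicator_sq_int[OF _ emeasure_bounded_finite[OF bounded_subset[OF bounded_closed_interval[of a b]]]]) auto

lemma ioc_split: "a < c \<Longrightarrow> c < b \<Longrightarrow> ioc a b = (\<lambda>x. ioc a c x + ioc c b x)"
  by (auto simp: fun_eq_iff ioc_def indicator_def)

lemma q_ioc: "q (ioc a b) = \<bar>qf f g (indicator {a..b})\<bar>"
proof -
  have "AE x in lborel. x \<noteq> a" by (rule AE_lborel_singleton)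
  then have "AE x in lborel. ioc a b x = indicator {a..b} x" by eventually_elim (auto simp: ioc_def indicator_def)
  then have "qf f g (ioc a b) = qf f g (indicator {a..b})" by (intro qf_cong_AE f g ioc_H box_sq_int)
  then show ?thesis using q_abs[OF ioc_H, of a b] by simp
qed

lemma q_ioc_upper: "a < b \<Longrightarrow> q (ioc a b) \<le> M / pi * ((b - a) * (g b - g a))"
proof -
  assume ab: "a < b"
  have "q (ioc a b) \<le> M * specV g a b 0" unfolding q_ioc by (rule qf_box_upper[OF f M(2) g ab])
  also have "\<dots> \<le> M * ((1 / pi) * ((b - a) * (g b - g a)))" using M(1) by (intro mult_left_mono specV_0_upper[OF g ab]) simp
  finally show ?thesis by simp
qed

text \<open>The constant collects the factor $1/8$ of \<open>qf_box_lower\<close> and the factor $1/(4\pi)$ of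
\<open>specV_0_lower\<close>.\<close>
lemma q_ioc_lower:
  assumes ab: "a < b" and small: "t * (b - a) \<le> 1"
  shows "M / (32 * pi) * ((b - a) * (g (b - (b - a) / 4) - g (a + (b - a) / 4))) \<le> q (ioc a b)"
proof -
  have "M / 8 * ((1 / pi) * ((b - a) / 4 * (g (b - (b - a) / 4) - g (a + (b - a) / 4)))) \<le> M / 8 * specV g a b 0"
    using M(1) by (intro mult_left_mono specV_0_lower[OF g ab]) simp
  also have "\<dots> \<le> qf f g (indicator {a..b})" by (rule qf_box_lower[OF f M(2) g ab t(1) small t(2)])
  also have "\<dots> \<le> q (ioc a b)" unfolding q_ioc by simp
  finally show ?thesis by (simp add: field_simps)
qed

lemma q_ioc_linear: assumes "a < b" shows "q (ioc a b) \<le> (2 * M * C / pi) * (b - a)"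
proof -
  have "g b - g a \<le> 2 * C" using C[of a] C[of b] by linarith
  then have "M / pi * ((b - a) * (g b - g a)) \<le> M / pi * ((b - a) * (2 * C))" using M(1) assms by (intro mult_left_mono) auto
  with q_ioc_upper[OF assms] show ?thesis by (simp add: ac_simps)
qed

definition cell :: "nat \<Rightarrow> int \<Rightarrow> real \<Rightarrow> complex" where
  "cell n k = ioc (real_of_int k / 2^n) (real_of_int (k + 1) / 2^n)"

text \<open>The weight makes this number comparable to the increment of \<open>g\<close> over the cell, see \<open>D_upper\<close> and
\<open>increment_le_D\<close>.\<close>
definition D :: "nat \<Rightarrow> int \<Rightarrow> real" where "D n k = 2^n * q (cell n k)"

text \<open>The window from $-N$ to $N$ stays fixed while the level varies; every compact set lies in such a window.\<close>
definition S :: "nat \<Rightarrow> nat \<Rightarrow> real" where "S N n = (\<Sum>k\<in>{- int N * 2^n..<int N * 2^n}. D n k)"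

lemma cell_H: "cell n k \<in> H" unfolding cell_def by (rule ioc_H)

lemma D_nonneg: "0 \<le> D n k" unfolding D_def using q_nonneg[OF cell_H] by simp

lemma cell_order: "real_of_int k / 2^n < real_of_int (k + 1) / 2^n" by (simp add: divide_strict_right_mono)

lemma cell_width: "real_of_int (k + 1) / 2^n - real_of_int k / 2^n = 1 / 2^n"
  by (simp add: diff_divide_distrib[symmetric])

lemma D_upper: "D n k \<le> M / pi * (g (real_of_int (k + 1) / 2^n) - g (real_of_int k / 2^n))"
proof -
  have "2^n * q (cell n k) \<le> 2^n * (M / pi * ((1 / 2^n) * (g (real_of_int (k + 1) / 2^n) - g (real_of_int k / 2^n))))"
    using q_ioc_upper[OF cell_order[of k n]] unfolding cell_width cell_def by (intro mult_left_mono) auto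
  then show ?thesis by (simp add: D_def)
qed

lemma S_bounded: "S N n \<le> 2 * M * C / pi"
proof -
  have "S N n \<le> (\<Sum>k\<in>{- int N * 2^n..<int N * 2^n}. M / pi * (g (real_of_int (k + 1) / 2^n) - g (real_of_int k / 2^n)))"
    unfolding S_def by (intro sum_mono D_upper)
  also have "\<dots> = M / pi * (\<Sum>k\<in>{- int N * 2^n..<int N * 2^n}. g (real_of_int (k + 1) / 2^n) - g (real_of_int k / 2^n))"
    by (simp add: sum_distrib_left)
  also have "(\<Sum>k\<in>{- int N * 2^n..<int N * 2^n}. g (real_of_int (k + 1) / 2^n) - g (real_of_int k / 2^n))
      = g (real_of_int (int N * 2^n) / 2^n) - g (real_of_int (- int N * 2^n) / 2^n)"
  proof (rule int_telescope)
    have "0 \<le> int N * 2^n" by simp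
    then show "- int N * 2^n \<le> int N * 2^n" by simp
  qed
  also have "M / pi * \<dots> \<le> M / pi * (2 * C)"
    using M(1) C[of "real_of_int (int N * 2^n) / 2^n"] C[of "real_of_int (- int N * 2^n) / 2^n"]
    by (intro mult_left_mono) (linarith, simp)
  finally show ?thesis by (simp add: ac_simps)
qed

text \<open>A point lies in exactly one cell of level \<open>n\<close>, and the index of this cell decides in which cell of level
\<open>m\<close> it lies.\<close>
lemma cell_refine:
  assumes "m \<le> n"
  shows "cell m j x = (\<Sum>k\<in>{j * 2^(n-m)..<(j + 1) * 2^(n-m)}. cell n k x)"
proof -
  define k0 where "k0 = \<lceil>x * 2^n\<rceil> - 1"
  have in_cell: "cell n k x = (if k = k0 then 1 else 0)" for k
  proof -
    have "x \<in> {real_of_int k / 2^n<..real_of_int (k + 1) / 2^n} \<longleftrightarrow> real_of_int k < x * 2^n \<and> x * 2^n \<le> real_of_int (k + 1)"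
      by (simp add: divide_less_eq le_divide_eq)
    also have "\<dots> \<longleftrightarrow> \<lceil>x * 2^n\<rceil> = k + 1" by (simp add: ceiling_eq_iff)
    also have "\<dots> \<longleftrightarrow> k = k0" by (auto simp: k0_def)
    finally show ?thesis by (simp add: cell_def ioc_def indicator_def)
  qed
  let ?R = "2^(n-m) :: int"
  have R: "(2::real)^n = 2^m * 2^(n-m)" using assms by (simp flip: power_add)
  have "k0 \<in> {j * ?R..<(j + 1) * ?R} \<longleftrightarrow> j * ?R < \<lceil>x * 2^n\<rceil> \<and> \<lceil>x * 2^n\<rceil> \<le> (j + 1) * ?R" by (auto simp: k0_def)
  also have "\<dots> \<longleftrightarrow> real_of_int (j * ?R) < x * 2^n \<and> x * 2^n \<le> real_of_int ((j + 1) * ?R)"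
    by (simp only: less_ceiling_iff ceiling_le_iff)
  also have "\<dots> \<longleftrightarrow> real_of_int j * 2^(n-m) < (x * 2^m) * 2^(n-m) \<and> (x * 2^m) * 2^(n-m) \<le> real_of_int (j + 1) * 2^(n-m)"
    unfolding R by (simp add: ac_simps)
  also have "\<dots> \<longleftrightarrow> real_of_int j < x * 2^m \<and> x * 2^m \<le> real_of_int (j + 1)"
    by (simp only: mult_less_cancel_right_pos mult_le_cancel_right_pos zero_less_power zero_less_numeral)
  also have "\<dots> \<longleftrightarrow> x \<in> {real_of_int j / 2^m<..real_of_int (j + 1) / 2^m}"
    by (simp add: divide_less_eq le_divide_eq)
  finally have "cell m j x = (if k0 \<in> {j * ?R..<(j + 1) * ?R} then 1 else 0)"
    by (simp add: cell_def ioc_def indicator_def)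
  also have "\<dots> = (\<Sum>k\<in>{j * ?R..<(j + 1) * ?R}. if k = k0 then 1 else 0)"
    by (simp add: sum.delta)
  finally show ?thesis by (simp add: in_cell)
qed

text \<open>The weighted squared distance of a cell of level \<open>n\<close> from the normalised cell of level \<open>m\<close> that contains
it, which is the mean of all cells of level \<open>n\<close> inside it.\<close>
definition dev :: "nat \<Rightarrow> nat \<Rightarrow> int \<Rightarrow> real" where
  "dev m n k = 2^n * q (\<lambda>x. cell n k x + complex_of_real (- 1 / 2^(n-m)) * cell m (k div 2^(n-m)) x)"

lemma dev_nonneg: "0 \<le> dev m n k"
  unfolding dev_def by (intro mult_nonneg_nonneg q_nonneg sq_int_add sq_int_cmult cell_H) simp

lemma dev_sum_block:
  assumes "m \<le> n"
  shows "(\<Sum>k\<in>{j * 2^(n-m)..<(j + 1) * 2^(n-m)}. dev m n k) = (\<Sum>k\<in>{j * 2^(n-m)..<(j + 1) * 2^(n-m)}. D n k) - D m j"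
proof -
  let ?R = "2^(n-m) :: int" and ?A = "{j * 2^(n-m)..<(j + 1) * 2^(n-m)} :: int set"
  have cardA: "card ?A = 2^(n-m)" by (simp add: distrib_right nat_power_eq)
  have cA: "real (card ?A) = 2^(n-m)" unfolding cardA by simp
  have divA: "k div ?R = j" if "k \<in> ?A" for k
    using that by (intro int_div_pos_eq[where r="k - j * ?R"]) (auto simp: algebra_simps)
  have R: "(2::real)^n = 2^m * 2^(n-m)" using assms by (simp flip: power_add)
  have "(\<Sum>k\<in>?A. dev m n k) = (\<Sum>k\<in>?A. 2^n * q (\<lambda>x. cell n k x + complex_of_real (- 1 / real (card ?A)) * cell m j x))"
    by (intro sum.cong refl) (simp only: dev_def divA cA)
  also have "\<dots> = 2^n * (\<sigma> * (\<Sum>k\<in>?A. qf f g (\<lambda>x. cell n k x + complex_of_real (- 1 / real (card ?A)) * cell m j x)))"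
    unfolding q_def by (simp add: sum_distrib_left)
  also have "(\<Sum>k\<in>?A. qf f g (\<lambda>x. cell n k x + complex_of_real (- 1 / real (card ?A)) * cell m j x))
     = (\<Sum>k\<in>?A. qf f g (cell n k)) - qf f g (cell m j) / real (card ?A)"
  proof (rule qf_variance[OF f(1) g(1)])
    show "?A \<noteq> {}" by (simp add: distrib_right)
    show "cell m j = (\<lambda>x. \<Sum>k\<in>?A. cell n k x)" using cell_refine[OF assms] by (intro ext)
  qed (auto simp: cell_H)
  also have "2^n * (\<sigma> * \<dots>) = (\<Sum>k\<in>?A. D n k) - 2^n * q (cell m j) / real (card ?A)"
    unfolding D_def q_def by (simp add: right_diff_distrib sum_distrib_left)
  also have "2^n * q (cell m j) / real (card ?A) = D m j"
    unfolding cardA R D_def by simp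
  finally show ?thesis .
qed

text \<open>Orthogonality of martingale increments.\<close>
lemma dev_sum:
  assumes "m \<le> n" shows "(\<Sum>k\<in>{- int N * 2^n..<int N * 2^n}. dev m n k) = S N n - S N m"
proof -
  let ?R = "2^(n-m) :: int"
  have R: "(2::int)^n = 2^m * ?R" using assms by (simp flip: power_add)
  have le: "- int N * 2^m \<le> int N * 2^m"
  proof -
    have "0 \<le> int N * 2^m" by simp
    then show ?thesis by simp
  qed
  have W: "{- int N * 2^n..<int N * 2^n} = {(- int N * 2^m) * ?R..<(int N * 2^m) * ?R}" unfolding R by (simp add: ac_simps)
  have "(\<Sum>k\<in>{- int N * 2^n..<int N * 2^n}. dev m n k) = (\<Sum>j\<in>{- int N * 2^m..<int N * 2^m}. \<Sum>k\<in>{j * ?R..<(j + 1) * ?R}. dev m n k)"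
    unfolding W by (rule int_sum_blocks[OF le]) simp
  also have "\<dots> = (\<Sum>j\<in>{- int N * 2^m..<int N * 2^m}. \<Sum>k\<in>{j * ?R..<(j + 1) * ?R}. D n k) - S N m"
    unfolding dev_sum_block[OF assms] S_def by (rule sum_subtractf)
  also have "(\<Sum>j\<in>{- int N * 2^m..<int N * 2^m}. \<Sum>k\<in>{j * ?R..<(j + 1) * ?R}. D n k) = S N n"
    unfolding S_def W by (rule int_sum_blocks[OF le, symmetric]) simp
  finally show ?thesis .
qed

lemma S_incseq: "m \<le> n \<Longrightarrow> S N m \<le> S N n"
  using dev_sum[of m n N] sum_nonneg[of "{- int N * 2^n..<int N * 2^n}" "dev m n", OF dev_nonneg] by linarith

lemma S_Cauchy: assumes "0 < e" obtains m where "\<And>n. m \<le> n \<Longrightarrow> S N n - S N m < e"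
proof -
  have "convergent (S N)"
    by (rule Bseq_mono_convergent[OF BseqI'[where K="2 * M * C / pi"]])
       (use S_bounded S_incseq in \<open>auto simp: S_def D_nonneg sum_nonneg\<close>)
  then obtain L where L: "S N \<longlonglongrightarrow> L" by (auto simp: convergent_def)
  have "\<forall>\<^sub>F m in sequentially. L - e < S N m" using order_tendstoD(1)[OF L, of "L - e"] assms by simp
  then obtain m where m: "L - e < S N m" by (auto simp: eventually_sequentially)
  have "S N n \<le> L" for n by (rule incseq_le[OF _ L]) (auto simp: incseq_def S_incseq)
  with m show thesis by (intro that[of m]) (smt (verit))
qed

text \<open>Each cell is its coarse mean plus a deviation. The means are bounded by a constant depending on \<open>m\<close>
times the length of the cell, and the deviations sum up to the increment of \<^const>\<open>S\<close>. For \<open>m\<close> chosen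
first, the right hand side is small if \<open>A\<close> covers little length.\<close>
lemma D_sum_le:
  assumes mn: "m \<le> n" and A: "A \<subseteq> {- int N * 2^n..<int N * 2^n}"
  shows "(\<Sum>k\<in>A. D n k) \<le> 2 * (2 * M * C / pi) * 2^m * (real (card A) / 2^n) + 2 * (S N n - S N m)"
proof -
  let ?R = "2^(n-m) :: real"
  have R: "(2::real)^n = 2^m * ?R" using mn by (simp flip: power_add)
  have D: "D n k \<le> 2 * (2 * M * C / pi) * 2^m / 2^n + 2 * dev m n k" for k
  proof -
    let ?j = "k div 2^(n-m)"
    let ?a = "\<lambda>x. complex_of_real (1 / ?R) * cell m ?j x"
    let ?b = "\<lambda>x. cell n k x + complex_of_real (- 1 / ?R) * cell m ?j x"
    have ab: "?a \<in> H" "?b \<in> H" by (intro sq_int_add sq_int_cmult cell_H)+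
    have "cell n k = (\<lambda>x. ?a x + ?b x)" by (auto simp: fun_eq_iff)
    then have "q (cell n k) \<le> 2 * q ?a + 2 * q ?b" using q_add_le[OF ab] by metis
    then have "2^n * q (cell n k) \<le> 2^n * (2 * q ?a + 2 * q ?b)" by (rule mult_left_mono) simp
    then have "D n k \<le> 2^n * (2 * q ?a) + 2 * dev m n k" by (simp add: D_def dev_def algebra_simps)
    also have "2^n * (2 * q ?a) \<le> 2 * (2 * M * C / pi) * 2^m / 2^n"
    proof -
      have "q (cell m ?j) \<le> (2 * M * C / pi) * (1 / 2^m)"
        using q_ioc_linear[OF cell_order[of ?j m]] unfolding cell_width cell_def[symmetric] .
      then have "2^n * (2 * ((1 / ?R)\<^sup>2 * q (cell m ?j))) \<le> 2^n * (2 * ((1 / ?R)\<^sup>2 * ((2 * M * C / pi) * (1 / 2^m))))"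
        by (intro mult_left_mono) auto
      also have "\<dots> = 2 * (2 * M * C / pi) * 2^m / 2^n" unfolding R by (simp add: power2_eq_square)
      finally show ?thesis unfolding q_scale[OF cell_H] .
    qed
    finally show ?thesis by simp
  qed
  have "(\<Sum>k\<in>A. D n k) \<le> (\<Sum>k\<in>A. 2 * (2 * M * C / pi) * 2^m / 2^n + 2 * dev m n k)" by (intro sum_mono D)
  also have "\<dots> = real (card A) * (2 * (2 * M * C / pi) * 2^m / 2^n) + 2 * (\<Sum>k\<in>A. dev m n k)"
    by (simp add: sum.distrib sum_distrib_left)
  also have "(\<Sum>k\<in>A. dev m n k) \<le> (\<Sum>k\<in>{- int N * 2^n..<int N * 2^n}. dev m n k)"
    by (intro sum_mono2 A dev_nonneg) auto
  also have "\<dots> = S N n - S N m" by (rule dev_sum[OF mn])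
  finally show ?thesis by (simp add: ac_simps)
qed

text \<open>The lower bound for the form of an interval sees only the increment over its middle half. Unions of two
adjacent cells have middle halves which, taken together, cover every cell.\<close>
lemma increment_le_D:
  assumes small: "t * (2 / 2^n) \<le> 1"
  shows "g (real_of_int (k + 1) / 2^n) - g (real_of_int k / 2^n) \<le> 32 * pi / M * (D n (k - 1) + 2 * D n k + D n (k + 1))"
proof -
  define mid where "mid k = g ((real_of_int k + 3/2) / 2^n) - g ((real_of_int k + 1/2) / 2^n)" for k
  have mid: "mid k \<le> 32 * pi / M * (D n k + D n (k + 1))" for k
  proof -
    let ?a = "real_of_int k / 2^n" and ?b = "real_of_int (k + 2) / 2^n"
    have ab: "?a < ?b" by (simp add: divide_strict_right_mono)
    have w: "?b - ?a = 2 / 2^n" by (simp add: diff_divide_distrib[symmetric])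
    have e: "?b - (2 / 2^n) / 4 = (real_of_int k + 3/2) / 2^n" "?a + (2 / 2^n) / 4 = (real_of_int k + 1/2) / 2^n"
      by (simp_all add: field_simps)
    have "M / (32 * pi) * (2 / 2^n * mid k) \<le> q (ioc ?a ?b)"
      using q_ioc_lower[OF ab] small unfolding w e mid_def by blast
    also have "ioc ?a ?b = (\<lambda>x. cell n k x + cell n (k + 1) x)"
    proof -
      have "?a < real_of_int (k + 1) / 2^n" "real_of_int (k + 1) / 2^n < ?b" by (simp_all add: divide_strict_right_mono)
      moreover have "k + 1 + 1 = k + 2" by simp
      ultimately show ?thesis unfolding cell_def by (simp only: ioc_split)
    qed
    also have "q (\<lambda>x. cell n k x + cell n (k + 1) x) \<le> 2 * q (cell n k) + 2 * q (cell n (k + 1))" by (intro q_add_le cell_H)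
    finally have "M / (32 * pi) * (2 / 2^n * mid k) \<le> 2 * q (cell n k) + 2 * q (cell n (k + 1))" .
    then have "(32 * pi / M * 2^n / 2) * (M / (32 * pi) * (2 / 2^n * mid k)) \<le> (32 * pi / M * 2^n / 2) * (2 * q (cell n k) + 2 * q (cell n (k + 1)))"
      using M(1) by (intro mult_left_mono) auto
    then show ?thesis using M(1) by (simp add: D_def field_simps)
  qed
  have "g (real_of_int (k + 1) / 2^n) \<le> g ((real_of_int k + 3/2) / 2^n)"
    by (rule monoD[OF g(2)]) (simp add: divide_right_mono)
  moreover have "g ((real_of_int (k - 1) + 1/2) / 2^n) \<le> g (real_of_int k / 2^n)"
    by (rule monoD[OF g(2)]) (simp add: divide_right_mono)
  moreover have "real_of_int (k - 1) + 3/2 = real_of_int k + 1/2" by simp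
  ultimately have "g (real_of_int (k + 1) / 2^n) - g (real_of_int k / 2^n) \<le> mid (k - 1) + mid k" unfolding mid_def by (simp only:)
  also have "\<dots> \<le> 32 * pi / M * (D n (k - 1) + D n k) + 32 * pi / M * (D n k + D n (k + 1))"
    using mid[of "k - 1"] mid[of k] by simp
  also have "\<dots> = 32 * pi / M * (D n (k - 1) + 2 * D n k + D n (k + 1))" by (simp add: algebra_simps)
  finally show ?thesis .
qed

text \<open>Choose \<open>m\<close> such that \<^const>\<open>S\<close> increases by less than \<open>e\<close> after level \<open>m\<close>, then an open neighbourhood of
\<open>K\<close> of length below $e / 2^m$, and finally a level at which all cells meeting \<open>K\<close>, together with their
neighbours, lie in that neighbourhood. The neighbours are needed because of \<open>increment_le_D\<close>.\<close>
lemma compact_null_set_estimate: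
  assumes K: "compact K" "K \<in> null_sets lborel" and e: "0 < e"
  shows "emeasure (interval_measure g) K \<le> ennreal (4 * (32 * pi / M) * ((4 * M * C / pi + 2) * e))"
proof -
  let ?\<nu> = "interval_measure g"
  have C0: "0 \<le> C" using C[of 0] by linarith
  obtain B where B: "\<And>x. x \<in> K \<Longrightarrow> \<bar>x\<bar> \<le> B" using compact_imp_bounded[OF K(1)] by (auto simp: bounded_iff)
  obtain N :: nat where N: "B + 2 \<le> real N" using real_arch_simple by blast
  obtain m where m: "\<And>n. m \<le> n \<Longrightarrow> S N n - S N m < e" using S_Cauchy[OF e] by blast
  have "0 < e / 2^m" using e by simp
  from outer_regular_lborel[OF _ this, of K] K obtain U where U: "open U" "K \<subseteq> U" "emeasure lborel (U - K) < ennreal (e / 2^m)"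
    by (auto simp: null_sets_def)
  have Um: "emeasure lborel U < ennreal (e / 2^m)"
  proof -
    have "emeasure lborel U = emeasure lborel (U - K)" using emeasure_Diff_null_set[OF K(2), of U] U(1) by simp
    then show ?thesis using U(3) by simp
  qed
  obtain r where r0: "0 < r" "(\<Union>x\<in>K. ball x r) \<subseteq> U"
    by (rule compact_subset_open_imp_ball_epsilon_subset[OF K(1) U(1,2)])
  have r: "0 < r" "\<And>x. x \<in> K \<Longrightarrow> ball x r \<subseteq> U" using r0 by auto
  \<comment> \<open>The three bounds on the mesh keep a cell and its neighbours inside the neighbourhood, make
    increment_le_D applicable, and keep the neighbours within the window of S.\<close>
  have "(\<lambda>n. (1 / 2 :: real)^n) \<longlonglongrightarrow> 0" by (rule LIMSEQ_realpow_zero) auto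
  then have "\<forall>\<^sub>F n in sequentially. (1/2::real)^n < min (r / 2) (min (1 / (2 * t + 1)) 1)"
    by (rule order_tendstoD(2)) (use r(1) t(1) in simp)
  then have "\<forall>\<^sub>F n in sequentially. (1/2::real)^n < min (r / 2) (min (1 / (2 * t + 1)) 1) \<and> m \<le> n"
    using eventually_ge_at_top[of m] by eventually_elim simp
  then obtain n where n0: "(1/2::real)^n < min (r / 2) (min (1 / (2 * t + 1)) 1)" and mn: "m \<le> n"
    by (auto simp: eventually_sequentially)
  define h where "h = 1 / (2::real)^n"
  have h: "0 < h" "2 * h < r" "h < 1 / (2 * t + 1)" "h < 1" using n0 by (auto simp: h_def power_one_over)
  have small: "t * (2 / 2^n) \<le> 1"
  proof -
    have "h * (2 * t + 1) < 1" using h(3) t(1) by (simp add: less_divide_eq)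
    then have "t * (2 * h) \<le> 1" using h(1) by (simp add: algebra_simps)
    then show ?thesis by (simp add: h_def)
  qed
  let ?I = "\<lambda>k::int. {real_of_int k / 2^n<..real_of_int (k + 1) / 2^n}"
  have I: "?I k = {real_of_int k * h<..(real_of_int k + 1) * h}" for k :: int by (simp add: h_def)
  define A where "A = {k. ?I k \<inter> K \<noteq> {}}"
  define A' where "A' = A \<union> (\<lambda>k. k - 1) ` A \<union> (\<lambda>k. k + 1) ` A"
  have near: "\<exists>x\<in>K. \<bar>real_of_int k * h - x\<bar> \<le> 2 * h \<and> ?I k \<subseteq> ball x r" if k: "k \<in> A'" for k :: int
  proof -
    obtain k' where k': "k' \<in> A" "\<bar>k - k'\<bar> \<le> 1" using k by (auto simp: A'_def)
    then obtain x where x: "x \<in> K" "real_of_int k' * h < x" "x \<le> (real_of_int k' + 1) * h" unfolding A_def I by auto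
    have kk: "real_of_int k' - 1 \<le> real_of_int k" "real_of_int k \<le> real_of_int k' + 1" using k'(2) by linarith+
    have b: "(real_of_int k' - 1) * h \<le> real_of_int k * h" "real_of_int k * h \<le> (real_of_int k' + 1) * h"
      using kk h(1) by (simp_all add: mult_right_mono)
    have b': "real_of_int k' * h - h \<le> real_of_int k * h" "real_of_int k * h \<le> real_of_int k' * h + h" "x \<le> real_of_int k' * h + h"
      using b x(3) by (simp_all add: algebra_simps)
    have "?I k \<subseteq> ball x r"
    proof
      fix y assume "y \<in> ?I k"
      then have "real_of_int k * h < y" "y \<le> real_of_int k * h + h" unfolding I by (auto simp: algebra_simps)
      then have "\<bar>x - y\<bar> < r" using b' x(2) h(2) by linarith
      then show "y \<in> ball x r" by (simp add: dist_real_def)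
    qed
    moreover have "\<bar>real_of_int k * h - x\<bar> \<le> 2 * h" using b' x(2) h(1) by linarith
    ultimately show ?thesis using x(1) by blast
  qed
  have sub: "A' \<subseteq> {- int N * 2^n..<int N * 2^n}"
  proof
    fix k assume "k \<in> A'"
    from near[OF this] obtain x where x: "x \<in> K" "\<bar>real_of_int k * h - x\<bar> \<le> 2 * h" by blast
    have "\<bar>real_of_int k * h\<bar> < real N" using x(2) B[OF x(1)] N h(4) by linarith
    then have "\<bar>real_of_int k\<bar> < real N * 2^n" using h(1) by (simp add: h_def abs_mult divide_less_eq)
    then have "real_of_int \<bar>k\<bar> < real_of_int (int N * 2^n)" by simp
    then have "\<bar>k\<bar> < int N * 2^n" by (simp only: of_int_less_iff)
    then show "k \<in> {- int N * 2^n..<int N * 2^n}" by auto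
  qed
  have fin': "finite A'" using sub finite_subset by blast
  have fin: "finite A" using fin' by (auto simp: A'_def)
  have len: "real (card A') / 2^n \<le> e / 2^m"
  proof -
    have disj: "disjoint_family_on ?I A'"
    proof (unfold disjoint_family_on_def, intro ballI impI)
      fix k l :: int assume "k \<noteq> l"
      have "False" if x: "x \<in> ?I k" "x \<in> ?I l" for x
      proof -
        have "real_of_int k < x / h" "x / h \<le> real_of_int k + 1" "real_of_int l < x / h" "x / h \<le> real_of_int l + 1"
          using x h(1) unfolding I by (auto simp: less_divide_eq divide_le_eq)
        then have "real_of_int k < real_of_int l + 1" "real_of_int l < real_of_int k + 1" by linarith+
        then show False using \<open>k \<noteq> l\<close> by linarith
      qed
      then show "?I k \<inter> ?I l = {}" by blast
    qed
    have "ennreal (real (card A') * h) = (\<Sum>k\<in>A'. ennreal h)"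
      using less_imp_le[OF h(1)] by (simp add: ennreal_mult ennreal_of_nat_eq_real_of_nat)
    also have "\<dots> = (\<Sum>k\<in>A'. emeasure lborel (?I k))"
      by (intro sum.cong refl) (simp only: emeasure_lborel_Ioc[OF less_imp_le[OF cell_order]] cell_width h_def)
    also have "\<dots> = emeasure lborel (\<Union>k\<in>A'. ?I k)"
      by (rule sum_emeasure[OF _ disj fin']) auto
    also have "\<dots> \<le> emeasure lborel U"
    proof (rule emeasure_mono)
      show "(\<Union>k\<in>A'. ?I k) \<subseteq> U" using near r(2) by blast
      show "U \<in> sets lborel" using U(1) by simp
    qed
    also have "\<dots> \<le> ennreal (e / 2^m)" using Um by simp
    finally have "real (card A') * h \<le> e / 2^m" using e by simp
    then show ?thesis by (simp add: h_def)
  qed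
  have "K \<subseteq> (\<Union>k\<in>A. ?I k)"
  proof
    fix x assume x: "x \<in> K"
    let ?k = "\<lceil>x * 2^n\<rceil> - 1"
    have "x \<in> ?I ?k" using ceiling_correct[of "x * 2^n"] by (simp add: divide_less_eq le_divide_eq)
    then show "x \<in> (\<Union>k\<in>A. ?I k)" using x unfolding A_def by blast
  qed
  then have cover: "emeasure ?\<nu> K \<le> emeasure ?\<nu> (\<Union>k\<in>A. ?I k)" by (intro emeasure_mono) auto
  have subadd: "emeasure ?\<nu> (\<Union>k\<in>A. ?I k) \<le> (\<Sum>k\<in>A. emeasure ?\<nu> (?I k))"
    by (rule emeasure_subadditive_finite[OF fin]) auto
  have incr: "(\<Sum>k\<in>A. emeasure ?\<nu> (?I k)) = (\<Sum>k\<in>A. ennreal (g (real_of_int (k + 1) / 2^n) - g (real_of_int k / 2^n)))"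
    by (intro sum.cong refl emeasure_interval_measure_Ioc less_imp_le[OF cell_order] rc monoD[OF g(2)])
  have incr': "(\<Sum>k\<in>A. ennreal (g (real_of_int (k + 1) / 2^n) - g (real_of_int k / 2^n))) = ennreal (\<Sum>k\<in>A. g (real_of_int (k + 1) / 2^n) - g (real_of_int k / 2^n))"
    by (rule sum_ennreal) (use monoD[OF g(2) less_imp_le[OF cell_order]] in simp)
  have "ennreal (\<Sum>k\<in>A. g (real_of_int (k + 1) / 2^n) - g (real_of_int k / 2^n)) \<le> ennreal (4 * (32 * pi / M) * ((4 * M * C / pi + 2) * e))"
  proof (rule ennreal_leI)
    have shift: "(\<Sum>k\<in>A. D n (k + s)) \<le> (\<Sum>k\<in>A'. D n k)" if "(\<lambda>k. k + s) ` A \<subseteq> A'" for s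
    proof -
      have "(\<Sum>k\<in>A. D n (k + s)) = (\<Sum>k\<in>(\<lambda>k. k + s) ` A. D n k)" by (subst sum.reindex) (auto simp: inj_on_def)
      also have "\<dots> \<le> (\<Sum>k\<in>A'. D n k)" by (rule sum_mono2[OF fin' that]) (rule D_nonneg)
      finally show ?thesis .
    qed
    let ?\<Sigma> = "\<Sum>k\<in>A'. D n k"
    have 3: "(\<Sum>k\<in>A. D n (k - 1)) \<le> ?\<Sigma>" "(\<Sum>k\<in>A. D n k) \<le> ?\<Sigma>" "(\<Sum>k\<in>A. D n (k + 1)) \<le> ?\<Sigma>"
      using shift[of "-1"] shift[of 0] shift[of 1] by (auto simp: A'_def)
    have "?\<Sigma> \<le> 2 * (2 * M * C / pi) * 2^m * (real (card A') / 2^n) + 2 * (S N n - S N m)" by (rule D_sum_le[OF mn sub])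
    also have "\<dots> \<le> 2 * (2 * M * C / pi) * 2^m * (e / 2^m) + 2 * e"
      using len m[OF mn] M(1) C0 by (intro add_mono mult_left_mono) auto
    also have "\<dots> = (4 * M * C / pi + 2) * e" by (simp add: algebra_simps)
    finally have sig: "4 * ?\<Sigma> \<le> 4 * ((4 * M * C / pi + 2) * e)" by simp
    have "(\<Sum>k\<in>A. g (real_of_int (k + 1) / 2^n) - g (real_of_int k / 2^n)) \<le> (\<Sum>k\<in>A. 32 * pi / M * (D n (k - 1) + 2 * D n k + D n (k + 1)))"
      by (intro sum_mono increment_le_D small)
    also have "\<dots> = 32 * pi / M * ((\<Sum>k\<in>A. D n (k - 1)) + 2 * (\<Sum>k\<in>A. D n k) + (\<Sum>k\<in>A. D n (k + 1)))"
      by (simp only: sum_distrib_left[symmetric] sum.distrib)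
    also have "\<dots> \<le> 32 * pi / M * (4 * ?\<Sigma>)" using 3 M(1) by (intro mult_left_mono) auto
    also have "\<dots> \<le> 32 * pi / M * (4 * ((4 * M * C / pi + 2) * e))" using M(1) by (intro mult_left_mono sig) simp
    finally show "(\<Sum>k\<in>A. g (real_of_int (k + 1) / 2^n) - g (real_of_int k / 2^n)) \<le> 4 * (32 * pi / M) * ((4 * M * C / pi + 2) * e)"
      by (simp only: ac_simps)
  qed
  then show ?thesis using cover subadd unfolding incr incr' by (meson order_trans)
qed

lemma compact_null_set:
  assumes K: "compact K" "K \<in> null_sets lborel"
  shows "emeasure (interval_measure g) K = 0"
proof -
  have C0: "0 \<le> C" using C[of 0] by linarith
  define c where "c = 4 * (32 * pi / M) * (4 * M * C / pi + 2)"
  have c: "0 < c" unfolding c_def using M(1) C0 by (intro mult_pos_pos add_nonneg_pos) auto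
  have "emeasure (interval_measure g) K \<le> 0"
  proof (rule ennreal_le_epsilon)
    fix e :: real assume "0 < e"
    then have "0 < e / c" using c by simp
    from compact_null_set_estimate[OF K this]
    have "emeasure (interval_measure g) K \<le> ennreal (c * (e / c))" by (simp only: c_def mult.assoc)
    then show "emeasure (interval_measure g) K \<le> 0 + ennreal e" using c by simp
  qed
  then show ?thesis by simp
qed

end

section \<open>Absolute continuity of both functions\<close>

lemma abs_cont_scale:
  assumes "abs_cont G" "\<bar>s\<bar> = 1" shows "abs_cont (\<lambda>x. s * G x)"
proof -
  have e: "\<bar>s * G b - s * G a\<bar> = \<bar>G b - G a\<bar>" for a b
  proof -
    have "s * G b - s * G a = s * (G b - G a)" by (rule right_diff_distrib[symmetric])
    then show ?thesis using assms(2) by (simp only: abs_mult mult_1)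
  qed
  show ?thesis using assms(1) unfolding abs_cont_def e .
qed

lemma has_L1_deriv_scale:
  assumes "has_L1_deriv G" shows "has_L1_deriv (\<lambda>x. s * G x)"
proof -
  obtain G' where G': "integrable lebesgue G'" "AE x in lebesgue. (G has_real_derivative G' x) (at x)"
    using assms by (auto simp: has_L1_deriv_def)
  have "AE x in lebesgue. ((\<lambda>x. s * G x) has_real_derivative s * G' x) (at x)"
    using G'(2) by eventually_elim (rule DERIV_cmult)
  then show ?thesis using G'(1) unfolding has_L1_deriv_def by (intro exI[of _ "\<lambda>x. s * G' x"]) simp
qed

lemma bdd_borel_cmult: assumes "bdd_borel f" shows "bdd_borel (\<lambda>x. s * f x)"
proof -
  obtain C where C: "\<And>x. \<bar>f x\<bar> \<le> C" using bdd_borel_bound[OF assms] by blast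
  note [measurable] = bdd_borel_measurable[OF assms]
  show ?thesis
  proof (rule bdd_borelI[where C="\<bar>s\<bar> * C"])
    show "\<bar>s * f x\<bar> \<le> \<bar>s\<bar> * C" for x unfolding abs_mult by (rule mult_left_mono[OF C]) simp
  qed measurable
qed

lemma cform_scale_left: "cform (\<lambda>x. s * f x) g \<phi> \<psi> = complex_of_real s * cform f g \<phi> \<psi>"
proof -
  have e: "fun_Q (\<lambda>x. s * f x) u = (\<lambda>x. complex_of_real s * fun_Q f u x)" for u by (simp add: fun_eq_iff fun_Q_def)
  show ?thesis unfolding cform_def e ip_cmult_right by (simp add: algebra_simps)
qed

lemma cform_scale_right:
  assumes f: "bdd_borel f" and g: "bdd_borel g" and H: "\<phi> \<in> H" "\<psi> \<in> H"
  shows "cform f (\<lambda>x. s * g x) \<phi> \<psi> = complex_of_real s * cform f g \<phi> \<psi>"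
proof -
  have "cform f (\<lambda>x. s * g x) \<phi> \<psi> = cform (\<lambda>x. s * g (- x)) (\<lambda>x. - f x) (FT \<phi>) (FT \<psi>)"
    by (rule cform_FT[OF f bdd_borel_cmult[OF g] H, symmetric])
  also have "\<dots> = complex_of_real s * cform f g \<phi> \<psi>"
    unfolding cform_scale_left cform_FT[OF f g H] ..
  finally show ?thesis .
qed

lemma cform_const:
  assumes g: "bdd_borel g" and H: "\<phi> \<in> H" "\<psi> \<in> H"
  shows "cform (\<lambda>x. a) g \<phi> \<psi> = 0"
proof -
  have e: "fun_Q (\<lambda>x. a) u = (\<lambda>x. complex_of_real a * u x)" for u by (simp add: fun_eq_iff fun_Q_def)
  show ?thesis
    unfolding cform_def e ip_cmult_right Plancherel_ip[OF H(1) fun_Q_sq_int[OF g H(2)]]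
      Plancherel_ip[OF fun_Q_sq_int[OF g H(1)] H(2)] ip_fun_Q by simp
qed

text \<open>The sign is that of the constant in \<open>positive_commutator_monotone\<close>.\<close>
lemma monotone_up_to_sign:
  assumes pc: "positive_commutator f g"
  obtains s g\<^sub>0 where "\<bar>s\<bar> = (1::real)" "mono g\<^sub>0" "\<And>a. continuous (at_right a) g\<^sub>0" "bdd_borel g\<^sub>0" "AE x in lborel. s * g x = g\<^sub>0 x"
proof -
  obtain c N where c: "c \<noteq> 0" and N: "N \<in> null_sets lebesgue" and m: "\<And>a b. a \<notin> N \<Longrightarrow> b \<notin> N \<Longrightarrow> a < b \<Longrightarrow> c * g a \<le> c * g b"
    using positive_commutator_monotone[OF pc] by blast
  have g: "bdd_borel g" using pc by (simp add: positive_commutator_def)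
  have "sgn c * g a \<le> sgn c * g b" if "a \<notin> N" "b \<notin> N" "a < b" for a b
  proof -
    have "\<bar>c\<bar> * (sgn c * g a) \<le> \<bar>c\<bar> * (sgn c * g b)" using m[OF that] by (simp add: mult.assoc[symmetric] abs_mult_sgn)
    then show ?thesis using c by simp
  qed
  from monotone_representative[OF bdd_borel_cmult[OF g] N this] obtain g\<^sub>0 where
    "mono g\<^sub>0" "\<And>a. continuous (at_right a) g\<^sub>0" "bdd_borel g\<^sub>0" "AE x in lborel. sgn c * g x = g\<^sub>0 x" by blast
  moreover have "\<bar>sgn c\<bar> = 1" using c by (simp add: abs_sgn_eq)
  ultimately show thesis using that by blast
qed

text \<open>Signs are removed by passing to the monotone versions. The total increment \<open>M\<close> of the version of \<open>f\<close>
is positive, because the form vanishes for constant \<open>f\<close>; and each end value is reached up to $M/8$ within a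
bounded interval, which leaves an increment of at least $3M/4$ there.\<close>
theorem positive_commutator_abs_cont:
  assumes pc: "positive_commutator f g"
  shows "\<exists>g\<^sub>0. (AE x in lebesgue. g x = g\<^sub>0 x) \<and> abs_cont g\<^sub>0 \<and> has_L1_deriv g\<^sub>0"
proof -
  have f: "bdd_borel f" and g: "bdd_borel g" using pc by (auto simp: positive_commutator_def)
  obtain s g\<^sub>0 where s: "\<bar>s\<bar> = (1::real)" and g0: "mono g\<^sub>0" "\<And>a. continuous (at_right a) g\<^sub>0" "bdd_borel g\<^sub>0" "AE x in lborel. s * g x = g\<^sub>0 x"
    using monotone_up_to_sign[OF pc] by blast
  obtain r f\<^sub>0 where r: "\<bar>r\<bar> = (1::real)" and f0: "mono f\<^sub>0" "bdd_borel f\<^sub>0" "AE x in lborel. r * (- f x) = f\<^sub>0 x"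
    using monotone_up_to_sign[OF positive_commutator_FT[OF pc]] by metis
  define \<sigma> where "\<sigma> = - r * s"
  have \<sigma>: "\<bar>\<sigma>\<bar> = 1" "\<sigma> * \<sigma> = 1"
  proof -
    show "\<bar>\<sigma>\<bar> = 1" using r s by (simp add: \<sigma>_def abs_mult)
    then have "\<bar>\<sigma>\<bar> * \<bar>\<sigma>\<bar> = 1" by simp
    then show "\<sigma> * \<sigma> = 1" by (simp add: abs_mult_self_eq)
  qed
  have form: "cform f\<^sub>0 g\<^sub>0 \<phi> \<psi> = complex_of_real \<sigma> * cform f g \<phi> \<psi>" if H: "\<phi> \<in> H" "\<psi> \<in> H" for \<phi> \<psi>
  proof -
    have ae: "AE x in lborel. (- r) * f x = f\<^sub>0 x" using f0(3) by eventually_elim simp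
    have "cform f\<^sub>0 g\<^sub>0 \<phi> \<psi> = cform (\<lambda>x. (- r) * f x) (\<lambda>x. s * g x) \<phi> \<psi>"
    proof (rule cform_cong_AE[OF f0(2) g0(3) bdd_borel_cmult[OF f] bdd_borel_cmult[OF g] H H])
      show "AE x in lborel. f\<^sub>0 x = - r * f x" using ae by eventually_elim simp
      show "AE x in lborel. g\<^sub>0 x = s * g x" using g0(4) by eventually_elim simp
    qed auto
    also have "\<dots> = complex_of_real \<sigma> * cform f g \<phi> \<psi>"
      unfolding cform_scale_left cform_scale_right[OF f g H] by (simp add: \<sigma>_def)
    finally show ?thesis .
  qed
  obtain C where C: "\<And>x. \<bar>g\<^sub>0 x\<bar> \<le> C" using bdd_borel_bound[OF g0(3)] by blast
  obtain B where B: "\<And>x. \<bar>f\<^sub>0 x\<bar> \<le> B" using bdd_borel_bound[OF f0(2)] by blast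
  have bd: "bdd_above (range f\<^sub>0)" "bdd_below (range f\<^sub>0)"
    using B by (auto intro!: bdd_aboveI[where M=B] bdd_belowI[where m="- B"] simp: abs_le_iff minus_le_iff)
  define M where "M = (SUP x. f\<^sub>0 x) - (INF x. f\<^sub>0 x)"
  have Mub: "f\<^sub>0 x - f\<^sub>0 y \<le> M" for x y
    unfolding M_def using cSUP_upper[OF UNIV_I bd(1), of x] cINF_lower[OF bd(2) UNIV_I, of y] by linarith
  have M0: "0 < M"
  proof (rule ccontr)
    assume "\<not> 0 < M"
    then have "f\<^sub>0 x = f\<^sub>0 0" for x using Mub[of x 0] Mub[of 0 x] by linarith
    then obtain k where k: "f\<^sub>0 = (\<lambda>x. k)" by blast
    have z: "cform f\<^sub>0 g\<^sub>0 \<phi> \<psi> = 0" if "\<phi> \<in> H" "\<psi> \<in> H" for \<phi> \<psi>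
      unfolding k by (rule cform_const[OF g0(3) that])
    obtain \<phi> \<psi> where H: "\<phi> \<in> H" "\<psi> \<in> H" "cform f g \<phi> \<psi> \<noteq> 0" using pc by (auto simp: positive_commutator_def)
    have "\<sigma> \<noteq> 0" using \<sigma>(1) by auto
    then show False using z[OF H(1,2)] form[OF H(1,2)] H(3) by simp
  qed
  obtain x where x: "(SUP x. f\<^sub>0 x) - M / 8 < f\<^sub>0 x"
    using less_cSUP_iff[OF UNIV_not_empty bd(1), of "(SUP x. f\<^sub>0 x) - M / 8"] M0 by auto
  obtain y where y: "f\<^sub>0 y < (INF x. f\<^sub>0 x) + M / 8"
    using cINF_less_iff[OF UNIV_not_empty bd(2), of "(INF x. f\<^sub>0 x) + M / 8"] M0 by auto
  define t where "t = max \<bar>x\<bar> \<bar>y\<bar>"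
  have t: "0 \<le> t" "x \<le> t" "- t \<le> y" by (auto simp: t_def)
  have "f\<^sub>0 x - f\<^sub>0 y \<le> f\<^sub>0 t - f\<^sub>0 (- t)" using monoD[OF f0(1) t(2)] monoD[OF f0(1) t(3)] by linarith
  moreover have "M - M / 8 - M / 8 \<le> f\<^sub>0 x - f\<^sub>0 y" using x y M_def by linarith
  ultimately have t34: "3 / 4 * M \<le> f\<^sub>0 t - f\<^sub>0 (- t)" by linarith
  interpret monotone_pair f\<^sub>0 g\<^sub>0 \<sigma> M t C
  proof
    fix \<phi> assume \<phi>: "\<phi> \<in> H"
    have "qf f\<^sub>0 g\<^sub>0 \<phi> = \<sigma> * qf f g \<phi>" unfolding qf_def form[OF \<phi> \<phi>] by simp
    then have "\<sigma> * qf f\<^sub>0 g\<^sub>0 \<phi> = qf f g \<phi>" using \<sigma>(2) by (simp add: mult.assoc[symmetric])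
    then show "0 \<le> \<sigma> * qf f\<^sub>0 g\<^sub>0 \<phi>" using positive_commutator_qf(1)[OF pc \<phi>] by simp
  qed (fact f0 g0 M0 Mub t t34 C \<sigma>)+
  have nice: "abs_cont g\<^sub>0" "has_L1_deriv g\<^sub>0"
    by (rule abs_cont_of_null_measure[OF g0(1,2) C], erule (1) compact_null_set)+
  have "AE x in lborel. g x = s * g\<^sub>0 x"
    using g0(4)
  proof eventually_elim
    case (elim x)
    have "s * s = 1" using s by (metis abs_mult_self_eq mult_1)
    then show ?case unfolding elim[symmetric] by (simp add: mult.assoc[symmetric])
  qed
  note rep = AE_completion[OF this] abs_cont_scale[OF nice(1) s] has_L1_deriv_scale[OF nice(2), of s]
  show ?thesis
    by (rule exI[of _ "\<lambda>x. s * g\<^sub>0 x"], intro conjI; rule rep)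
qed

text \<open>For \<open>f\<close>, the symmetric pair $(g(-\cdot), -f)$ is used, which has $-f$ in the place of \<open>g\<close>.\<close>
theorem theorem1p1:
  fixes f g :: "real \<Rightarrow> real" and K :: L2_op
  assumes "f \<in> borel_measurable lebesgue" and "bounded (range f)"
    and "g \<in> borel_measurable lebesgue" and "bounded (range g)"
    and "K = scale_op \<i> (commutator (fun_P f) (fun_Q g))"
    and "op_nonneg K" and "\<not> op_zero K"
  shows "(\<exists>f\<^sub>0. (AE x in lebesgue. f x = f\<^sub>0 x) \<and> abs_cont f\<^sub>0 \<and> has_L1_deriv f\<^sub>0) \<and>
         (\<exists>g\<^sub>0. (AE x in lebesgue. g x = g\<^sub>0 x) \<and> abs_cont g\<^sub>0 \<and> has_L1_deriv g\<^sub>0)"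
proof -
  obtain f' g' where pc: "positive_commutator f' g'" and f': "AE x in lebesgue. f x = f' x" and g': "AE x in lebesgue. g x = g' x"
    using positive_commutatorI[OF assms] by blast
  obtain g\<^sub>0 where g0: "AE x in lebesgue. g' x = g\<^sub>0 x" "abs_cont g\<^sub>0" "has_L1_deriv g\<^sub>0"
    using positive_commutator_abs_cont[OF pc] by blast
  obtain f\<^sub>0 where f0: "AE x in lebesgue. - f' x = f\<^sub>0 x" "abs_cont f\<^sub>0" "has_L1_deriv f\<^sub>0"
    using positive_commutator_abs_cont[OF positive_commutator_FT[OF pc]] by blast
  have "AE x in lebesgue. f x = (-1) * f\<^sub>0 x" using f' f0(1) by eventually_elim simp
  moreover have "abs_cont (\<lambda>x. (-1) * f\<^sub>0 x)" by (rule abs_cont_scale[OF f0(2)]) simp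
  moreover have "has_L1_deriv (\<lambda>x. (-1) * f\<^sub>0 x)" by (rule has_L1_deriv_scale[OF f0(3)])
  ultimately have nice: "\<exists>f\<^sub>0. (AE x in lebesgue. f x = f\<^sub>0 x) \<and> abs_cont f\<^sub>0 \<and> has_L1_deriv f\<^sub>0"
    by (intro exI[of _ "\<lambda>x. (-1) * f\<^sub>0 x"] conjI)
  have "AE x in lebesgue. g x = g\<^sub>0 x" using g' g0(1) by eventually_elim simp
  then have "\<exists>g\<^sub>0. (AE x in lebesgue. g x = g\<^sub>0 x) \<and> abs_cont g\<^sub>0 \<and> has_L1_deriv g\<^sub>0"
    using g0(2,3) by (intro exI[of _ g\<^sub>0] conjI)
  with nice show ?thesis by (rule conjI)
qed

end
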